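(* The Poincaré series $\sum_{i\ge0}\dim_{\mathbb{F}_2}H^i(V(2),\mathbb{F}_2)\,x^i$ of $H^*(V(2),\mathbb{F}_2)$ is $$\frac{1-x+x^2}{(1-x)^3(1-x^2)^2},$$ which expands to $1+2x+6x^2+11x^3+22x^4+36x^5+60x^6+90x^7+135x^8+190x^9+266x^{10}+\cdots$.
   Context: For a free pro-$2$-group $G$ on $n$ generators let $\Phi(G)=G^2[G,G]$ denote its Frattini subgroup; then $V(n)=G/\Phi(\Phi(G))$. Equivalently, $V(n)=F_n/R^2[R,R]$, where $F_n$ is the free group on $n$ generators and $R$ is the kernel of the standard surjection $F_n\to(\mathbb{Z}/2\mathbb{Z})^n$. The group $V(2)$ is a finite group of order $2^7$. *)

theory Defs
  imports
    "HOL-Algebra.Algebra"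
    "HOL-Library.Z2"
    "HOL-Computational_Algebra.Formal_Power_Series"
    "Jordan_Normal_Form.VS_Connect"
begin

section \<open>Free groups\<close>

text \<open>
  A letter \<open>(i, True)\<close> stands for the generator \<open>x\<^sub>i\<close> and \<open>(i, False)\<close> for its inverse.
  The elements of the free group are the reduced words.
\<close>

type_synonym letter = "nat \<times> bool"

fun reduced :: "letter list \<Rightarrow> bool" where
  "reduced (x # y # w) \<longleftrightarrow> \<not> (fst x = fst y \<and> snd x \<noteq> snd y) \<and> reduced (y # w)"
| "reduced _ \<longleftrightarrow> True"

fun push :: "letter \<Rightarrow> letter list \<Rightarrow> letter list" where
  "push x [] = [x]"
| "push x (y # w) = (if fst x = fst y \<and> snd x \<noteq> snd y then w else x # y # w)"

definition free_group :: "nat \<Rightarrow> letter list monoid" where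
  "free_group n =
     \<lparr> carrier = {w. set w \<subseteq> {..<n} \<times> UNIV \<and> reduced w},
       monoid.mult = (\<lambda>u v. foldr push u v),
       one = [] \<rparr>"


section \<open>The groups \<open>V(n)\<close>\<close>

definition elementary_abelian_2 :: "nat \<Rightarrow> (nat \<Rightarrow> int) monoid" where
  "elementary_abelian_2 n = product_group {..<n} (\<lambda>_. integer_mod_group 2)"

text \<open>The \<open>i\<close>-th component of the image of a word is its exponent sum in \<open>x\<^sub>i\<close> modulo 2.\<close>

definition standard_surjection :: "nat \<Rightarrow> letter list \<Rightarrow> nat \<Rightarrow> int" where
  "standard_surjection n w =
     (\<lambda>i\<in>{..<n}. (\<Sum>x\<leftarrow>w. if fst x = i then (if snd x then 1 else - 1) else 0) mod 2)"

text \<open>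
  \<open>V(n) = F\<^sub>n / R\<^sup>2[R,R]\<close>, where \<open>R\<close> is the kernel of the standard surjection onto \<open>(\<int>/2)\<^sup>n\<close>. Here
  \<open>R\<^sup>2\<close> is the subgroup generated by the squares of elements of \<open>R\<close>. This is the quotient
  \<open>G/\<Phi>(\<Phi>(G))\<close> of the free pro-2 group \<open>G\<close> on \<open>n\<close> generators by an iterated Frattini subgroup.
\<close>

definition R_subgroup :: "nat \<Rightarrow> letter list set" where
  "R_subgroup n = kernel (free_group n) (elementary_abelian_2 n) (standard_surjection n)"

definition squares_commutators :: "('a, 'b) monoid_scheme \<Rightarrow> 'a set \<Rightarrow> 'a set" where
  "squares_commutators G H = generate G ((\<lambda>h. h \<otimes>\<^bsub>G\<^esub> h) ` H) <#>\<^bsub>G\<^esub> derived G H"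

definition V_group :: "nat \<Rightarrow> letter list set monoid" where
  "V_group n = free_group n Mod squares_commutators (free_group n) (R_subgroup n)"


section \<open>Group cohomology with trivial coefficients in a field\<close>

text \<open>
  The cohomology of the complex of inhomogeneous cochains. Tuples of group elements are lists;
  the coefficient field is the type \<open>'k\<close>, on which the group acts trivially.
\<close>

definition tuples :: "('a, 'b) monoid_scheme \<Rightarrow> nat \<Rightarrow> 'a list set" where
  "tuples G n = {gs. length gs = n \<and> set gs \<subseteq> carrier G}"

definition cochains ::
  "('a, 'b) monoid_scheme \<Rightarrow> nat \<Rightarrow> ('k :: field, 'a list \<Rightarrow> 'k) module" where
  "cochains G n = LinearCombinations.ring.func_space class_ring (tuples G n)"

definition coboundary ::
  "('a, 'b) monoid_scheme \<Rightarrow> nat \<Rightarrow> ('a list \<Rightarrow> 'k :: field) \<Rightarrow> 'a list \<Rightarrow> 'k" where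
  "coboundary G n f =
     (\<lambda>gs\<in>tuples G (Suc n).
        f (tl gs)
        + (\<Sum>i<n. (- 1) ^ Suc i *
             f (take i gs @ [gs ! i \<otimes>\<^bsub>G\<^esub> gs ! Suc i] @ drop (Suc (Suc i)) gs))
        + (- 1) ^ Suc n * f (butlast gs))"

definition cocycles ::
  "('a, 'b) monoid_scheme \<Rightarrow> nat \<Rightarrow> ('a list \<Rightarrow> 'k :: field) set" where
  "cocycles G n =
     {f \<in> carrier (cochains G n). coboundary G n f = \<zero>\<^bsub>cochains G (Suc n)\<^esub>}"

fun coboundaries ::
  "('a, 'b) monoid_scheme \<Rightarrow> nat \<Rightarrow> ('a list \<Rightarrow> 'k :: field) set" where
  "coboundaries G 0 = {\<zero>\<^bsub>cochains G 0\<^esub>}"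
| "coboundaries G (Suc n) = coboundary G n ` carrier (cochains G n)"

text \<open>
  Module records extend ring records; as for \<open>func_space\<close>, the multiplicative fields carry no
  meaning. The scalar multiple of a coset is the coset of the scalar multiples of its elements.
\<close>

definition quotient_module ::
  "('k, 'v, 'c) module_scheme \<Rightarrow> 'v set \<Rightarrow> ('k, 'v set) module" where
  "quotient_module M N =
     \<lparr> carrier = a_rcosets\<^bsub>M\<^esub> N,
       monoid.mult = (\<lambda>_ _. N),
       one = N,
       ring.zero = N,
       add = set_add M,
       smult = (\<lambda>c C. \<Union>x\<in>C. N +>\<^bsub>M\<^esub> (c \<odot>\<^bsub>M\<^esub> x)) \<rparr>"

definition cohomology ::
  "('a, 'b) monoid_scheme \<Rightarrow> nat \<Rightarrow> ('k :: field, ('a list \<Rightarrow> 'k) set) module" where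
  "cohomology G n =
     quotient_module ((cochains G n) \<lparr>carrier := cocycles G n\<rparr>) (coboundaries G n)"

definition cohomology_dim ::
  "'k :: field itself \<Rightarrow> ('a, 'b) monoid_scheme \<Rightarrow> nat \<Rightarrow> nat" where
  "cohomology_dim _ G n =
     vectorspace.dim (class_ring :: 'k ring)
       (cohomology G n :: ('k, ('a list \<Rightarrow> 'k) set) module)"

definition poincare_series ::
  "'k :: field itself \<Rightarrow> ('a, 'b) monoid_scheme \<Rightarrow> rat fps" where
  "poincare_series k G = Abs_fps (\<lambda>i. of_nat (cohomology_dim k G i))"

end

theory Submission
  imports Defs "HOL-Library.Function_Algebras" "HOL-Library.Product_Plus"
begin

text \<open>
  Let \<open>Q = (\<int>/2)\<^sup>2\<close>. By the Magnus embedding \<open>V(2)\<close> consists of the pairs \<open>(q, s)\<close> of an element \<open>q\<close> of \<open>Q\<close>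
  and a 1-chain \<open>s\<close> modulo 2 on the Cayley graph of \<open>Q\<close> (4 vertices, 8 edges) with boundary \<open>q + 0\<close>. It acts
  freely on a product of eight infinite-dimensional spheres, one for each edge, so its cohomology is that of
  the invariant cellular cochains. A triangular change of basis identifies these with the \<open>Q\<close>-invariants of
  the part of odd total degree of the Koszul complex of the four linear forms \<open>\<ell>\<^sub>r\<close> (sum of the edges at
  the vertex \<open>r\<close>) over the polynomial ring on the edges. The forms satisfy one linear relation and are
  otherwise regular, hence the Koszul homology consists of the symmetric algebra
  \<open>S = \<F>\<^sub>2[a, b, w, \<alpha>, \<beta>]\<close> in homological degrees 0 and 1. In odd total degree \<open>Q\<close> permutes the basis of the
  complex freely, so that invariants of exact sequences stay exact: this gives \<open>H\<^bsup>2m\<^esup> = (S\<^bsub>2m\<^esub>)\<^bsup>Q\<^esup>\<close>, and the odd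
  degrees follow from the Euler characteristic. Finally the invariants of \<open>S\<close> are counted by solving the
  invariance equations over the ring generated by \<open>w\<close>, \<open>\<alpha>\<close>, \<open>\<beta>\<close> and the norms of \<open>a\<close> and \<open>b\<close>.
\<close>

text \<open>Every space involved is finite over the field with two elements, so dimensions are
  compared through cardinalities: chases and exact sequences become equations between products of
  cardinals, multiplied out to avoid division, and the class \<open>char_2\<close> removes all
  signs. The obstacle is that taking \<open>Q\<close>-invariants is not exact. It is overcome by
  parity: the label of a cell \<open>(m, s)\<close> sums to 1 plus the degree of \<open>m\<close>,
  so only sets \<open>B\<close> for which \<open>m\<close> and \<open>B\<close> together have odd
  degree matter, while a pair fixed by a nonzero translation has even degree. The homology
  \<open>S\<close> is not free over \<open>Q\<close>, but it stands at the end of the exact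
  sequence, where freeness of the other terms lets invariants be lifted. Regularity of the vertex
  forms is made visible by a substitution that sends the eight edges into
  \<open>S[t1, t2, t3]\<close> and the vertex forms to \<open>t1\<close>, \<open>t2\<close>,
  \<open>t3\<close> and their sum; it is bijective because it is onto and the cardinalities agree.
  \<open>S\<close> in turn is built as a free module of rank 16 over a polynomial ring of
  invariants, so that invariance becomes a linear system for sixteen coefficients.\<close>

class char_2 = ab_group_add +
  assumes add_self [simp]: "x + x = 0"
begin

lemma add_self_left [simp]: "x + (x + y) = y"
  by (metis add.assoc add_0_left add_self)

lemma uminus_char_2 [simp]: "- x = x"
  by (rule minus_unique) simp

lemma minus_char_2 [simp]: "x - y = x + y"
  by (simp add: diff_conv_add_uminus del: add_uminus_conv_diff)

lemma add_eq_0_iff_char_2: "x + y = 0 \<longleftrightarrow> x = y"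
  by (metis add_self add_self_left add_0_right)

end

instance bit :: char_2
  by standard simp

instance "fun" :: (type, char_2) char_2
  by standard (simp add: fun_eq_iff)

instance prod :: (char_2, char_2) char_2
  by standard (simp add: prod_eq_iff)

section \<open>Additive subgroups and counting in characteristic two\<close>

definition add_closed :: "'a :: char_2 set \<Rightarrow> bool" where
  "add_closed A \<longleftrightarrow> 0 \<in> A \<and> (\<forall>x\<in>A. \<forall>y\<in>A. x + y \<in> A)"

lemma add_closedI:
  "0 \<in> A \<Longrightarrow> (\<And>x y. x \<in> A \<Longrightarrow> y \<in> A \<Longrightarrow> x + y \<in> A) \<Longrightarrow> add_closed A"
  by (auto simp: add_closed_def)

lemma add_closed_0: "add_closed A \<Longrightarrow> 0 \<in> A"
  and add_closed_add: "add_closed A \<Longrightarrow> x \<in> A \<Longrightarrow> y \<in> A \<Longrightarrow> x + y \<in> A"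
  by (auto simp: add_closed_def)

definition add_hom :: "('a :: char_2 \<Rightarrow> 'b :: char_2) \<Rightarrow> bool" where
  "add_hom f \<longleftrightarrow> (\<forall>x y. f (x + y) = f x + f y)"

lemma add_homI: "(\<And>x y. f (x + y) = f x + f y) \<Longrightarrow> add_hom f"
  by (simp add: add_hom_def)

lemma add_hom_add: "add_hom f \<Longrightarrow> f (x + y) = f x + f y"
  by (simp add: add_hom_def)

lemma add_hom_0: "add_hom f \<Longrightarrow> f 0 = 0"
  by (metis add_hom_add add_self)

lemma add_hom_sum: "add_hom f \<Longrightarrow> f (sum g A) = (\<Sum>a\<in>A. f (g a))"
  by (induction A rule: infinite_finite_induct) (auto simp: add_hom_0 add_hom_add)

lemma add_closed_kernel: "add_closed D \<Longrightarrow> add_hom f \<Longrightarrow> add_closed {d \<in> D. f d = 0}"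
  by (auto simp: add_closed_def add_hom_add add_hom_0)

lemma add_closed_image: "add_closed D \<Longrightarrow> add_hom f \<Longrightarrow> add_closed (f ` D)"
  unfolding add_closed_def by (auto simp: image_iff) (metis add_hom_0, metis add_hom_add)

text \<open>Each fibre over a point of the image is a coset of the kernel; translation by one
  preimage is its own inverse and gives the bijection.\<close>

lemma card_fibres:
  fixes f :: "'a :: char_2 \<Rightarrow> 'b :: char_2"
  assumes "finite D" "add_closed D" "add_hom f" "A \<subseteq> f ` D"
  shows "card {d \<in> D. f d \<in> A} = card A * card {d \<in> D. f d = 0}"
proof -
  have fin: "finite A" using assms finite_subset by blast
  have *: "card {d \<in> D. f d = a} = card {d \<in> D. f d = 0}" if a: "a \<in> A" for a
  proof -
    obtain e where e: "e \<in> D" "f e = a" using a assms by blast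
    have "bij_betw (\<lambda>d. d + e) {d \<in> D. f d = 0} {d \<in> D. f d = a}"
      by (rule bij_betw_byWitness[where f' = "\<lambda>d. d + e"])
        (use e assms in \<open>auto simp: add_hom_add add_closed_add add.assoc\<close>)
    then show ?thesis by (simp add: bij_betw_same_card)
  qed
  have "{d \<in> D. f d \<in> A} = (\<Union>a\<in>A. {d \<in> D. f d = a})" by auto
  also have "card \<dots> = (\<Sum>a\<in>A. card {d \<in> D. f d = a})"
    by (rule card_UN_disjoint) (use fin assms in auto)
  also have "\<dots> = card A * card {d \<in> D. f d = 0}" using * by simp
  finally show ?thesis .
qed

lemma card_eq_image_kernel:
  fixes f :: "'a :: char_2 \<Rightarrow> 'b :: char_2"
  assumes "finite D" "add_closed D" "add_hom f"
  shows "card D = card (f ` D) * card {d \<in> D. f d = 0}"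
proof -
  have "{d \<in> D. f d \<in> f ` D} = D" by auto
  then show ?thesis using card_fibres[of D f "f ` D"] assms by simp
qed

text \<open>Multiplicative form of an equality of indices: the preimage of a subgroup has the same
  index in \<open>D\<close> as the subgroup has in the image.\<close>

lemma card_preimage:
  fixes f :: "'a :: char_2 \<Rightarrow> 'b :: char_2"
  assumes "finite D" "add_closed D" "add_hom f" "A \<subseteq> f ` D"
  shows "card (f ` D) * card {d \<in> D. f d \<in> A} = card D * card A"
  using card_fibres[OF assms] card_eq_image_kernel[OF assms(1-3)] by simp

lemma card_pos_add_closed: "finite D \<Longrightarrow> add_closed D \<Longrightarrow> card D > 0"
  by (auto simp: card_gt_0_iff add_closed_def)

text \<open>Composes the proportions \<open>A : B = z : b\<close> and
  \<open>z : b = w : k\<close>.\<close>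

lemma cancel_chain:
  fixes b :: nat
  assumes "A * b = B * z" "z * k = b * w" "b > 0"
  shows "A * k = B * w"
proof -
  have "b * (A * k) = b * (B * w)" using assms(1,2) by (metis mult.assoc mult.commute)
  with assms(3) show ?thesis by (metis nat_mult_eq_cancel1)
qed

text \<open>Both \<open>x : k\<close> and \<open>y : b\<close> equal \<open>d : e\<close>.\<close>

lemma cancel_cross:
  fixes d :: nat
  assumes "x * e = d * k" "y * e = d * b" "d > 0"
  shows "y * k = b * x"
proof -
  have "d * (y * k) = y * (d * k)" by (rule mult.left_commute)
  also have "\<dots> = x * (y * e)" unfolding assms(1)[symmetric] by (rule mult.left_commute)
  also have "\<dots> = d * (b * x)" unfolding assms(2) by (metis mult.commute mult.assoc)
  finally show ?thesis using assms(3) by (metis nat_mult_eq_cancel1)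
qed

subsection \<open>Bar cochains\<close>

text \<open>All faces of the bar complex except the one that drops the first entry. The face that
  drops the last entry is the singleton clause. Recursion on the list takes the place of an indexed
  sum and suits induction.\<close>

fun inner_bar :: "('g \<Rightarrow> 'g \<Rightarrow> 'g) \<Rightarrow> ('g list \<Rightarrow> 'v) \<Rightarrow> 'g list \<Rightarrow> 'v :: comm_monoid_add" where
  "inner_bar m f [] = 0"
| "inner_bar m f [g] = f []"
| "inner_bar m f (g # h # r) = f (m g h # r) + inner_bar m (\<lambda>l. f (g # l)) (h # r)"

lemma inner_bar_add: "inner_bar m (\<lambda>l. f l + f' l) gs = inner_bar m f gs + inner_bar m f' gs"
proof (induction m f gs arbitrary: f' rule: inner_bar.induct)
  case (3 m f g h r)
  show ?case by (simp add: 3 add.assoc add.left_commute)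
qed auto

lemma inner_bar_hom: "add_hom d \<Longrightarrow> d (inner_bar m f gs) = inner_bar m (\<lambda>l. d (f l)) gs"
  by (induction m f gs rule: inner_bar.induct) (auto simp: add_hom_0 add_hom_add)

lemma inner_bar_apply: "inner_bar m f gs x = inner_bar m (\<lambda>l. f l x) gs"
  by (induction m f gs rule: inner_bar.induct) auto

lemma inner_bar_nonzero:
  "inner_bar m f gs x \<noteq> 0 \<Longrightarrow> \<exists>l. f l x \<noteq> 0 \<and> length gs = Suc (length l)"
proof (induction m f gs rule: inner_bar.induct)
  case (3 m f g h r)
  show ?case
  proof (cases "f (m g h # r) x = 0")
    case True
    then have "inner_bar m (\<lambda>l. f (g # l)) (h # r) x \<noteq> 0" using 3(2) by simp
    from 3(1)[OF this] obtain l where "f (g # l) x \<noteq> 0" "length (h # r) = Suc (length l)" by blast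
    then show ?thesis by (intro exI[of _ "g # l"]) simp
  qed (auto intro!: exI[of _ "m g h # r"])
qed auto

context group
begin

lemma inner_bar_cong:
  assumes "set gs \<subseteq> carrier G"
    "\<And>l. set l \<subseteq> carrier G \<Longrightarrow> Suc (length l) = length gs \<Longrightarrow> F l = F' l"
  shows "inner_bar (\<otimes>) F gs = inner_bar (\<otimes>) F' gs"
  using assms
proof (induction "(\<otimes>)" F gs arbitrary: F' rule: inner_bar.induct)
  case (3 F g h r)
  have "inner_bar (\<otimes>) (\<lambda>l. F (g # l)) (h # r) = inner_bar (\<otimes>) (\<lambda>l. F' (g # l)) (h # r)"
    by (rule 3(1)) (use 3 in auto)
  with 3(3)[of "g \<otimes> h # r"] 3(2) show ?case by simp
qed auto

text \<open>The simplicial identities cancel the double faces in pairs. Splitting off the first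
  entry reduces this to the list without it; what remains is one use of associativity.\<close>

lemma inner_bar_inner_bar:
  fixes f :: "'a list \<Rightarrow> 'v :: char_2"
  assumes "set gs \<subseteq> carrier G"
  shows "inner_bar (\<otimes>) (inner_bar (\<otimes>) f) gs = 0"
  using assms
proof (induction "length gs" arbitrary: gs f rule: less_induct)
  case less
  show ?case
  proof (cases gs rule: remdups_adj.cases)
    case (3 g h r)
    show ?thesis
    proof (cases r)
      case Nil
      then show ?thesis using 3 by simp
    next
      case (Cons k r')
      let ?fg = "\<lambda>l. f (g # l)"
      have "inner_bar (\<otimes>) (inner_bar (\<otimes>) ?fg) (h # k # r') = 0"
        by (rule less(1)) (use less(2) 3 Cons in auto)
      then have 1: "inner_bar (\<otimes>) ?fg (h \<otimes> k # r')
          = inner_bar (\<otimes>) (\<lambda>l. inner_bar (\<otimes>) ?fg (h # l)) (k # r')"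
        by (simp add: add_eq_0_iff_char_2)
      have 2: "g \<otimes> h \<otimes> k = g \<otimes> (h \<otimes> k)"
        using less(2) 3 Cons by (simp add: m_assoc)
      show ?thesis
        using 1 2 by (simp add: 3 Cons inner_bar_add ac_simps)
    qed
  qed auto
qed

end

text \<open>The bar cochains with values in the cell cochains form a double complex with exact rows and
  columns. A chase along its diagonal compares the bar cohomology of \<open>G\<close> with the cohomology of the
  invariant cell cochains; everything being finite, it is enough to compare cardinalities.\<close>

locale free_cochain_complex = group G for G (structure) +
  fixes act :: "'a \<Rightarrow> 'c \<Rightarrow> 'c" and cells :: "nat \<Rightarrow> 'c set"
    and \<delta> :: "('c \<Rightarrow> 'k :: {char_2, finite}) \<Rightarrow> 'c \<Rightarrow> 'k"
  assumes fin_G: "finite (carrier G)"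
    and fin_cells: "finite (cells n)"
    and act_cells: "g \<in> carrier G \<Longrightarrow> act g x \<in> cells n \<longleftrightarrow> x \<in> cells n"
    and act_one: "act \<one> x = x"
    and act_mult: "g \<in> carrier G \<Longrightarrow> h \<in> carrier G \<Longrightarrow> act (g \<otimes> h) x = act g (act h x)"
    and act_free: "g \<in> carrier G \<Longrightarrow> act g x = x \<Longrightarrow> g = \<one>"
    and hom_\<delta>: "add_hom \<delta>"
    and \<delta>_cells: "(\<And>x. \<phi> x \<noteq> 0 \<Longrightarrow> x \<in> cells n) \<Longrightarrow> \<delta> \<phi> x \<noteq> 0 \<Longrightarrow> x \<in> cells (Suc n)"
    and \<delta>_act: "g \<in> carrier G \<Longrightarrow> \<delta> (\<lambda>x. \<phi> (act g x)) = (\<lambda>x. \<delta> \<phi> (act g x))"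
    and \<delta>_\<delta>: "\<delta> (\<delta> \<phi>) = 0"
    and exact_Suc: "(\<And>x. \<phi> x \<noteq> 0 \<Longrightarrow> x \<in> cells (Suc n)) \<Longrightarrow> \<delta> \<phi> = 0 \<Longrightarrow>
        \<exists>\<psi>. (\<forall>x. \<psi> x \<noteq> 0 \<longrightarrow> x \<in> cells n) \<and> \<phi> = \<delta> \<psi>"
    and exact_0: "(\<And>x. \<phi> x \<noteq> 0 \<Longrightarrow> x \<in> cells 0) \<Longrightarrow>
        \<delta> \<phi> = 0 \<longleftrightarrow> (\<exists>c. \<phi> = (\<lambda>x. if x \<in> cells 0 then c else 0))"
    and cells_0: "cells 0 \<noteq> {}"
begin

text \<open>The first face carries the action on coefficients, and the inverse makes precomposition
  a left action on functions. The default 0 off the carrier lets cochains be compared as total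
  functions.\<close>

definition bar_d :: "('a list \<Rightarrow> 'c \<Rightarrow> 'k) \<Rightarrow> 'a list \<Rightarrow> 'c \<Rightarrow> 'k" where
  "bar_d f gs = (if gs \<noteq> [] \<and> set gs \<subseteq> carrier G
     then (\<lambda>x. f (tl gs) (act (inv (hd gs)) x)) + inner_bar (\<otimes>) f gs else 0)"

definition cell_d :: "('a list \<Rightarrow> 'c \<Rightarrow> 'k) \<Rightarrow> 'a list \<Rightarrow> 'c \<Rightarrow> 'k" where
  "cell_d f gs = \<delta> (f gs)"

definition C :: "nat \<Rightarrow> nat \<Rightarrow> ('a list \<Rightarrow> 'c \<Rightarrow> 'k) set" where
  "C p q = {f. \<forall>gs x. f gs x \<noteq> 0 \<longrightarrow> gs \<in> tuples G p \<and> x \<in> cells q}"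

lemma bar_d_Cons:
  assumes "g \<in> carrier G" "set r \<subseteq> carrier G"
  shows "bar_d f (g # r) = (\<lambda>x. f r (act (inv g) x)) + inner_bar (\<otimes>) f (g # r)"
  using assms by (simp add: bar_d_def)

lemma bar_d_Nil [simp]: "bar_d f [] = 0"
  by (simp add: bar_d_def)

lemma hom_bar_d: "add_hom bar_d"
proof (rule add_homI, rule ext)
  fix f f' :: "'a list \<Rightarrow> 'c \<Rightarrow> 'k" and gs
  have "inner_bar (\<otimes>) (f + f') gs = inner_bar (\<otimes>) f gs + inner_bar (\<otimes>) f' gs"
    using inner_bar_add[of "(\<otimes>)" f f' gs] by (simp add: plus_fun_def)
  then show "bar_d (f + f') gs = (bar_d f + bar_d f') gs"
    by (simp add: bar_d_def fun_eq_iff ac_simps)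
qed

lemma hom_cell_d: "add_hom cell_d"
  by (rule add_homI) (simp add: cell_d_def fun_eq_iff add_hom_add[OF hom_\<delta>])

lemma cell_d_cell_d: "cell_d (cell_d f) = 0"
  by (simp add: cell_d_def fun_eq_iff \<delta>_\<delta>)

text \<open>The double inner faces vanish, so only the terms in which a first face was taken
  survive; they reassemble to the translate of a single \<open>bar_d\<close>, and this yields
  \<open>bar_d_bar_d\<close>.\<close>

lemma inner_bar_bar_d:
  assumes "g \<in> carrier G" "h \<in> carrier G" "set r \<subseteq> carrier G"
  shows "inner_bar (\<otimes>) (bar_d f) (g # h # r) = (\<lambda>x. bar_d f (h # r) (act (inv g) x))"
proof -
  let ?P = "\<lambda>l. (\<lambda>x. f (tl l) (act (inv (hd l)) x))"
  have sub: "inner_bar (\<otimes>) (bar_d f) gs = inner_bar (\<otimes>) (\<lambda>l. ?P l + inner_bar (\<otimes>) f l) gs"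
    if "set gs \<subseteq> carrier G" "length gs \<ge> 2" for gs
    using that
  proof -
    show ?thesis
    proof (rule inner_bar_cong)
      fix l assume "set l \<subseteq> carrier G" "Suc (length l) = length gs"
      then show "bar_d f l = ?P l + inner_bar (\<otimes>) f l"
        using that by (auto simp: bar_d_def)
    qed (rule that)
  qed
  have "inner_bar (\<otimes>) (bar_d f) (g # h # r) = inner_bar (\<otimes>) ?P (g # h # r)"
    using inner_bar_inner_bar[of "g # h # r" f] assms
    by (subst sub) (simp_all only: inner_bar_add, simp_all)
  also have "\<dots> = (\<lambda>x. bar_d f (h # r) (act (inv g) x))"
  proof
    fix x
    have "inner_bar (\<otimes>) (\<lambda>l. f l (act (inv g) x)) (h # r) = inner_bar (\<otimes>) f (h # r) (act (inv g) x)"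
      by (simp add: inner_bar_apply)
    then show "inner_bar (\<otimes>) ?P (g # h # r) x = bar_d f (h # r) (act (inv g) x)"
      using assms
      by (simp add: bar_d_Cons inv_mult_group act_mult inner_bar_apply[where x = x])
  qed
  finally show ?thesis .
qed

lemma bar_d_bar_d: "bar_d (bar_d f) = 0"
proof
  fix gs
  show "bar_d (bar_d f) gs = 0 gs"
  proof (cases "set gs \<subseteq> carrier G")
    case True
    then show ?thesis
    proof (cases gs rule: remdups_adj.cases)
      case (3 g h r)
      then show ?thesis using True
        by (subst 3, subst bar_d_Cons) (auto simp: inner_bar_bar_d simp del: inner_bar.simps)
    qed (auto simp: bar_d_Cons fun_eq_iff)
  qed (auto simp: bar_d_def)
qed

lemma bar_d_cell_d: "bar_d (cell_d f) = cell_d (bar_d f)"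
proof
  fix gs
  show "bar_d (cell_d f) gs = cell_d (bar_d f) gs"
  proof (cases gs)
    case (Cons g r)
    have "inner_bar (\<otimes>) (cell_d f) gs = \<delta> (inner_bar (\<otimes>) f gs)"
      unfolding cell_d_def by (simp add: inner_bar_hom hom_\<delta>)
    moreover have "(\<lambda>x. \<delta> (f r) (act (inv g) x)) = \<delta> (\<lambda>x. f r (act (inv g) x))" if "g \<in> carrier G"
      using that by (simp add: \<delta>_act)
    ultimately show ?thesis
      unfolding bar_d_def cell_d_def using Cons
      by (auto simp: add_hom_add[OF hom_\<delta>] add_hom_0[OF hom_\<delta>])
  qed (simp add: cell_d_def add_hom_0[OF hom_\<delta>])
qed

lemma bar_d_C:
  assumes "f \<in> C p q" shows "bar_d f \<in> C (Suc p) q"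
proof -
  have nz: "f l x \<noteq> 0 \<Longrightarrow> length l = p \<and> x \<in> cells q" for l x
    using assms by (auto simp: C_def tuples_def)
  show ?thesis
    unfolding C_def
  proof (intro CollectI allI impI)
    fix gs x assume d: "bar_d f gs x \<noteq> 0"
    then have gs: "gs \<noteq> []" "set gs \<subseteq> carrier G" by (auto simp: bar_d_def split: if_splits)
    have "length gs = Suc p \<and> x \<in> cells q"
    proof (cases "inner_bar (\<otimes>) f gs x = 0")
      case True
      then have "f (tl gs) (act (inv hd gs) x) \<noteq> 0" using d gs by (simp add: bar_d_def)
      from nz[OF this] gs show ?thesis
        using act_cells[of "inv hd gs" x q] by (cases gs) auto
    next
      case False
      from inner_bar_nonzero[OF this] nz show ?thesis by force
    qed
    then show "gs \<in> tuples G (Suc p) \<and> x \<in> cells q" using gs by (auto simp: tuples_def)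
  qed
qed

lemma cell_d_C: "f \<in> C p q \<Longrightarrow> cell_d f \<in> C p (Suc q)"
proof -
  assume f: "f \<in> C p q"
  show "cell_d f \<in> C p (Suc q)"
    unfolding C_def
  proof (intro CollectI allI impI)
    fix gs x assume nz: "cell_d f gs x \<noteq> 0"
    then have "f gs \<noteq> 0" by (auto simp: cell_d_def add_hom_0[OF hom_\<delta>])
    then have "gs \<in> tuples G p" using f by (auto simp: C_def fun_eq_iff)
    moreover have "x \<in> cells (Suc q)"
      using nz f unfolding cell_d_def C_def by (intro \<delta>_cells[of "f gs" q x]) auto
    ultimately show "gs \<in> tuples G p \<and> x \<in> cells (Suc q)" by simp
  qed
qed

lemma add_closed_C: "add_closed (C p q)"
proof (rule add_closedI)
  fix f f' assume "f \<in> C p q" "f' \<in> C p q"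
  then show "f + f' \<in> C p q" unfolding C_def
    by (auto) (metis add_0_left)+
qed (simp add: C_def)

lemma finite_tuples: "finite (tuples G p)"
  unfolding tuples_def
  using finite_lists_length_eq[OF fin_G, of p] by (simp add: conj_commute)

lemma finite_C: "finite (C p q)"
proof -
  let ?S = "tuples G p \<times> cells q"
  have fin: "finite {f. \<forall>y. (y \<in> ?S \<longrightarrow> f y \<in> (UNIV :: 'k set)) \<and> (y \<notin> ?S \<longrightarrow> f y = 0)}"
    by (rule finite_set_of_finite_funs) (use finite_tuples fin_cells in auto)
  have "C p q \<subseteq> curry ` {f. \<forall>y. (y \<in> ?S \<longrightarrow> f y \<in> (UNIV :: 'k set)) \<and> (y \<notin> ?S \<longrightarrow> f y = 0)}"
  proof
    fix f assume "f \<in> C p q"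
    then show "f \<in> curry ` {f. \<forall>y. (y \<in> ?S \<longrightarrow> f y \<in> (UNIV :: 'k set)) \<and> (y \<notin> ?S \<longrightarrow> f y = 0)}"
      by (intro image_eqI[of _ _ "\<lambda>(gs, x). f gs x"]) (auto simp: C_def curry_def)
  qed
  with fin show ?thesis using finite_surj by blast
qed

text \<open>Here freeness enters: a free \<open>G\<close>-set is a disjoint union of copies of
  \<open>G\<close>, and one representative per orbit gives every point a coordinate in
  \<open>G\<close>.\<close>

lemma equivariant_map:
  obtains \<gamma> where "\<And>x. \<gamma> x \<in> carrier G"
    "\<And>g x. g \<in> carrier G \<Longrightarrow> \<gamma> (act g x) = g \<otimes> \<gamma> x"
proof -
  define orb where "orb x = (\<lambda>g. act g x) ` carrier G" for x
  define rep where "rep x = (SOME y. y \<in> orb x)" for x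
  have orb_self: "x \<in> orb x" for x
    unfolding orb_def using act_one one_closed by (metis image_eqI)
  have orb_eq: "orb (act g x) = orb x" if g: "g \<in> carrier G" for g x
  proof (intro equalityI subsetI)
    fix y assume "y \<in> orb x"
    then obtain h where h: "h \<in> carrier G" "y = act h x" by (auto simp: orb_def)
    then have "y = act (h \<otimes> inv g) (act g x)" using g
      by (simp add: act_mult[symmetric] m_assoc)
    then show "y \<in> orb (act g x)" using g h by (auto simp: orb_def)
  next
    fix y assume "y \<in> orb (act g x)"
    then show "y \<in> orb x" using g by (auto simp: orb_def act_mult[symmetric])
  qed
  have rep_in: "rep x \<in> orb x" for x unfolding rep_def using orb_self by (rule someI)
  have "\<exists>h. h \<in> carrier G \<and> x = act h (rep x)" for x
  proof -
    obtain h where h: "h \<in> carrier G" "rep x = act h x" using rep_in by (auto simp: orb_def)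
    then have "x = act (inv h) (rep x)" by (simp add: act_mult[symmetric] act_one)
    then show ?thesis using h by blast
  qed
  then obtain \<gamma> where \<gamma>: "\<And>x. \<gamma> x \<in> carrier G" "\<And>x. x = act (\<gamma> x) (rep x)" by metis
  have inj: "a = b" if ab: "a \<in> carrier G" "b \<in> carrier G" "act a z = act b z" for a b z
  proof -
    have "act (inv b \<otimes> a) z = act (inv b) (act b z)" using ab by (simp add: act_mult)
    also have "\<dots> = z" using ab by (simp add: act_mult[symmetric] act_one)
    finally have "inv b \<otimes> a = \<one>" using ab by (intro act_free) auto
    then show ?thesis using ab by (metis inv_closed inv_equality inv_inv)
  qed
  have "\<gamma> (act g x) = g \<otimes> \<gamma> x" if g: "g \<in> carrier G" for g x
  proof (rule inj)
    have "act (\<gamma> (act g x)) (rep (act g x)) = act g x" using \<gamma>(2) by metis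
    also have "\<dots> = act (g \<otimes> \<gamma> x) (rep x)" using g \<gamma> act_mult by metis
    finally show "act (\<gamma> (act g x)) (rep x) = act (g \<otimes> \<gamma> x) (rep x)"
      using orb_eq[OF g] by (simp add: rep_def)
  qed (use g \<gamma> in auto)
  with \<gamma>(1) show thesis by (rule that)
qed

text \<open>Functions on a free \<open>G\<close>-set are coinduced, hence acyclic for the bar
  differential.\<close>

lemma bar_exact:
  assumes f: "f \<in> C (Suc p) q" and df: "bar_d f = 0"
  shows "\<exists>h\<in>C p q. f = bar_d h"
proof -
  obtain \<gamma> where \<gamma>: "\<And>x. \<gamma> x \<in> carrier G"
    "\<And>g x. g \<in> carrier G \<Longrightarrow> \<gamma> (act g x) = g \<otimes> \<gamma> x" using equivariant_map by blast
  \<comment> \<open>Contracting homotopy: prepend the inverse coordinate of the cell and move the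
    cell to the point of its orbit with coordinate \<open>\<one>\<close>.\<close>
  define h where "h gs x = f (inv \<gamma> x # gs) (act (inv \<gamma> x) x)" for gs x
  have "h \<in> C p q"
    unfolding C_def
  proof (intro CollectI allI impI)
    fix gs x assume "h gs x \<noteq> 0"
    then have "inv \<gamma> x # gs \<in> tuples G (Suc p)" "act (inv \<gamma> x) x \<in> cells q"
      using f by (auto simp: C_def h_def)
    then show "gs \<in> tuples G p \<and> x \<in> cells q" using \<gamma>(1) act_cells[of "inv \<gamma> x" x q]
      by (auto simp: tuples_def)
  qed
  moreover have "f = bar_d h"
  proof (intro ext)
    fix gs x
    show "f gs x = bar_d h gs x"
    proof (cases "set gs \<subseteq> carrier G \<and> gs \<noteq> []")
      case False
      then have "gs \<notin> tuples G (Suc p)" by (auto simp: tuples_def)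
      with f False show ?thesis by (auto simp: C_def bar_d_def)
    next
      case True
      then obtain g r where gs: "gs = g # r" "g \<in> carrier G" "set r \<subseteq> carrier G"
        by (cases gs) auto
      let ?k = "inv \<gamma> x"
      let ?y = "act ?k x"
      \<comment> \<open>The cocycle equation at the extended tuple has \<open>f gs x\<close> as its
        first face; the other faces are those of \<open>h\<close>.\<close>
      have "0 = bar_d f (?k # gs) ?y" using df by simp
      also have "\<dots> = f gs x + (f (?k \<otimes> g # r) ?y + inner_bar (\<otimes>) (\<lambda>l. f (?k # l) ?y) (g # r))"
      proof -
        have "act (inv ?k) ?y = x" using \<gamma>(1) by (simp add: act_mult[symmetric] act_one)
        then show ?thesis using gs \<gamma>(1) True
          by (simp add: bar_d_Cons inner_bar_apply[where x = ?y])
      qed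
      also have "inner_bar (\<otimes>) (\<lambda>l. f (?k # l) ?y) (g # r) = inner_bar (\<otimes>) h gs x"
        by (simp add: inner_bar_apply[where x = x] h_def gs)
      also have "f (?k \<otimes> g # r) ?y = h r (act (inv g) x)"
      proof -
        have 1: "inv \<gamma> (act (inv g) x) = ?k \<otimes> g"
          using gs \<gamma> by (simp add: inv_mult_group)
        then have "act (inv \<gamma> (act (inv g) x)) (act (inv g) x) = ?y"
          using gs \<gamma>(1) by (simp add: act_mult[symmetric] m_assoc)
        with 1 show ?thesis by (simp add: h_def)
      qed
      finally show ?thesis using gs
        by (simp add: bar_d_Cons) (metis add_eq_0_iff_char_2)
    qed
  qed
  ultimately show ?thesis by blast
qed

text \<open>Exactness of the cell complex is applied to each tuple separately; the preimage 0 off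
  \<open>tuples\<close> keeps the chosen family in \<open>C p q\<close>.\<close>

lemma cell_exact:
  assumes f: "f \<in> C p (Suc q)" and df: "cell_d f = 0"
  shows "\<exists>h\<in>C p q. f = cell_d h"
proof -
  have "\<exists>\<psi>. (\<forall>x. \<psi> x \<noteq> 0 \<longrightarrow> gs \<in> tuples G p \<and> x \<in> cells q) \<and> f gs = \<delta> \<psi>" for gs
  proof (cases "gs \<in> tuples G p")
    case True
    have "\<exists>\<psi>. (\<forall>x. \<psi> x \<noteq> 0 \<longrightarrow> x \<in> cells q) \<and> f gs = \<delta> \<psi>"
      by (rule exact_Suc) (use f df in \<open>auto simp: C_def cell_d_def fun_eq_iff\<close>)
    with True show ?thesis by blast
  next
    case False
    then have "f gs = 0" using f unfolding C_def fun_eq_iff by fastforce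
    then have "f gs = \<delta> 0" by (simp add: add_hom_0[OF hom_\<delta>])
    then show ?thesis by (intro exI[of _ 0]) auto
  qed
  then obtain h where h: "\<And>gs x. h gs x \<noteq> 0 \<longrightarrow> gs \<in> tuples G p \<and> x \<in> cells q"
    "\<And>gs. f gs = \<delta> (h gs)" by metis
  then have "h \<in> C p q" "f = cell_d h" by (auto simp: C_def cell_d_def)
  then show ?thesis by blast
qed

text \<open>Cocycles for both differentials. At the two ends of a diagonal, \<open>Z n 0\<close>
  will be the cocycles of \<open>G\<close> and \<open>Z 0 n\<close> the invariant cell
  cocycles.\<close>

definition Z :: "nat \<Rightarrow> nat \<Rightarrow> ('a list \<Rightarrow> 'c \<Rightarrow> 'k) set" where
  "Z p q = {f \<in> C p q. bar_d f = 0 \<and> cell_d f = 0}"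

definition bar_ker :: "nat \<Rightarrow> nat \<Rightarrow> ('a list \<Rightarrow> 'c \<Rightarrow> 'k) set" where
  "bar_ker p q = {f \<in> C p q. bar_d f = 0}"

definition cell_ker :: "nat \<Rightarrow> nat \<Rightarrow> ('a list \<Rightarrow> 'c \<Rightarrow> 'k) set" where
  "cell_ker p q = {f \<in> C p q. cell_d f = 0}"

text \<open>The elements of \<open>C p q\<close> killed by the composite of both differentials map
  onto \<open>Z p (Suc q)\<close> and onto \<open>Z (Suc p) q\<close>. Each of the two quotients
  compared here is this group modulo the sum of the two kernels.\<close>

lemma zigzag_step:
  "card (Z (Suc p) q) * card (cell_d ` bar_ker p q) = card (bar_d ` cell_ker p q) * card (Z p (Suc q))"
proof -
  define D where "D = {g \<in> C p q. cell_d (bar_d g) = 0}"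
  have hom2: "add_hom (\<lambda>g. cell_d (bar_d g))"
    by (rule add_homI) (simp add: add_hom_add hom_bar_d hom_cell_d)
  have D: "finite D" "add_closed D"
    unfolding D_def using finite_C add_closed_kernel[OF add_closed_C hom2] by auto
  have im1: "cell_d ` D = Z p (Suc q)"
  proof (intro equalityI subsetI)
    fix f assume f: "f \<in> Z p (Suc q)"
    then obtain h where h: "h \<in> C p q" "f = cell_d h" using cell_exact[of f p q] by (auto simp: Z_def)
    with f have "h \<in> D" by (simp add: D_def Z_def bar_d_cell_d)
    with h show "f \<in> cell_d ` D" by blast
  qed (auto simp: D_def Z_def cell_d_C bar_d_cell_d cell_d_cell_d)
  have im2: "bar_d ` D = Z (Suc p) q"
  proof (intro equalityI subsetI)
    fix f assume f: "f \<in> Z (Suc p) q"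
    then obtain h where h: "h \<in> C p q" "f = bar_d h" using bar_exact[of f p q] by (auto simp: Z_def)
    with f have "h \<in> D" by (simp add: D_def Z_def)
    with h show "f \<in> bar_d ` D" by blast
  qed (auto simp: D_def Z_def bar_d_C bar_d_bar_d)
  have sub1: "cell_d ` bar_ker p q \<subseteq> cell_d ` D"
    by (auto simp: D_def bar_ker_def add_hom_0[OF hom_cell_d])
  have sub2: "bar_d ` cell_ker p q \<subseteq> bar_d ` D"
    by (auto simp: D_def cell_ker_def bar_d_cell_d[symmetric] add_hom_0[OF hom_bar_d])
  have mem1: "cell_d g \<in> cell_d ` bar_ker p q \<longleftrightarrow> (\<exists>k\<in>bar_ker p q. g + k \<in> cell_ker p q)"
    if "g \<in> C p q" for g
    using that add_closed_add[OF add_closed_C]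
    by (auto simp: bar_ker_def cell_ker_def image_iff add_hom_add[OF hom_cell_d] add_eq_0_iff_char_2)
  have mem2: "bar_d g \<in> bar_d ` cell_ker p q \<longleftrightarrow> (\<exists>k\<in>cell_ker p q. g + k \<in> bar_ker p q)"
    if "g \<in> C p q" for g
    using that add_closed_add[OF add_closed_C]
    by (auto simp: bar_ker_def cell_ker_def image_iff add_hom_add[OF hom_bar_d] add_eq_0_iff_char_2)
  \<comment> \<open>Either condition says that \<open>g\<close> lies in the sum of the two
    kernels.\<close>
  have "cell_d g \<in> cell_d ` bar_ker p q \<longleftrightarrow> bar_d g \<in> bar_d ` cell_ker p q" if g: "g \<in> D" for g
  proof -
    have "(\<exists>k\<in>bar_ker p q. g + k \<in> cell_ker p q) \<longleftrightarrow> (\<exists>k\<in>cell_ker p q. g + k \<in> bar_ker p q)"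
      by (metis add.commute add_self_left)
    then show ?thesis using g by (simp add: mem1 mem2 D_def)
  qed
  then have E: "{g \<in> D. cell_d g \<in> cell_d ` bar_ker p q} = {g \<in> D. bar_d g \<in> bar_d ` cell_ker p q}"
    by blast
  define e where "e = card {g \<in> D. cell_d g \<in> cell_d ` bar_ker p q}"
  have 1: "card (Z p (Suc q)) * e = card D * card (cell_d ` bar_ker p q)"
    using card_preimage[OF D hom_cell_d sub1] by (simp add: im1 e_def)
  have 2: "card (Z (Suc p) q) * e = card D * card (bar_d ` cell_ker p q)"
    using card_preimage[OF D hom_bar_d sub2] by (simp add: im2 e_def E)
  show ?thesis by (rule cancel_cross[OF 1 2 card_pos_add_closed[OF D]])
qed

text \<open>By exactness of rows and columns both sides are the image of \<open>C p q\<close> under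
  the composite of the two differentials. This makes consecutive steps of the staircase fit
  together.\<close>

lemma cell_d_bar_ker: "cell_d ` bar_ker (Suc p) q = bar_d ` cell_ker p (Suc q)"
proof (intro equalityI subsetI)
  fix f assume "f \<in> cell_d ` bar_ker (Suc p) q"
  then obtain k where k: "k \<in> C (Suc p) q" "bar_d k = 0" "f = cell_d k" by (auto simp: bar_ker_def)
  then obtain h where "h \<in> C p q" "k = bar_d h" using bar_exact by blast
  with k show "f \<in> bar_d ` cell_ker p (Suc q)"
    by (auto simp: cell_ker_def bar_d_cell_d[symmetric] cell_d_C cell_d_cell_d intro!: image_eqI[of _ _ "cell_d h"])
next
  fix f assume "f \<in> bar_d ` cell_ker p (Suc q)"
  then obtain k where k: "k \<in> C p (Suc q)" "cell_d k = 0" "f = bar_d k" by (auto simp: cell_ker_def)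
  then obtain h where "h \<in> C p q" "k = cell_d h" using cell_exact by blast
  with k show "f \<in> cell_d ` bar_ker (Suc p) q"
    by (auto simp: bar_ker_def bar_d_cell_d bar_d_C bar_d_bar_d intro!: image_eqI[of _ _ "bar_d h"])
qed

text \<open>Telescoping of \<open>zigzag_step\<close> along the diagonal down to the column of
  functions on the empty tuple.\<close>

lemma zigzag:
  "card (Z (Suc p) q) * card (cell_d ` bar_ker 0 (p + q))
     = card (bar_d ` cell_ker p q) * card (Z 0 (Suc (p + q)))"
proof (induction p arbitrary: q)
  case 0
  show ?case using zigzag_step[of 0 q] unfolding add_0 .
next
  case (Suc p)
  let ?z = "card (Z (Suc p) (Suc q))" and ?b = "card (bar_d ` cell_ker p (Suc q))"
  have pos: "?b > 0"
  proof (rule card_pos_add_closed)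
    show "finite (bar_d ` cell_ker p (Suc q))" unfolding cell_ker_def using finite_C by simp
    show "add_closed (bar_d ` cell_ker p (Suc q))" unfolding cell_ker_def
      by (rule add_closed_image[OF add_closed_kernel[OF add_closed_C hom_cell_d] hom_bar_d])
  qed
  have 1: "card (Z (Suc (Suc p)) q) * ?b = card (bar_d ` cell_ker (Suc p) q) * ?z"
    using zigzag_step[of "Suc p" q] unfolding cell_d_bar_ker .
  have 2: "?z * card (cell_d ` bar_ker 0 (Suc p + q)) = ?b * card (Z 0 (Suc (Suc p + q)))"
    using Suc[of "Suc q"] unfolding add_Suc add_Suc_right .
  show ?case by (rule cancel_chain[OF 1 2 pos])
qed

end

instance bit :: finite
proof
  have "(UNIV :: bit set) = {0, 1}" using bit_not_zero_iff by auto
  then show "finite (UNIV :: bit set)" by (metis finite.emptyI finite.insertI)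
qed

lemma card_UNIV_bit: "card (UNIV :: bit set) = 2"
proof -
  have "(UNIV :: bit set) = {0, 1}" using bit_not_zero_iff by auto
  then show ?thesis by (metis card_2_iff zero_neq_one)
qed

subsection \<open>Dimensions over the field with two elements\<close>

text \<open>Coordinates in a basis identify the space with the functions from the basis to
  \<open>bit\<close>; cardinals thereby determine library dimensions.\<close>

lemma card_eq_two_power_dim:
  fixes V :: "(bit, 'v, 'm) module_scheme"
  assumes "vectorspace class_ring V" "finite (carrier V)"
  shows "card (carrier V) = 2 ^ vectorspace.dim class_ring V"
proof -
  interpret V: vectorspace class_ring V by fact
  have "V.module.span (carrier V) = carrier V"
    by (metis V.module.in_own_span V.module.span_is_subset2 subset_antisym order_refl)
  then have "V.fin_dim" unfolding V.fin_dim_def using assms(2) by blast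
  then obtain A where A: "finite A" "V.basis A" using V.finite_basis_exists by blast
  then have sub: "A \<subseteq> carrier V" unfolding V.basis_def by blast
  have uniq: "\<exists>!a. a \<in> A \<rightarrow>\<^sub>E (UNIV :: bit set) \<and> V.module.lincomb a A = v" if "v \<in> carrier V" for v
    using V.basis_criterion[OF A(1) sub] A(2) that by simp
  have "bij_betw (\<lambda>a. V.module.lincomb a A) (A \<rightarrow>\<^sub>E (UNIV :: bit set)) (carrier V)"
    unfolding bij_betw_def
  proof
    have closed: "V.module.lincomb a A \<in> carrier V" for a
      by (rule V.module.lincomb_closed) (use sub in auto)
    then show "inj_on (\<lambda>a. V.module.lincomb a A) (A \<rightarrow>\<^sub>E (UNIV :: bit set))"
      using uniq by (intro inj_onI) metis
    show "(\<lambda>a. V.module.lincomb a A) ` (A \<rightarrow>\<^sub>E (UNIV :: bit set)) = carrier V"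
      using uniq closed by (auto simp: image_iff) metis
  qed
  then have "card (carrier V) = card (A \<rightarrow>\<^sub>E (UNIV :: bit set))"
    by (simp add: bij_betw_same_card)
  also have "\<dots> = 2 ^ card A" using A(1) by (simp add: card_PiE card_UNIV_bit)
  also have "card A = V.dim" using V.dim_basis[OF A] by simp
  finally show ?thesis .
qed

text \<open>A scalar is 0 or 1, so the union in \<open>smult\<close> gives the zero coset or the
  coset itself, and the module laws reduce to \<open>C + C = 0\<close>.\<close>

lemma vectorspace_quotient_module:
  fixes M :: "(bit, 'v, 'm) module_scheme"
  assumes "Module.module class_ring M" "Module.submodule N class_ring M"
  shows "vectorspace class_ring (quotient_module M N)"
proof -
  interpret M: Module.module class_ring M by fact
  interpret N: Module.submodule N class_ring M by fact
  interpret N: abelian_subgroup N M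
    by (rule abelian_subgroupI3)
      (simp_all add: additive_subgroup_def N.subgroup_axioms M.abelian_group_axioms)
  let ?Q = "quotient_module M N"
  interpret C: comm_group "M A_Mod N" by (rule N.a_factorgroup_is_comm_group)
  have fields: "carrier ?Q = carrier (M A_Mod N)" "(\<oplus>\<^bsub>?Q\<^esub>) = (\<otimes>\<^bsub>M A_Mod N\<^esub>)"
      "\<zero>\<^bsub>?Q\<^esub> = \<one>\<^bsub>M A_Mod N\<^esub>"
    by (simp_all add: quotient_module_def A_FactGroup_def')
  interpret Q: abelian_group ?Q
    by (rule abelian_groupI; unfold fields)
      (rule C.m_closed C.one_closed C.m_assoc C.m_comm C.l_one C.l_inv_ex; assumption)+
  have coset: "\<exists>x\<in>carrier M. C = N +>\<^bsub>M\<^esub> x" if "C \<in> carrier ?Q" for C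
    using that by (auto simp: quotient_module_def A_RCOSETS_def')
  have smult: "c \<odot>\<^bsub>?Q\<^esub> C = (if c = 0 then \<zero>\<^bsub>?Q\<^esub> else C)" if C: "C \<in> carrier ?Q" for c C
  proof -
    obtain x where x: "x \<in> carrier M" "C = N +>\<^bsub>M\<^esub> x" using coset[OF C] by blast
    have sub: "y \<in> carrier M" "N +>\<^bsub>M\<^esub> y = C" if "y \<in> C" for y
      using that x M.a_repr_independence[of y N x] N.a_elemrcos_carrier[of x y] N.subgroup_axioms by auto
    have x': "x \<in> C" using x N.a_rcos_self by simp
    show ?thesis
    proof (cases "c = 0")
      case True
      have "0 \<odot>\<^bsub>M\<^esub> y = \<zero>\<^bsub>M\<^esub>" if "y \<in> C" for y using M.smult_l_null[of y] sub(1)[OF that] by simp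
      then have "c \<odot>\<^bsub>?Q\<^esub> C = (\<Union>y\<in>C. N +>\<^bsub>M\<^esub> \<zero>\<^bsub>M\<^esub>)" using True by (simp add: quotient_module_def)
      also have "\<dots> = N" using x' N.a_subset by auto
      finally show ?thesis using True by (simp add: quotient_module_def)
    next
      case False
      then have "c = 1" by simp
      moreover have "1 \<odot>\<^bsub>M\<^esub> y = y" if "y \<in> C" for y using M.smult_one[of y] sub(1)[OF that] by simp
      ultimately have "c \<odot>\<^bsub>?Q\<^esub> C = (\<Union>y\<in>C. C)" using sub(2) by (simp add: quotient_module_def)
      then show ?thesis using False x' by auto
    qed
  qed
  have double: "C \<oplus>\<^bsub>?Q\<^esub> C = \<zero>\<^bsub>?Q\<^esub>" if C: "C \<in> carrier ?Q" for C
  proof -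
    obtain x where x: "x \<in> carrier M" "C = N +>\<^bsub>M\<^esub> x" using coset[OF C] by blast
    have "x \<oplus>\<^bsub>M\<^esub> x = (1 + 1) \<odot>\<^bsub>M\<^esub> x"
      using M.smult_l_distr[of 1 1 x] M.smult_one[of x] x by simp
    also have "\<dots> = \<zero>\<^bsub>M\<^esub>" using M.smult_l_null[of x] x by simp
    finally have "x \<oplus>\<^bsub>M\<^esub> x = \<zero>\<^bsub>M\<^esub>" .
    then have "C <+>\<^bsub>M\<^esub> C = N +>\<^bsub>M\<^esub> \<zero>\<^bsub>M\<^esub>" using x N.a_rcos_sum[of x x] by simp
    then show ?thesis using N.a_subset by (simp add: quotient_module_def)
  qed
  have "Module.module class_ring ?Q"
  proof (rule Module.moduleI)
    show "cring (class_ring :: bit ring)" using assms(1) unfolding Module.module_def by blast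
    show "abelian_group ?Q" by (rule Q.abelian_group_axioms)
  qed (auto simp: smult double)
  then show ?thesis
    unfolding vectorspace_def using class_field by blast
qed

text \<open>Lagrange's theorem for the coboundaries inside the cocycles, followed by
  \<open>card_eq_two_power_dim\<close>.\<close>

lemma cohomology_dim_eq:
  fixes G :: "('a, 'b) monoid_scheme"
  assumes G: "finite (carrier G)"
    and sub: "Module.submodule (cocycles G n) class_ring (cochains G n :: (bit, _) module)"
    and sub': "Module.submodule (coboundaries G n) class_ring ((cochains G n :: (bit, _) module)\<lparr>carrier := cocycles G n\<rparr>)"
    and card: "card (cocycles G n :: ('a list \<Rightarrow> bit) set) = 2 ^ d * card (coboundaries G n :: ('a list \<Rightarrow> bit) set)"
  shows "cohomology_dim TYPE(bit) G n = d"
proof -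
  let ?Z = "cocycles G n :: ('a list \<Rightarrow> bit) set" and ?B = "coboundaries G n :: ('a list \<Rightarrow> bit) set"
  let ?M = "(cochains G n :: (bit, _) module)\<lparr>carrier := ?Z\<rparr>"
  have mod: "Module.module class_ring (cochains G n :: (bit, _) module)"
    unfolding cochains_def by (rule class_cring.func_space_is_module)
  have M: "Module.module class_ring ?M"
    by (rule Module.submodule.submodule_is_module[OF sub mod])
  interpret V: vectorspace class_ring "quotient_module ?M ?B"
    by (rule vectorspace_quotient_module[OF M sub'])
  interpret M: Module.module class_ring ?M by (rule M)
  have sg: "subgroup ?B (add_monoid ?M)" using sub' by (rule Module.submodule.axioms)
  have "finite (tuples G n)" unfolding tuples_def
    using finite_lists_length_eq[OF G, of n] by (simp add: conj_commute)
  then have "finite (tuples G n \<rightarrow>\<^sub>E (UNIV :: bit set))" by (intro finite_PiE) auto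
  moreover have "carrier (cochains G n :: (bit, _) module) = tuples G n \<rightarrow>\<^sub>E UNIV"
    unfolding cochains_def class_ring.func_space_def partial_object.simps by (rule refl)
  ultimately have finZ: "finite ?Z"
    by (metis (no_types, lifting) cocycles_def finite_subset mem_Collect_eq subsetI)
  have car: "carrier (quotient_module ?M ?B) = rcosets\<^bsub>add_monoid ?M\<^esub> ?B"
    by (simp add: quotient_module_def A_RCOSETS_def)
  have ord: "Coset.order (add_monoid ?M) = card ?Z" by (simp add: Coset.order_def)
  have "card (rcosets\<^bsub>add_monoid ?M\<^esub> ?B) * card ?B = card ?Z"
    using group.lagrange[OF M.a_group sg] ord by (rule trans)
  moreover have "card ?B > 0"
    using subgroup.subset[OF sg] subgroup.one_closed[OF sg] finZ finite_subset[of ?B ?Z]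
    by (auto simp: card_gt_0_iff)
  ultimately have cc: "card (carrier (quotient_module ?M ?B)) = 2 ^ d" using card by (simp add: car)
  then have "finite (carrier (quotient_module ?M ?B))" by (metis card.infinite power_eq_0_iff zero_neq_numeral)
  from card_eq_two_power_dim[OF V.vectorspace_axioms this] cc
  show ?thesis by (simp add: cohomology_dim_def cohomology_def)
qed

text \<open>Negation is the identity and scalars are 0 and 1, so closure under addition is
  enough.\<close>

lemma submodule_bitI:
  assumes M: "Module.module class_ring (M :: (bit, 'v, 'm) module_scheme)"
    and H: "H \<subseteq> carrier M" "\<zero>\<^bsub>M\<^esub> \<in> H" "\<And>x y. x \<in> H \<Longrightarrow> y \<in> H \<Longrightarrow> x \<oplus>\<^bsub>M\<^esub> y \<in> H"
  shows "Module.submodule H class_ring M"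
proof -
  interpret M: Module.module class_ring M by (rule M)
  have smult: "c \<odot>\<^bsub>M\<^esub> x = (if c = 0 then \<zero>\<^bsub>M\<^esub> else x)" if "x \<in> carrier M" for c x
    using M.smult_one[OF that] M.smult_l_null[OF that] by auto
  have "x \<oplus>\<^bsub>M\<^esub> x = \<zero>\<^bsub>M\<^esub>" if "x \<in> carrier M" for x
    using M.smult_l_distr[of 1 1 x] M.smult_one[of x] M.smult_l_null[of x] that by simp
  then have inv: "\<ominus>\<^bsub>M\<^esub> x = x" if "x \<in> carrier M" for x
    using that M.minus_equality by simp
  show ?thesis
    by (rule M.submoduleI) (use H smult inv in \<open>auto simp: subset_iff\<close>)
qed

lemma inner_bar_eq_sum:
  "length gs = Suc n \<Longrightarrow> inner_bar m f gs =
     (\<Sum>i<n. f (take i gs @ [m (gs ! i) (gs ! Suc i)] @ drop (Suc (Suc i)) gs)) + f (butlast gs)"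
proof (induction m f gs arbitrary: n rule: inner_bar.induct)
  case (3 m f g h r)
  then obtain n' where n: "n = Suc n'" "length (h # r) = Suc n'" by (cases n) auto
  have "inner_bar m (\<lambda>l. f (g # l)) (h # r)
      = (\<Sum>i<n'. f (take (Suc i) (g # h # r) @ [m ((g # h # r) ! Suc i) ((g # h # r) ! Suc (Suc i))]
           @ drop (Suc (Suc (Suc i))) (g # h # r))) + f (butlast (g # h # r))"
    using 3(1)[OF n(2)] by simp
  then show ?case
    by (simp add: n(1) sum.lessThan_Suc_shift add.assoc del: sum.lessThan_Suc)
qed auto

text \<open>The powers of \<open>-1\<close> are all 1, which links the indexed sum of the
  definitions to the recursive faces.\<close>

lemma coboundary_eq_inner_bar:
  fixes f :: "'a list \<Rightarrow> 'k :: {field, char_2}"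
  assumes "gs \<in> tuples G (Suc n)"
  shows "coboundary G n f gs = f (tl gs) + inner_bar (\<otimes>\<^bsub>G\<^esub>) f gs"
proof -
  have "(- 1 :: 'k) = 1" by simp
  then have [simp]: "(- 1 :: 'k) ^ i = 1" for i by (metis power_one)
  show ?thesis
    using assms inner_bar_eq_sum[of gs n "(\<otimes>\<^bsub>G\<^esub>)" f]
    by (simp add: coboundary_def tuples_def add.assoc)
qed

lemma (in group) tuples_faces:
  assumes "gs \<in> tuples G (Suc n)"
  shows "tl gs \<in> tuples G n" "butlast gs \<in> tuples G n"
  using assms by (auto simp: tuples_def dest: in_set_butlastD) (cases gs; auto)+

lemma (in group) inner_bar_tuples_cong:
  assumes "gs \<in> tuples G (Suc n)" "\<And>l. l \<in> tuples G n \<Longrightarrow> f l = f' l"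
  shows "inner_bar (\<otimes>) f gs = inner_bar (\<otimes>) f' gs"
  by (rule inner_bar_cong) (use assms in \<open>auto simp: tuples_def\<close>)

context
  fixes G :: "('a, 'b) monoid_scheme" (structure)
  assumes G: "Group.group G"
begin

interpretation Group.group G by (rule G)

interpretation M: Module.module class_ring "cochains G n :: ('k :: {field, char_2}, _) module" for n
  unfolding cochains_def by (rule class_cring.func_space_is_module)

lemma cochains_sel:
  "carrier (cochains G n :: ('k :: field, _) module) = tuples G n \<rightarrow>\<^sub>E UNIV"
  "\<zero>\<^bsub>cochains G n\<^esub> = (\<lambda>gs\<in>tuples G n. 0 :: 'k)"
  "f \<oplus>\<^bsub>cochains G n\<^esub> g = (\<lambda>gs\<in>tuples G n. f gs + g gs :: 'k)"
  "c \<odot>\<^bsub>cochains G n\<^esub> g = (\<lambda>gs\<in>tuples G n. c * g gs :: 'k)"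
  unfolding cochains_def class_ring.func_space_def by simp_all

lemma coboundary_add:
  fixes f :: "'a list \<Rightarrow> 'k :: {field, char_2}"
  shows "coboundary G n (f \<oplus>\<^bsub>cochains G n\<^esub> f')
       = coboundary G n f \<oplus>\<^bsub>cochains G (Suc n)\<^esub> coboundary G n f'"
proof
  fix gs
  show "coboundary G n (f \<oplus>\<^bsub>cochains G n\<^esub> f') gs
      = (coboundary G n f \<oplus>\<^bsub>cochains G (Suc n)\<^esub> coboundary G n f') gs"
  proof (cases "gs \<in> tuples G (Suc n)")
    case True
    have "inner_bar (\<otimes>) (f \<oplus>\<^bsub>cochains G n\<^esub> f') gs = inner_bar (\<otimes>) (\<lambda>l. f l + f' l) gs"
      by (rule inner_bar_tuples_cong[OF True]) (simp add: cochains_sel)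
    with True tuples_faces[OF True] show ?thesis
      by (simp add: coboundary_eq_inner_bar cochains_sel inner_bar_add add.assoc add.left_commute)
  qed (simp add: coboundary_def cochains_sel)
qed

lemma submodule_cocycles:
  "Module.submodule (cocycles G n) class_ring (cochains G n :: (bit, _) module)"
proof (rule submodule_bitI)
  show "Module.module class_ring (cochains G n :: (bit, _) module)" by (rule M.module_axioms)
  show sub: "cocycles G n \<subseteq> carrier (cochains G n :: (bit, _) module)" by (auto simp: cocycles_def)
  have z: "coboundary G n \<zero>\<^bsub>cochains G n\<^esub> = (\<zero>\<^bsub>cochains G (Suc n)\<^esub> :: _ \<Rightarrow> bit)"
    using coboundary_add[of n "\<zero>\<^bsub>cochains G n\<^esub> :: _ \<Rightarrow> bit" "\<zero>\<^bsub>cochains G n\<^esub>"]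
    by (simp add: M.l_zero M.zero_closed) (simp add: cochains_sel fun_eq_iff)
  then show "\<zero>\<^bsub>cochains G n\<^esub> \<in> (cocycles G n :: (_ \<Rightarrow> bit) set)" by (simp add: cocycles_def)
  show "f \<oplus>\<^bsub>cochains G n\<^esub> f' \<in> cocycles G n"
    if "f \<in> cocycles G n" "f' \<in> cocycles G n" for f f' :: "_ \<Rightarrow> bit"
    using that by (auto simp: cocycles_def coboundary_add)
qed

lemma submodule_coboundaries:
  assumes "coboundaries G n \<subseteq> (cocycles G n :: (_ \<Rightarrow> bit) set)"
  shows "Module.submodule (coboundaries G n) class_ring
    ((cochains G n :: (bit, _) module)\<lparr>carrier := cocycles G n\<rparr>)"
proof (rule submodule_bitI)
  show "Module.module class_ring ((cochains G n :: (bit, _) module)\<lparr>carrier := cocycles G n\<rparr>)"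
    by (rule Module.submodule.submodule_is_module[OF submodule_cocycles M.module_axioms])
  show "coboundaries G n \<subseteq> carrier ((cochains G n :: (bit, _) module)\<lparr>carrier := cocycles G n\<rparr>)"
    using assms by simp
  have "\<zero>\<^bsub>cochains G n\<^esub> \<in> (coboundaries G n :: (_ \<Rightarrow> bit) set)"
  proof (cases n)
    case (Suc m)
    have "\<zero>\<^bsub>cochains G m\<^esub> \<in> (cocycles G m :: (_ \<Rightarrow> bit) set)"
      using Module.submodule.axioms(1)[OF submodule_cocycles] subgroup.one_closed by fastforce
    then show ?thesis unfolding Suc cocycles_def coboundaries.simps
      by (metis (mono_tags, lifting) image_eqI mem_Collect_eq)
  qed simp
  then show "\<zero>\<^bsub>(cochains G n :: (bit, _) module)\<lparr>carrier := cocycles G n\<rparr>\<^esub> \<in> coboundaries G n"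
    by simp
  have "f \<oplus>\<^bsub>cochains G n\<^esub> f' \<in> coboundaries G n"
    if "f \<in> coboundaries G n" "f' \<in> coboundaries G n" for f f' :: "_ \<Rightarrow> bit"
  proof (cases n)
    case (Suc m)
    with that obtain h h' where "h \<in> carrier (cochains G m)" "h' \<in> carrier (cochains G m)"
      "f = coboundary G m h" "f' = coboundary G m h'" by auto
    then show ?thesis using Suc by (auto simp: coboundary_add[symmetric] intro!: imageI)
  next
    case 0
    with that show ?thesis using M.l_zero[of "\<zero>\<^bsub>cochains G 0\<^esub>" 0] M.zero_closed by simp
  qed
  then show "f \<oplus>\<^bsub>(cochains G n :: (bit, _) module)\<lparr>carrier := cocycles G n\<rparr>\<^esub> f' \<in> coboundaries G n"
    if "f \<in> coboundaries G n" "f' \<in> coboundaries G n" for f f' using that by simp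
qed

end

section \<open>Comparison of group cohomology with invariant cell cochains\<close>

locale free_cochain_complex_field = free_cochain_complex G act cells \<delta>
  for G (structure) and act :: "'a \<Rightarrow> 'c \<Rightarrow> 'c" and cells
    and \<delta> :: "('c \<Rightarrow> 'k :: {field, char_2, finite}) \<Rightarrow> 'c \<Rightarrow> 'k"
begin

text \<open>A cochain with trivial coefficients becomes a function constant on the 0-cells; by
  \<open>exact_0\<close> these functions are the whole kernel of the cell differential.\<close>

definition emb :: "nat \<Rightarrow> ('a list \<Rightarrow> 'k) \<Rightarrow> 'a list \<Rightarrow> 'c \<Rightarrow> 'k" where
  "emb n c = (\<lambda>gs x. if gs \<in> tuples G n \<and> x \<in> cells 0 then c gs else 0)"

lemma emb_C: "emb n c \<in> C n 0"
  by (auto simp: emb_def C_def)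

lemma bar_d_emb: "bar_d (emb n c) = emb (Suc n) (coboundary G n c)"
proof (intro ext)
  fix gs x
  show "bar_d (emb n c) gs x = emb (Suc n) (coboundary G n c) gs x"
  proof (cases "gs \<in> tuples G (Suc n) \<and> x \<in> cells 0")
    case True
    then have gs: "gs \<in> tuples G (Suc n)" and x: "x \<in> cells 0" by auto
    obtain g r where gr: "gs = g # r" "g \<in> carrier G" "set r \<subseteq> carrier G"
      using gs by (cases gs) (auto simp: tuples_def)
    have "inner_bar (\<otimes>) (emb n c) gs x = inner_bar (\<otimes>) (\<lambda>l. emb n c l x) gs"
      by (rule inner_bar_apply)
    also have "\<dots> = inner_bar (\<otimes>) c gs"
      by (rule inner_bar_tuples_cong[OF gs]) (simp add: emb_def x)
    finally show ?thesis
      using True tuples_faces[OF gs] act_cells[of "inv g" x 0] gr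
      by (simp add: bar_d_def emb_def coboundary_eq_inner_bar)
  next
    case False
    then show ?thesis using bar_d_C[OF emb_C, of n c] by (auto simp: C_def emb_def)
  qed
qed

lemma inj_emb: "inj_on (emb n) (carrier (cochains G n))"
proof (rule inj_onI)
  fix c c' :: "'a list \<Rightarrow> 'k"
  assume c: "c \<in> carrier (cochains G n)" "c' \<in> carrier (cochains G n)" and eq: "emb n c = emb n c'"
  obtain x where "x \<in> cells 0" using cells_0 by blast
  then have "c gs = c' gs" if "gs \<in> tuples G n" for gs
    using fun_cong[OF fun_cong[OF eq, of gs], of x] that by (simp add: emb_def)
  then show "c = c'" using c unfolding cochains_sel[OF is_group] by (intro PiE_ext) auto
qed

lemma emb_image: "emb n ` carrier (cochains G n) = cell_ker n 0"
proof (intro equalityI subsetI)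
  fix f assume "f \<in> emb n ` carrier (cochains G n)"
  then obtain c where f: "f = emb n c" by blast
  have "\<delta> (emb n c gs) = 0" for gs
  proof -
    have "emb n c gs = (\<lambda>x. if x \<in> cells 0 then (if gs \<in> tuples G n then c gs else 0) else 0)"
      by (auto simp: emb_def)
    moreover have "\<delta> (\<lambda>x. if x \<in> cells 0 then k else 0) = 0" for k
      by (rule exact_0[THEN iffD2]) (auto split: if_splits)
    ultimately show ?thesis by simp
  qed
  then show "f \<in> cell_ker n 0" by (auto simp: cell_ker_def f emb_C cell_d_def fun_eq_iff)
next
  fix f assume f: "f \<in> cell_ker n 0"
  have "\<exists>c. f gs = (\<lambda>x. if x \<in> cells 0 then c else 0)" for gs
    using exact_0[of "f gs"] f by (auto simp: cell_ker_def C_def cell_d_def fun_eq_iff)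
  then obtain c where c: "\<And>gs. f gs = (\<lambda>x. if x \<in> cells 0 then c gs else 0)" by metis
  have "f = emb n (restrict c (tuples G n))"
  proof (intro ext)
    fix gs x
    show "f gs x = emb n (restrict c (tuples G n)) gs x"
    proof (cases "gs \<in> tuples G n")
      case True
      then show ?thesis by (simp add: c[of gs] emb_def)
    next
      case False
      then show ?thesis using f by (auto simp: emb_def cell_ker_def C_def)
    qed
  qed
  then show "f \<in> emb n ` carrier (cochains G n)"
    unfolding cochains_sel[OF is_group] by auto
qed

lemma emb_cocycles: "emb n ` cocycles G n = Z n 0"
proof -
  have "emb (Suc n) c = 0 \<longleftrightarrow> c = \<zero>\<^bsub>cochains G (Suc n)\<^esub>" if "c \<in> carrier (cochains G (Suc n))" for c
  proof -
    have "emb (Suc n) \<zero>\<^bsub>cochains G (Suc n)\<^esub> = 0"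
      by (auto simp: emb_def cochains_sel[OF is_group] fun_eq_iff)
    moreover have "\<zero>\<^bsub>cochains G (Suc n)\<^esub> \<in> (carrier (cochains G (Suc n)) :: (_ \<Rightarrow> 'k) set)"
      by (simp add: cochains_sel[OF is_group])
    ultimately show ?thesis using inj_emb[of "Suc n"] that by (metis inj_onD)
  qed
  moreover have "coboundary G n c \<in> carrier (cochains G (Suc n))" for c :: "'a list \<Rightarrow> 'k"
    by (simp add: coboundary_def cochains_sel[OF is_group])
  ultimately have "bar_d (emb n c) = 0 \<longleftrightarrow> coboundary G n c = \<zero>\<^bsub>cochains G (Suc n)\<^esub>" for c
    by (simp add: bar_d_emb)
  then have "emb n ` cocycles G n = {f \<in> emb n ` carrier (cochains G n). bar_d f = 0}"
    by (auto simp: cocycles_def)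
  then show ?thesis unfolding emb_image by (auto simp: Z_def cell_ker_def)
qed

lemma card_cocycles: "card (cocycles G n :: (_ \<Rightarrow> 'k) set) = card (Z n 0)"
  using card_image[OF inj_on_subset[OF inj_emb, of "cocycles G n" n]] emb_cocycles
  by (force simp: cocycles_def)

lemma coboundaries_carrier: "coboundaries G (Suc n) \<subseteq> (carrier (cochains G (Suc n)) :: (_ \<Rightarrow> 'k) set)"
  by (auto simp: coboundary_def cochains_sel[OF is_group])

lemma emb_coboundaries: "emb (Suc n) ` coboundaries G (Suc n) = bar_d ` cell_ker n 0"
  unfolding emb_image[symmetric] coboundaries.simps image_image bar_d_emb ..

lemma card_coboundaries:
  "card (coboundaries G (Suc n) :: (_ \<Rightarrow> 'k) set) = card (bar_d ` cell_ker n 0)"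
  using card_image[OF inj_on_subset[OF inj_emb coboundaries_carrier], of n] emb_coboundaries by simp

text \<open>Read back from the double complex, where the square of \<open>bar_d\<close> is 0, along
  the injective \<open>emb\<close>.\<close>

lemma coboundaries_subset: "coboundaries G (Suc n) \<subseteq> (cocycles G (Suc n) :: (_ \<Rightarrow> 'k) set)"
proof -
  have "bar_d ` cell_ker n 0 \<subseteq> Z (Suc n) 0"
    by (auto simp: cell_ker_def Z_def bar_d_C bar_d_bar_d bar_d_cell_d[symmetric] add_hom_0[OF hom_bar_d])
  then have "emb (Suc n) ` coboundaries G (Suc n) \<subseteq> emb (Suc n) ` cocycles G (Suc n)"
    unfolding emb_coboundaries emb_cocycles .
  moreover have "cocycles G (Suc n) \<subseteq> (carrier (cochains G (Suc n)) :: (_ \<Rightarrow> 'k) set)"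
    by (auto simp: cocycles_def)
  ultimately show ?thesis
    using inj_onD[OF inj_emb] coboundaries_carrier by (fastforce simp: subset_iff image_iff simp del: coboundaries.simps)
qed

definition inv_cochains :: "nat \<Rightarrow> ('c \<Rightarrow> 'k) set" where
  "inv_cochains n = {\<phi>. (\<forall>x. \<phi> x \<noteq> 0 \<longrightarrow> x \<in> cells n) \<and> (\<forall>g\<in>carrier G. \<forall>x. \<phi> (act g x) = \<phi> x)}"

definition single :: "('c \<Rightarrow> 'k) \<Rightarrow> 'a list \<Rightarrow> 'c \<Rightarrow> 'k" where
  "single \<phi> gs = (if gs = [] then \<phi> else 0)"

lemma single_bar_ker: "single ` inv_cochains n = bar_ker 0 n"
proof (intro equalityI subsetI)
  fix f assume "f \<in> single ` inv_cochains n"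
  then obtain \<phi> where f: "f = single \<phi>" "\<phi> \<in> inv_cochains n" by blast
  have "bar_d f gs = 0" for gs
  proof (cases gs rule: remdups_adj.cases)
    case (2 g)
    then show ?thesis using f by (auto simp: bar_d_def single_def inv_cochains_def fun_eq_iff)
  next
    case (3 g h r)
    have "inner_bar (\<otimes>) f gs x = 0" for x
    proof (rule ccontr)
      assume "inner_bar (\<otimes>) f gs x \<noteq> 0"
      from inner_bar_nonzero[OF this] obtain l where "f l x \<noteq> 0" "length gs = Suc (length l)" by blast
      then show False using 3 f by (auto simp: single_def split: if_splits)
    qed
    then have "inner_bar (\<otimes>) f gs = 0" by (simp add: fun_eq_iff)
    moreover have "f (tl gs) = 0" using f 3 by (simp add: single_def)
    ultimately show ?thesis by (auto simp: bar_d_def fun_eq_iff)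
  qed simp
  then have "bar_d f = 0" by (simp add: fun_eq_iff)
  then show "f \<in> bar_ker 0 n" using f
    by (auto simp: bar_ker_def C_def tuples_def single_def inv_cochains_def split: if_splits)
next
  fix f assume f: "f \<in> bar_ker 0 n"
  have "f gs x = single (f []) gs x" for gs x
    using f by (cases gs) (auto simp: bar_ker_def C_def tuples_def single_def)
  then have "f = single (f [])" by blast
  moreover have "f [] \<in> inv_cochains n"
  proof -
    have "f [] (act g x) = f [] x" if g: "g \<in> carrier G" for g x
    proof -
      have "bar_d f [inv g] x = 0" using f by (simp add: bar_ker_def)
      then show ?thesis using g by (simp add: bar_d_def add_eq_0_iff_char_2)
    qed
    then show ?thesis using f by (auto simp: inv_cochains_def bar_ker_def C_def)
  qed
  ultimately show "f \<in> single ` inv_cochains n" by blast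
qed

lemma inj_single: "inj single"
  by (rule injI) (metis single_def)

lemma cell_d_single: "cell_d (single \<phi>) = single (\<delta> \<phi>)"
  by (auto simp: cell_d_def single_def add_hom_0[OF hom_\<delta>])

text \<open>The staircase with both ends identified, by \<open>emb\<close> at the side of the group
  and by \<open>single\<close> at the side of the cells: the index of coboundaries in cocycles is
  the same for both complexes in positive degree.\<close>

theorem card_cocycles_eq_invariant:
  "card (cocycles G (Suc n) :: (_ \<Rightarrow> 'k) set) * card (\<delta> ` inv_cochains n)
     = card (coboundaries G (Suc n) :: (_ \<Rightarrow> 'k) set) * card {\<phi> \<in> inv_cochains (Suc n). \<delta> \<phi> = 0}"
proof -
  have "cell_d ` bar_ker 0 n = single ` \<delta> ` inv_cochains n"
    unfolding single_bar_ker[symmetric] by (simp add: image_image cell_d_single)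
  then have 1: "card (cell_d ` bar_ker 0 n) = card (\<delta> ` inv_cochains n)"
    by (simp add: card_image inj_on_subset[OF inj_single])
  have "single \<phi> = 0 \<longleftrightarrow> \<phi> = 0" for \<phi>
  proof
    assume "single \<phi> = 0"
    then have "single \<phi> [] = 0" by simp
    then show "\<phi> = 0" by (simp add: single_def)
  qed (simp add: single_def fun_eq_iff)
  then have "Z 0 (Suc n) = single ` {\<phi> \<in> inv_cochains (Suc n). \<delta> \<phi> = 0}"
    using single_bar_ker[of "Suc n"] unfolding Z_def bar_ker_def set_eq_iff image_iff
    by (simp add: cell_d_single) (metis cell_d_single)
  then have 2: "card (Z 0 (Suc n)) = card {\<phi> \<in> inv_cochains (Suc n). \<delta> \<phi> = 0}"
    by (simp add: card_image inj_on_subset[OF inj_single])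
  show ?thesis using zigzag[of n 0] unfolding card_cocycles card_coboundaries by (simp add: 1 2)
qed

end

text \<open>From here on arithmetic of bits stays in ring form instead of being rewritten into
  bitwise operations.\<close>

declare bit_not_zero_iff [simp del] bit_not_one_iff [simp del] add_bit_eq_xor [simp del] mult_bit_eq_and [simp del]
declare minus_bit_def [simp del] uminus_bit_def [simp del]

subsection \<open>The free group\<close>

definition flip_letter :: "letter \<Rightarrow> letter" where
  "flip_letter x = (fst x, \<not> snd x)"

lemma cancel_iff: "fst x = fst y \<and> snd x \<noteq> snd y \<longleftrightarrow> y = flip_letter x"
  by (cases x; cases y) (auto simp: flip_letter_def)

lemma flip_flip [simp]: "flip_letter (flip_letter x) = x"
  by (simp add: flip_letter_def)

lemma push_Cons: "push x (y # w) = (if y = flip_letter x then w else x # y # w)"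
  by (simp only: push.simps cancel_iff)

lemma reduced_Cons_Cons: "reduced (x # y # w) \<longleftrightarrow> y \<noteq> flip_letter x \<and> reduced (y # w)"
  by (simp only: reduced.simps cancel_iff not_not)

declare push.simps(2) [simp del] reduced.simps(1) [simp del]
declare push_Cons [simp] reduced_Cons_Cons [simp]

lemma reduced_Cons_D: "reduced (x # w) \<Longrightarrow> reduced w"
  by (cases w) auto

lemma reduced_push: "reduced w \<Longrightarrow> reduced (push x w)"
  by (cases w) (auto dest: reduced_Cons_D)

lemma reduced_foldr_push: "reduced w \<Longrightarrow> reduced (foldr push u w)"
  by (induction u) (auto intro: reduced_push)

lemma push_flip_push: "reduced w \<Longrightarrow> push (flip_letter x) (push x w) = w"
  by (cases w rule: remdups_adj.cases) auto

text \<open>Pushing a letter and pushing its inverse are mutually inverse on reduced words. This is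
  the van der Waerden argument: reduced words act on reduced words, and associativity of the product
  follows.\<close>

lemma foldr_push_push:
  assumes "reduced w" shows "foldr push (push x v) w = push x (foldr push v w)"
proof (cases v)
  case (Cons y v')
  then show ?thesis
    using push_flip_push[OF reduced_foldr_push[OF assms], of "flip_letter x" v'] by auto
qed simp

lemma foldr_push_assoc:
  "reduced w \<Longrightarrow> foldr push (foldr push u v) w = foldr push u (foldr push v w)"
  by (induction u) (auto simp: foldr_push_push)

lemma foldr_push_Nil: "reduced w \<Longrightarrow> foldr push w [] = w"
proof (induction w)
  case (Cons x w)
  then show ?case by (cases w) (auto dest: reduced_Cons_D)
qed simp

lemma foldr_push_snoc: "reduced (w @ [x]) \<Longrightarrow> foldr push w [x] = w @ [x]"
  using foldr_push_Nil[of "w @ [x]"] by simp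

lemma foldr_push_inverse: "reduced w \<Longrightarrow> foldr push (map flip_letter (rev w)) w = []"
proof (induction w)
  case (Cons x w)
  then have "push (flip_letter x) (x # w) = w" by simp
  with Cons reduced_Cons_D[OF Cons.prems] show ?case by simp
qed simp

lemma set_push: "set (push x w) \<subseteq> insert x (set w)"
  by (cases w) auto

lemma set_foldr_push: "set (foldr push u w) \<subseteq> set u \<union> set w"
proof (induction u)
  case (Cons x u)
  then show ?case using set_push[of x "foldr push u w"] by auto
qed simp

lemma reduced_appendD: "reduced (u @ v) \<Longrightarrow> reduced u"
proof (induction u)
  case (Cons x u)
  then show ?case by (cases u) (auto dest: reduced_Cons_D)
qed simp

lemma free_group_sel:
  "carrier (free_group n) = {w. set w \<subseteq> {..<n} \<times> UNIV \<and> reduced w}"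
  "u \<otimes>\<^bsub>free_group n\<^esub> v = foldr push u v"
  "\<one>\<^bsub>free_group n\<^esub> = []"
  by (simp_all add: free_group_def)

lemma group_free_group: "Group.group (free_group n)"
proof (rule groupI)
  let ?F = "free_group n"
  fix u v w
  assume "u \<in> carrier ?F" "v \<in> carrier ?F"
  then show "u \<otimes>\<^bsub>?F\<^esub> v \<in> carrier ?F"
    using set_foldr_push[of u v] by (auto simp: free_group_sel reduced_foldr_push)
  assume "w \<in> carrier ?F"
  then show "u \<otimes>\<^bsub>?F\<^esub> v \<otimes>\<^bsub>?F\<^esub> w = u \<otimes>\<^bsub>?F\<^esub> (v \<otimes>\<^bsub>?F\<^esub> w)"
    by (auto simp: free_group_sel foldr_push_assoc)
next
  let ?F = "free_group n"
  fix w assume w: "w \<in> carrier ?F"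
  define v where "v = foldr push (map flip_letter (rev w)) []"
  have "v \<in> carrier ?F"
    using w set_foldr_push[of "map flip_letter (rev w)" "[]"] reduced_foldr_push[of "[]"]
    by (fastforce simp: v_def free_group_sel flip_letter_def)
  moreover have "v \<otimes>\<^bsub>?F\<^esub> w = \<one>\<^bsub>?F\<^esub>"
    using w by (simp add: v_def free_group_sel foldr_push_assoc foldr_push_inverse)
  ultimately show "\<exists>v\<in>carrier ?F. v \<otimes>\<^bsub>?F\<^esub> w = \<one>\<^bsub>?F\<^esub>" by blast
qed (auto simp: free_group_sel)

subsection \<open>The Cayley graph of the Klein four-group\<close>

type_synonym vertex = "bit \<times> bit"
type_synonym edge = "vertex \<times> bool"

definition dir :: "bool \<Rightarrow> vertex" where
  "dir i = (if i then (0, 1) else (1, 0))"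

definition src :: "edge \<Rightarrow> vertex" where "src e = fst e"
definition tgt :: "edge \<Rightarrow> vertex" where "tgt e = fst e + dir (snd e)"

definition dirac :: "'a \<Rightarrow> 'a \<Rightarrow> bit" where
  "dirac a = (\<lambda>b. if b = a then 1 else 0)"

definition bd :: "(edge \<Rightarrow> bit) \<Rightarrow> vertex \<Rightarrow> bit" where
  "bd s r = (\<Sum>e\<in>UNIV. s e * (dirac (src e) r + dirac (tgt e) r))"

definition move :: "vertex \<Rightarrow> edge \<Rightarrow> edge" where
  "move q e = (fst e + q, snd e)"

lemma add_self_right [simp]: "x + y + y = (x :: 'a :: char_2)"
  by (simp add: add.assoc)

lemma move_move [simp]: "move q (move q' e) = move (q + q') e"
  by (simp add: move_def ac_simps)

lemma move_0 [simp]: "move 0 e = e"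
  by (simp add: move_def)

lemma bij_move: "bij (move q)"
  by (rule bij_betw_byWitness[where f' = "move q"]) (auto simp: move_def add.assoc)

lemma src_move [simp]: "src (move q e) = src e + q"
  and tgt_move [simp]: "tgt (move q e) = tgt e + q"
  by (simp_all add: src_def tgt_def move_def ac_simps)

lemma dirac_add: "dirac (a + q) (r :: 'a :: char_2) = dirac a (r + q)"
  by (auto simp: dirac_def)

lemma hom_bd: "add_hom bd"
  by (rule add_homI) (simp add: bd_def fun_eq_iff distrib_right sum.distrib)

lemma bd_move: "bd (\<lambda>e. s (move q e)) r = bd s (r + q)"
proof -
  have "bd s (r + q) = (\<Sum>e\<in>UNIV. s (move q e) * (dirac (src (move q e)) (r + q) + dirac (tgt (move q e)) (r + q)))"
    unfolding bd_def by (rule sum.reindex_bij_betw[OF bij_move, symmetric])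
  then show ?thesis by (simp add: bd_def dirac_add)
qed

lemma bd_dirac: "bd (dirac e) = dirac (src e) + dirac (tgt e)"
proof
  fix r
  have "bd (dirac e) r = (\<Sum>e'\<in>UNIV. if e' = e then dirac (src e') r + dirac (tgt e') r else 0)"
    unfolding bd_def by (rule sum.cong) (auto simp: dirac_def)
  then show "bd (dirac e) r = (dirac (src e) + dirac (tgt e)) r" by simp
qed

subsection \<open>The Magnus embedding\<close>

text \<open>A word traces a path from \<open>0\<close> in the Cayley graph; \<open>q\<close> is its
  end and \<open>s\<close> the set of edges crossed an odd number of times. In a product the second
  path is translated to start at the end of the first.\<close>

definition magnus :: "(vertex \<times> (edge \<Rightarrow> bit)) monoid" where
  "magnus = \<lparr>carrier = {(q, s). bd s = dirac q + dirac 0},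
     monoid.mult = (\<lambda>(q, s) (q', s'). (q + q', s + (\<lambda>e. s' (move q e)))), one = (0, 0)\<rparr>"

lemma magnus_sel:
  "(q, s) \<in> carrier magnus \<longleftrightarrow> bd s = dirac q + dirac 0"
  "(q, s) \<otimes>\<^bsub>magnus\<^esub> (q', s') = (q + q', s + (\<lambda>e. s' (move q e)))"
  "\<one>\<^bsub>magnus\<^esub> = (0, 0)"
  by (simp_all add: magnus_def)

lemma group_magnus: "Group.group magnus"
proof (rule groupI)
  fix v v' v'' assume *: "v \<in> carrier magnus" "v' \<in> carrier magnus"
  obtain q s q' s' where v: "v = (q, s)" "v' = (q', s')" by (cases v; cases v')
  have "bd (\<lambda>e. s' (move q e)) r = dirac (q + q') r + dirac q r" for r
  proof -
    have "bd s' (r + q) = dirac q' (r + q) + dirac 0 (r + q)" using * by (simp add: v magnus_sel)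
    then show ?thesis unfolding bd_move dirac_add[symmetric] by (simp add: add.commute)
  qed
  then have "bd (\<lambda>e. s' (move q e)) = dirac (q + q') + dirac q" by (simp add: fun_eq_iff)
  then show "v \<otimes>\<^bsub>magnus\<^esub> v' \<in> carrier magnus"
    using * by (simp add: v magnus_sel add_hom_add[OF hom_bd] ac_simps)
  show "v \<otimes>\<^bsub>magnus\<^esub> v' \<otimes>\<^bsub>magnus\<^esub> v'' = v \<otimes>\<^bsub>magnus\<^esub> (v' \<otimes>\<^bsub>magnus\<^esub> v'')"
    by (cases v'') (simp add: v magnus_sel fun_eq_iff ac_simps)
next
  fix v assume *: "v \<in> carrier magnus"
  obtain q s where v: "v = (q, s)" by (cases v)
  have "bd (\<lambda>e. s (move q e)) r = dirac q r + dirac 0 r" for r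
  proof -
    have "bd s (r + q) = dirac q (r + q) + dirac 0 (r + q)" using * by (simp add: v magnus_sel)
    then show ?thesis unfolding bd_move dirac_add[symmetric] by (simp add: add.commute)
  qed
  then have "(q, \<lambda>e. s (move q e)) \<in> carrier magnus" by (simp add: magnus_sel fun_eq_iff)
  moreover have "(q, \<lambda>e. s (move q e)) \<otimes>\<^bsub>magnus\<^esub> v = \<one>\<^bsub>magnus\<^esub>"
    by (simp add: v magnus_sel fun_eq_iff)
  ultimately show "\<exists>v'\<in>carrier magnus. v' \<otimes>\<^bsub>magnus\<^esub> v = \<one>\<^bsub>magnus\<^esub>" by blast
qed (auto simp: magnus_sel magnus_def fun_eq_iff add_hom_0[OF hom_bd])

text \<open>An inverse letter leaves \<open>0\<close> backwards, along the edge that starts at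
  \<open>dir i\<close> and ends at \<open>0\<close>.\<close>

definition magnus_letter :: "letter \<Rightarrow> vertex \<times> (edge \<Rightarrow> bit)" where
  "magnus_letter x = (let i = fst x = 1 in
     (dir i, if snd x then dirac (0, i) else dirac (dir i, i)))"

definition magnus_map :: "letter list \<Rightarrow> vertex \<times> (edge \<Rightarrow> bit)" where
  "magnus_map w = foldr (\<lambda>x v. magnus_letter x \<otimes>\<^bsub>magnus\<^esub> v) w \<one>\<^bsub>magnus\<^esub>"

lemma magnus_letter_carrier: "magnus_letter x \<in> carrier magnus"
  by (auto simp: magnus_letter_def Let_def magnus_sel bd_dirac src_def tgt_def ac_simps)

lemma dirac_move: "dirac e (move q e') = dirac (move q e) e'"
  by (auto simp: dirac_def move_def)

lemma magnus_letter_flip: "magnus_letter (flip_letter x) \<otimes>\<^bsub>magnus\<^esub> magnus_letter x = \<one>\<^bsub>magnus\<^esub>"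
  by (auto simp: magnus_letter_def Let_def magnus_sel flip_letter_def fun_eq_iff dirac_move)
     (auto simp: move_def dirac_def)

interpretation magnus: Group.group magnus by (rule group_magnus)

lemma magnus_map_simps [simp]:
  "magnus_map [] = \<one>\<^bsub>magnus\<^esub>"
  "magnus_map (x # w) = magnus_letter x \<otimes>\<^bsub>magnus\<^esub> magnus_map w"
  by (simp_all add: magnus_map_def)

lemma magnus_map_carrier [simp]: "magnus_map w \<in> carrier magnus"
  by (induction w) (auto intro: magnus_letter_carrier)

lemma magnus_map_push: "magnus_map (push x w) = magnus_letter x \<otimes>\<^bsub>magnus\<^esub> magnus_map w"
proof (cases w)
  case (Cons y w')
  have "magnus_letter x \<otimes>\<^bsub>magnus\<^esub> (magnus_letter (flip_letter x) \<otimes>\<^bsub>magnus\<^esub> magnus_map w') = magnus_map w'"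
    using magnus_letter_flip[of "flip_letter x"] magnus_letter_carrier
    by (simp add: magnus.m_assoc[symmetric])
  with Cons show ?thesis by auto
qed simp

lemma magnus_map_foldr_push:
  "magnus_map (foldr push u v) = magnus_map u \<otimes>\<^bsub>magnus\<^esub> magnus_map v"
  by (induction u) (auto simp: magnus_map_push magnus.m_assoc magnus_letter_carrier)

interpretation free: Group.group "free_group 2" by (rule group_free_group)

interpretation magnus_hom: group_hom "free_group 2" magnus magnus_map
  by unfold_locales (auto simp: hom_def free_group_sel(2) magnus_map_foldr_push)

definition gen :: "bool \<Rightarrow> letter list" where
  "gen i = [(if i then 1 else 0, True)]"

lemma gen_carrier [simp]: "gen i \<in> carrier (free_group 2)"
  by (simp add: gen_def free_group_sel)

lemma magnus_gen: "magnus_map (gen i) = (dir i, dirac (0, i))"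
  using magnus.r_one[OF magnus_letter_carrier, of "(if i then 1 else 0, True)"]
  by (simp add: gen_def) (simp add: magnus_letter_def)

text \<open>A Schreier transversal: the spanning tree of the Cayley graph consists of the two
  edges at \<open>0\<close> and of the edge labelled \<open>y\<close> from \<open>x\<close> to \<open>xy\<close>.\<close>

definition transversal :: "vertex \<Rightarrow> letter list" where
  "transversal q = (if fst q = 1 then gen False else []) \<otimes>\<^bsub>free_group 2\<^esub> (if snd q = 1 then gen True else [])"

text \<open>The Schreier generator of an edge: along the transversal to its source, across the edge,
  and back from its target.\<close>

definition schreier :: "edge \<Rightarrow> letter list" where
  "schreier e = transversal (src e) \<otimes>\<^bsub>free_group 2\<^esub> gen (snd e) \<otimes>\<^bsub>free_group 2\<^esub> inv\<^bsub>free_group 2\<^esub> transversal (tgt e)"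

lemma transversal_carrier [simp]: "transversal q \<in> carrier (free_group 2)"
  unfolding transversal_def by (intro free.m_closed) (auto simp: free_group_sel(1) gen_def)

lemma schreier_carrier [simp]: "schreier e \<in> carrier (free_group 2)"
  unfolding schreier_def by simp

lemma fst_transversal: "fst (magnus_map (transversal q)) = q"
proof -
  have "magnus_map (transversal q) = magnus_map (if fst q = 1 then gen False else [])
      \<otimes>\<^bsub>magnus\<^esub> magnus_map (if snd q = 1 then gen True else [])"
    unfolding transversal_def by (rule magnus_hom.hom_mult) (auto simp: free_group_sel(1) gen_def)
  then show ?thesis
    by (cases q; cases "fst q"; cases "snd q") (auto simp: magnus_gen magnus_sel dir_def zero_prod_def)
qed

lemma magnus_inv: "(q, s) \<in> carrier magnus \<Longrightarrow> inv\<^bsub>magnus\<^esub> (q, s) = (q, \<lambda>e. s (move q e))"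
proof (rule magnus.inv_equality)
  assume *: "(q, s) \<in> carrier magnus"
  then show "(q, s) \<in> carrier magnus" .
  show "(q, \<lambda>e. s (move q e)) \<otimes>\<^bsub>magnus\<^esub> (q, s) = \<one>\<^bsub>magnus\<^esub>"
    by (simp add: magnus_sel fun_eq_iff)
  have "bd (\<lambda>e. s (move q e)) r = dirac q r + dirac 0 r" for r
  proof -
    have "bd s (r + q) = dirac q (r + q) + dirac 0 (r + q)" using * by (simp add: magnus_sel)
    then show ?thesis unfolding bd_move dirac_add[symmetric] by (simp add: add.commute)
  qed
  then show "(q, \<lambda>e. s (move q e)) \<in> carrier magnus" by (simp add: magnus_sel fun_eq_iff)
qed

definition tree_path :: "vertex \<Rightarrow> edge \<Rightarrow> bit" where
  "tree_path q = snd (magnus_map (transversal q))"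

lemma magnus_transversal: "magnus_map (transversal q) = (q, tree_path q)"
  using fst_transversal[of q] by (simp add: tree_path_def prod_eq_iff)

lemma magnus_schreier:
  "magnus_map (schreier e) = (0, tree_path (src e) + dirac e + tree_path (tgt e))"
proof -
  have car: "(tgt e, tree_path (tgt e)) \<in> carrier magnus"
    using magnus_map_carrier[of "transversal (tgt e)"] unfolding magnus_transversal .
  have e: "src e + dir (snd e) = tgt e" by (simp add: src_def tgt_def)
  have d: "dirac (0, snd e) (move (src e) e') = dirac e e'" for e'
    unfolding dirac_move by (simp add: move_def src_def)
  have "magnus_map (schreier e) = (src e, tree_path (src e)) \<otimes>\<^bsub>magnus\<^esub> (dir (snd e), dirac (0, snd e))
      \<otimes>\<^bsub>magnus\<^esub> inv\<^bsub>magnus\<^esub> (tgt e, tree_path (tgt e))"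
    unfolding schreier_def by (simp add: magnus_transversal magnus_gen)
  then show ?thesis
    by (simp add: magnus_sel e magnus_inv[OF car] fun_eq_iff d)
qed

lemma sum_dirac: "(\<Sum>b\<in>UNIV. f b * dirac a b) = f (a :: 'a :: finite)"
proof -
  have "(\<Sum>b\<in>UNIV. f b * dirac a b) = (\<Sum>b\<in>UNIV. if b = a then f b else 0)"
    by (rule sum.cong) (auto simp: dirac_def)
  then show ?thesis by simp
qed

lemma dirac_commute: "dirac a b = dirac b a"
  by (auto simp: dirac_def)

text \<open>A cycle is the sum of the fundamental cycles of its edges: in that sum the tree path to
  \<open>r\<close> gets the coefficient \<open>bd s' r\<close>, which is 0. Each fundamental cycle
  is the image of a Schreier generator.\<close>

lemma magnus_hom_surj: "magnus_map ` carrier (free_group 2) = carrier magnus"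
proof (intro equalityI subsetI)
  fix v assume v: "v \<in> carrier magnus"
  obtain q s where qs: "v = (q, s)" by (cases v)
  let ?I = "magnus_map ` carrier (free_group 2)"
  have mult: "v \<otimes>\<^bsub>magnus\<^esub> v' \<in> ?I" if "v \<in> ?I" "v' \<in> ?I" for v v'
  proof -
    obtain u u' where u: "u \<in> carrier (free_group 2)" "v = magnus_map u"
      "u' \<in> carrier (free_group 2)" "v' = magnus_map u'" using \<open>v \<in> ?I\<close> \<open>v' \<in> ?I\<close> by blast
    then have "v \<otimes>\<^bsub>magnus\<^esub> v' = magnus_map (u \<otimes>\<^bsub>free_group 2\<^esub> u')" by simp
    then show ?thesis using u(1,3) free.m_closed by blast
  qed
  \<comment> \<open>Removing the tree path to \<open>q\<close> turns the chain into a cycle.\<close>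
  define s' where "s' = s + tree_path q"
  have "bd (tree_path q) = dirac q + dirac 0"
    using magnus_map_carrier[of "transversal q"] by (simp add: magnus_transversal magnus_sel)
  then have bd: "bd s' = 0"
    using v by (simp add: qs s'_def magnus_sel add_hom_add[OF hom_bd])
  define c where "c e = tree_path (src e) + dirac e + tree_path (tgt e)" for e
  have sum_in: "(0, \<Sum>e\<in>E. c e) \<in> ?I" if "finite E" for E
    using that
  proof induction
    case empty
    have "magnus_map [] \<in> ?I" by (rule imageI) (simp add: free_group_sel)
    moreover have "(0, sum c {}) = magnus_map []" by (simp add: magnus_sel fun_eq_iff zero_prod_def)
    ultimately show ?case by (simp only:)
  next
    case (insert e E)
    have "(0, c e) \<otimes>\<^bsub>magnus\<^esub> (0, sum c E) \<in> ?I"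
    proof (rule mult)
      show "(0, c e) \<in> ?I"
        by (rule image_eqI[of _ _ "schreier e"]) (simp_all add: magnus_schreier c_def)
    qed (rule insert(3))
    moreover have "(0, c e) \<otimes>\<^bsub>magnus\<^esub> (0, sum c E) = (0, sum c (insert e E))"
      using insert(1,2) by (simp add: magnus_sel fun_eq_iff)
    ultimately show ?case by simp
  qed
  have "(\<Sum>e\<in>{e. s' e = 1}. c e) = s'"
  proof
    fix e'
    have "(\<Sum>e\<in>{e. s' e = 1}. c e) e' = (\<Sum>e\<in>UNIV. s' e * c e e')"
    proof -
      have "(\<Sum>e\<in>{e. s' e = 1}. c e) e' = (\<Sum>e\<in>{e. s' e = 1}. c e e')"
        by (induction rule: finite_induct[OF finite[of "{e. s' e = 1}"]]) auto
      also have "\<dots> = (\<Sum>e\<in>UNIV. if s' e = 1 then c e e' else 0)"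
        by (simp add: sum.If_cases)
      also have "\<dots> = (\<Sum>e\<in>UNIV. s' e * c e e')"
        by (rule sum.cong) (auto simp: bit_not_one_iff)
      finally show ?thesis .
    qed
    also have "\<dots> = (\<Sum>e\<in>UNIV. s' e * dirac e e') + (\<Sum>e\<in>UNIV. s' e * (tree_path (src e) e' + tree_path (tgt e) e'))"
      unfolding sum.distrib[symmetric] by (rule sum.cong) (simp_all add: c_def distrib_left ac_simps)
    also have "(\<Sum>e\<in>UNIV. s' e * dirac e e') = s' e'"
      by (simp add: sum_dirac dirac_commute[of _ e'])
    also have "(\<Sum>e\<in>UNIV. s' e * (tree_path (src e) e' + tree_path (tgt e) e'))
        = (\<Sum>r\<in>UNIV. tree_path r e' * bd s' r)"
    proof -
      have "(\<Sum>r\<in>UNIV. tree_path r e' * bd s' r)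
          = (\<Sum>r\<in>UNIV. \<Sum>e\<in>UNIV. tree_path r e' * (s' e * (dirac (src e) r + dirac (tgt e) r)))"
        by (simp add: bd_def sum_distrib_left)
      also have "\<dots> = (\<Sum>e\<in>UNIV. \<Sum>r\<in>UNIV. s' e * (tree_path r e' * dirac (src e) r + tree_path r e' * dirac (tgt e) r))"
        by (subst sum.swap) (rule sum.cong, simp, rule sum.cong, simp_all add: distrib_left ac_simps)
      also have "\<dots> = (\<Sum>e\<in>UNIV. s' e * (tree_path (src e) e' + tree_path (tgt e) e'))"
        by (simp add: sum_distrib_left[symmetric] sum.distrib sum_dirac)
      finally show ?thesis by simp
    qed
    finally show "(\<Sum>e\<in>{e. s' e = 1}. c e) e' = s' e'" by (simp add: bd)
  qed
  then have "(0, s') \<in> ?I" using sum_in[of "{e. s' e = 1}"] by simp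
  moreover have "(q, tree_path q) \<in> ?I"
    by (rule image_eqI[of _ _ "transversal q"]) (simp_all add: magnus_transversal)
  ultimately have "(0, s') \<otimes>\<^bsub>magnus\<^esub> (q, tree_path q) \<in> ?I" by (rule mult)
  then show "v \<in> ?I" by (simp add: magnus_sel qs s'_def)
qed auto

definition exponent_sum :: "nat \<Rightarrow> letter list \<Rightarrow> int" where
  "exponent_sum i w = (\<Sum>x\<leftarrow>w. if fst x = i then (if snd x then 1 else - 1) else 0)"

lemma fst_magnus_mult: "fst (v \<otimes>\<^bsub>magnus\<^esub> v') = fst v + fst v'"
  by (cases v; cases v') (simp add: magnus_sel)

lemma fst_magnus_map:
  "set w \<subseteq> {..<2} \<times> UNIV \<Longrightarrow> fst (magnus_map w) = (of_int (exponent_sum 0 w), of_int (exponent_sum 1 w))"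
proof (induction w)
  case (Cons x w)
  then have "fst x = 0 \<or> fst x = 1" by auto
  with Cons show ?case
    by (auto simp: exponent_sum_def fst_magnus_mult magnus_letter_def dir_def Let_def)
qed (simp add: exponent_sum_def magnus_sel zero_prod_def)

text \<open>The vertex reached by a word is its vector of exponent sums modulo 2.\<close>

lemma R_subgroup_2: "R_subgroup 2 = {w \<in> carrier (free_group 2). fst (magnus_map w) = 0}"
proof -
  have "standard_surjection 2 w = \<one>\<^bsub>elementary_abelian_2 2\<^esub> \<longleftrightarrow> fst (magnus_map w) = 0"
    if w: "w \<in> carrier (free_group 2)" for w
  proof -
    have "standard_surjection 2 w = \<one>\<^bsub>elementary_abelian_2 2\<^esub>
        \<longleftrightarrow> (\<forall>i\<in>{..<2}. exponent_sum i w mod 2 = 0)"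
      by (auto simp: standard_surjection_def elementary_abelian_2_def exponent_sum_def restrict_def
          integer_mod_group_def fun_eq_iff)
    also have "\<dots> \<longleftrightarrow> even (exponent_sum 0 w) \<and> even (exponent_sum 1 w)"
      by (auto simp: lessThan_Suc numeral_2_eq_2 even_iff_mod_2_eq_zero)
    also have "\<dots> \<longleftrightarrow> fst (magnus_map w) = 0"
    proof -
      have "(of_int k :: bit) = 0 \<longleftrightarrow> even k" for k :: int
        by (cases "even k") (auto elim!: evenE oddE)
      then show ?thesis using w by (simp add: fst_magnus_map free_group_sel zero_prod_def)
    qed
    finally show ?thesis .
  qed
  then show ?thesis by (auto simp: R_subgroup_def kernel_def)
qed

definition vertex_group :: "vertex monoid" where
  "vertex_group = \<lparr>carrier = UNIV, monoid.mult = (+), one = 0\<rparr>"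

lemma group_vertex_group: "Group.group vertex_group"
  by (rule groupI) (auto simp: vertex_group_def add.assoc intro: exI[of "\<lambda>y. y + x = 0" for x] add_self)

lemma R_normal: "R_subgroup 2 \<lhd> free_group 2"
proof -
  interpret group_hom "free_group 2" vertex_group "\<lambda>w. fst (magnus_map w)"
    by (intro group_hom.intro group_free_group group_vertex_group)
      (auto simp: group_hom_axioms_def hom_def vertex_group_def fst_magnus_mult)
  have "R_subgroup 2 = kernel (free_group 2) vertex_group (\<lambda>w. fst (magnus_map w))"
    by (auto simp: R_subgroup_2 kernel_def vertex_group_def)
  then show ?thesis using normal_kernel by simp
qed

section \<open>The kernel of the Magnus map is \<open>R\<^sup>2[R,R]\<close>\<close>

lemma (in group) squares_commutators_normal:
  assumes "H \<lhd> G"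
  shows "squares_commutators G H \<lhd> G"
proof -
  interpret H: normal H G by fact
  have sq: "generate G ((\<lambda>h. h \<otimes> h) ` H) \<lhd> G"
  proof (rule normal_generateI)
    show "(\<lambda>h. h \<otimes> h) ` H \<subseteq> carrier G" using H.subset by auto
    fix x g assume x: "x \<in> (\<lambda>h. h \<otimes> h) ` H" and g: "g \<in> carrier G"
    then obtain h where h: "h \<in> H" "x = h \<otimes> h" by blast
    have hc: "h \<in> carrier G" using h H.subset by blast
    have "g \<otimes> x \<otimes> inv g = (g \<otimes> h \<otimes> inv g) \<otimes> (g \<otimes> h \<otimes> inv g)"
    proof -
      have "inv g \<otimes> (g \<otimes> (h \<otimes> inv g)) = h \<otimes> inv g" using g hc by (simp add: m_assoc[symmetric])
      then show ?thesis using g hc by (simp add: h m_assoc)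
    qed
    moreover have "g \<otimes> h \<otimes> inv g \<in> H" using H.inv_op_closed2[OF g h(1)] .
    ultimately show "g \<otimes> x \<otimes> inv g \<in> (\<lambda>h. h \<otimes> h) ` H" by blast
  qed
  show ?thesis unfolding squares_commutators_def
    by (rule normal_subgroup_set_mult_closed[OF sq derived_is_normal[OF assms]])
qed

lemma (in group) squares_commutators_mem:
  assumes "H \<lhd> G" "h \<in> H" "k \<in> H"
  shows "h \<otimes> h \<in> squares_commutators G H"
    and "h \<otimes> k \<otimes> inv h \<otimes> inv k \<in> squares_commutators G H"
proof -
  interpret H: normal H G by fact
  have hk: "h \<in> carrier G" "k \<in> carrier G" using assms H.subset by auto
  have 1: "h \<otimes> h \<in> generate G ((\<lambda>h. h \<otimes> h) ` H)" using assms by (auto intro: generate.incl)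
  have 2: "\<one> \<in> derived G H" unfolding derived_def by (rule generate.one)
  have 3: "\<one> \<in> generate G ((\<lambda>h. h \<otimes> h) ` H)" by (rule generate.one)
  have 4: "h \<otimes> k \<otimes> inv h \<otimes> inv k \<in> derived G H"
    unfolding derived_def using assms(2,3) by (auto intro!: generate.incl)
  have "(h \<otimes> h) \<otimes> \<one> \<in> squares_commutators G H"
    unfolding squares_commutators_def set_mult_def using 1 2 by blast
  then show "h \<otimes> h \<in> squares_commutators G H" using hk by simp
  have "\<one> \<otimes> (h \<otimes> k \<otimes> inv h \<otimes> inv k) \<in> squares_commutators G H"
    unfolding squares_commutators_def set_mult_def using 3 4 by blast
  then show "h \<otimes> k \<otimes> inv h \<otimes> inv k \<in> squares_commutators G H" using hk by simp
qed

abbreviation "F2 \<equiv> free_group 2"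
abbreviation "N2 \<equiv> squares_commutators F2 (R_subgroup 2)"
abbreviation "K2 \<equiv> kernel F2 magnus magnus_map"

lemma magnus_R:
  assumes "r \<in> R_subgroup 2" obtains s where "r \<in> carrier F2" "magnus_map r = (0, s)"
  using assms that[of "snd (magnus_map r)"] by (auto simp: R_subgroup_2 prod_eq_iff)

lemma magnus_sub_mult: "(0, s) \<otimes>\<^bsub>magnus\<^esub> (0, s') = (0, s + s')"
  by (simp add: magnus_sel fun_eq_iff)

text \<open>On \<open>R\<close> the vertex part is \<open>0\<close>, so the images multiply like
  chains modulo 2, in a commutative group of exponent two.\<close>

lemma N2_subset_K2: "N2 \<subseteq> K2"
proof -
  have sub: "subgroup K2 F2" by (rule magnus_hom.subgroup_kernel)
  have P: "generate F2 ((\<lambda>h. h \<otimes>\<^bsub>F2\<^esub> h) ` R_subgroup 2) \<subseteq> K2"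
  proof (rule free.generate_subgroup_incl[OF _ sub], rule image_subsetI)
    fix h assume "h \<in> R_subgroup 2"
    then show "h \<otimes>\<^bsub>F2\<^esub> h \<in> K2"
      by (elim magnus_R) (simp add: kernel_def magnus_sub_mult magnus_sel)
  qed
  have D: "derived F2 (R_subgroup 2) \<subseteq> K2"
    unfolding derived_def
  proof (rule free.generate_subgroup_incl[OF _ sub], clarify)
    fix h k assume hk: "h \<in> R_subgroup 2" "k \<in> R_subgroup 2"
    then have c: "h \<in> carrier F2" "k \<in> carrier F2" by (auto simp: R_subgroup_2)
    have comm: "magnus_map h \<otimes>\<^bsub>magnus\<^esub> magnus_map k = magnus_map k \<otimes>\<^bsub>magnus\<^esub> magnus_map h"
      using hk by (elim magnus_R) (simp add: magnus_sub_mult add.commute)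
    have "magnus_map (h \<otimes>\<^bsub>F2\<^esub> k \<otimes>\<^bsub>F2\<^esub> inv\<^bsub>F2\<^esub> h \<otimes>\<^bsub>F2\<^esub> inv\<^bsub>F2\<^esub> k)
       = magnus_map k \<otimes>\<^bsub>magnus\<^esub> magnus_map h \<otimes>\<^bsub>magnus\<^esub> inv\<^bsub>magnus\<^esub> (magnus_map h) \<otimes>\<^bsub>magnus\<^esub> inv\<^bsub>magnus\<^esub> (magnus_map k)"
      using c by (simp add: comm)
    also have "\<dots> = \<one>\<^bsub>magnus\<^esub>" by (simp add: magnus.m_assoc)
    finally show "h \<otimes>\<^bsub>F2\<^esub> k \<otimes>\<^bsub>F2\<^esub> inv\<^bsub>F2\<^esub> h \<otimes>\<^bsub>F2\<^esub> inv\<^bsub>F2\<^esub> k \<in> K2"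
      using c by (simp add: kernel_def)
  qed
  show ?thesis unfolding squares_commutators_def set_mult_def
    using P D subgroup.m_closed[OF sub] by blast
qed

lemma schreier_R: "schreier e \<in> R_subgroup 2"
  by (simp add: R_subgroup_2 magnus_schreier)

interpretation N2: normal N2 F2
  by (rule free.squares_commutators_normal[OF R_normal])

abbreviation "cl x \<equiv> N2 #>\<^bsub>F2\<^esub> x"

lemma cl_eq: "x \<in> carrier F2 \<Longrightarrow> y \<in> carrier F2 \<Longrightarrow> x \<otimes>\<^bsub>F2\<^esub> inv\<^bsub>F2\<^esub> y \<in> N2 \<Longrightarrow> cl x = cl y"
proof -
  assume xy: "x \<in> carrier F2" "y \<in> carrier F2" and n: "x \<otimes>\<^bsub>F2\<^esub> inv\<^bsub>F2\<^esub> y \<in> N2"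
  have "x = (x \<otimes>\<^bsub>F2\<^esub> inv\<^bsub>F2\<^esub> y) \<otimes>\<^bsub>F2\<^esub> y" using xy by (simp add: free.m_assoc)
  then have "x \<in> cl y" using n unfolding r_coset_def by blast
  then show ?thesis using free.repr_independence[OF _ xy(2) N2.subgroup_axioms] by simp
qed

text \<open>The quotient of \<open>R\<close> as a group record of its own; being commutative, it
  admits \<open>finprod\<close> over the edges.\<close>

definition R_mod :: "letter list set monoid" where
  "R_mod = \<lparr>carrier = (\<lambda>r. cl r) ` R_subgroup 2, monoid.mult = set_mult F2, one = cl \<one>\<^bsub>F2\<^esub>\<rparr>"

lemma comm_group_R_mod: "comm_group R_mod"
proof (rule comm_groupI)
  interpret R: normal "R_subgroup 2" F2 by (rule R_normal)
  have Rc: "r \<in> carrier F2" if "r \<in> R_subgroup 2" for r using that R.subset by blast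
  show "\<one>\<^bsub>R_mod\<^esub> \<in> carrier R_mod" using R.one_closed by (simp add: R_mod_def)
  fix x y z assume "x \<in> carrier R_mod" "y \<in> carrier R_mod"
  then obtain r s where r: "r \<in> R_subgroup 2" "x = cl r" and s: "s \<in> R_subgroup 2" "y = cl s"
    by (auto simp: R_mod_def)
  show "x \<otimes>\<^bsub>R_mod\<^esub> y \<in> carrier R_mod"
    using r s Rc by (auto simp: R_mod_def N2.rcos_sum)
  have "(r \<otimes>\<^bsub>F2\<^esub> s) \<otimes>\<^bsub>F2\<^esub> inv\<^bsub>F2\<^esub> (s \<otimes>\<^bsub>F2\<^esub> r) \<in> N2"
    using free.squares_commutators_mem(2)[OF R_normal r(1) s(1)] Rc[OF r(1)] Rc[OF s(1)]
    by (simp add: free.inv_mult_group free.m_assoc)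
  then show "x \<otimes>\<^bsub>R_mod\<^esub> y = y \<otimes>\<^bsub>R_mod\<^esub> x"
    using r s Rc by (simp add: R_mod_def N2.rcos_sum cl_eq)
  show "\<one>\<^bsub>R_mod\<^esub> \<otimes>\<^bsub>R_mod\<^esub> x = x"
    using r Rc by (simp add: R_mod_def N2.rcos_sum)
  have "cl (r \<otimes>\<^bsub>F2\<^esub> r) = cl \<one>\<^bsub>F2\<^esub>"
    using free.squares_commutators_mem(1)[OF R_normal r(1) r(1)] Rc[OF r(1)] by (intro cl_eq) auto
  then show "\<exists>y\<in>carrier R_mod. y \<otimes>\<^bsub>R_mod\<^esub> x = \<one>\<^bsub>R_mod\<^esub>"
    using r Rc by (intro bexI[of _ x]) (auto simp: R_mod_def N2.rcos_sum)
  assume "z \<in> carrier R_mod"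
  then obtain t where t: "t \<in> R_subgroup 2" "z = cl t" by (auto simp: R_mod_def)
  show "x \<otimes>\<^bsub>R_mod\<^esub> y \<otimes>\<^bsub>R_mod\<^esub> z = x \<otimes>\<^bsub>R_mod\<^esub> (y \<otimes>\<^bsub>R_mod\<^esub> z)"
    using r s t Rc by (simp add: R_mod_def N2.rcos_sum free.m_assoc)
qed

interpretation R_mod: comm_group R_mod by (rule comm_group_R_mod)

definition normal_form :: "(edge \<Rightarrow> bit) \<Rightarrow> letter list set" where
  "normal_form s = finprod R_mod (\<lambda>e. if s e = 1 then cl (schreier e) else \<one>\<^bsub>R_mod\<^esub>) UNIV"

lemma cl_schreier [simp]: "cl (schreier e) \<in> carrier R_mod"
  by (simp add: R_mod_def schreier_R)

lemma normal_form_carrier: "normal_form s \<in> carrier R_mod"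
  unfolding normal_form_def by (rule R_mod.finprod_closed) auto

lemma schreier_square: "cl (schreier e) \<otimes>\<^bsub>R_mod\<^esub> cl (schreier e) = \<one>\<^bsub>R_mod\<^esub>"
proof -
  have "cl (schreier e \<otimes>\<^bsub>F2\<^esub> schreier e) = cl \<one>\<^bsub>F2\<^esub>"
    using free.squares_commutators_mem(1)[OF R_normal schreier_R schreier_R] by (intro cl_eq) auto
  then show ?thesis by (simp add: R_mod_def N2.rcos_sum)
qed

lemma normal_form_0: "normal_form 0 = \<one>\<^bsub>R_mod\<^esub>"
  unfolding normal_form_def by (simp add: R_mod.finprod_one_eqI)

lemma magnus_map_Nil: "magnus_map [] = (0, 0)"
  by (simp only: magnus_map_simps magnus_sel)

text \<open>If the edge was already present, the two copies of its Schreier generator cancel by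
  \<open>schreier_square\<close>.\<close>

lemma normal_form_dirac: "normal_form (s + dirac e) = normal_form s \<otimes>\<^bsub>R_mod\<^esub> cl (schreier e)"
proof -
  define f where "f s e = (if s e = (1 :: bit) then cl (schreier e) else \<one>\<^bsub>R_mod\<^esub>)" for s and e :: edge
  have f: "f s \<in> A \<rightarrow> carrier R_mod" for s A by (auto simp: f_def)
  define rest where "rest = finprod R_mod (f s) (UNIV - {e})"
  have split: "finprod R_mod (f s') UNIV = f s' e \<otimes>\<^bsub>R_mod\<^esub> finprod R_mod (f s') (UNIV - {e})" for s'
    using R_mod.finprod_insert[of "UNIV - {e}" e "f s'"] f by (simp add: insert_absorb f_def)
  have "finprod R_mod (f (s + dirac e)) (UNIV - {e}) = rest"
    unfolding rest_def by (rule R_mod.finprod_cong) (auto simp: f_def dirac_def)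
  then have 1: "normal_form (s + dirac e) = f (s + dirac e) e \<otimes>\<^bsub>R_mod\<^esub> rest"
    and 2: "normal_form s = f s e \<otimes>\<^bsub>R_mod\<^esub> rest"
    unfolding normal_form_def f_def[symmetric] by (simp_all only: split rest_def)
  have rest: "rest \<in> carrier R_mod" unfolding rest_def by (rule R_mod.finprod_closed[OF f])
  have "f (s + dirac e) e = f s e \<otimes>\<^bsub>R_mod\<^esub> cl (schreier e)"
    by (cases "s e") (simp_all add: f_def dirac_def schreier_square)
  moreover have "f s e \<in> carrier R_mod" using f by blast
  ultimately show ?thesis unfolding 1 2 using rest
    by (simp add: R_mod.m_assoc R_mod.m_comm)
qed

text \<open>Reidemeister-Schreier rewriting: every letter contributes the Schreier generator of the
  edge it crosses, and modulo \<open>N2\<close> only the parity of the crossings survives. Hence the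
  Magnus image determines the class, which gives the inclusion of the kernel in
  \<open>N2\<close>.\<close>

lemma cl_normal_form:
  assumes "w \<in> carrier F2"
  shows "cl w = normal_form (snd (magnus_map w)) <#>\<^bsub>F2\<^esub> cl (transversal (fst (magnus_map w)))"
  using assms
proof (induction w rule: rev_induct)
  case Nil
  have "transversal 0 = []" by (simp add: transversal_def free_group_sel zero_prod_def)
  then show ?case
    using N2.rcos_sum[OF free.one_closed free.one_closed]
    by (simp only: magnus_map_Nil fst_conv snd_conv normal_form_0) (simp add: R_mod_def free_group_sel)
next
  case (snoc x w)
  have w: "w \<in> carrier F2" and x: "[x] \<in> carrier F2"
    using snoc.prems reduced_appendD by (auto simp: free_group_sel(1))
  have wx: "w @ [x] = w \<otimes>\<^bsub>F2\<^esub> [x]"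
    using snoc.prems by (simp add: free_group_sel foldr_push_snoc)
  define i b where "i = (fst x = 1)" and "b = snd x"
  obtain q s where qs: "magnus_map w = (q, s)" by (cases "magnus_map w")
  \<comment> \<open>The edge crossed by the last letter; an inverse letter crosses it from its
    target \<open>q\<close> to its source.\<close>
  define e :: edge where "e = (if b then q else q + dir i, i)"
  have m: "magnus_map (w @ [x]) = (q + dir i, s + dirac e)"
  proof -
    have "magnus_map [x] = (dir i, if b then dirac (0, i) else dirac (dir i, i))"
      using magnus.r_one[OF magnus_letter_carrier, of x]
      by (simp only: magnus_map_simps magnus_letter_def Let_def i_def b_def)
    then show ?thesis
      unfolding wx magnus_hom.hom_mult[OF w x] qs
      by (auto simp: magnus_sel e_def fun_eq_iff dirac_move) (simp_all add: move_def add.commute)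
  qed
  obtain r where r: "r \<in> R_subgroup 2" "normal_form s = cl r"
    using normal_form_carrier[of s] by (auto simp: R_mod_def)
  have rc: "r \<in> carrier F2" using r by (simp add: R_subgroup_2)
  let ?t = "transversal q" and ?t' = "transversal (q + dir i)"
  have "cl (?t \<otimes>\<^bsub>F2\<^esub> [x]) = cl (schreier e \<otimes>\<^bsub>F2\<^esub> ?t')"
  proof (cases b)
    case True
    then have "[x] = gen i" using x by (cases x) (auto simp: gen_def i_def b_def free_group_sel)
    then have "schreier e \<otimes>\<^bsub>F2\<^esub> ?t' = ?t \<otimes>\<^bsub>F2\<^esub> [x]"
      using True by (simp add: schreier_def e_def src_def tgt_def free.m_assoc)
    then show ?thesis by simp
  next
    case False
    have "[x] \<otimes>\<^bsub>F2\<^esub> gen i = \<one>\<^bsub>F2\<^esub>"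
      using False x by (cases x) (auto simp: gen_def i_def b_def free_group_sel flip_letter_def)
    then have xi: "[x] = inv\<^bsub>F2\<^esub> gen i" using x by (simp add: free.inv_equality)
    have "tgt e = q" "src e = q + dir i" using False by (simp_all add: e_def src_def tgt_def)
    then have "schreier e = ?t' \<otimes>\<^bsub>F2\<^esub> gen i \<otimes>\<^bsub>F2\<^esub> inv\<^bsub>F2\<^esub> ?t" by (simp add: schreier_def e_def)
    then have g: "?t \<otimes>\<^bsub>F2\<^esub> [x] = inv\<^bsub>F2\<^esub> schreier e \<otimes>\<^bsub>F2\<^esub> ?t'"
      by (simp add: xi free.inv_mult_group free.m_assoc)
    \<comment> \<open>Crossing backwards produces the inverse Schreier generator, which agrees with
      the generator modulo squares.\<close>
    have "inv\<^bsub>F2\<^esub> schreier e \<otimes>\<^bsub>F2\<^esub> inv\<^bsub>F2\<^esub> schreier e \<in> N2"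
      by (rule free.squares_commutators_mem(1)[OF R_normal]; rule subgroup.m_inv_closed[OF normal_imp_subgroup[OF R_normal] schreier_R])
    then have "cl (inv\<^bsub>F2\<^esub> schreier e) = cl (schreier e)" by (intro cl_eq) auto
    then have "cl (inv\<^bsub>F2\<^esub> schreier e) <#>\<^bsub>F2\<^esub> cl ?t' = cl (schreier e) <#>\<^bsub>F2\<^esub> cl ?t'" by simp
    then show ?thesis unfolding g by (simp add: N2.rcos_sum)
  qed
  then have step: "cl (?t \<otimes>\<^bsub>F2\<^esub> [x]) = cl (schreier e \<otimes>\<^bsub>F2\<^esub> ?t')" .
  have "cl (w @ [x]) = cl w <#>\<^bsub>F2\<^esub> cl [x]" unfolding wx using w x by (simp add: N2.rcos_sum)
  also have "\<dots> = cl r <#>\<^bsub>F2\<^esub> cl ?t <#>\<^bsub>F2\<^esub> cl [x]" using snoc.IH[OF w] by (simp add: qs r)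
  also have "\<dots> = cl r <#>\<^bsub>F2\<^esub> cl (?t \<otimes>\<^bsub>F2\<^esub> [x])" using rc x by (simp add: N2.rcos_sum free.m_assoc)
  also have "\<dots> = (cl r <#>\<^bsub>F2\<^esub> cl (schreier e)) <#>\<^bsub>F2\<^esub> cl ?t'"
    unfolding step using rc by (simp add: N2.rcos_sum free.m_assoc)
  also have "cl r <#>\<^bsub>F2\<^esub> cl (schreier e) = normal_form (s + dirac e)"
    unfolding normal_form_dirac r(2) by (simp add: R_mod_def)
  finally show ?case by (simp only: m fst_conv snd_conv)
qed

lemma K2_eq_N2: "K2 = N2"
proof (rule antisym[OF _ N2_subset_K2], rule subsetI)
  fix w assume "w \<in> K2"
  then have w: "w \<in> carrier F2" "magnus_map w = (0, 0)" by (auto simp: kernel_def magnus_sel)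
  have "transversal 0 = \<one>\<^bsub>F2\<^esub>" by (simp add: transversal_def free_group_sel zero_prod_def)
  then have "cl w = cl \<one>\<^bsub>F2\<^esub>"
    using cl_normal_form[OF w(1)] N2.rcos_sum[OF free.one_closed free.one_closed]
    by (simp only: w(2) fst_conv snd_conv normal_form_0) (simp add: R_mod_def)
  then have "cl w = N2" using N2.subset by simp
  then show "w \<in> N2" using w(1) by (metis free.coset_join1 N2.subgroup_axioms)
qed

lemma V_group_iso: "\<exists>h. h \<in> iso (V_group 2) magnus"
  using magnus_hom.FactGroup_iso_set[OF magnus_hom_surj] unfolding K2_eq_N2 V_group_def by blast

lemma group_V_group: "Group.group (V_group 2)"
  unfolding V_group_def by (rule N2.factorgroup_is_group)

subsection \<open>Cells of a product of infinite-dimensional spheres\<close>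

text \<open>The off-diagonal terms come in equal pairs and cancel.\<close>

lemma sum_symmetric_char_2:
  fixes g :: "'a \<Rightarrow> 'a \<Rightarrow> 'v :: char_2"
  assumes "finite A" "\<And>e f. g e f = g f e"
  shows "(\<Sum>e\<in>A. \<Sum>f\<in>A. g e f) = (\<Sum>e\<in>A. g e e)"
  using assms(1)
proof induction
  case (insert a A)
  have "(\<Sum>e\<in>A. g e a) = (\<Sum>f\<in>A. g a f)" using assms(2) by metis
  with insert show ?case by (simp add: sum.distrib add.assoc)
qed simp

definition drop_edge :: "('e \<Rightarrow> nat) \<Rightarrow> 'e \<Rightarrow> 'e \<Rightarrow> nat" where
  "drop_edge m e = m(e := m e - 1)"

text \<open>Each sphere has two antipodal cells in every dimension: \<open>m\<close> gives the
  dimension in each factor and \<open>s\<close> says which of the two cells is taken.\<close>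

definition cells :: "nat \<Rightarrow> (('e :: finite \<Rightarrow> nat) \<times> ('e \<Rightarrow> bit)) set" where
  "cells n = {(m, s). sum m UNIV = n}"

text \<open>In one sphere both cells of dimension \<open>k + 1\<close> have as boundary modulo 2 the
  sum of the two cells of dimension \<open>k\<close>.\<close>

definition cobd1 :: "'e \<Rightarrow> (('e :: finite \<Rightarrow> nat) \<times> ('e \<Rightarrow> bit) \<Rightarrow> 'k :: char_2) \<Rightarrow> ('e \<Rightarrow> nat) \<times> ('e \<Rightarrow> bit) \<Rightarrow> 'k" where
  "cobd1 e \<phi> = (\<lambda>(m, s). if m e > 0 then \<phi> (drop_edge m e, s) + \<phi> (drop_edge m e, s + dirac e) else 0)"

definition cobd :: "(('e :: finite \<Rightarrow> nat) \<times> ('e \<Rightarrow> bit) \<Rightarrow> 'k :: char_2) \<Rightarrow> ('e \<Rightarrow> nat) \<times> ('e \<Rightarrow> bit) \<Rightarrow> 'k" where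
  "cobd \<phi> = (\<lambda>x. \<Sum>e\<in>UNIV. cobd1 e \<phi> x)"

text \<open>Dual of the chain homotopy that sends the cell labelled 1 in dimension \<open>k\<close>
  to the cell labelled 0 in dimension \<open>k + 1\<close> and kills the cells labelled 0.\<close>

definition contract :: "'e \<Rightarrow> (('e :: finite \<Rightarrow> nat) \<times> ('e \<Rightarrow> bit) \<Rightarrow> 'k :: char_2) \<Rightarrow> ('e \<Rightarrow> nat) \<times> ('e \<Rightarrow> bit) \<Rightarrow> 'k" where
  "contract e \<phi> = (\<lambda>(m, s). if s e = 1 then \<phi> (m(e := Suc (m e)), s + dirac e) else 0)"

text \<open>Pullback along the retraction of one sphere to its 0-cell labelled 0.\<close>

definition project :: "'e \<Rightarrow> (('e :: finite \<Rightarrow> nat) \<times> ('e \<Rightarrow> bit) \<Rightarrow> 'k :: char_2) \<Rightarrow> ('e \<Rightarrow> nat) \<times> ('e \<Rightarrow> bit) \<Rightarrow> 'k" where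
  "project e \<phi> = (\<lambda>(m, s). if m e = 0 then \<phi> (m, s(e := 0)) else 0)"

lemma dirac_same [simp]: "dirac e e = 1"
  and dirac_other: "e \<noteq> f \<Longrightarrow> dirac e f = 0"
  by (auto simp: dirac_def)

lemma drop_edge_commute: "drop_edge (drop_edge m e) f = drop_edge (drop_edge m f) e"
  by (auto simp: drop_edge_def fun_eq_iff)

lemma hom_cobd1: "add_hom (cobd1 e)"
  by (rule add_homI) (auto simp: cobd1_def fun_eq_iff ac_simps)

lemma hom_cobd: "add_hom cobd"
  by (rule add_homI) (simp add: cobd_def add_hom_add[OF hom_cobd1] sum.distrib fun_eq_iff)

lemma cobd1_sum: "cobd1 e (\<lambda>x. \<Sum>f\<in>A. g f x) = (\<lambda>x. \<Sum>f\<in>A. cobd1 e (g f) x)"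
proof
  fix x :: "('a \<Rightarrow> nat) \<times> ('a \<Rightarrow> bit)"
  show "cobd1 e (\<lambda>x. \<Sum>f\<in>A. g f x) x = (\<Sum>f\<in>A. cobd1 e (g f) x)"
    by (cases x) (simp add: cobd1_def sum.distrib)
qed

lemma cobd1_commute: "cobd1 e (cobd1 f \<phi>) = cobd1 f (cobd1 e \<phi>)"
proof (cases "e = f")
  case False
  then have "drop_edge m e f = m f" "drop_edge m f e = m e" for m :: "'a \<Rightarrow> nat" by (auto simp: drop_edge_def)
  then show ?thesis
    by (auto simp: cobd1_def fun_eq_iff drop_edge_commute[of _ e f] ac_simps)
qed simp

lemma cobd1_cobd1: "cobd1 e (cobd1 e \<phi>) = 0"
  by (auto simp: cobd1_def fun_eq_iff ac_simps)

lemma cobd_cobd: "cobd (cobd \<phi>) = 0"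
proof
  fix x
  have "cobd (cobd \<phi>) x = (\<Sum>e\<in>UNIV. \<Sum>f\<in>UNIV. cobd1 e (cobd1 f \<phi>) x)"
    by (simp add: cobd_def cobd1_sum)
  also have "\<dots> = (\<Sum>e\<in>UNIV. cobd1 e (cobd1 e \<phi>) x)"
    by (rule sum_symmetric_char_2) (simp_all add: cobd1_commute[of _ _ \<phi>] finite)
  also have "\<dots> = 0" by (simp add: cobd1_cobd1)
  finally show "cobd (cobd \<phi>) x = 0 x" by simp
qed

lemma contract_cobd1_same: "contract e (cobd1 e \<phi>) + cobd1 e (contract e \<phi>) = \<phi> + project e \<phi>"
proof
  fix x :: "('a \<Rightarrow> nat) \<times> ('a \<Rightarrow> bit)"
  obtain m s where x: "x = (m, s)" by (cases x)
  have a: "drop_edge (m(e := Suc (m e))) e = m" by (simp add: drop_edge_def)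
  have c: "s(e := 0) = (if s e = 1 then s + dirac e else s)"
    by (auto simp: fun_eq_iff dirac_def bit_not_one_iff)
  have d: "(s + dirac e) e = 1 \<longleftrightarrow> s e \<noteq> 1" by (cases "s e") simp_all
  show "(contract e (cobd1 e \<phi>) + cobd1 e (contract e \<phi>)) x = (\<phi> + project e \<phi>) x"
  proof (cases "m e > 0")
    case True
    then have b: "(drop_edge m e)(e := Suc (drop_edge m e e)) = m" by (auto simp: drop_edge_def)
    show ?thesis
      unfolding x plus_fun_apply[of _ _ "(m, s)"] contract_def cobd1_def project_def prod.case d b a
      using True by (auto simp: ac_simps)
  next
    case False
    then show ?thesis
      unfolding x plus_fun_apply[of _ _ "(m, s)"] contract_def cobd1_def project_def prod.case d c a
      by (auto simp: ac_simps)
  qed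
qed

lemma contract_cobd1_other:
  assumes "e \<noteq> f" shows "contract e (cobd1 f \<phi>) = cobd1 f (contract e \<phi>)"
proof
  fix x :: "('a \<Rightarrow> nat) \<times> ('a \<Rightarrow> bit)"
  obtain m s where x: "x = (m, s)" by (cases x)
  have a: "drop_edge (m(e := Suc (m e))) f = (drop_edge m f)(e := Suc (drop_edge m f e))"
    using assms by (auto simp: drop_edge_def fun_eq_iff)
  have b: "(s + dirac f) e = s e" using assms by (simp add: dirac_other)
  have c: "s + dirac f + dirac e = s + dirac e + dirac f" by (simp only: add.assoc add.commute[of "dirac e"])
  show "contract e (cobd1 f \<phi>) x = cobd1 f (contract e \<phi>) x"
    unfolding x contract_def cobd1_def prod.case a b c using assms by simp
qed

lemma contract_sum: "contract e (\<lambda>x. \<Sum>f\<in>A. g f x) = (\<lambda>x. \<Sum>f\<in>A. contract e (g f) x)"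
  by (auto simp: contract_def fun_eq_iff)

lemma contract_cobd: "contract e (cobd \<phi>) + cobd (contract e \<phi>) = \<phi> + project e \<phi>"
proof
  fix x
  have "(contract e (cobd \<phi>) + cobd (contract e \<phi>)) x
      = (\<Sum>f\<in>UNIV. (contract e (cobd1 f \<phi>) + cobd1 f (contract e \<phi>)) x)"
    by (simp add: cobd_def contract_sum sum.distrib)
  also have "\<dots> = (\<Sum>f\<in>UNIV. if f = e then (\<phi> + project e \<phi>) x else 0)"
  proof (rule sum.cong[OF refl])
    fix f show "(contract e (cobd1 f \<phi>) + cobd1 f (contract e \<phi>)) x = (if f = e then (\<phi> + project e \<phi>) x else 0)"
      using contract_cobd1_same[of e \<phi>] contract_cobd1_other[of e f \<phi>] by (cases "f = e") auto
  qed
  finally show "(contract e (cobd \<phi>) + cobd (contract e \<phi>)) x = (\<phi> + project e \<phi>) x" by simp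
qed

lemma sum_drop_edge:
  assumes "m e > 0" shows "Suc (sum (drop_edge m e) UNIV) = sum (m :: 'e :: finite \<Rightarrow> nat) UNIV"
proof -
  have "sum m UNIV = m e + sum m (UNIV - {e})" by (rule sum.remove) auto
  moreover have "sum (drop_edge m e) UNIV = drop_edge m e e + sum (drop_edge m e) (UNIV - {e})"
    by (rule sum.remove) auto
  moreover have "sum (drop_edge m e) (UNIV - {e}) = sum m (UNIV - {e})"
    by (rule sum.cong) (auto simp: drop_edge_def)
  ultimately show ?thesis using assms by (simp add: drop_edge_def)
qed

lemma cobd_cells:
  assumes "\<And>x. \<phi> x \<noteq> 0 \<Longrightarrow> x \<in> cells n" "cobd \<phi> x \<noteq> 0" shows "x \<in> cells (Suc n)"
proof -
  obtain m s where x: "x = (m, s)" by (cases x)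
  obtain e where "cobd1 e \<phi> x \<noteq> 0" using assms(2) unfolding cobd_def by (metis sum.neutral)
  then have e: "m e > 0" "\<phi> (drop_edge m e, s) \<noteq> 0 \<or> \<phi> (drop_edge m e, s + dirac e) \<noteq> 0"
    by (auto simp: x cobd1_def split: if_splits)
  then have "sum (drop_edge m e) UNIV = n" using assms(1) by (auto simp: cells_def)
  then show ?thesis using sum_drop_edge[of m e] e(1) by (simp add: x cells_def)
qed

lemma contract_cells:
  assumes "\<And>x. \<phi> x \<noteq> 0 \<Longrightarrow> x \<in> cells (Suc n)" "contract e \<phi> x \<noteq> 0" shows "x \<in> cells n"
proof -
  obtain m s where x: "x = (m, s)" by (cases x)
  let ?m = "m(e := Suc (m e))"
  have "\<phi> (?m, s + dirac e) \<noteq> 0" using assms(2) by (auto simp: x contract_def split: if_splits)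
  from assms(1)[OF this] have "sum ?m UNIV = Suc n" by (simp only: cells_def mem_Collect_eq prod.case)
  moreover have "drop_edge ?m e = m" by (simp add: drop_edge_def)
  ultimately show ?thesis using sum_drop_edge[of ?m e] by (simp add: x cells_def)
qed

text \<open>The spheres are contracted one after the other. After all of them the cocycle lives in
  multidegree 0, which contradicts its positive degree unless it is 0.\<close>

lemma cobd_exact_Suc:
  assumes supp: "\<And>x. \<phi> x \<noteq> 0 \<Longrightarrow> x \<in> cells (Suc n)" and d: "cobd \<phi> = 0"
  shows "\<exists>\<psi>. (\<forall>x. \<psi> x \<noteq> 0 \<longrightarrow> x \<in> cells n) \<and> \<phi> = cobd \<psi>"
proof -
  \<comment> \<open>\<open>A\<close> is the set of edges already contracted.\<close>
  have "\<exists>\<psi>. (\<forall>x. \<psi> x \<noteq> 0 \<longrightarrow> x \<in> cells n) \<and> (\<forall>m s. (\<phi> + cobd \<psi>) (m, s) \<noteq> 0 \<longrightarrow> (\<forall>e\<in>A. m e = 0))"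
    if "finite A" for A
    using that
  proof induction
    case empty
    show ?case by (intro exI[of _ 0]) auto
  next
    case (insert e A)
    then obtain \<psi> where \<psi>: "\<And>x. \<psi> x \<noteq> 0 \<Longrightarrow> x \<in> cells n"
      "\<And>m s. (\<phi> + cobd \<psi>) (m, s) \<noteq> 0 \<Longrightarrow> \<forall>e\<in>A. m e = 0" by blast
    define \<phi>' where "\<phi>' = \<phi> + cobd \<psi>"
    have "cobd \<phi>' = 0" unfolding \<phi>'_def by (simp add: add_hom_add[OF hom_cobd] d cobd_cobd)
    then have "\<phi>' + cobd (contract e \<phi>') = project e \<phi>'"
    proof -
      have "contract e (0 :: ('a \<Rightarrow> nat) \<times> ('a \<Rightarrow> bit) \<Rightarrow> 'b) = 0" by (auto simp: contract_def fun_eq_iff)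
      then have "cobd (contract e \<phi>') = \<phi>' + project e \<phi>'"
        using contract_cobd[of e \<phi>'] \<open>cobd \<phi>' = 0\<close> by (simp only: add_0_left)
      then show ?thesis by (simp only: add_self_left)
    qed
    then have eq: "\<phi> + cobd (\<psi> + contract e \<phi>') = project e \<phi>'"
      by (simp add: add_hom_add[OF hom_cobd] add.assoc[symmetric] \<phi>'_def)
    have supp': "x \<in> cells (Suc n)" if "\<phi>' x \<noteq> 0" for x
    proof (rule ccontr)
      assume "x \<notin> cells (Suc n)"
      then have "\<phi> x = 0" "cobd \<psi> x = 0" using supp cobd_cells[of \<psi> n x] \<psi>(1) by blast+
      then show False using that by (simp add: \<phi>'_def)
    qed
    show ?case
    proof (intro exI[of _ "\<psi> + contract e \<phi>'"] conjI allI impI)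
      fix x assume x: "(\<psi> + contract e \<phi>') x \<noteq> 0"
      show "x \<in> cells n"
      proof (cases "\<psi> x = 0")
        case True
        then show ?thesis using x contract_cells[of \<phi>' n e x] supp' by simp
      qed (use \<psi>(1) in blast)
    next
      fix m s assume "(\<phi> + cobd (\<psi> + contract e \<phi>')) (m, s) \<noteq> 0"
      then have "m e = 0" "\<phi>' (m, s(e := 0)) \<noteq> 0"
        unfolding eq by (auto simp: project_def split: if_splits)
      with \<psi>(2)[of m "s(e := 0)"] show "\<forall>e\<in>insert e A. m e = 0" by (simp add: \<phi>'_def)
    qed
  qed
  from this[OF finite[of UNIV]] obtain \<psi> where \<psi>': "\<forall>x. \<psi> x \<noteq> 0 \<longrightarrow> x \<in> cells n"
    "\<forall>m s. (\<phi> + cobd \<psi>) (m, s) \<noteq> 0 \<longrightarrow> (\<forall>e\<in>UNIV. m e = 0)" by (elim exE conjE)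
  note \<psi> = \<psi>'[rule_format]
  have "\<phi> + cobd \<psi> = 0"
  proof (rule ext, rule ccontr)
    fix x assume nz: "(\<phi> + cobd \<psi>) x \<noteq> 0 x"
    obtain m s where x: "x = (m, s)" by (cases x)
    have "x \<in> cells (Suc n)"
    proof (rule ccontr)
      assume "x \<notin> cells (Suc n)"
      then have "\<phi> x = 0" "cobd \<psi> x = 0" using supp cobd_cells[of \<psi> n x] \<psi>(1) by blast+
      then show False using nz by simp
    qed
    moreover have "\<forall>e. m e = 0" using \<psi>(2)[of m s] nz by (simp only: x UNIV_I zero_fun_apply) blast
    ultimately show False by (simp add: x cells_def)
  qed
  then have "\<phi> = cobd \<psi>" by (simp add: add_eq_0_iff_char_2)
  with \<psi>(1) show ?thesis by blast
qed

text \<open>The 0-cells are the corners of a cube and the 1-cells join corners that differ in one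
  coordinate, so a cocycle is constant.\<close>

lemma cobd_exact_0:
  assumes supp: "\<And>x. \<phi> x \<noteq> 0 \<Longrightarrow> x \<in> cells 0"
  shows "cobd \<phi> = 0 \<longleftrightarrow> (\<exists>c. \<phi> = (\<lambda>x. if x \<in> cells 0 then c else 0))"
proof
  assume d: "cobd \<phi> = 0"
  have flip: "\<phi> (0, s + dirac e) = \<phi> (0, s)" for s e
  proof -
    let ?m = "(\<lambda>f. if f = e then 1 else 0 :: nat)"
    have "cobd1 f \<phi> (?m, s) = (if f = e then \<phi> (0, s) + \<phi> (0, s + dirac e) else 0)" for f
    proof -
      have "drop_edge ?m e = 0" by (auto simp: drop_edge_def)
      then show ?thesis by (simp add: cobd1_def)
    qed
    then have "cobd \<phi> (?m, s) = \<phi> (0, s) + \<phi> (0, s + dirac e)" by (simp add: cobd_def)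
    then show ?thesis using d by (simp add: add_eq_0_iff_char_2)
  qed
  have const: "\<phi> (0, s) = \<phi> (0, 0)" for s
  proof (induction "card {e. s e = 1}" arbitrary: s)
    case 0
    then have "s = 0" by (auto simp: fun_eq_iff bit_not_one_iff)
    then show ?case by simp
  next
    case (Suc k)
    then have "{e. s e = 1} \<noteq> {}" by (metis card.empty nat.distinct(1))
    then obtain e where e: "s e = 1" by blast
    have "{f. (s + dirac e) f = 1} = {f. s f = 1} - {e}"
      using e by (auto simp: dirac_def split: if_splits)
    then have "k = card {f. (s + dirac e) f = 1}" using Suc(2) e by simp
    from Suc(1)[OF this] show ?case unfolding flip .
  qed
  have "\<phi> = (\<lambda>x. if x \<in> cells 0 then \<phi> (0, 0) else 0)"
  proof
    fix x :: "('a \<Rightarrow> nat) \<times> ('a \<Rightarrow> bit)"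
    obtain m s where x: "x = (m, s)" by (cases x)
    show "\<phi> x = (if x \<in> cells 0 then \<phi> (0, 0) else 0)"
    proof (cases "x \<in> cells 0")
      case True
      then have "m = 0" by (auto simp: x cells_def)
      then show ?thesis using const[of s] True by (simp add: x)
    next
      case False
      then have "\<phi> x = 0" using supp[of x] by blast
      then show ?thesis using False by simp
    qed
  qed
  then show "\<exists>c. \<phi> = (\<lambda>x. if x \<in> cells 0 then c else 0)" by blast
next
  assume "\<exists>c. \<phi> = (\<lambda>x. if x \<in> cells 0 then c else 0)"
  then obtain c where "\<phi> = (\<lambda>x. if x \<in> cells 0 then c else 0)" by blast
  then have "cobd1 e \<phi> x = 0" for e x by (cases x) (simp add: cobd1_def cells_def)
  then show "cobd \<phi> = 0" by (simp add: cobd_def fun_eq_iff)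
qed

lemma finite_multidegrees: "finite {m :: 'e :: finite \<Rightarrow> nat. sum m UNIV = n}"
proof (rule finite_subset)
  show "{m :: 'e \<Rightarrow> nat. sum m UNIV = n} \<subseteq> UNIV \<rightarrow>\<^sub>E {..n}"
  proof
    fix m :: "'e \<Rightarrow> nat" assume "m \<in> {m. sum m UNIV = n}"
    then have "m e \<le> n" for e using member_le_sum[of e UNIV m] by simp
    then show "m \<in> UNIV \<rightarrow>\<^sub>E {..n}" by (auto simp: PiE_iff)
  qed
  show "finite (UNIV \<rightarrow>\<^sub>E {..n} :: ('e \<Rightarrow> nat) set)" by (rule finite_PiE) auto
qed

lemma finite_cells: "finite (cells n :: (('e :: finite \<Rightarrow> nat) \<times> ('e \<Rightarrow> bit)) set)"
proof -
  have "(cells n :: (('e \<Rightarrow> nat) \<times> ('e \<Rightarrow> bit)) set) = {m. sum m UNIV = n} \<times> UNIV"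
    by (auto simp: cells_def)
  moreover have "finite ({m :: 'e \<Rightarrow> nat. sum m UNIV = n} \<times> (UNIV :: ('e \<Rightarrow> bit) set))"
    by (intro finite_cartesian_product finite_multidegrees finite)
  ultimately show ?thesis by simp
qed

section \<open>The free action of the Magnus group on the cells\<close>

definition act :: "vertex \<times> (edge \<Rightarrow> bit) \<Rightarrow> (edge \<Rightarrow> nat) \<times> (edge \<Rightarrow> bit) \<Rightarrow> (edge \<Rightarrow> nat) \<times> (edge \<Rightarrow> bit)" where
  "act = (\<lambda>(q, t) (m, s). (\<lambda>e. m (move q e), t + (\<lambda>e. s (move q e))))"

lemma act_mult: "act (v \<otimes>\<^bsub>magnus\<^esub> v') x = act v (act v' x)"
proof -
  obtain q t q' t' m s where x: "v = (q, t)" "v' = (q', t')" "x = (m, s)" by (cases v; cases v'; cases x)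
  show ?thesis by (simp add: x act_def magnus_sel fun_eq_iff add.assoc add.commute[of q'])
qed

lemma act_one: "act \<one>\<^bsub>magnus\<^esub> x = x"
  by (cases x) (simp add: act_def magnus_sel fun_eq_iff)

lemma act_cells: "act v x \<in> cells n \<longleftrightarrow> x \<in> cells n"
proof -
  have "sum (\<lambda>e. m (move q e)) UNIV = sum m UNIV" for m :: "edge \<Rightarrow> nat" and q
    by (rule sum.reindex_bij_betw[OF bij_move])
  then show ?thesis by (cases v; cases x) (simp add: act_def cells_def)
qed

lemma sum_bd: "(\<Sum>r\<in>UNIV. bd s r) = 0"
proof -
  have "(\<Sum>r\<in>UNIV. bd s r) = (\<Sum>e\<in>UNIV. \<Sum>r\<in>UNIV. s e * (dirac (src e) r + dirac (tgt e) r))"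
    unfolding bd_def by (rule sum.swap)
  also have "\<dots> = 0"
    by (rule sum.neutral) (simp add: distrib_left sum.distrib sum_dirac)
  finally show ?thesis .
qed

lemma sum_vertex: "(\<Sum>r\<in>UNIV. f (r :: vertex)) = f (0, 0) + f (1, 0) + f (0, 1) + (f (1, 1) :: 'v :: comm_monoid_add)"
proof -
  have "(UNIV :: vertex set) = {(0, 0), (1, 0), (0, 1), (1, 1)}"
  proof (intro equalityI subsetI)
    fix r :: vertex
    show "r \<in> {(0, 0), (1, 0), (0, 1), (1, 1)}" by (cases r; cases "fst r"; cases "snd r") auto
  qed simp
  then have "(\<Sum>r\<in>UNIV. f r) = (\<Sum>r\<in>{(0, 0), (1, 0), (0, 1), (1, 1)}. f r)" by (rule arg_cong)
  also have "\<dots> = f (0, 0) + f (1, 0) + f (0, 1) + f (1, 1)" by (simp add: add.assoc)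
  finally show ?thesis .
qed

text \<open>The orbits of a nonzero translation have two elements.\<close>

lemma sum_translation_invariant:
  assumes "q \<noteq> 0" "\<And>r. f (r + q) = (f r :: 'v :: char_2)" shows "(\<Sum>r\<in>UNIV. f (r :: vertex)) = 0"
proof -
  consider "q = (1, 0)" | "q = (0, 1)" | "q = (1, 1)"
    using assms(1) by (cases q; cases "fst q"; cases "snd q") (auto simp: zero_prod_def)
  then show ?thesis
  proof cases
    case 1
    then show ?thesis using assms(2)[of "(0, 0)"] assms(2)[of "(0, 1)"] by (simp add: sum_vertex)
  next
    case 2
    then show ?thesis using assms(2)[of "(0, 0)"] assms(2)[of "(1, 0)"] by (simp add: sum_vertex ac_simps)
  next
    case 3
    then show ?thesis using assms(2)[of "(0, 0)"] assms(2)[of "(1, 0)"] by (simp add: sum_vertex ac_simps)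
  qed
qed

text \<open>If \<open>q\<close> is nonzero, a fixed cell makes \<open>bd s + dirac 0\<close>
  invariant under translation by \<open>q\<close>, so its values sum to 0. But the values of
  \<open>bd s\<close> sum to 0 and those of \<open>dirac 0\<close> to 1.\<close>

lemma act_free:
  assumes v: "v \<in> carrier magnus" and fixed: "act v x = x" shows "v = \<one>\<^bsub>magnus\<^esub>"
proof -
  obtain q t m s where x: "v = (q, t)" "x = (m, s)" by (cases v; cases x)
  have t: "t + (\<lambda>e. s (move q e)) = s" using fixed by (simp add: x act_def)
  show ?thesis
  proof (cases "q = 0")
    case True
    then have "t + s = 0 + s" using t by simp
    then show ?thesis unfolding x True magnus_sel by (metis add_right_cancel)
  next
    case False
    have "t = s + (\<lambda>e. s (move q e))" using t by (metis add_self_right)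
    then have "bd t r = bd s r + bd s (r + q)" for r
      by (simp add: add_hom_add[OF hom_bd] bd_move)
    moreover have "bd t r = dirac q r + dirac 0 r" for r using v by (simp add: x magnus_sel)
    ultimately have bd: "bd s (r + q) = bd s r + (dirac q r + dirac 0 r)" for r
      by (metis add_self_left)
    have "dirac 0 (r + q) = dirac q r" for r using dirac_add[of 0 q r] by simp
    then have "bd s (r + q) + dirac 0 (r + q) = bd s r + (dirac q r + dirac 0 r) + dirac q r" for r
      by (simp only: bd)
    also have "bd s r + (dirac q r + dirac 0 r) + dirac q r = bd s r + dirac 0 r" for r
      by (simp add: ac_simps)
    finally have "bd s (r + q) + dirac 0 (r + q) = bd s r + dirac 0 r" for r .
    from sum_translation_invariant[OF False, of "\<lambda>r. bd s r + dirac 0 r", OF this]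
    have "(1 :: bit) = 0" using sum_dirac[of "\<lambda>_. 1" "0 :: vertex"] by (simp add: sum.distrib sum_bd)
    then show ?thesis by simp
  qed
qed

lemma cobd1_act: "cobd1 e (\<lambda>x. \<phi> (act (q, t) x)) x = cobd1 (move q e) \<phi> (act (q, t) x)"
proof -
  obtain m s where x: "x = (m, s)" by (cases x)
  have a: "(\<lambda>f. drop_edge m e (move q f)) = drop_edge (\<lambda>f. m (move q f)) (move q e)"
  proof
    fix f
    have "move q f = e \<longleftrightarrow> f = move q e" by (metis move_0 move_move add_self)
    then show "drop_edge m e (move q f) = drop_edge (\<lambda>f. m (move q f)) (move q e) f"
      by (auto simp: drop_edge_def)
  qed
  have b: "t + (\<lambda>f. (s + dirac e) (move q f)) = t + (\<lambda>f. s (move q f)) + dirac (move q e)"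
    by (simp add: fun_eq_iff dirac_move add.assoc)
  show ?thesis unfolding x cobd1_def act_def prod.case a b by simp
qed

lemma cobd_act: "cobd (\<lambda>x. \<phi> (act v x)) = (\<lambda>x. cobd \<phi> (act v x))"
proof
  fix x obtain q t where v: "v = (q, t)" by (cases v)
  show "cobd (\<lambda>x. \<phi> (act v x)) x = cobd \<phi> (act v x)"
    unfolding v cobd_def cobd1_act by (rule sum.reindex_bij_betw[OF bij_move])
qed

definition supported :: "'a set \<Rightarrow> ('a \<Rightarrow> 'v :: zero) set" where
  "supported A = {\<phi>. \<forall>x. \<phi> x \<noteq> 0 \<longrightarrow> x \<in> A}"

lemma supported_iff: "\<phi> \<in> supported A \<longleftrightarrow> (\<forall>x. x \<notin> A \<longrightarrow> \<phi> x = 0)"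
  by (auto simp: supported_def)

lemma add_closed_supported: "add_closed (supported A)"
  by (auto simp: add_closed_def supported_iff)

lemma bij_betw_supported: "bij_betw (\<lambda>\<phi>. restrict \<phi> A) (supported A) (A \<rightarrow>\<^sub>E UNIV)"
  by (rule bij_betw_byWitness[where f' = "\<lambda>\<phi> x. if x \<in> A then \<phi> x else 0"])
    (auto simp: supported_iff fun_eq_iff PiE_iff extensional_def)

lemma finite_supported:
  assumes "finite A" shows "finite (supported A :: ('a \<Rightarrow> 'v :: {zero, finite}) set)"
proof -
  have "finite (A \<rightarrow>\<^sub>E (UNIV :: 'v set))" using assms by (intro finite_PiE) auto
  then show ?thesis using bij_betw_finite[OF bij_betw_supported[where A = A and 'b = 'v]] by (rule iffD2[rotated])
qed

lemma card_supported:
  assumes "finite A" shows "card (supported A :: ('a \<Rightarrow> bit) set) = 2 ^ card A"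
  using bij_betw_same_card[OF bij_betw_supported[where A = A and 'b = bit]] assms
  by (simp add: card_PiE card_UNIV_bit)

definition invariant_cochains :: "nat \<Rightarrow> ((edge \<Rightarrow> nat) \<times> (edge \<Rightarrow> bit) \<Rightarrow> bit) set" where
  "invariant_cochains n = {\<phi> \<in> supported (cells n). \<forall>v\<in>carrier magnus. \<forall>x. \<phi> (act v x) = \<phi> x}"

lemma add_closed_invariant_cochains: "add_closed (invariant_cochains n)"
  using add_closed_supported by (auto simp: add_closed_def invariant_cochains_def)

lemma finite_invariant_cochains: "finite (invariant_cochains n)"
  by (rule finite_subset[OF _ finite_supported[OF finite_cells[of n]]]) (auto simp: invariant_cochains_def)

text \<open>The abstract comparison for \<open>V_group 2\<close>, which acts through an isomorphism
  to the Magnus group.\<close>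

lemma cohomology_dim_V:
  assumes "card {\<phi> \<in> invariant_cochains (Suc n). cobd \<phi> = 0} = 2 ^ d * card (cobd ` invariant_cochains n)"
  shows "cohomology_dim TYPE(bit) (V_group 2) (Suc n) = d"
proof -
  obtain h where h: "h \<in> iso (V_group 2) magnus" using V_group_iso by blast
  then have hom: "h \<in> hom (V_group 2) magnus" and bij: "bij_betw h (carrier (V_group 2)) (carrier magnus)"
    by (auto simp: iso_def)
  interpret V: Group.group "V_group 2" by (rule group_V_group)
  interpret h: group_hom "V_group 2" magnus h
    by (unfold_locales) (rule hom)
  have "finite (carrier magnus)" by simp
  then have fin: "finite (carrier (V_group 2))" using bij bij_betw_finite by blast
  interpret free_cochain_complex_field "V_group 2" "\<lambda>g. act (h g)" cells
    "cobd :: ((edge \<Rightarrow> nat) \<times> (edge \<Rightarrow> bit) \<Rightarrow> bit) \<Rightarrow> _"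
  proof unfold_locales
    let ?C = "cells :: nat \<Rightarrow> ((edge \<Rightarrow> nat) \<times> (edge \<Rightarrow> bit)) set"
    show "finite (carrier (V_group 2))" by (rule fin)
    show "finite (?C n)" for n by (rule finite_cells)
    show "act (h g) x \<in> ?C n \<longleftrightarrow> x \<in> ?C n" for g x n by (rule act_cells)
    show "act (h \<one>\<^bsub>V_group 2\<^esub>) x = x" for x by (simp add: act_one)
    show "act (h (g \<otimes>\<^bsub>V_group 2\<^esub> g')) x = act (h g) (act (h g') x)"
      if "g \<in> carrier (V_group 2)" "g' \<in> carrier (V_group 2)" for g g' x
      using that by (simp add: act_mult)
    show "g = \<one>\<^bsub>V_group 2\<^esub>" if g: "g \<in> carrier (V_group 2)" and fixed: "act (h g) x = x" for g x
      using act_free[OF h.hom_closed[OF g] fixed] bij g V.one_closed h.hom_one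
      by (metis bij_betw_imp_inj_on inj_onD)
    show "add_hom (cobd :: ((edge \<Rightarrow> nat) \<times> (edge \<Rightarrow> bit) \<Rightarrow> bit) \<Rightarrow> _)" by (rule hom_cobd)
    show "?C 0 \<noteq> {}" by (auto simp: cells_def intro!: exI[of _ 0])
    fix \<phi> :: "(edge \<Rightarrow> nat) \<times> (edge \<Rightarrow> bit) \<Rightarrow> bit" and n x
    show "cobd (cobd \<phi>) = 0" by (rule cobd_cobd)
    show "cobd (\<lambda>x. \<phi> (act (h g) x)) = (\<lambda>x. cobd \<phi> (act (h g) x))" for g by (rule cobd_act)
    show "x \<in> ?C (Suc n)" if "\<And>x. \<phi> x \<noteq> 0 \<Longrightarrow> x \<in> ?C n" "cobd \<phi> x \<noteq> 0"
      using that by (rule cobd_cells)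
    show "\<exists>\<psi>. (\<forall>x. \<psi> x \<noteq> 0 \<longrightarrow> x \<in> ?C n) \<and> \<phi> = cobd \<psi>"
      if "\<And>x. \<phi> x \<noteq> 0 \<Longrightarrow> x \<in> ?C (Suc n)" "cobd \<phi> = 0"
      using that by (rule cobd_exact_Suc)
    show "cobd \<phi> = 0 \<longleftrightarrow> (\<exists>c. \<phi> = (\<lambda>x. if x \<in> ?C 0 then c else 0))"
      if "\<And>x. \<phi> x \<noteq> 0 \<Longrightarrow> x \<in> ?C 0"
      using that by (rule cobd_exact_0)
  qed
  have "inv_cochains k = invariant_cochains k" for k
  proof -
    have "carrier magnus = h ` carrier (V_group 2)" using bij by (simp add: bij_betw_def)
    then show ?thesis unfolding inv_cochains_def invariant_cochains_def supported_def by simp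
  qed
  moreover have "card (cobd ` invariant_cochains n) > 0"
    by (intro card_pos_add_closed finite_imageI finite_invariant_cochains add_closed_image
        add_closed_invariant_cochains hom_cobd)
  ultimately have "card (cocycles (V_group 2) (Suc n) :: (_ \<Rightarrow> bit) set)
      = 2 ^ d * card (coboundaries (V_group 2) (Suc n) :: (_ \<Rightarrow> bit) set)"
    using card_cocycles_eq_invariant[of n] assms by simp
  then show ?thesis
    by (intro cohomology_dim_eq fin submodule_cocycles submodule_coboundaries coboundaries_subset)
      (simp_all add: V.is_group)
qed

subsection \<open>Invariant cochains and Koszul chains\<close>

type_synonym cell = "(edge \<Rightarrow> nat) \<times> (edge \<Rightarrow> bit)"
type_synonym pair = "(edge \<Rightarrow> nat) \<times> vertex set"

text \<open>The odd vertices of the label form the set \<open>T\<close> that determines the orbit of a cell \<open>(m, s)\<close> under the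
  kernel of \<open>V(2) \<longrightarrow> (\<int>/2)\<^sup>2\<close>, for fixed \<open>m\<close>. Summing a function of \<open>(m, B)\<close> over all \<open>B \<subseteq> T\<close> turns the Koszul
  differential into the cellular coboundary.\<close>

definition label :: "cell \<Rightarrow> vertex \<Rightarrow> bit" where
  "label = (\<lambda>(m, s) r. dirac 0 r + bd s r + (\<Sum>e\<in>UNIV. of_nat (m e) * dirac (src e) r))"

definition odd_set :: "(vertex \<Rightarrow> bit) \<Rightarrow> vertex set" where
  "odd_set l = {r. l r = 1}"

definition translate :: "vertex \<Rightarrow> pair \<Rightarrow> pair" where
  "translate q = (\<lambda>(m, B). (\<lambda>e. m (move q e), {r. r + q \<in> B}))"

text \<open>Multiplication by the linear form of the vertex \<open>r\<close>, for polynomials in the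
  edges given as functions of the exponent vector.\<close>

definition incident :: "vertex \<Rightarrow> ((edge \<Rightarrow> nat) \<Rightarrow> bit) \<Rightarrow> (edge \<Rightarrow> nat) \<Rightarrow> bit" where
  "incident r \<phi> m = (\<Sum>e\<in>UNIV. if (r = src e \<or> r = tgt e) \<and> m e > 0 then \<phi> (drop_edge m e) else 0)"

text \<open>\<open>g (m, B)\<close> is the coefficient of the monomial \<open>m\<close> times the
  exterior product of the generators in \<open>B\<close>; the differential trades a generator for
  its linear form.\<close>

definition koszul :: "(pair \<Rightarrow> bit) \<Rightarrow> pair \<Rightarrow> bit" where
  "koszul g = (\<lambda>(m, B). \<Sum>r\<in>- B. incident r (\<lambda>m. g (m, insert r B)) m)"

definition spread :: "(pair \<Rightarrow> bit) \<Rightarrow> cell \<Rightarrow> bit" where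
  "spread g = (\<lambda>x. \<Sum>B\<in>Pow (odd_set (label x)). g (fst x, B))"

definition pairs :: "nat \<Rightarrow> nat \<Rightarrow> pair set" where
  "pairs i j = {(m, B). sum m UNIV = i \<and> card B = j}"

definition odd_pairs :: "nat \<Rightarrow> pair set" where
  "odd_pairs n = {(m, B). sum m UNIV = n \<and> odd (n + card B)}"

definition invariant :: "(pair \<Rightarrow> bit) \<Rightarrow> bool" where
  "invariant g \<longleftrightarrow> (\<forall>q p. g (translate q p) = g p)"

definition koszul_chains :: "nat \<Rightarrow> (pair \<Rightarrow> bit) set" where
  "koszul_chains n = {g \<in> supported (odd_pairs n). invariant g}"

lemma of_nat_bit_eq_0_iff: "(of_nat n :: bit) = 0 \<longleftrightarrow> even n"
proof (induction n)
  case (Suc n)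
  then show ?case by (cases "of_nat n :: bit") auto
qed simp

lemma src_neq_tgt: "src e \<noteq> tgt e"
  by (simp add: src_def tgt_def dir_def zero_prod_def)

lemma sum_dirac_left: "(\<Sum>r\<in>UNIV. dirac a r) = (1 :: bit)" for a :: "'a :: finite"
  using sum_dirac[of "\<lambda>_. 1" a] by simp

text \<open>The summand \<open>dirac 0\<close> of the label absorbs the \<open>dirac q\<close> in
  the boundary of \<open>t\<close>. Labels are therefore unchanged by cycles and only translated by
  \<open>q\<close>.\<close>

lemma label_act:
  assumes "(q, t) \<in> carrier magnus" shows "label (act (q, t) x) r = label x (r + q)"
proof -
  obtain m s where x: "x = (m, s)" by (cases x)
  have a: "(\<Sum>e\<in>UNIV. of_nat (m (move q e)) * dirac (src e) r) = (\<Sum>e\<in>UNIV. of_nat (m e) * dirac (src e) (r + q))"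
  proof -
    have "(\<Sum>e\<in>UNIV. of_nat (m e) * dirac (src e) (r + q))
        = (\<Sum>e\<in>UNIV. of_nat (m (move q e)) * dirac (src (move q e)) (r + q))"
      by (rule sum.reindex_bij_betw[OF bij_move, symmetric])
    then show ?thesis by (simp add: dirac_add)
  qed
  have b: "bd (t + (\<lambda>e. s (move q e))) r = dirac q r + dirac 0 r + bd s (r + q)"
    using assms by (simp add: magnus_sel add_hom_add[OF hom_bd] bd_move)
  have c: "dirac 0 (r + q) = dirac q r" using dirac_add[of 0 q r] by simp
  show ?thesis unfolding x label_def act_def prod.case a b c by (simp add: ac_simps)
qed

lemma sum_drop_edge_dirac:
  fixes h :: "'e :: finite \<Rightarrow> bit"
  assumes "m e > 0"
  shows "(\<Sum>f\<in>UNIV. of_nat (drop_edge m e f) * h f) = (\<Sum>f\<in>UNIV. of_nat (m f) * h f) + h e"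
proof -
  have "(\<Sum>f\<in>UNIV. of_nat (m f) * h f) = of_nat (m e) * h e + (\<Sum>f\<in>UNIV - {e}. of_nat (m f) * h f)"
    by (rule sum.remove) auto
  moreover have "(\<Sum>f\<in>UNIV. of_nat (drop_edge m e f) * h f)
      = of_nat (drop_edge m e e) * h e + (\<Sum>f\<in>UNIV - {e}. of_nat (drop_edge m e f) * h f)"
    by (rule sum.remove) auto
  moreover have "(\<Sum>f\<in>UNIV - {e}. of_nat (drop_edge m e f) * h f) = (\<Sum>f\<in>UNIV - {e}. of_nat (m f) * h f)"
    by (rule sum.cong) (auto simp: drop_edge_def)
  moreover obtain k where "m e = Suc k" using assms gr0_implies_Suc by blast
  ultimately show ?thesis by (simp add: drop_edge_def algebra_simps)
qed

text \<open>This is what the term in \<open>m\<close> of \<open>label\<close> achieves: the two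
  faces across an edge change the label at one vertex each, its source and its target.\<close>

lemma label_drop_edge:
  assumes "m e > 0"
  shows "label (drop_edge m e, s) = label (m, s) + dirac (src e)"
    "label (drop_edge m e, s + dirac e) = label (m, s) + dirac (tgt e)"
proof -
  show "label (drop_edge m e, s) = label (m, s) + dirac (src e)"
    by (rule ext) (simp only: label_def prod.case plus_fun_apply sum_drop_edge_dirac[of m e, OF assms] add.assoc)
  show "label (drop_edge m e, s + dirac e) = label (m, s) + dirac (tgt e)"
    by (rule ext, simp only: label_def prod.case plus_fun_apply sum_drop_edge_dirac[of m e, OF assms]
        add_hom_add[OF hom_bd] bd_dirac) (simp add: ac_simps)
qed

lemma sum_label: "(\<Sum>r\<in>UNIV. label (m, s) r) = 1 + of_nat (sum m UNIV)"
proof -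
  have "(\<Sum>r\<in>UNIV. \<Sum>e\<in>UNIV. of_nat (m e) * dirac (src e) r)
      = (\<Sum>e\<in>UNIV. \<Sum>r\<in>UNIV. of_nat (m e) * dirac (src e) r)" by (rule sum.swap)
  also have "\<dots> = of_nat (sum m UNIV)" by (simp add: sum_dirac)
  finally show ?thesis
    unfolding label_def prod.case sum.distrib sum_bd sum_dirac_left by simp
qed

lemma sum_eq_card_odd_set: "(\<Sum>r\<in>UNIV. l r) = of_nat (card (odd_set l))"
proof -
  have "(\<Sum>r\<in>UNIV. l r) = (\<Sum>r\<in>UNIV. if r \<in> odd_set l then 1 else 0)"
    by (rule sum.cong) (auto simp: odd_set_def bit_not_one_iff)
  also have "\<dots> = of_nat (card (odd_set l))" by (simp add: sum.If_cases)
  finally show ?thesis .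
qed

text \<open>The size of the odd set has the parity of the sum of the label, by
  \<open>sum_label\<close> that of 1 plus the degree of \<open>m\<close>. This is the origin of the
  odd total degrees.\<close>

lemma odd_set_label: "(m, odd_set (label (m, s))) \<in> odd_pairs (sum m UNIV)"
proof -
  have "(of_nat (card (odd_set (label (m, s)))) :: bit) = 1 + of_nat (sum m UNIV)"
    using sum_label[of m s] by (simp only: sum_eq_card_odd_set)
  then have "(of_nat (sum m UNIV + card (odd_set (label (m, s)))) :: bit) \<noteq> 0"
    by (simp only: of_nat_add) (simp add: ac_simps)
  then show ?thesis unfolding of_nat_bit_eq_0_iff by (simp add: odd_pairs_def)
qed

lemma sum_fun_apply: "(\<Sum>a\<in>A. f a) x = (\<Sum>a\<in>A. f a x)"
  by (induction A rule: infinite_finite_induct) auto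

text \<open>Every 0-chain with sum 0 is a boundary, filled here by tree paths, so a label can be
  prescribed up to its parity.\<close>

lemma label_surj:
  assumes "(m, B) \<in> odd_pairs n" shows "\<exists>s. odd_set (label (m, s)) = B"
proof -
  define l where "l = (\<lambda>r. label (m, 0) r + (if r \<in> B then 1 else 0))"
  have bd_tree: "bd (tree_path q) = dirac q + dirac 0" for q
    using magnus_map_carrier[of "transversal q"] by (simp add: magnus_transversal magnus_sel)
  have "(\<Sum>r\<in>UNIV. l r) = 1 + of_nat n + of_nat (card B)"
    using assms by (simp add: l_def sum.distrib sum_label odd_pairs_def sum.If_cases)
  also have "\<dots> = 0"
    using assms of_nat_bit_eq_0_iff[of "Suc (n + card B)"] by (simp add: odd_pairs_def add.assoc)
  finally have l0: "(\<Sum>r\<in>UNIV. l r) = 0" .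
  define s where "s = (\<Sum>q\<in>odd_set l. tree_path q)"
  have "bd s r = l r" for r
  proof -
    have "bd s r = (\<Sum>q\<in>odd_set l. dirac q r + dirac 0 r)"
      by (simp only: s_def add_hom_sum[OF hom_bd] sum_fun_apply bd_tree plus_fun_apply)
    also have "\<dots> = (\<Sum>q\<in>UNIV. l q * (dirac q r + dirac 0 r))"
      by (rule sum.mono_neutral_cong_left) (auto simp: odd_set_def bit_not_one_iff)
    also have "\<dots> = (\<Sum>q\<in>UNIV. l q * dirac r q) + (\<Sum>q\<in>UNIV. l q) * dirac 0 r"
      by (simp add: distrib_left sum.distrib sum_distrib_right dirac_commute[of r])
    also have "\<dots> = l r" by (simp add: l0 sum_dirac)
    finally show ?thesis .
  qed
  then have "label (m, s) r = (if r \<in> B then 1 else 0)" for r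
    using add_hom_0[OF hom_bd] by (simp add: label_def l_def ac_simps)
  then have "odd_set (label (m, s)) = B" by (auto simp: odd_set_def split: if_splits)
  then show ?thesis by blast
qed

lemma sum_Pow_insert:
  assumes "finite W" "r \<notin> W"
  shows "(\<Sum>B\<in>Pow (insert r W). f B) = (\<Sum>B\<in>Pow W. f B) + (\<Sum>B\<in>Pow W. f (insert r B))"
proof -
  have "(\<Sum>B\<in>Pow (insert r W). f B) = (\<Sum>B\<in>Pow W. f B) + (\<Sum>B\<in>insert r ` Pow W. f B)"
    unfolding Pow_insert by (rule sum.union_disjoint) (use assms in auto)
  also have "(\<Sum>B\<in>insert r ` Pow W. f B) = (\<Sum>B\<in>Pow W. f (insert r B))"
    by (rule sum.reindex_cong[of "insert r"]) (use assms in \<open>auto simp: inj_on_def\<close>)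
  finally show ?thesis .
qed

text \<open>Whether \<open>r\<close> enters or leaves the odd set, the sum changes by the terms of
  the subsets that contain \<open>r\<close>; in characteristic two both cases are one
  formula.\<close>

lemma sum_Pow_flip:
  fixes h :: "vertex set \<Rightarrow> bit"
  shows "(\<Sum>B\<in>Pow (odd_set (l + dirac r)). h B)
    = (\<Sum>B\<in>Pow (odd_set l). h B) + (\<Sum>B\<in>Pow (odd_set l). if r \<notin> B then h (insert r B) else 0)"
proof (cases "l r = 1")
  case True
  define W where "W = odd_set (l + dirac r)"
  have W: "odd_set l = insert r W" "r \<notin> W" using True by (auto simp: W_def odd_set_def dirac_def)
  have "(\<Sum>B\<in>Pow W. if r \<notin> B then h (insert r B) else 0) = (\<Sum>B\<in>Pow W. h (insert r B))"
    by (rule sum.cong) (use W(2) in auto)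
  then show ?thesis unfolding W(1) W_def[symmetric] sum_Pow_insert[OF finite W(2)] by simp
next
  case False
  then have W: "odd_set (l + dirac r) = insert r (odd_set l)" and r: "r \<notin> odd_set l"
    by (auto simp: odd_set_def dirac_def bit_not_one_iff)
  have "(\<Sum>B\<in>Pow (odd_set l). if r \<notin> B then h (insert r B) else 0) = (\<Sum>B\<in>Pow (odd_set l). h (insert r B))"
    by (rule sum.cong) (use r in auto)
  then show ?thesis unfolding W sum_Pow_insert[OF finite r] by simp
qed

text \<open>An edge has two faces, each with one flipped vertex. By \<open>sum_Pow_flip\<close> the
  unflipped sums cancel, and the two corrections are the Koszul terms of the source and the
  target.\<close>

lemma cobd_spread: "cobd (spread g) = spread (koszul g)"
proof
  fix x :: cell obtain m s where x: "x = (m, s)" by (cases x)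
  let ?U = "odd_set (label (m, s))"
  let ?f = "\<lambda>e B r. if (r = src e \<or> r = tgt e) \<and> m e > 0 then g (drop_edge m e, insert r B) else 0"
  have "cobd1 e (spread g) (m, s) = (\<Sum>B\<in>Pow ?U. \<Sum>r\<in>- B. ?f e B r)" for e
  proof (cases "m e > 0")
    case True
    let ?h = "\<lambda>B. g (drop_edge m e, B)"
    have *: "(\<Sum>r\<in>- B. ?f e B r) = (if src e \<notin> B then ?h (insert (src e) B) else 0)
        + (if tgt e \<notin> B then ?h (insert (tgt e) B) else 0)" for B
    proof -
      have "(\<Sum>r\<in>- B. ?f e B r) = (\<Sum>r\<in>- B. (if r = src e then ?h (insert (src e) B) else 0)
          + (if r = tgt e then ?h (insert (tgt e) B) else 0))"
        by (rule sum.cong) (use True src_neq_tgt[of e] in auto)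
      then show ?thesis by (simp add: sum.distrib)
    qed
    have "cobd1 e (spread g) (m, s) = spread g (drop_edge m e, s) + spread g (drop_edge m e, s + dirac e)"
      using True by (simp add: cobd1_def)
    also have "\<dots> = (\<Sum>B\<in>Pow ?U. if src e \<notin> B then ?h (insert (src e) B) else 0)
        + (\<Sum>B\<in>Pow ?U. if tgt e \<notin> B then ?h (insert (tgt e) B) else 0)"
      by (simp only: spread_def fst_conv label_drop_edge(1)[of m e s, OF True] label_drop_edge(2)[of m e s, OF True] sum_Pow_flip) (simp add: ac_simps)
    finally show ?thesis by (simp only: * sum.distrib)
  qed (simp add: cobd1_def)
  then have "cobd (spread g) x = (\<Sum>e\<in>UNIV. \<Sum>B\<in>Pow ?U. \<Sum>r\<in>- B. ?f e B r)" by (simp add: x cobd_def)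
  also have "\<dots> = (\<Sum>B\<in>Pow ?U. \<Sum>e\<in>UNIV. \<Sum>r\<in>- B. ?f e B r)" by (rule sum.swap)
  also have "\<dots> = (\<Sum>B\<in>Pow ?U. \<Sum>r\<in>- B. \<Sum>e\<in>UNIV. ?f e B r)" by (rule sum.cong[OF refl sum.swap])
  also have "\<dots> = spread (koszul g) x" unfolding x spread_def koszul_def incident_def fst_conv prod.case ..
  finally show "cobd (spread g) x = spread (koszul g) x" .
qed

lemma hom_incident: "add_hom (incident r)"
proof (rule add_homI, rule ext)
  fix \<phi> \<psi> :: "(edge \<Rightarrow> nat) \<Rightarrow> bit" and m
  show "incident r (\<phi> + \<psi>) m = (incident r \<phi> + incident r \<psi>) m"
    unfolding incident_def plus_fun_apply sum.distrib[symmetric] by (rule sum.cong) auto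
qed

lemma hom_koszul: "add_hom koszul"
proof (rule add_homI, rule ext)
  fix g g' :: "pair \<Rightarrow> bit" and p :: pair
  obtain m B where p: "p = (m, B)" by (cases p)
  have "incident r (\<lambda>m. (g + g') (m, insert r B)) m
      = incident r (\<lambda>m. g (m, insert r B)) m + incident r (\<lambda>m. g' (m, insert r B)) m" for r
    using add_hom_add[OF hom_incident, of r "\<lambda>m. g (m, insert r B)" "\<lambda>m. g' (m, insert r B)"]
    by (simp add: plus_fun_def)
  then show "koszul (g + g') p = (koszul g + koszul g') p" by (simp add: p koszul_def sum.distrib)
qed

lemma hom_spread: "add_hom spread"
  by (rule add_homI) (simp add: spread_def fun_eq_iff sum.distrib)

lemma incident_translate: "incident r (\<lambda>m. \<phi> (\<lambda>e. m (move q e))) m = incident (r + q) \<phi> (\<lambda>e. m (move q e))"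
proof -
  have eq: "drop_edge (\<lambda>f. m (move q f)) (move q e) = (\<lambda>f. drop_edge m e (move q f))" for e
  proof
    fix f
    have "move q f = e \<longleftrightarrow> f = move q e" by (metis move_0 move_move add_self)
    then show "drop_edge (\<lambda>f. m (move q f)) (move q e) f = drop_edge m e (move q f)"
      by (auto simp: drop_edge_def)
  qed
  then have "incident r (\<lambda>m. \<phi> (\<lambda>e. m (move q e))) m = (\<Sum>e\<in>UNIV.
      if (r + q = src (move q e) \<or> r + q = tgt (move q e)) \<and> m (move q (move q e)) > 0
      then \<phi> (drop_edge (\<lambda>f. m (move q f)) (move q e)) else 0)"
    by (simp only: incident_def eq src_move tgt_move move_move add_self move_0 add_right_cancel)
  also have "\<dots> = incident (r + q) \<phi> (\<lambda>e. m (move q e))"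
    unfolding incident_def by (rule sum.reindex_bij_betw[OF bij_move])
  finally show ?thesis .
qed

lemma koszul_translate: "koszul (\<lambda>p. g (translate q p)) = (\<lambda>p. koszul g (translate q p))"
proof
  fix p :: pair obtain m B where p: "p = (m, B)" by (cases p)
  have ins: "{r'. r' + q \<in> insert r B} = insert (r + q) {r'. r' + q \<in> B}" for r
  proof -
    have "r' + q = r \<longleftrightarrow> r' = r + q" for r' by (metis add_self_right)
    then show ?thesis by auto
  qed
  have "koszul g (translate q p)
      = (\<Sum>r\<in>- {r. r + q \<in> B}. incident r (\<lambda>m. g (m, insert r {r. r + q \<in> B})) (\<lambda>e. m (move q e)))"
    by (simp add: p koszul_def translate_def)
  also have "\<dots> = (\<Sum>r\<in>- B. incident (r + q) (\<lambda>m. g (m, insert (r + q) {r. r + q \<in> B})) (\<lambda>e. m (move q e)))"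
    by (rule sum.reindex_bij_witness[where i = "\<lambda>r. r + q" and j = "\<lambda>r. r + q"]) auto
  also have "\<dots> = koszul (\<lambda>p. g (translate q p)) p"
    unfolding p koszul_def prod.case translate_def ins incident_translate[symmetric] ..
  finally show "koszul (\<lambda>p. g (translate q p)) p = koszul g (translate q p)" ..
qed

lemma card_translate: "card {r. r + q \<in> B} = card (B :: vertex set)"
  by (rule bij_betw_same_card[of "\<lambda>r. r + q"], rule bij_betw_byWitness[where f' = "\<lambda>r. r + q"]) auto

lemma sum_move: "sum (\<lambda>e. m (move q e)) UNIV = sum m UNIV"
  by (rule sum.reindex_bij_betw[OF bij_move])

lemma translate_odd_pairs: "translate q p \<in> odd_pairs n \<longleftrightarrow> p \<in> odd_pairs n"
  by (cases p) (simp add: translate_def odd_pairs_def card_translate sum_move)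

lemma translate_translate [simp]: "translate q (translate q' p) = translate (q + q') p"
  by (cases p) (simp add: translate_def add.commute[of q'] add.assoc)

lemma translate_0 [simp]: "translate 0 p = p"
  by (cases p) (simp add: translate_def)

lemma koszul_nonzero:
  assumes "koszul g (m, B) \<noteq> 0"
  shows "\<exists>e r. r \<notin> B \<and> m e > 0 \<and> g (drop_edge m e, insert r B) \<noteq> 0"
proof -
  have "(\<Sum>r\<in>- B. incident r (\<lambda>m. g (m, insert r B)) m) \<noteq> 0" using assms by (simp add: koszul_def)
  from sum.not_neutral_contains_not_neutral[OF this]
  obtain r where r: "r \<in> - B" "incident r (\<lambda>m. g (m, insert r B)) m \<noteq> 0" .
  from sum.not_neutral_contains_not_neutral[OF r(2)[unfolded incident_def]]
  obtain e where e: "(if (r = src e \<or> r = tgt e) \<and> m e > 0 then g (drop_edge m e, insert r B) else 0) \<noteq> 0"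
    by blast
  then have "m e > 0" "g (drop_edge m e, insert r B) \<noteq> 0" by presburger+
  then show ?thesis using r(1) by blast
qed

lemma invariantD: "invariant g \<Longrightarrow> g (translate q p) = g p"
  unfolding invariant_def by blast

lemma invariant_koszul: assumes "invariant g" shows "invariant (koszul g)"
proof -
  have "(\<lambda>p. g (translate q p)) = g" for q using invariantD[OF assms] by blast
  then show ?thesis unfolding invariant_def by (metis koszul_translate)
qed

lemma koszul_koszul_chains:
  assumes "g \<in> koszul_chains n" shows "koszul g \<in> koszul_chains (Suc n)"
proof -
  have "(m, B) \<in> odd_pairs (Suc n)" if nz: "koszul g (m, B) \<noteq> 0" for m B
  proof -
    obtain e r where er: "r \<notin> B" "m e > 0" "g (drop_edge m e, insert r B) \<noteq> 0"
      using koszul_nonzero[OF nz] by blast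
    then have "(drop_edge m e, insert r B) \<in> odd_pairs n"
      using assms unfolding koszul_chains_def supported_def by blast
    then show ?thesis using er(1) by (simp add: odd_pairs_def sum_drop_edge[of m e, OF er(2), symmetric])
  qed
  then have "koszul g \<in> supported (odd_pairs (Suc n))" by (auto simp: supported_def)
  then show ?thesis using assms invariant_koszul by (simp add: koszul_chains_def)
qed

text \<open>Summation over subsets is triangular with ones on the diagonal; subsets of the wrong
  parity contribute 0.\<close>

lemma spread_inject:
  assumes g: "g \<in> koszul_chains n" and zero: "\<And>m T. (m, T) \<in> odd_pairs n \<Longrightarrow> (\<Sum>B\<in>Pow T. g (m, B)) = 0"
  shows "g = 0"
proof
  fix p :: pair obtain m T where p: "p = (m, T)" by (cases p)
  have "g (m, T) = 0"
  proof (induction "card T" arbitrary: T rule: less_induct)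
    case less
    show ?case
    proof (cases "(m, T) \<in> odd_pairs n")
      case True
      have "(\<Sum>B\<in>Pow T. g (m, B)) = g (m, T) + (\<Sum>B\<in>Pow T - {T}. g (m, B))"
        by (rule sum.remove) auto
      also have "(\<Sum>B\<in>Pow T - {T}. g (m, B)) = 0"
        proof (rule sum.neutral, rule ballI)
          fix B assume "B \<in> Pow T - {T}"
          then have "card B < card T" by (intro psubset_card_mono) auto
          then show "g (m, B) = 0" by (rule less)
        qed
      finally show ?thesis using zero[OF True] by simp
    next
      case False
      then show ?thesis using g by (auto simp: koszul_chains_def supported_def)
    qed
  qed
  then show "g p = 0 p" by (simp add: p)
qed

lemma finite_pairs: "finite (pairs i j)"
proof -
  have "pairs i j \<subseteq> {m. sum m UNIV = i} \<times> UNIV" by (auto simp: pairs_def)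
  moreover have "finite ({m :: edge \<Rightarrow> nat. sum m UNIV = i} \<times> (UNIV :: vertex set set))"
    by (intro finite_cartesian_product finite_multidegrees) simp
  ultimately show ?thesis by (rule finite_subset)
qed

lemma finite_odd_pairs: "finite (odd_pairs n)"
proof -
  have "odd_pairs n \<subseteq> {m. sum m UNIV = n} \<times> UNIV" by (auto simp: odd_pairs_def)
  moreover have "finite ({m :: edge \<Rightarrow> nat. sum m UNIV = n} \<times> (UNIV :: vertex set set))"
    by (intro finite_cartesian_product finite_multidegrees) simp
  ultimately show ?thesis by (rule finite_subset)
qed

lemma finite_koszul_chains: "finite (koszul_chains n)"
  by (rule finite_subset[OF _ finite_supported[OF finite_odd_pairs]]) (auto simp: koszul_chains_def)

lemma add_closed_invariant: "add_closed {g \<in> D. invariant g}" if "add_closed D"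
  using that by (auto simp: add_closed_def invariant_def)

lemma add_closed_koszul_chains: "add_closed (koszul_chains n)"
  unfolding koszul_chains_def by (rule add_closed_invariant[OF add_closed_supported])

lemma inj_spread: "inj_on spread (koszul_chains n)"
proof (rule inj_onI)
  fix g g' assume g: "g \<in> koszul_chains n" "g' \<in> koszul_chains n" and eq: "spread g = spread g'"
  have "g + g' = 0"
  proof (rule spread_inject)
    show "g + g' \<in> koszul_chains n" using g add_closed_add[OF add_closed_koszul_chains] by blast
    fix m T assume mT: "(m, T) \<in> odd_pairs n"
    obtain s where "odd_set (label (m, s)) = T" using label_surj[OF mT] by blast
    then have "(\<Sum>B\<in>Pow T. (g + g') (m, B)) = spread (g + g') (m, s)" by (simp add: spread_def)
    also have "\<dots> = 0" by (simp add: add_hom_add[OF hom_spread] eq)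
    finally show "(\<Sum>B\<in>Pow T. (g + g') (m, B)) = 0" .
  qed
  then show "g = g'" by (simp add: add_eq_0_iff_char_2)
qed

lemma spread_invariant_cochains:
  assumes g: "g \<in> koszul_chains n" shows "spread g \<in> invariant_cochains n"
proof -
  have "spread g (m, s) = 0" if "sum m UNIV \<noteq> n" for m s
    unfolding spread_def by (rule sum.neutral) (use g that in \<open>auto simp: koszul_chains_def supported_iff odd_pairs_def\<close>)
  moreover have "spread g (act v x) = spread g x" if v: "v \<in> carrier magnus" for v x
  proof -
    obtain q t m s where *: "v = (q, t)" "x = (m, s)" by (cases v; cases x)
    have "odd_set (label (act v x)) = {r. r + q \<in> odd_set (label x)}"
      using v by (simp add: * odd_set_def label_act)
    moreover have "fst (act v x) = (\<lambda>e. m (move q e))" by (simp add: * act_def)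
    ultimately have "spread g (act v x)
        = (\<Sum>B\<in>Pow {r. r + q \<in> odd_set (label x)}. g (\<lambda>e. m (move q e), B))" by (simp add: spread_def)
    also have "\<dots> = (\<Sum>B\<in>Pow (odd_set (label x)). g (translate q (m, B)))"
      by (rule sum.reindex_bij_witness[where i = "\<lambda>B. {r. r + q \<in> B}" and j = "\<lambda>B. {r. r + q \<in> B}"])
        (auto simp: translate_def)
    also have "\<dots> = spread g x" using g by (simp only: * koszul_chains_def mem_Collect_eq invariantD spread_def fst_conv)
    finally show ?thesis .
  qed
  ultimately show ?thesis by (auto simp: invariant_cochains_def supported_iff cells_def)
qed

lemma invariant_cochainsD:
  "\<phi> \<in> invariant_cochains n \<Longrightarrow> v \<in> carrier magnus \<Longrightarrow> \<phi> (act v x) = \<phi> x"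
  unfolding invariant_cochains_def by blast

text \<open>Surjectivity comes from injectivity: the subset sum is an injective map of the finite
  set of Koszul chains to itself, and the cochain is first rewritten as such a chain in terms of odd
  sets.\<close>

lemma spread_onto:
  assumes \<phi>: "\<phi> \<in> invariant_cochains n" shows "\<exists>g\<in>koszul_chains n. \<phi> = spread g"
proof -
  define \<Upsilon> where "\<Upsilon> g = (\<lambda>(m, T). if (m, T) \<in> odd_pairs n then \<Sum>B\<in>Pow T. g (m, B) else 0)"
    for g :: "pair \<Rightarrow> bit"
  have "\<Upsilon> ` koszul_chains n = koszul_chains n"
  proof (rule endo_inj_surj[OF finite_koszul_chains])
    show "\<Upsilon> ` koszul_chains n \<subseteq> koszul_chains n"
    proof (rule image_subsetI)
      fix g assume g: "g \<in> koszul_chains n"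
      have "\<Upsilon> g (translate q (m, T)) = \<Upsilon> g (m, T)" for q m T
      proof -
        have "(\<Sum>B\<in>Pow {r. r + q \<in> T}. g (\<lambda>e. m (move q e), B)) = (\<Sum>B\<in>Pow T. g (translate q (m, B)))"
          by (rule sum.reindex_bij_witness[where i = "\<lambda>B. {r. r + q \<in> B}" and j = "\<lambda>B. {r. r + q \<in> B}"])
            (auto simp: translate_def)
        also have "\<dots> = (\<Sum>B\<in>Pow T. g (m, B))" using g by (simp only: koszul_chains_def mem_Collect_eq invariantD)
        finally show ?thesis using translate_odd_pairs[of q "(m, T)" n] by (simp add: \<Upsilon>_def translate_def)
      qed
      then show "\<Upsilon> g \<in> koszul_chains n"
        by (auto simp: koszul_chains_def invariant_def supported_iff) (simp add: \<Upsilon>_def)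
    qed
    show "inj_on \<Upsilon> (koszul_chains n)"
    proof (rule inj_onI)
      fix g g' assume g: "g \<in> koszul_chains n" "g' \<in> koszul_chains n" and eq: "\<Upsilon> g = \<Upsilon> g'"
      have "g + g' = 0"
      proof (rule spread_inject)
        show "g + g' \<in> koszul_chains n" using g add_closed_add[OF add_closed_koszul_chains] by blast
        fix m T assume "(m, T) \<in> odd_pairs n"
        then show "(\<Sum>B\<in>Pow T. (g + g') (m, B)) = 0"
          using fun_cong[OF eq, of "(m, T)"] by (simp add: \<Upsilon>_def sum.distrib)
      qed
      then show "g = g'" by (simp add: add_eq_0_iff_char_2)
    qed
  qed
  \<comment> \<open>Cells with equal \<open>m\<close> and equal odd set differ by a cycle, hence by
    an element \<open>(0, t)\<close> of the group, so \<phi> depends only on the pair.\<close>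
  define f where "f = (\<lambda>(m, T). if (m, T) \<in> odd_pairs n then \<phi> (m, SOME s. odd_set (label (m, s)) = T) else 0)"
  have \<phi>f: "\<phi> (m, s) = f (m, odd_set (label (m, s)))" if "sum m UNIV = n" for m s
  proof -
    let ?T = "odd_set (label (m, s))"
    define s' where "s' = (SOME s. odd_set (label (m, s)) = ?T)"
    have "odd_set (label (m, s')) = ?T" unfolding s'_def by (rule someI[of "\<lambda>s'. odd_set (label (m, s')) = ?T" s]) simp
    then have iff: "label (m, s') r = 1 \<longleftrightarrow> label (m, s) r = 1" for r
      unfolding odd_set_def set_eq_iff mem_Collect_eq by blast
    have eq: "label (m, s') r = label (m, s) r" for r
      using iff[of r] by (cases "label (m, s) r"; cases "label (m, s') r") simp_all
    have "bd s' r = bd s r" for r using eq[of r] by (simp add: label_def)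
    then have "bd (s' + s) = 0" by (simp add: fun_eq_iff add_hom_add[OF hom_bd])
    then have "(0, s' + s) \<in> carrier magnus" by (simp add: magnus_sel)
    from invariant_cochainsD[OF \<phi> this, of "(m, s)"]
    have "\<phi> (m, s') = \<phi> (m, s)" by (simp add: act_def fun_eq_iff)
    moreover have "f (m, ?T) = \<phi> (m, s')" using odd_set_label[of m s] that by (simp add: f_def s'_def)
    ultimately show ?thesis by simp
  qed
  have "f \<in> koszul_chains n"
  proof -
    have "f (translate q (m, T)) = f (m, T)" for q m T
    proof (cases "(m, T) \<in> odd_pairs n")
      case True
      then have m: "sum m UNIV = n" by (simp add: odd_pairs_def)
      obtain s where s: "odd_set (label (m, s)) = T" using label_surj[OF True] by blast
      let ?v = "(q, tree_path q)"
      have v: "?v \<in> carrier magnus"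
        using magnus_map_carrier[of "transversal q"] by (simp add: magnus_transversal)
      obtain s' where a: "act ?v (m, s) = (\<lambda>e. m (move q e), s')" by (simp add: act_def)
      have T: "odd_set (label (act ?v (m, s))) = {r. r + q \<in> T}"
        using v by (auto simp: s[symmetric] odd_set_def label_act)
      have "f (translate q (m, T)) = f (\<lambda>e. m (move q e), odd_set (label (\<lambda>e. m (move q e), s')))"
        using T by (simp add: translate_def a)
      also have "\<dots> = \<phi> (act ?v (m, s))"
        unfolding a by (rule \<phi>f[symmetric]) (simp add: sum_move m)
      also have "\<dots> = \<phi> (m, s)" by (rule invariant_cochainsD[OF \<phi> v])
      also have "\<dots> = f (m, T)" using \<phi>f[OF m, of s] s by simp
      finally show ?thesis .
    next
      case False
      then show ?thesis using translate_odd_pairs[of q "(m, T)" n] by (simp add: f_def translate_def)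
    qed
    then show ?thesis by (auto simp: koszul_chains_def invariant_def supported_iff) (simp add: f_def)
  qed
  then obtain g where g: "g \<in> koszul_chains n" "f = \<Upsilon> g" using \<open>\<Upsilon> ` koszul_chains n = _\<close> by blast
  have "\<phi> (m, s) = spread g (m, s)" for m s
  proof (cases "sum m UNIV = n")
    case True
    then show ?thesis using \<phi>f[OF True, of s] odd_set_label[of m s]
      by (simp add: g(2) \<Upsilon>_def spread_def)
  next
    case False
    then have "\<phi> (m, s) = 0" "spread g (m, s) = 0"
      using \<phi> spread_invariant_cochains[OF g(1)] by (auto simp: invariant_cochains_def supported_iff cells_def)
    then show ?thesis by simp
  qed
  then show ?thesis using g(1) by (intro bexI[of _ g]) auto
qed

lemma spread_image: "spread ` koszul_chains n = invariant_cochains n"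
  using spread_onto spread_invariant_cochains by blast

lemma cohomology_dim_koszul:
  assumes "card {g \<in> koszul_chains (Suc n). koszul g = 0} = 2 ^ d * card (koszul ` koszul_chains n)"
  shows "cohomology_dim TYPE(bit) (V_group 2) (Suc n) = d"
proof (rule cohomology_dim_V)
  have "cobd ` invariant_cochains n = spread ` koszul ` koszul_chains n"
    unfolding spread_image[symmetric] by (simp add: image_image cobd_spread)
  moreover have "koszul ` koszul_chains n \<subseteq> koszul_chains (Suc n)" using koszul_koszul_chains by blast
  ultimately have 1: "card (cobd ` invariant_cochains n) = card (koszul ` koszul_chains n)"
    by (simp add: card_image inj_on_subset[OF inj_spread])
  have "cobd (spread g) = 0 \<longleftrightarrow> koszul g = 0" if "g \<in> koszul_chains (Suc n)" for g
  proof -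
    have "cobd (spread g) = 0 \<longleftrightarrow> spread (koszul g) = spread 0"
      by (simp add: cobd_spread add_hom_0[OF hom_spread])
    then show ?thesis
      using inj_onD[OF inj_spread, of "koszul g" 0] koszul_koszul_chains[OF that]
        add_closed_0[OF add_closed_koszul_chains] by auto
  qed
  then have "{\<phi> \<in> invariant_cochains (Suc n). cobd \<phi> = 0} = spread ` {g \<in> koszul_chains (Suc n). koszul g = 0}"
    unfolding spread_image[symmetric] by auto
  then have 2: "card {\<phi> \<in> invariant_cochains (Suc n). cobd \<phi> = 0} = card {g \<in> koszul_chains (Suc n). koszul g = 0}"
    using card_image[OF inj_on_subset[OF inj_spread[of "Suc n"]], of "{g \<in> koszul_chains (Suc n). koszul g = 0}"]
    by auto
  show "card {\<phi> \<in> invariant_cochains (Suc n). cobd \<phi> = 0} = 2 ^ d * card (cobd ` invariant_cochains n)"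
    using assms by (simp add: 1 2)
qed

declare split_paired_All [simp del] split_paired_Ex [simp del]

subsection \<open>Fixed points of an involution on an exact sequence\<close>

text \<open>Exactness of \<open>0 \<rightarrow> A \<rightarrow> B \<rightarrow> C \<rightarrow> Z
  \<rightarrow> H \<rightarrow> 0\<close>, where \<open>Z\<close> is meant to be the cycles in the
  next term, so that \<open>H\<close> is a homology group.\<close>

definition exact_sequence ::
  "'a :: char_2 set \<Rightarrow> 'a set \<Rightarrow> 'a set \<Rightarrow> 'a set \<Rightarrow> 'b :: char_2 set \<Rightarrow> ('a \<Rightarrow> 'a) \<Rightarrow> ('a \<Rightarrow> 'b) \<Rightarrow> bool" where
  "exact_sequence A B C Z H d p \<longleftrightarrow> (\<forall>a\<in>A. d a = 0 \<longrightarrow> a = 0) \<and> {b \<in> B. d b = 0} = d ` A \<and>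
     {c \<in> C. d c = 0} = d ` B \<and> d ` C \<subseteq> Z \<and> {z \<in> Z. p z = 0} = d ` C \<and> p ` Z = H"

text \<open>The form in which freeness under an involution is used: every fixed element is a
  norm.\<close>

definition free_under :: "('a :: char_2 \<Rightarrow> 'a) \<Rightarrow> 'a set \<Rightarrow> bool" where
  "free_under t D \<longleftrightarrow> {d \<in> D. t d = d} \<subseteq> (\<lambda>d. d + t d) ` D"

text \<open>Fixed elements are lifted by correction: for a preimage \<open>x\<close> of a fixed
  element, \<open>x + t x\<close> comes from the term to the left, from an element that may be taken
  fixed and is thus a norm \<open>y + t y\<close>; then \<open>x + d y\<close> is a fixed
  preimage.\<close>

lemma exact_sequence_fixed:
  assumes ex: "exact_sequence A B C Z H d p"
    and closed: "add_closed A" "add_closed B" "add_closed C" "add_closed Z"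
    and hom: "add_hom d" "add_hom p" "add_hom t"
    and t: "\<And>x. t (t x) = x" "t ` A \<subseteq> A" "t ` B \<subseteq> B" "t ` C \<subseteq> C" "t ` Z \<subseteq> Z"
    and dt: "\<And>x. d (t x) = t (d x)" and pt: "\<And>z. z \<in> Z \<Longrightarrow> p (t z) = u (p z)"
    and free: "free_under t A" "free_under t B" "free_under t C"
  shows "exact_sequence {x \<in> A. t x = x} {x \<in> B. t x = x} {x \<in> C. t x = x} {x \<in> Z. t x = x}
    {x \<in> H. u x = x} d p"
proof -
  have A: "a = 0" if "a \<in> A" "d a = 0" for a using that ex by (auto simp: exact_sequence_def)
  have B: "\<exists>a\<in>A. b = d a" if "b \<in> B" "d b = 0" for b using that ex by (auto simp: exact_sequence_def)
  have C: "\<exists>b\<in>B. c = d b" if "c \<in> C" "d c = 0" for c using that ex by (auto simp: exact_sequence_def)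
  have Z: "\<exists>c\<in>C. z = d c" if "z \<in> Z" "p z = 0" for z using that ex by (auto simp: exact_sequence_def)
  have H: "\<exists>z\<in>Z. h = p z" if "h \<in> H" for h using that ex by (auto simp: exact_sequence_def)
  have dA: "d a \<in> B" "d (d a) = 0" if "a \<in> A" for a using that ex by (auto simp: exact_sequence_def)
  have dB: "d b \<in> C" "d (d b) = 0" if "b \<in> B" for b using that ex by (auto simp: exact_sequence_def)
  have dC: "d c \<in> Z" "p (d c) = 0" if "c \<in> C" for c using that ex by (auto simp: exact_sequence_def)
  have pZ: "p z \<in> H" if "z \<in> Z" for z using that ex by (auto simp: exact_sequence_def)
  note add = hom[THEN add_hom_add] and zero = hom[THEN add_hom_0]
  have tx: "t x \<in> A" if "x \<in> A" for x using that t by auto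
  have tB: "t x \<in> B" if "x \<in> B" for x using that t by auto
  have tC: "t x \<in> C" if "x \<in> C" for x using that t by auto
  have tZ: "t x \<in> Z" if "x \<in> Z" for x using that t by auto
  have fA: "\<exists>x'\<in>A. x = x' + t x'" if "x \<in> A" "t x = x" for x using that free by (auto simp: free_under_def)
  have fB: "\<exists>x'\<in>B. x = x' + t x'" if "x \<in> B" "t x = x" for x using that free by (auto simp: free_under_def)
  have fC: "\<exists>x'\<in>C. x = x' + t x'" if "x \<in> C" "t x = x" for x using that free by (auto simp: free_under_def)
  have inv_A: "t a = a" if "a \<in> A" "t (d a) = d a" for a
  proof -
    have "d (a + t a) = 0" using that by (simp add: add dt)
    then have "a + t a = 0" using A[of "a + t a"] that tx closed add_closed_add by blast
    then show ?thesis by (simp add: add_eq_0_iff_char_2)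
  qed
  have lift_B: "\<exists>b'\<in>B. t b' = b' \<and> d b' = d b" if b: "b \<in> B" "t (d b) = d b" for b
  proof -
    have "d (b + t b) = 0" using b by (simp add: add dt)
    then obtain a where a: "a \<in> A" "b + t b = d a"
      using B[of "b + t b"] b tB closed add_closed_add by blast
    have "t (d a) = d a" unfolding a(2)[symmetric] by (simp add: add t(1) add.commute)
    then obtain a' where a': "a' \<in> A" "a = a' + t a'" using fA[OF a(1)] inv_A[OF a(1)] by blast
    have "d a' \<in> B" "d (d a') = 0" using dA a' by auto
    moreover have "b + t b = d a' + t (d a')" using a(2) by (simp add: a'(2) add dt)
    then have "t (b + d a') = b + d a'" by (simp add: add) (metis add_self_left add.commute add.left_commute)
    ultimately show ?thesis using b(1) closed(2) add_closed_add
      by (intro bexI[of _ "b + d a'"]) (auto simp: add)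
  qed
  have lift_C: "\<exists>c'\<in>C. t c' = c' \<and> d c' = d c" if c: "c \<in> C" "t (d c) = d c" for c
  proof -
    have "d (c + t c) = 0" using c by (simp add: add dt)
    then obtain b where b: "b \<in> B" "c + t c = d b"
      using C[of "c + t c"] c tC closed add_closed_add by blast
    have "t (d b) = d b" unfolding b(2)[symmetric] by (simp add: add t(1) add.commute)
    then obtain b1 where b1: "b1 \<in> B" "t b1 = b1" "d b1 = d b" using lift_B[OF b(1)] by blast
    then obtain b' where b': "b' \<in> B" "b1 = b' + t b'" using fB by blast
    have "d b' \<in> C" "d (d b') = 0" using dB b' by auto
    moreover have "c + t c = d b' + t (d b')" using b(2) b1(3) by (simp add: b'(2) add dt)
    then have "t (c + d b') = c + d b'" by (simp add: add) (metis add_self_left add.commute add.left_commute)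
    ultimately show ?thesis using c(1) closed(3) add_closed_add
      by (intro bexI[of _ "c + d b'"]) (auto simp: add)
  qed
  have lift_Z: "\<exists>z'\<in>Z. t z' = z' \<and> p z' = p z" if z: "z \<in> Z" "u (p z) = p z" for z
  proof -
    have "p (z + t z) = 0" using z by (simp add: add pt)
    then obtain c where c: "c \<in> C" "z + t z = d c"
      using Z[of "z + t z"] z tZ closed add_closed_add by blast
    have "t (d c) = d c" unfolding c(2)[symmetric] by (simp add: add t(1) add.commute)
    then obtain c1 where c1: "c1 \<in> C" "t c1 = c1" "d c1 = d c" using lift_C[OF c(1)] by blast
    then obtain c' where c': "c' \<in> C" "c1 = c' + t c'" using fC by blast
    have "d c' \<in> Z" "p (d c') = 0" using dC c' by auto
    moreover have "z + t z = d c' + t (d c')" using c(2) c1(3) by (simp add: c'(2) add dt)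
    then have "t (z + d c') = z + d c'" by (simp add: add) (metis add_self_left add.commute add.left_commute)
    ultimately show ?thesis using z(1) closed(4) add_closed_add
      by (intro bexI[of _ "z + d c'"]) (auto simp: add)
  qed
  show ?thesis unfolding exact_sequence_def
  proof (intro conjI equalityI subsetI ballI impI)
    fix a assume "a \<in> {x \<in> A. t x = x}" "d a = 0"
    then show "a = 0" using A by blast
  next
    fix b assume b: "b \<in> {b \<in> {x \<in> B. t x = x}. d b = 0}"
    then obtain a where "a \<in> A" "b = d a" using B by blast
    then show "b \<in> d ` {x \<in> A. t x = x}" using inv_A b by blast
  next
    fix b assume "b \<in> d ` {x \<in> A. t x = x}"
    then show "b \<in> {b \<in> {x \<in> B. t x = x}. d b = 0}" using dA by (auto simp: dt[symmetric])
  next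
    fix c assume c: "c \<in> {c \<in> {x \<in> C. t x = x}. d c = 0}"
    then obtain b where b: "b \<in> B" "c = d b" using C by blast
    then obtain b' where "b' \<in> B" "t b' = b'" "d b' = d b" using lift_B[of b] c by blast
    then show "c \<in> d ` {x \<in> B. t x = x}" unfolding b(2) by (metis (mono_tags, lifting) image_eqI mem_Collect_eq)
  next
    fix c assume "c \<in> d ` {x \<in> B. t x = x}"
    then show "c \<in> {c \<in> {x \<in> C. t x = x}. d c = 0}" using dB by (auto simp: dt[symmetric])
  next
    fix z assume "z \<in> d ` {x \<in> C. t x = x}"
    then show "z \<in> {x \<in> Z. t x = x}" using dC by (auto simp: dt[symmetric])
  next
    fix z assume z: "z \<in> {z \<in> {x \<in> Z. t x = x}. p z = 0}"
    then obtain c where c: "c \<in> C" "z = d c" using Z by blast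
    then obtain c' where "c' \<in> C" "t c' = c'" "d c' = d c" using lift_C[of c] z by blast
    then show "z \<in> d ` {x \<in> C. t x = x}" unfolding c(2) by (metis (mono_tags, lifting) image_eqI mem_Collect_eq)
  next
    fix z assume "z \<in> d ` {x \<in> C. t x = x}"
    then show "z \<in> {z \<in> {x \<in> Z. t x = x}. p z = 0}" using dC by (auto simp: dt[symmetric])
  next
    fix h assume "h \<in> p ` {x \<in> Z. t x = x}"
    then show "h \<in> {x \<in> H. u x = x}" using pZ by (auto simp: pt[symmetric])
  next
    fix h assume h: "h \<in> {x \<in> H. u x = x}"
    then obtain z where z: "z \<in> Z" "h = p z" using H by blast
    then obtain z' where "z' \<in> Z" "t z' = z'" "p z' = p z" using lift_Z[of z] h by blast
    then show "h \<in> p ` {x \<in> Z. t x = x}" unfolding z(2) by (metis (mono_tags, lifting) image_eqI mem_Collect_eq)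
  qed
qed

text \<open>The fixed elements are both the kernel and the image of
  \<open>d \<mapsto> d + t d\<close>.\<close>

lemma card_fixed_square:
  assumes "finite D" "add_closed D" "add_hom t" "\<And>x. t (t x) = x" "t ` D \<subseteq> D" "free_under t D"
  shows "card D = card {d \<in> D. t d = d} ^ 2"
proof -
  have hom: "add_hom (\<lambda>d. d + t d)"
    using add_hom_add[OF assms(3)] by (auto intro!: add_homI simp: ac_simps)
  have "(\<lambda>d. d + t d) ` D = {d \<in> D. t d = d}"
    using assms by (auto simp: free_under_def add_hom_add add.commute intro: add_closed_add)
  moreover have "{d \<in> D. d + t d = 0} = {d \<in> D. t d = d}" by (auto simp: add_eq_0_iff_char_2)
  ultimately show ?thesis using card_eq_image_kernel[OF assms(1,2) hom] by (simp add: power2_eq_square)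
qed

subsection \<open>The action on Koszul chains of odd degree\<close>

text \<open>\<open>N\<close> is the total degree, each exterior generator counting 1; the Koszul
  differential preserves \<open>N\<close> and lowers \<open>j\<close>.\<close>

definition layer_pairs :: "nat \<Rightarrow> nat \<Rightarrow> pair set" where
  "layer_pairs N j = {(m, B). sum m UNIV + card B = N \<and> card B = j}"

definition layer :: "nat \<Rightarrow> nat \<Rightarrow> (pair \<Rightarrow> bit) set" where
  "layer N j = supported (layer_pairs N j)"

definition shift :: "vertex \<Rightarrow> (pair \<Rightarrow> bit) \<Rightarrow> pair \<Rightarrow> bit" where
  "shift q g = (\<lambda>p. g (translate q p))"

lemma translate_layer_pairs: "translate q p \<in> layer_pairs N j \<longleftrightarrow> p \<in> layer_pairs N j"
  by (cases p) (simp add: translate_def layer_pairs_def card_translate sum_move)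

lemma finite_layer_pairs: "finite (layer_pairs N j)"
proof (rule finite_subset)
  show "layer_pairs N j \<subseteq> pairs (N - j) j" by (auto simp: layer_pairs_def pairs_def)
qed (rule finite_pairs)

lemma finite_layer: "finite (layer N j)"
  unfolding layer_def by (rule finite_supported[OF finite_layer_pairs])

lemma add_closed_layer: "add_closed (layer N j)"
  unfolding layer_def by (rule add_closed_supported)

lemma hom_shift: "add_hom (shift q)"
  by (rule add_homI) (simp add: shift_def fun_eq_iff)

lemma shift_shift: "shift q (shift q' g) = shift (q + q') g"
  by (simp add: shift_def add.commute)

lemma shift_0: "shift 0 g = g"
  by (simp add: shift_def)

lemma shift_layer: "g \<in> layer N j \<Longrightarrow> shift q g \<in> layer N j"
  by (simp add: layer_def supported_iff shift_def translate_layer_pairs)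

lemma koszul_shift: "koszul (shift q g) = shift q (koszul g)"
  unfolding shift_def by (rule koszul_translate)

lemma invariant_iff_shift: "invariant g \<longleftrightarrow> shift (1, 0) g = g \<and> shift (0, 1) g = g"
proof
  assume "invariant g"
  then show "shift (1, 0) g = g \<and> shift (0, 1) g = g" by (simp only: shift_def invariantD)
next
  assume *: "shift (1, 0) g = g \<and> shift (0, 1) g = g"
  then have "shift ((1, 0) + (0, 1)) g = g" unfolding shift_shift[symmetric] by simp
  then have "shift (1, 1) g = g" by simp
  with * shift_0[of g] have "shift q g = g" for q
    by (cases q; cases "fst q"; cases "snd q") (auto simp: zero_prod_def)
  then show "invariant g" unfolding invariant_def shift_def by metis
qed

text \<open>A nonzero translation pairs off the edges and the vertices, so an invariant exponent
  vector and an invariant set both have even size.\<close>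

lemma translate_free:
  assumes N: "odd N" and p: "p \<in> layer_pairs N j" and fixed: "translate q p = p" shows "q = 0"
proof (rule ccontr)
  assume q: "q \<noteq> 0"
  obtain m B where mB: "p = (m, B)" by (cases p)
  have m: "m (move q e) = m e" for e using fixed by (simp add: mB translate_def) metis
  have B: "r + q \<in> B \<longleftrightarrow> r \<in> B" for r using fixed by (simp add: mB translate_def) blast
  have "(\<Sum>r\<in>UNIV. of_nat (m (r, i)) :: bit) = 0" for i
    using sum_translation_invariant[OF q, of "\<lambda>r. of_nat (m (r, i)) :: bit"] m[of "(_, i)"]
    by (simp add: move_def)
  moreover have "(\<Sum>e\<in>UNIV. of_nat (m e) :: bit) = (\<Sum>r\<in>UNIV. \<Sum>i\<in>UNIV. of_nat (m (r, i)))"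
    unfolding sum.cartesian_product by simp
  ultimately have 1: "(of_nat (sum m UNIV) :: bit) = 0"
    by (simp add: sum.swap[of _ "UNIV :: bool set"])
  have "(\<Sum>r\<in>UNIV. if r \<in> B then 1 else 0 :: bit) = 0"
    by (rule sum_translation_invariant[OF q]) (simp add: B)
  then have "(of_nat (card B) :: bit) = 0" by (simp add: sum.If_cases)
  with 1 have "(of_nat N :: bit) = 0" using p by (auto simp: mB layer_pairs_def)
  then show False using N by (simp add: of_nat_bit_eq_0_iff)
qed

text \<open>A representative in each orbit gives every pair a position in \<open>Q\<close>, unique
  by \<open>translate_free\<close>.\<close>

lemma coordinates:
  assumes N: "odd N"
  shows "\<exists>c :: pair \<Rightarrow> vertex. \<forall>p\<in>layer_pairs N j. \<forall>q. c (translate q p) = c p + q"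
proof -
  define r where "r p = (SOME p'. \<exists>q. p' = translate q p)" for p :: pair
  define c where "c p = (SOME q. p = translate q (r p))" for p
  have r: "\<exists>q. r p = translate q p" for p unfolding r_def by (rule someI[of _ p]) (metis translate_0)
  have r_eq: "r (translate q p) = r p" for p q
  proof -
    have "(\<exists>q'. p' = translate q' (translate q p)) \<longleftrightarrow> (\<exists>q'. p' = translate q' p)" for p'
    proof
      assume "\<exists>q'. p' = translate q' p"
      then obtain q' where "p' = translate q' p" ..
      then have "p' = translate (q' + q) (translate q p)" by simp
      then show "\<exists>q'. p' = translate q' (translate q p)" ..
    next
      assume "\<exists>q'. p' = translate q' (translate q p)"
      then obtain q' where "p' = translate q' (translate q p)" ..
      then have "p' = translate (q' + q) p" by simp
      then show "\<exists>q'. p' = translate q' p" ..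
    qed
    then show ?thesis by (simp only: r_def)
  qed
  have c: "p = translate (c p) (r p)" for p
  proof -
    obtain q where "r p = translate q p" using r by blast
    then have "p = translate q (r p)" by simp
    then show ?thesis unfolding c_def by (rule someI)
  qed
  have "c (translate q p) = c p + q" if p: "p \<in> layer_pairs N j" for p q
  proof -
    have "translate q p = translate (c (translate q p)) (r p)" using c[of "translate q p"] by (simp only: r_eq)
    then have "translate (c p) (translate q p) = translate (c p) (translate (c (translate q p)) (r p))" by simp
    then have "translate (c p + q) p = translate (c (translate q p)) (translate (c p) (r p))"
      by (simp add: add.commute)
    also have "\<dots> = translate (c (translate q p)) p" by (simp only: c[symmetric])
    finally have "translate (c (translate q p)) (translate (c p + q) p)
        = translate (c (translate q p)) (translate (c (translate q p)) p)" by simp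
    then have "translate (c (translate q p) + (c p + q)) p = p" by simp
    from translate_free[OF N p this] show ?thesis by (simp add: add_eq_0_iff_char_2)
  qed
  then show ?thesis by blast
qed

text \<open>A fixed function is the norm of its restriction to the pairs where one coordinate of the
  position is 1. Cutting by the second coordinate preserves invariance under \<open>(1, 0)\<close>,
  so the two involutions can be treated in succession.\<close>

lemma free_layer:
  assumes N: "odd N"
  shows "free_under (shift (1, 0)) (layer N j)"
    "free_under (shift (0, 1)) {g \<in> layer N j. shift (1, 0) g = g}"
proof -
  obtain c where c: "\<And>p q. p \<in> layer_pairs N j \<Longrightarrow> c (translate q p) = c p + (q :: vertex)"
    using coordinates[OF N] by blast
  \<comment> \<open>\<open>pr\<close> selects the coordinate by which \<open>g\<close> is cut;
    translations with \<open>pr q' = 0\<close> preserve the cut.\<close>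
  have half: "\<exists>f\<in>layer N j. g = f + shift q f \<and> (\<forall>q'. pr q' = 0 \<longrightarrow> shift q' g = g \<longrightarrow> shift q' f = f)"
    if g: "g \<in> layer N j" "shift q g = g" and pr: "\<And>v w. pr (v + w) = pr v + pr w" "pr q = (1 :: bit)"
    for pr :: "vertex \<Rightarrow> bit" and g q
  proof (intro bexI conjI allI impI)
    define f where "f = (\<lambda>p. if p \<in> layer_pairs N j \<and> pr (c p) = 1 then g p else 0)"
    have inv: "g (translate q' p) = g p" if "shift q' g = g" for p q'
      using fun_cong[OF that, of p] by (simp add: shift_def)
    show "f \<in> layer N j" by (simp add: layer_def supported_iff f_def)
    show "g = f + shift q f"
    proof
      fix p show "g p = (f + shift q f) p"
      proof (cases "p \<in> layer_pairs N j")
        case True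
        then show ?thesis using inv[OF g(2), of p] c[OF True, of q] pr
          by (cases "pr (c p)") (simp_all add: f_def shift_def translate_layer_pairs)
      next
        case False
        then show ?thesis using g(1) by (simp add: f_def shift_def translate_layer_pairs layer_def supported_iff)
      qed
    qed
    fix q' assume q': "pr q' = 0" "shift q' g = g"
    show "shift q' f = f"
    proof
      fix p show "shift q' f p = f p"
        using inv[OF q'(2), of p] c[of p q'] pr(1)[of "c p" q'] q'(1)
        by (cases "p \<in> layer_pairs N j") (simp_all add: f_def shift_def translate_layer_pairs)
    qed
  qed
  show "free_under (shift (1, 0)) (layer N j)"
    unfolding free_under_def using half[of _ "(1, 0)" fst] by fastforce
  show "free_under (shift (0, 1)) {g \<in> layer N j. shift (1, 0) g = g}"
    unfolding free_under_def
  proof (rule subsetI)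
    fix g assume g: "g \<in> {d \<in> {g \<in> layer N j. shift (1, 0) g = g}. shift (0, 1) d = d}"
    then obtain f where f: "f \<in> layer N j" "g = f + shift (0, 1) f"
      "\<forall>q'. snd q' = 0 \<longrightarrow> shift q' g = g \<longrightarrow> shift q' f = f"
      using half[of g "(0, 1)" snd] by auto
    then have "shift (1, 0) f = f" using g by auto
    with f show "g \<in> (\<lambda>d. d + shift (0, 1) d) ` {g \<in> layer N j. shift (1, 0) g = g}" by blast
  qed
qed

definition inv_layer :: "nat \<Rightarrow> nat \<Rightarrow> (pair \<Rightarrow> bit) set" where
  "inv_layer N j = {g \<in> layer N j. invariant g}"

lemma inv_layer_eq: "inv_layer N j = {g \<in> {g \<in> layer N j. shift (1, 0) g = g}. shift (0, 1) g = g}"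
  by (auto simp: inv_layer_def invariant_iff_shift)

lemma finite_inv_layer: "finite (inv_layer N j)"
  using finite_layer by (simp add: inv_layer_def)

lemma add_closed_inv_layer: "add_closed (inv_layer N j)"
  unfolding inv_layer_def by (rule add_closed_invariant[OF add_closed_layer])

lemma add_closed_fixed: "add_closed D \<Longrightarrow> add_hom t \<Longrightarrow> add_closed {g \<in> D. t g = g}"
  by (auto simp: add_closed_def add_hom_add add_hom_0)

text \<open>Each of the two free involutions takes a square root. The fourth power avoids dividing
  the exponent by 4.\<close>

lemma card_inv_layer:
  assumes N: "odd N" shows "card (inv_layer N j) ^ 4 = 2 ^ card (layer_pairs N j)"
proof -
  let ?D = "{g \<in> layer N j. shift (1, 0) g = g}"
  have inv: "shift q (shift q g) = g" for q g by (simp add: shift_shift shift_0)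
  have comm: "shift q (shift q' g) = shift q' (shift q g)" for q q' g by (simp add: shift_shift add.commute)
  have "card (layer N j) = card ?D ^ 2"
    by (rule card_fixed_square[OF finite_layer add_closed_layer hom_shift inv _ free_layer(1)[OF N]])
      (auto intro: shift_layer)
  moreover have "card ?D = card (inv_layer N j) ^ 2"
    unfolding inv_layer_eq
    by (rule card_fixed_square[OF _ add_closed_fixed[OF add_closed_layer hom_shift] hom_shift inv _ free_layer(2)[OF N]])
      (use finite_layer in \<open>auto intro: shift_layer simp: comm[of "(1, 0)"]\<close>)
  ultimately show ?thesis
    using card_supported[OF finite_layer_pairs, of N j] by (simp add: layer_def power_mult[symmetric])
qed

subsection \<open>Cohomology from the Koszul complex\<close>

lemma koszul_layer:
  assumes "g \<in> layer N (Suc j)" shows "koszul g \<in> layer N j"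
proof -
  have "(m, B) \<in> layer_pairs N j" if nz: "koszul g (m, B) \<noteq> 0" for m B
  proof -
    obtain e r where er: "r \<notin> B" "m e > 0" "g (drop_edge m e, insert r B) \<noteq> 0"
      using koszul_nonzero[OF nz] by blast
    then have "(drop_edge m e, insert r B) \<in> layer_pairs N (Suc j)"
      using assms unfolding layer_def supported_def by blast
    then show ?thesis using er(1) sum_drop_edge[of m e, OF er(2)] by (simp add: layer_pairs_def)
  qed
  then show ?thesis by (auto simp: layer_def supported_def)
qed

lemma koszul_inv_layer: "g \<in> inv_layer N (Suc j) \<Longrightarrow> koszul g \<in> inv_layer N j"
  by (simp add: inv_layer_def koszul_layer invariant_koszul)

definition part :: "nat \<Rightarrow> (pair \<Rightarrow> bit) \<Rightarrow> pair \<Rightarrow> bit" where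
  "part j g = (\<lambda>p. if card (snd p) = j then g p else 0)"

lemma hom_part: "add_hom (part j)"
  by (rule add_homI) (simp add: part_def fun_eq_iff)

lemma koszul_part: "koszul (part (Suc j) g) = part j (koszul g)"
proof
  fix p :: pair obtain m B where p: "p = (m, B)" by (cases p)
  have "incident r (\<lambda>m. part (Suc j) g (m, insert r B)) m
      = (if card B = j then incident r (\<lambda>m. g (m, insert r B)) m else 0)" if "r \<in> - B" for r
    using that by (simp add: part_def incident_def cong: if_cong)
  then have "koszul (part (Suc j) g) p
      = (\<Sum>r\<in>- B. if card B = j then incident r (\<lambda>m. g (m, insert r B)) m else 0)"
    unfolding p koszul_def prod.case by (rule sum.cong[OF refl])
  then show "koszul (part (Suc j) g) p = part j (koszul g) p" by (simp add: p koszul_def part_def)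
qed

lemma part_0_koszul_chains: "part j (0 :: pair \<Rightarrow> bit) = 0"
  by (simp add: part_def fun_eq_iff)

lemma supported_mono: "A \<subseteq> B \<Longrightarrow> supported A \<subseteq> supported B"
  by (auto simp: supported_def)

lemma koszul_koszul: assumes "g \<in> koszul_chains n" shows "koszul (koszul g) = 0"
proof -
  have "spread (koszul (koszul g)) = spread 0"
    by (simp only: cobd_spread[symmetric] cobd_cobd add_hom_0[OF hom_spread])
  then show ?thesis
    by (rule inj_onD[OF inj_spread]) (use assms in \<open>auto intro: koszul_koszul_chains add_closed_0 add_closed_koszul_chains\<close>)
qed

lemma koszul_layer_0: assumes "g \<in> layer N 0" shows "koszul g = 0"
proof (rule ext, rule ccontr)
  fix p :: pair assume nz: "koszul g p \<noteq> 0 p"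
  obtain m B where p: "p = (m, B)" by (cases p)
  have "koszul g (m, B) \<noteq> 0" using nz by (simp add: p)
  from koszul_nonzero[OF this] obtain e r where "g (drop_edge m e, insert r B) \<noteq> 0" by blast
  then have "(drop_edge m e, insert r B) \<in> layer_pairs N 0" using assms unfolding layer_def supported_def by blast
  then show False by (simp add: layer_pairs_def)
qed

text \<open>Koszul chains fix the degree \<open>n\<close> of \<open>m\<close>, whereas exactness is
  known in fixed total degree; the part with \<open>j\<close> exterior generators has total degree
  \<open>n + j\<close>.\<close>

lemma part_koszul_chains:
  assumes g: "g \<in> koszul_chains n" shows "part j g \<in> inv_layer (n + j) j"
proof -
  have "part j g (translate q (m, B)) = part j g (m, B)" for q m B
    using g invariantD[of g q "(m, B)"] by (simp add: koszul_chains_def part_def translate_def card_translate)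
  then have "invariant (part j g)" unfolding invariant_def by auto
  moreover have "part j g \<in> layer (n + j) j"
  proof -
    have "(m, B) \<in> layer_pairs (n + j) j" if "part j g (m, B) \<noteq> 0" for m B
    proof -
      have "card B = j" "g (m, B) \<noteq> 0" using that by (auto simp: part_def split: if_splits)
      moreover have "(m, B) \<in> odd_pairs n" using g \<open>g (m, B) \<noteq> 0\<close> unfolding koszul_chains_def supported_def by blast
      ultimately show ?thesis by (simp add: odd_pairs_def layer_pairs_def)
    qed
    then show ?thesis by (auto simp: layer_def supported_def)
  qed
  ultimately show ?thesis by (simp add: inv_layer_def)
qed

lemma inv_layer_koszul_chains:
  assumes "odd (n + j)" shows "inv_layer (n + j) j \<subseteq> koszul_chains n"
proof -
  have "(m, B) \<in> odd_pairs n" if "(m, B) \<in> layer_pairs (n + j) j" for m B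
    using that assms by (simp add: layer_pairs_def odd_pairs_def)
  then have "layer_pairs (n + j) j \<subseteq> odd_pairs n" by auto
  from supported_mono[OF this] show ?thesis unfolding inv_layer_def layer_def koszul_chains_def by blast
qed

lemma part_inv_layer: "g \<in> inv_layer N j \<Longrightarrow> part i g = (if i = j then g else 0)"
  by (auto simp: inv_layer_def layer_def supported_iff layer_pairs_def part_def fun_eq_iff)

lemma card_vertex_set: "card (B :: vertex set) \<le> 4"
proof -
  have "(\<Sum>r\<in>(UNIV :: vertex set). 1 :: nat) = 4" by (simp only: sum_vertex)
  then have "card (UNIV :: vertex set) = 4" by simp
  then show ?thesis using card_mono[of UNIV B] by simp
qed

lemma koszul_chains_decompose:
  assumes g: "g \<in> koszul_chains n"
  shows "odd n \<Longrightarrow> g = part 0 g + part 2 g + part 4 g" "even n \<Longrightarrow> g = part 1 g + part 3 g"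
proof -
  have g0: "g (m, B) = 0" if "even (n + card B)" for m B
    using g that by (auto simp: koszul_chains_def supported_iff odd_pairs_def)
  have le: "card B = 0 \<or> card B = 1 \<or> card B = 2 \<or> card B = 3 \<or> card B = 4" for B :: "vertex set"
    using card_vertex_set[of B] by linarith
  show "g = part 0 g + part 2 g + part 4 g" if "odd n"
  proof
    fix p show "g p = (part 0 g + part 2 g + part 4 g) p"
      using le[of "snd p"] g0[of "snd p" "fst p"] that by (auto simp: part_def)
  qed
  show "g = part 1 g + part 3 g" if "even n"
  proof
    fix p show "g p = (part 1 g + part 3 g) p"
      using le[of "snd p"] g0[of "snd p" "fst p"] that by (auto simp: part_def)
  qed
qed

text \<open>Interface to the algebra: \<open>S n\<close> is the homology with one exterior generator
  and polynomial degree \<open>n\<close>, hence total degree \<open>Suc n\<close>, and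
  \<open>\<pi> n\<close> takes a cycle to its class.\<close>

locale koszul_homology =
  fixes S :: "nat \<Rightarrow> 's :: char_2 set" and \<pi> :: "nat \<Rightarrow> (pair \<Rightarrow> bit) \<Rightarrow> 's" and act_x act_y :: "'s \<Rightarrow> 's"
  assumes exact: "exact_sequence (layer (Suc n) 4) (layer (Suc n) 3) (layer (Suc n) 2)
      {g \<in> layer (Suc n) 1. koszul g = 0} (S n) koszul (\<pi> n)"
    and hom_\<pi>: "add_hom (\<pi> n)"
    and \<pi>_x: "g \<in> layer (Suc n) 1 \<Longrightarrow> koszul g = 0 \<Longrightarrow> \<pi> n (shift (1, 0) g) = act_x (\<pi> n g)"
    and \<pi>_y: "g \<in> layer (Suc n) 1 \<Longrightarrow> koszul g = 0 \<Longrightarrow> \<pi> n (shift (0, 1) g) = act_y (\<pi> n g)"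
begin

definition inv_S :: "nat \<Rightarrow> 's set" where
  "inv_S n = {s \<in> S n. act_x s = s \<and> act_y s = s}"

text \<open>For even \<open>n\<close> the total degree \<open>Suc n\<close> is odd and the layers
  are free; the two generators of \<open>Q\<close> are treated one after the other.\<close>

lemma exact_inv:
  assumes "even n"
  shows "exact_sequence (inv_layer (Suc n) 4) (inv_layer (Suc n) 3) (inv_layer (Suc n) 2)
      {g \<in> inv_layer (Suc n) 1. koszul g = 0} (inv_S n) koszul (\<pi> n)"
proof -
  let ?L = "layer (Suc n)" and ?x = "shift (1, 0)" and ?y = "shift (0, 1)"
  let ?F = "\<lambda>j. {g \<in> ?L j. ?x g = g}"
  have inv: "shift q (shift q g) = g" for q g by (simp add: shift_shift shift_0)
  have comm: "?x (?y g) = ?y (?x g)" for g by (simp add: shift_shift)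
  have k0: "koszul (shift q g) = 0" if "koszul g = 0" for q g
    unfolding koszul_shift that by (simp add: shift_def fun_eq_iff)
  have kZ: "{z \<in> ?F 1. koszul z = 0} = {z \<in> {g \<in> ?L 1. koszul g = 0}. ?x z = z}" by auto
  have N: "odd (Suc n)" using assms by simp
  have 1: "exact_sequence (?F 4) (?F 3) (?F 2) {z \<in> ?F 1. koszul z = 0} {s \<in> S n. act_x s = s} koszul (\<pi> n)"
    unfolding kZ
    by (rule exact_sequence_fixed[OF exact add_closed_layer add_closed_layer add_closed_layer
          add_closed_kernel[OF add_closed_layer hom_koszul] hom_koszul hom_\<pi> hom_shift inv _ _ _ _ koszul_shift
          _ free_layer(1)[OF N] free_layer(1)[OF N] free_layer(1)[OF N]])
      (auto intro: shift_layer k0 \<pi>_x)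
  have "exact_sequence {g \<in> ?F 4. ?y g = g} {g \<in> ?F 3. ?y g = g} {g \<in> ?F 2. ?y g = g}
      {z \<in> {z \<in> ?F 1. koszul z = 0}. ?y z = z} {s \<in> {s \<in> S n. act_x s = s}. act_y s = s} koszul (\<pi> n)"
    by (rule exact_sequence_fixed[OF 1 add_closed_fixed[OF add_closed_layer hom_shift]
          add_closed_fixed[OF add_closed_layer hom_shift] add_closed_fixed[OF add_closed_layer hom_shift]
          add_closed_kernel[OF add_closed_fixed[OF add_closed_layer hom_shift] hom_koszul]
          hom_koszul hom_\<pi> hom_shift inv _ _ _ _ koszul_shift
          _ free_layer(2)[OF N] free_layer(2)[OF N] free_layer(2)[OF N]])
      (auto intro: shift_layer k0 \<pi>_y simp: comm)
  moreover have "{z \<in> {z \<in> ?F 1. koszul z = 0}. ?y z = z} = {g \<in> inv_layer (Suc n) 1. koszul g = 0}"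
    by (auto simp: inv_layer_eq)
  moreover have "{s \<in> {s \<in> S n. act_x s = s}. act_y s = s} = inv_S n" by (auto simp: inv_S_def)
  ultimately show ?thesis unfolding inv_layer_eq by simp
qed

lemma boundary_3:
  assumes n: "odd n" and g: "g \<in> inv_layer n 3" "koszul g = 0" shows "\<exists>h\<in>inv_layer n 4. g = koszul h"
proof -
  obtain k where k: "n = Suc k" "even k" using n by (cases n) auto
  have "{b \<in> inv_layer n 3. koszul b = 0} = koszul ` inv_layer n 4"
    using exact_inv[OF k(2)] unfolding k(1)[symmetric] exact_sequence_def by (elim conjE)
  then show ?thesis using g by blast
qed

lemma boundary_2:
  assumes n: "odd n" and g: "g \<in> inv_layer n 2" "koszul g = 0" shows "\<exists>h\<in>inv_layer n 3. g = koszul h"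
proof -
  obtain k where k: "n = Suc k" "even k" using n by (cases n) auto
  have "{b \<in> inv_layer n 2. koszul b = 0} = koszul ` inv_layer n 3"
    using exact_inv[OF k(2)] unfolding k(1)[symmetric] exact_sequence_def by (elim conjE)
  then show ?thesis using g by blast
qed

lemma boundary_4:
  assumes n: "odd n" and g: "g \<in> inv_layer n 4" "koszul g = 0" shows "g = 0"
proof -
  obtain k where k: "n = Suc k" "even k" using n by (cases n) auto
  have "\<forall>a\<in>inv_layer n 4. koszul a = 0 \<longrightarrow> a = 0"
    using exact_inv[OF k(2)] unfolding k(1)[symmetric] exact_sequence_def by (elim conjE)
  then show ?thesis using g by blast
qed

lemma koszul_part_eq_0: "koszul g = 0 \<Longrightarrow> koszul (part (Suc j) g) = 0"
  by (simp add: koszul_part part_0_koszul_chains)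

text \<open>In even degree chains have parts with one and three exterior generators. The latter is a
  cycle, hence a boundary, so the cohomology is the class of the former.\<close>

lemma card_koszul_even:
  assumes n: "even (Suc n)"
  shows "card {g \<in> koszul_chains (Suc n). koszul g = 0} = card (inv_S (Suc n)) * card (koszul ` koszul_chains n)"
proof -
  let ?Z = "{g \<in> koszul_chains (Suc n). koszul g = 0}"
  have ex: "{z \<in> {g \<in> inv_layer (Suc (Suc n)) 1. koszul g = 0}. \<pi> (Suc n) z = 0} = koszul ` inv_layer (Suc (Suc n)) 2"
    "\<pi> (Suc n) ` {g \<in> inv_layer (Suc (Suc n)) 1. koszul g = 0} = inv_S (Suc n)"
    using exact_inv[OF n] unfolding exact_sequence_def by auto
  have hom: "add_hom (\<lambda>g. \<pi> (Suc n) (part 1 g))"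
    by (rule add_homI) (simp add: add_hom_add[OF hom_\<pi>] add_hom_add[OF hom_part])
  have part1: "part 1 g \<in> {g \<in> inv_layer (Suc (Suc n)) 1. koszul g = 0}" if "g \<in> ?Z" for g
    using that part_koszul_chains[of g "Suc n" 1] koszul_part_eq_0[of g 0] by simp
  have "(\<lambda>g. \<pi> (Suc n) (part 1 g)) ` ?Z = inv_S (Suc n)"
  proof (intro equalityI subsetI)
    fix s assume "s \<in> (\<lambda>g. \<pi> (Suc n) (part 1 g)) ` ?Z"
    then show "s \<in> inv_S (Suc n)" using part1 ex(2) by blast
  next
    fix s assume "s \<in> inv_S (Suc n)"
    then obtain z where z: "z \<in> inv_layer (Suc (Suc n)) 1" "koszul z = 0" "s = \<pi> (Suc n) z" using ex(2) by blast
    then have "z \<in> ?Z" "part 1 z = z"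
      using inv_layer_koszul_chains[of "Suc n" 1] n part_inv_layer[of z _ 1 1] by auto
    then show "s \<in> (\<lambda>g. \<pi> (Suc n) (part 1 g)) ` ?Z" using z(3) by force
  qed
  moreover have "{g \<in> ?Z. \<pi> (Suc n) (part 1 g) = 0} = koszul ` koszul_chains n"
  proof (intro equalityI subsetI)
    fix g assume g: "g \<in> {g \<in> ?Z. \<pi> (Suc n) (part 1 g) = 0}"
    then have "part 1 g \<in> koszul ` inv_layer (Suc (Suc n)) 2" using ex(1) part1 by blast
    then obtain h where h: "h \<in> inv_layer (n + 2) 2" "part 1 g = koszul h" by auto
    have "part 3 g \<in> inv_layer (n + 4) 3" "koszul (part 3 g) = 0"
      using g part_koszul_chains[of g "Suc n" 3] koszul_part_eq_0[of g 2] by (auto simp: eval_nat_numeral)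
    then obtain h' where h': "h' \<in> inv_layer (n + 4) 4" "part 3 g = koszul h'"
      using boundary_3[of "n + 4" "part 3 g"] n by auto
    have "h + h' \<in> koszul_chains n"
      using h(1) h'(1) inv_layer_koszul_chains[of n 2] inv_layer_koszul_chains[of n 4] n
      by (intro add_closed_add[OF add_closed_koszul_chains]) auto
    moreover have "g = koszul (h + h')"
    proof -
      have "g = part 1 g + part 3 g" using koszul_chains_decompose(2)[of g "Suc n"] g n by blast
      then show ?thesis by (simp only: add_hom_add[OF hom_koszul] h(2)[symmetric] h'(2)[symmetric])
    qed
    ultimately show "g \<in> koszul ` koszul_chains n" by blast
  next
    fix g assume "g \<in> koszul ` koszul_chains n"
    then obtain h where h: "h \<in> koszul_chains n" "g = koszul h" by blast
    have part2: "part 2 h \<in> inv_layer (Suc (Suc n)) 2" using part_koszul_chains[OF h(1), of 2] by simp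
    have "part 1 g = koszul (part 2 h)" using koszul_part[of 1 h] h by (simp add: eval_nat_numeral)
    then have "\<pi> (Suc n) (part 1 g) = 0" using ex(1) part2 by blast
    moreover have "koszul g = 0" using koszul_koszul[OF h(1)] h(2) by simp
    ultimately show "g \<in> {g \<in> ?Z. \<pi> (Suc n) (part 1 g) = 0}" using h koszul_koszul_chains by blast
  qed
  ultimately show ?thesis
    using card_eq_image_kernel[OF _ add_closed_kernel[OF add_closed_koszul_chains hom_koszul] hom, of "Suc n"]
      finite_koszul_chains by simp
qed

text \<open>In odd degree the parts have 0, 2 and 4 generators. For a cocycle the last is 0 and the
  middle one a boundary, which leaves the cokernel of the map from layer 1 to layer 0. Its size
  follows from the exact sequence of layers.\<close>

lemma card_koszul_odd:
  assumes n: "even n"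
  shows "card {g \<in> koszul_chains (Suc n). koszul g = 0} * (card (inv_layer (Suc n) 1) * card (inv_layer (Suc n) 3))
    = card (koszul ` koszul_chains n) * (card (inv_S n) * card (inv_layer (Suc n) 0)
        * card (inv_layer (Suc n) 2) * card (inv_layer (Suc n) 4))"
proof -
  let ?Z = "{g \<in> koszul_chains (Suc n). koszul g = 0}" and ?L = "inv_layer (Suc n)"
  let ?A = "koszul ` ?L 1" and ?z = "{g \<in> ?L 1. koszul g = 0}"
  have ex: "{a \<in> ?L 4. koszul a = 0} \<subseteq> {0}" "{b \<in> ?L 3. koszul b = 0} = koszul ` ?L 4"
    "{c \<in> ?L 2. koszul c = 0} = koszul ` ?L 3" "{z \<in> ?z. \<pi> n z = 0} = koszul ` ?L 2" "\<pi> n ` ?z = inv_S n"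
    using exact_inv[OF n] unfolding exact_sequence_def by auto
  have card_d: "card (?L j) = card (koszul ` ?L j) * card {g \<in> ?L j. koszul g = 0}" for j
    by (rule card_eq_image_kernel[OF finite_inv_layer add_closed_inv_layer hom_koszul])
  have "card {a \<in> ?L 4. koszul a = 0} = 1"
  proof -
    have "{a \<in> ?L 4. koszul a = 0} = {0}"
      using ex(1) add_closed_0[OF add_closed_kernel[OF add_closed_inv_layer hom_koszul, of "Suc n" 4]] by blast
    then show ?thesis by simp
  qed
  then have c4: "card (?L 4) = card (koszul ` ?L 4)" using card_d[of 4] by simp
  have c3: "card (?L 3) = card (koszul ` ?L 3) * card (koszul ` ?L 4)" using card_d[of 3] ex(2) by simp
  have c2: "card (?L 2) = card (koszul ` ?L 2) * card (koszul ` ?L 3)" using card_d[of 2] ex(3) by simp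
  have "card ?z = card (inv_S n) * card (koszul ` ?L 2)"
    using card_eq_image_kernel[OF _ add_closed_kernel[OF add_closed_inv_layer hom_koszul] hom_\<pi>, of "Suc n" 1 n]
      finite_inv_layer by (simp only: ex(4,5)) simp
  then have c1: "card (?L 1) = card ?A * (card (inv_S n) * card (koszul ` ?L 2))"
    using card_d[of 1] by simp
  have image: "part 0 ` ?Z = ?L 0"
  proof (intro equalityI subsetI)
    fix g assume "g \<in> part 0 ` ?Z"
    then show "g \<in> ?L 0" using part_koszul_chains[of _ "Suc n" 0] by auto
  next
    fix g assume g: "g \<in> ?L 0"
    then have "g \<in> ?Z" "part 0 g = g"
      using inv_layer_koszul_chains[of "Suc n" 0] n part_inv_layer[of g _ 0 0] koszul_layer_0[of g "Suc n"]
      by (auto simp: inv_layer_def)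
    then show "g \<in> part 0 ` ?Z" by force
  qed
  have preimage: "{g \<in> ?Z. part 0 g \<in> ?A} = koszul ` koszul_chains n"
  proof (intro equalityI subsetI)
    fix g assume g: "g \<in> {g \<in> ?Z. part 0 g \<in> ?A}"
    then obtain h where h: "h \<in> inv_layer (n + 1) 1" "part 0 g = koszul h" by auto
    have "part 2 g \<in> inv_layer (n + 3) 2" "koszul (part 2 g) = 0"
      using g part_koszul_chains[of g "Suc n" 2] koszul_part_eq_0[of g 1] by (auto simp: eval_nat_numeral)
    then obtain h' where h': "h' \<in> inv_layer (n + 3) 3" "part 2 g = koszul h'"
      using boundary_2[of "n + 3" "part 2 g"] n by auto
    have "part 4 g \<in> inv_layer (n + 5) 4" "koszul (part 4 g) = 0"
      using g part_koszul_chains[of g "Suc n" 4] koszul_part_eq_0[of g 3] by (auto simp: eval_nat_numeral)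
    then have "part 4 g = 0" using boundary_4[of "n + 5" "part 4 g"] n by auto
    moreover have "g = part 0 g + part 2 g + part 4 g" using koszul_chains_decompose(1)[of g "Suc n"] g n by auto
    ultimately have "g = koszul (h + h')"
      by (simp only: add_hom_add[OF hom_koszul] h(2)[symmetric] h'(2)[symmetric] add_0_right)
    moreover have "h + h' \<in> koszul_chains n"
      using h(1) h'(1) inv_layer_koszul_chains[of n 1] inv_layer_koszul_chains[of n 3] n
      by (intro add_closed_add[OF add_closed_koszul_chains]) auto
    ultimately show "g \<in> koszul ` koszul_chains n" by blast
  next
    fix g assume "g \<in> koszul ` koszul_chains n"
    then obtain h where h: "h \<in> koszul_chains n" "g = koszul h" by blast
    have "part 0 g = koszul (part (Suc 0) h)" using koszul_part[of 0 h] h by simp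
    then have "part 0 g \<in> ?A" using part_koszul_chains[OF h(1), of 1] by simp
    then show "g \<in> {g \<in> ?Z. part 0 g \<in> ?A}"
      using koszul_koszul[OF h(1)] koszul_koszul_chains[OF h(1)] h(2) by simp
  qed
  have "?A \<subseteq> ?L 0" using koszul_inv_layer[of _ "Suc n" 0] by auto
  then have "card (?L 0) * card (koszul ` koszul_chains n) = card ?Z * card ?A"
    using card_preimage[OF _ add_closed_kernel[OF add_closed_koszul_chains hom_koszul] hom_part, of "Suc n" ?A 0]
      finite_koszul_chains by (simp only: image preimage) simp
  then have "card ?Z * card ?A * (card (inv_S n) * card (koszul ` ?L 2) * card (?L 3))
      = card (?L 0) * card (koszul ` koszul_chains n) * (card (inv_S n) * card (koszul ` ?L 2) * card (?L 3))"
    by simp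
  then show ?thesis unfolding c1 c2 c3 c4 by (simp add: ac_simps)
qed

lemma cohomology_dim_even:
  assumes "even (Suc n)" "card (inv_S (Suc n)) = 2 ^ d"
  shows "cohomology_dim TYPE(bit) (V_group 2) (Suc n) = d"
  by (rule cohomology_dim_koszul) (simp only: card_koszul_even[OF assms(1)] assms(2))

text \<open>\<open>k j\<close> is the number of \<open>Q\<close>-orbits on the basis of layer
  \<open>j\<close>, and \<open>d\<close> the alternating sum along the exact sequence.\<close>

lemma cohomology_dim_odd:
  assumes n: "even n" and S: "card (inv_S n) = 2 ^ s"
    and k: "\<And>j. j \<le> 4 \<Longrightarrow> card (layer_pairs (Suc n) j) = 4 * k j"
    and d: "s + k 0 + k 2 + k 4 = d + k 1 + k 3"
  shows "cohomology_dim TYPE(bit) (V_group 2) (Suc n) = d"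
proof (rule cohomology_dim_koszul)
  let ?z = "card {g \<in> koszul_chains (Suc n). koszul g = 0}" and ?b = "card (koszul ` koszul_chains n)"
  have c: "card (inv_layer (Suc n) j) = 2 ^ k j" if "j \<le> 4" for j
  proof -
    have "card (inv_layer (Suc n) j) ^ 4 = (2 ^ k j) ^ 4"
      using card_inv_layer[of "Suc n" j] n k[OF that] by (simp add: power_mult[symmetric] mult.commute)
    then show ?thesis using power_eq_iff_eq_base[of 4 "card (inv_layer (Suc n) j)" "2 ^ k j"] by simp
  qed
  have "?z * (2 ^ k 1 * 2 ^ k 3) = ?b * (2 ^ s * 2 ^ k 0 * 2 ^ k 2 * 2 ^ k 4)"
    using card_koszul_odd[OF n] c S by simp
  also have "(2 :: nat) ^ s * 2 ^ k 0 * 2 ^ k 2 * 2 ^ k 4 = 2 ^ d * (2 ^ k 1 * 2 ^ k 3)"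
    using d by (simp only: power_add[symmetric] add.assoc)
  finally have "?z * (2 ^ k 1 * 2 ^ k 3) = 2 ^ d * ?b * (2 ^ k 1 * 2 ^ k 3)" by (simp only: ac_simps)
  then show "?z = 2 ^ d * ?b" by simp
qed

end

subsection \<open>The square of the Koszul differential\<close>

text \<open>\<open>koszul_koszul\<close> reaches only invariant chains of odd total degree. Here the
  cancellation is direct: multiplications by vertex forms commute, so the terms for
  \<open>(r, q)\<close> and \<open>(q, r)\<close> agree.\<close>

lemma koszul_square: "koszul (koszul g) = 0"
proof
  fix p :: pair obtain m B where p: "p = (m, B)" by (cases p)
  define sh where "sh e \<phi> = (\<lambda>m. if m e > 0 then \<phi> (drop_edge m e) else 0)"
    for e :: edge and \<phi> :: "(edge \<Rightarrow> nat) \<Rightarrow> bit"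
  define on where "on r e \<longleftrightarrow> r = src e \<or> r = tgt e" for r e
  have inc: "incident r \<phi> = (\<lambda>m. \<Sum>e\<in>UNIV. if on r e then sh e \<phi> m else 0)" for r \<phi>
    unfolding incident_def fun_eq_iff by (intro allI sum.cong) (auto simp: sh_def on_def)
  have sh_sum: "sh e (\<lambda>m. \<Sum>f\<in>UNIV. if on r f then \<psi> f m else 0) m
      = (\<Sum>f\<in>UNIV. if on r f then sh e (\<psi> f) m else 0)" for e r \<psi> m
    by (simp add: sh_def cong: if_cong)
  have sh_commute: "sh e (sh f \<phi>) = sh f (sh e \<phi>)" for e f \<phi>
  proof (cases "e = f")
    case False
    then have "drop_edge m e f = m f" "drop_edge m f e = m e" for m :: "edge \<Rightarrow> nat"
      by (auto simp: drop_edge_def)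
    then show ?thesis by (simp add: sh_def fun_eq_iff drop_edge_commute[of _ e f])
  qed simp
  have commute: "incident r (incident q \<phi>) = incident q (incident r \<phi>)" for r q \<phi>
  proof
    fix m
    have *: "incident r (incident q \<phi>) m
        = (\<Sum>e\<in>UNIV. \<Sum>f\<in>UNIV. if on r e \<and> on q f then sh e (sh f \<phi>) m else 0)" for r q
    proof -
      have "incident r (incident q \<phi>) m
          = (\<Sum>e\<in>UNIV. if on r e then \<Sum>f\<in>UNIV. if on q f then sh e (sh f \<phi>) m else 0 else 0)"
        unfolding inc[of r] inc[of q] sh_sum ..
      also have "\<dots> = (\<Sum>e\<in>UNIV. \<Sum>f\<in>UNIV. if on r e \<and> on q f then sh e (sh f \<phi>) m else 0)"
        by (rule sum.cong[OF refl]) (auto intro: sum.cong)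
      finally show ?thesis .
    qed
    show "incident r (incident q \<phi>) m = incident q (incident r \<phi>) m"
    proof -
      have "incident q (incident r \<phi>) m
          = (\<Sum>f\<in>UNIV. \<Sum>e\<in>UNIV. if on q e \<and> on r f then sh e (sh f \<phi>) m else 0)"
        unfolding *[of q r] by (rule sum.swap)
      also have "\<dots> = (\<Sum>f\<in>UNIV. \<Sum>e\<in>UNIV. if on r f \<and> on q e then sh f (sh e \<phi>) m else 0)"
      proof (intro sum.cong refl)
        fix e f show "(if on q e \<and> on r f then sh e (sh f \<phi>) m else 0)
            = (if on r f \<and> on q e then sh f (sh e \<phi>) m else 0)"
          unfolding sh_commute[of e f] by (simp only: conj_commute)
      qed
      finally show ?thesis unfolding *[of r q] ..
    qed
  qed
  have inc_sum: "incident r (\<lambda>m. \<Sum>q\<in>A. \<psi> q m) = (\<lambda>m. \<Sum>q\<in>A. incident r (\<psi> q) m)"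
    for r and A :: "vertex set" and \<psi>
  proof -
    have "(\<lambda>m. \<Sum>q\<in>A. \<psi> q m) = sum \<psi> A" by (simp add: fun_eq_iff sum_fun_apply)
    then show ?thesis unfolding \<open>_ = sum \<psi> A\<close> add_hom_sum[OF hom_incident] by (simp add: fun_eq_iff sum_fun_apply)
  qed
  let ?G = "\<lambda>r q. if q = r then 0 else incident r (incident q (\<lambda>m. g (m, insert q (insert r B)))) m"
  have "koszul (koszul g) p
      = (\<Sum>r\<in>- B. \<Sum>q\<in>- insert r B. incident r (incident q (\<lambda>m. g (m, insert q (insert r B)))) m)"
    unfolding p koszul_def prod.case inc_sum ..
  also have "\<dots> = (\<Sum>r\<in>- B. \<Sum>q\<in>- B. ?G r q)"
    by (intro sum.cong[OF refl] sum.mono_neutral_cong_left) auto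
  also have "\<dots> = (\<Sum>r\<in>- B. ?G r r)"
    by (rule sum_symmetric_char_2) (auto simp: commute insert_commute)
  also have "\<dots> = 0" by simp
  finally show "koszul (koszul g) p = 0 p" by simp
qed

subsection \<open>Power series with graded coefficients\<close>

text \<open>Homogeneous elements of degree \<open>n\<close> of \<open>V[t]\<close> with
  \<open>t\<close> in degree 1; since a graded \<open>V\<close> vanishes in negative degrees they
  are polynomials.\<close>

definition series :: "(int \<Rightarrow> 'v set) \<Rightarrow> int \<Rightarrow> (nat \<Rightarrow> 'v) set" where
  "series V n = {F. \<forall>i. F i \<in> V (n - int i)}"

definition graded :: "(int \<Rightarrow> 'v :: char_2 set) \<Rightarrow> bool" where
  "graded V \<longleftrightarrow> (\<forall>n. add_closed (V n) \<and> finite (V n)) \<and> (\<forall>n<0. V n = {0})"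

definition raise :: "(nat \<Rightarrow> 'v :: zero) \<Rightarrow> nat \<Rightarrow> 'v" where
  "raise F = (\<lambda>i. case i of 0 \<Rightarrow> 0 | Suc i \<Rightarrow> F i)"

definition strip :: "(nat \<Rightarrow> 'v) \<Rightarrow> nat \<Rightarrow> 'v" where
  "strip F = (\<lambda>i. F (Suc i))"

definition const_series :: "'v :: zero \<Rightarrow> nat \<Rightarrow> 'v" where
  "const_series v = (\<lambda>i. if i = 0 then v else 0)"

lemma strip_raise [simp]: "strip (raise F) = F"
  by (simp add: strip_def raise_def)

lemma series_decompose: "(F :: nat \<Rightarrow> 'v :: char_2) = raise (strip F) + const_series (F 0)"
  by (auto simp: fun_eq_iff raise_def strip_def const_series_def split: nat.split)

lemma graded_neg: "graded V \<Longrightarrow> n < 0 \<Longrightarrow> v \<in> V n \<Longrightarrow> v = 0"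
  and graded_0: "graded V \<Longrightarrow> 0 \<in> V n"
  and graded_add: "graded V \<Longrightarrow> v \<in> V n \<Longrightarrow> w \<in> V n \<Longrightarrow> v + w \<in> V n"
  by (auto simp: graded_def add_closed_def)

lemma raise_series: "graded V \<Longrightarrow> F \<in> series V n \<Longrightarrow> raise F \<in> series V (n + 1)"
proof -
  assume V: "graded V" and F: "F \<in> series V n"
  have "raise F i \<in> V (n + 1 - int i)" for i
  proof (cases i)
    case (Suc k)
    have "F k \<in> V (n - int k)" using F by (simp add: series_def)
    then show ?thesis by (simp add: Suc raise_def)
  qed (simp add: raise_def graded_0[OF V])
  then show ?thesis by (simp add: series_def)
qed

lemma strip_series: "F \<in> series V n \<Longrightarrow> strip F \<in> series V (n - 1)"
proof -
  assume F: "F \<in> series V n"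
  have "F (Suc i) \<in> V (n - int (Suc i))" for i using F by (simp add: series_def del: of_nat_Suc)
  moreover have "n - int (Suc i) = n - 1 - int i" for i by simp
  ultimately show ?thesis by (simp only: series_def strip_def mem_Collect_eq) simp
qed

lemma const_series_series: "graded V \<Longrightarrow> v \<in> V n \<Longrightarrow> const_series v \<in> series V n"
  by (auto simp: series_def const_series_def graded_0)

lemma series_split:
  assumes "graded V"
  shows "bij_betw (\<lambda>F. (F 0, strip F)) (series V n) (V n \<times> series V (n - 1))"
proof (rule bij_betw_byWitness[where f' = "\<lambda>(v, F). raise F + const_series v"])
  show "\<forall>F\<in>series V n. (case (F 0, strip F) of (v, F) \<Rightarrow> raise F + const_series v) = F"
    by (simp add: series_decompose[symmetric])
  show "\<forall>p\<in>V n \<times> series V (n - 1).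
      ((case p of (v, F) \<Rightarrow> raise F + const_series v) 0, strip (case p of (v, F) \<Rightarrow> raise F + const_series v)) = p"
    by (auto simp: raise_def const_series_def strip_def fun_eq_iff)
  show "(\<lambda>F. (F 0, strip F)) ` series V n \<subseteq> V n \<times> series V (n - 1)"
  proof clarify
    fix F assume F: "F \<in> series V n"
    then have "F 0 \<in> V n" by (simp add: series_def) (metis diff_zero of_nat_0)
    then show "F 0 \<in> V n \<and> strip F \<in> series V (n - 1)" using strip_series[OF F] by simp
  qed
  show "(\<lambda>(v, F). raise F + const_series v) ` (V n \<times> series V (n - 1)) \<subseteq> series V n"
  proof clarify
    fix v F assume v: "v \<in> V n" "F \<in> series V (n - 1)"
    have "raise F \<in> series V n" using raise_series[OF assms v(2)] by simp
    then show "raise F + const_series v \<in> series V n"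
      using const_series_series[OF assms v(1)] graded_add[OF assms] by (simp add: series_def)
  qed
qed

lemma series_neg: "graded V \<Longrightarrow> n < 0 \<Longrightarrow> series V n = {0}"
proof -
  assume V: "graded V" "n < 0"
  have "F = 0" if F: "F \<in> series V n" for F
  proof
    fix i
    have "F i \<in> V (n - int i)" using F by (simp add: series_def)
    then show "F i = 0 i" using graded_neg[OF V(1), of "n - int i" "F i"] V(2) by simp
  qed
  then show ?thesis using graded_0[OF V(1)] by (auto simp: series_def)
qed

lemma graded_series:
  assumes V: "graded V" shows "graded (series V)"
proof -
  have "finite (series V (int k - 1))" for k
  proof (induction k)
    case 0
    then show ?case by (simp add: series_neg[OF V])
  next
    case (Suc k)
    then have "finite (V (int k) \<times> series V (int k - 1))" using V by (auto simp: graded_def)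
    then have "finite (series V (int k))" using bij_betw_finite[OF series_split[OF V, of "int k"]] by blast
    then show ?case by simp
  qed
  then have "finite (series V (int (nat (n + 1)) - 1))" for n .
  then have "finite (series V n)" for n
    by (cases "n < 0") (simp add: series_neg[OF V], metis add_diff_cancel_right' add_increasing2 nat_0_le not_less zero_le_one)
  moreover have "add_closed (series V n)" for n
    using V by (auto simp: graded_def add_closed_def series_def)
  ultimately show ?thesis using series_neg[OF V] by (simp add: graded_def)
qed

text \<open>Splitting off the constant term adds exponents, which is Pascal's rule.\<close>

lemma card_series:
  assumes V: "graded V" and card: "\<And>n. card (V (int n)) = 2 ^ ((n + d) choose d)"
  shows "card (series V (int n)) = 2 ^ ((n + Suc d) choose Suc d)"
proof (induction n)
  case 0
  have "card (series V 0) = card (V 0) * card (series V (- 1))"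
    using bij_betw_same_card[OF series_split[OF V, of 0]] by (simp add: card_cartesian_product)
  then show ?case using card[of 0] series_neg[OF V, of "- 1"] by simp
next
  case (Suc n)
  have "card (series V (int (Suc n))) = card (V (int (Suc n))) * card (series V (int n))"
    using bij_betw_same_card[OF series_split[OF V, of "int (Suc n)"]] by (simp add: card_cartesian_product)
  then show ?case using card[of "Suc n"] Suc by (simp add: power_add[symmetric] add.commute)
qed

lemma card_multidegrees: "card {m :: edge \<Rightarrow> nat. sum m UNIV = n} = (n + 7) choose 7"
proof -
  obtain es :: "edge list" where es: "set es = UNIV" "distinct es"
    using finite_distinct_list[OF finite[of "UNIV :: edge set"]] by blast
  have "length es = card (UNIV :: edge set)" using es distinct_card by fastforce
  also have "\<dots> = 8"
    by (simp add: UNIV_Times_UNIV[symmetric] card_cartesian_product card_UNIV_bit del: UNIV_Times_UNIV)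
  finally have len: "length es = 8" .
  have inj: "m = m'" if "map m es = map m' es" for m m' :: "edge \<Rightarrow> nat"
    using that es by (auto simp: fun_eq_iff)
  have "bij_betw (\<lambda>m. map m es) {m. sum m UNIV = n} {l :: nat list. length l = 8 \<and> sum_list l = n}"
    unfolding bij_betw_def
  proof
    show "inj_on (\<lambda>m. map m es) {m. sum m UNIV = n}" using inj by (auto intro: inj_onI)
    show "(\<lambda>m. map m es) ` {m. sum m UNIV = n} = {l. length l = 8 \<and> sum_list l = n}"
    proof (intro equalityI subsetI)
      fix l assume "l \<in> (\<lambda>m. map m es) ` {m. sum m UNIV = n}"
      then show "l \<in> {l. length l = 8 \<and> sum_list l = n}"
        using len es sum_list_distinct_conv_sum_set[OF es(2)] by auto
    next
      fix l :: "nat list" assume l: "l \<in> {l. length l = 8 \<and> sum_list l = n}"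
      define m where "m e = the (map_of (zip es l) e)" for e
      have "m (es ! i) = l ! i" if "i < 8" for i
        using that l len es by (simp add: m_def map_of_zip_nth)
      then have "map m es = l" using l len by (intro nth_equalityI) auto
      moreover have "sum m UNIV = sum_list (map m es)"
        using es sum_list_distinct_conv_sum_set[OF es(2), of m] by simp
      ultimately show "l \<in> (\<lambda>m. map m es) ` {m. sum m UNIV = n}" using l by force
    qed
  qed
  then have "card {m :: edge \<Rightarrow> nat. sum m UNIV = n} = card {l :: nat list. length l = 8 \<and> sum_list l = n}"
    by (rule bij_betw_same_card)
  also have "\<dots> = (n + 7) choose n" by (subst card_length_sum_list) (simp add: add.commute)
  also have "\<dots> = (n + 7) choose 7" using binomial_symmetric[of n "n + 7"] by simp
  finally show ?thesis .
qed

subsection \<open>Monomials in eight linear forms\<close>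

definition scale :: "bit \<Rightarrow> 'v :: zero \<Rightarrow> 'v" where
  "scale c v = (if c = 1 then v else 0)"

lemma scale_simps [simp]: "scale 0 v = 0" "scale 1 v = v"
  by (simp_all add: scale_def)

lemma scale_add: "scale c (v + w) = scale c v + scale c (w :: 'v :: char_2)"
  by (simp add: scale_def)

lemma scale_add_left: "scale (c + d) v = scale c v + scale d (v :: 'v :: char_2)"
  by (cases c; cases d) simp_all

lemma scale_commute: "scale c (scale d v) = scale d (scale c v)"
  by (simp add: scale_def)

lemma scale_hom: "add_hom h \<Longrightarrow> h (scale c v) = scale c (h v)"
  by (simp add: scale_def add_hom_0)

text \<open>\<open>S\<close> is described by graded pieces and by the operators of multiplication
  with \<open>a\<close>, \<open>b\<close>, \<open>w\<close>, \<alpha>, \<beta> in place of a ring.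
  Generation in degree 1 together with the size of the pieces expresses that the generators are
  independent.\<close>

locale symmetric_algebra =
  fixes V :: "int \<Rightarrow> 's :: char_2 set" and unity :: 's
    and ma mb mw mal mbe ax ay :: "'s \<Rightarrow> 's"
  assumes graded: "graded V" and V_0: "V 0 = {0, unity}"
    and card_V: "card (V (int k)) = 2 ^ ((k + 4) choose 4)"
    and hom: "add_hom ma" "add_hom mb" "add_hom mw" "add_hom mal" "add_hom mbe" "add_hom ax" "add_hom ay"
    and mult_V: "v \<in> V n \<Longrightarrow> ma v \<in> V (n + 1)" "v \<in> V n \<Longrightarrow> mb v \<in> V (n + 1)"
      "v \<in> V n \<Longrightarrow> mw v \<in> V (n + 1)" "v \<in> V n \<Longrightarrow> mal v \<in> V (n + 1)" "v \<in> V n \<Longrightarrow> mbe v \<in> V (n + 1)"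
    and act_V: "v \<in> V n \<Longrightarrow> ax v \<in> V n" "v \<in> V n \<Longrightarrow> ay v \<in> V n"
    and commute: "mb (ma v) = ma (mb v)" "mw (ma v) = ma (mw v)" "mal (ma v) = ma (mal v)" "mbe (ma v) = ma (mbe v)"
      "mw (mb v) = mb (mw v)" "mal (mb v) = mb (mal v)" "mbe (mb v) = mb (mbe v)"
      "mal (mw v) = mw (mal v)" "mbe (mw v) = mw (mbe v)" "mbe (mal v) = mal (mbe v)"
    and generate: "n > 0 \<Longrightarrow> v \<in> V n \<Longrightarrow> \<exists>a b c d e. a \<in> V (n - 1) \<and> b \<in> V (n - 1) \<and> c \<in> V (n - 1) \<and>
      d \<in> V (n - 1) \<and> e \<in> V (n - 1) \<and> v = ma a + mb b + mw c + mal d + mbe e"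
    and ax: "ax unity = unity" "ax (ma v) = ma (ax v) + mw (ax v)" "ax (mb v) = mb (ax v) + mbe (ax v)"
      "ax (mw v) = mw (ax v)" "ax (mal v) = mal (ax v)" "ax (mbe v) = mbe (ax v)"
    and ay: "ay unity = unity" "ay (ma v) = ma (ay v) + mal (ay v)" "ay (mb v) = mb (ay v) + mw (ay v)"
      "ay (mw v) = mw (ay v)" "ay (mal v) = mal (ay v)" "ay (mbe v) = mbe (ay v)"
begin

lemmas hom_simps = hom[THEN add_hom_add] hom[THEN add_hom_0] hom[THEN scale_hom]

text \<open>The image of an edge is the translate of \<open>a\<close> or \<open>b\<close> by its
  base vertex. At every vertex the two edges of either direction add up to \<open>w\<close>, so the
  vertex form becomes 0 in \<open>S\<close>.\<close>

definition xs :: "edge \<Rightarrow> 's \<Rightarrow> 's" where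
  "xs = (\<lambda>((i, j), d) v. if d then mb v + scale j (mw v) + scale i (mbe v)
     else ma v + scale i (mw v) + scale j (mal v))"

lemma hom_xs: "add_hom (xs e)"
  by (rule add_homI) (cases e; auto simp: xs_def hom_simps scale_add ac_simps split: prod.splits)

lemma xs_commute: "xs e (xs f v) = xs f (xs e v)"
  by (cases e; cases f)
    (auto simp: xs_def hom_simps scale_add commute scale_commute ac_simps split: prod.splits)

lemma xs_V: "v \<in> V n \<Longrightarrow> xs e v \<in> V (n + 1)"
proof -
  assume v: "v \<in> V n"
  have "scale c w \<in> V (n + 1)" if "w \<in> V (n + 1)" for c w
    using that graded_0[OF graded] by (simp add: scale_def)
  note closed = this graded_add[OF graded] mult_V[OF v]
  obtain i j d where e: "e = ((i, j), d)" by (cases e) auto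
  show ?thesis unfolding e xs_def prod.case by (cases d) (simp_all add: closed)
qed

lemma ax_xs: "ax (xs e v) = xs (move (1, 0) e) (ax v)"
  by (cases e) (auto simp: xs_def move_def hom_simps ax scale_add scale_add_left ac_simps split: prod.splits)

lemma ay_xs: "ay (xs e v) = xs (move (0, 1) e) (ay v)"
  by (cases e) (auto simp: xs_def move_def hom_simps ay scale_add scale_add_left ac_simps split: prod.splits)

text \<open>The graded pieces of \<open>S[t1, t2, t3]\<close>; the three indices of an element are
  the exponents of the variables.\<close>

definition Rg :: "int \<Rightarrow> (nat \<Rightarrow> nat \<Rightarrow> nat \<Rightarrow> 's) set" where
  "Rg = series (series (series V))"

definition t1 :: "(nat \<Rightarrow> nat \<Rightarrow> nat \<Rightarrow> 's) \<Rightarrow> nat \<Rightarrow> nat \<Rightarrow> nat \<Rightarrow> 's" where "t1 = raise"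
definition t2 :: "(nat \<Rightarrow> nat \<Rightarrow> nat \<Rightarrow> 's) \<Rightarrow> nat \<Rightarrow> nat \<Rightarrow> nat \<Rightarrow> 's" where "t2 F = (\<lambda>i. raise (F i))"
definition t3 :: "(nat \<Rightarrow> nat \<Rightarrow> nat \<Rightarrow> 's) \<Rightarrow> nat \<Rightarrow> nat \<Rightarrow> nat \<Rightarrow> 's" where "t3 F = (\<lambda>i j. raise (F i j))"
definition s1 :: "(nat \<Rightarrow> nat \<Rightarrow> nat \<Rightarrow> 's) \<Rightarrow> nat \<Rightarrow> nat \<Rightarrow> nat \<Rightarrow> 's" where "s1 = strip"
definition s2 :: "(nat \<Rightarrow> nat \<Rightarrow> nat \<Rightarrow> 's) \<Rightarrow> nat \<Rightarrow> nat \<Rightarrow> nat \<Rightarrow> 's" where "s2 F = (\<lambda>i. strip (F i))"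
definition s3 :: "(nat \<Rightarrow> nat \<Rightarrow> nat \<Rightarrow> 's) \<Rightarrow> nat \<Rightarrow> nat \<Rightarrow> nat \<Rightarrow> 's" where "s3 F = (\<lambda>i j. strip (F i j))"

lemmas t_defs = t1_def t2_def t3_def s1_def s2_def s3_def raise_def strip_def

lemma hom_t: "add_hom t1" "add_hom t2" "add_hom t3" "add_hom s1" "add_hom s2" "add_hom s3"
  by (auto intro!: add_homI simp: t_defs fun_eq_iff split: nat.splits)

lemma t_commute: "t2 (t1 F) = t1 (t2 F)" "t3 (t1 F) = t1 (t3 F)" "t3 (t2 F) = t2 (t3 F)"
  by (auto simp: t_defs fun_eq_iff split: nat.splits)

lemma s_t: "s1 (t1 F) = F" "s2 (t2 F) = F" "s3 (t3 F) = F"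
  "s1 (t2 F) = t2 (s1 F)" "s1 (t3 F) = t3 (s1 F)" "s2 (t1 F) = t1 (s2 F)" "s2 (t3 F) = t3 (s2 F)"
  "s3 (t1 F) = t1 (s3 F)" "s3 (t2 F) = t2 (s3 F)"
  by (auto simp: t_defs fun_eq_iff split: nat.splits)

lemmas t_simps = hom_t[THEN add_hom_add] hom_t[THEN add_hom_0] s_t t_commute

lemma graded_Rg: "graded Rg"
  unfolding Rg_def by (intro graded_series graded)

lemma Rg_iff: "F \<in> Rg n \<longleftrightarrow> (\<forall>i j k. F i j k \<in> V (n - int i - int j - int k))"
  by (simp add: Rg_def series_def)

lemma card_Rg: "card (Rg (int n)) = 2 ^ ((n + 7) choose 7)"
proof -
  have "card (series V (int n)) = 2 ^ ((n + 5) choose 5)" for n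
    using card_series[OF graded card_V] by simp
  from card_series[OF graded_series[OF graded], of 5, OF this]
  have "card (series (series V) (int n)) = 2 ^ ((n + 6) choose 6)" for n by simp
  from card_series[OF graded_series[OF graded_series[OF graded]], of 6, OF this] show ?thesis
    by (simp add: Rg_def)
qed

lemma t_Rg: "F \<in> Rg n \<Longrightarrow> t1 F \<in> Rg (n + 1)" "F \<in> Rg n \<Longrightarrow> t2 F \<in> Rg (n + 1)" "F \<in> Rg n \<Longrightarrow> t3 F \<in> Rg (n + 1)"
proof -
  assume F: "F \<in> Rg n"
  note g = graded graded_series[OF graded] graded_series[OF graded_series[OF graded]]
  show "t1 F \<in> Rg (n + 1)" using raise_series[OF g(3), of F n] F by (simp add: Rg_def t1_def)
  have eq: "n + 1 - int i = n - int i + 1" "n + 1 - int i - int j = n - int i - int j + 1" for i j by auto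
  show "t2 F \<in> Rg (n + 1)" using raise_series[OF g(2)] F unfolding Rg_def t2_def series_def[of "series (series V)"] eq by simp
  have "raise (F i j) \<in> series V (n + 1 - int i - int j)" for i j
    unfolding eq(2) by (rule raise_series[OF g(1)]) (use F in \<open>simp add: Rg_def series_def\<close>)
  then show "t3 F \<in> Rg (n + 1)" unfolding Rg_def t3_def series_def[of "series (series V)"] series_def[of "series V"] by simp
qed

lemma s_Rg: "F \<in> Rg n \<Longrightarrow> s1 F \<in> Rg (n - 1)" "F \<in> Rg n \<Longrightarrow> s2 F \<in> Rg (n - 1)" "F \<in> Rg n \<Longrightarrow> s3 F \<in> Rg (n - 1)"
proof -
  assume F: "F \<in> Rg n"
  have eq: "n - int (Suc i) - int j - int k = n - 1 - int i - int j - int k"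
    "n - int i - int (Suc j) - int k = n - 1 - int i - int j - int k"
    "n - int i - int j - int (Suc k) = n - 1 - int i - int j - int k" for i j k by auto
  show "s1 F \<in> Rg (n - 1)" "s2 F \<in> Rg (n - 1)" "s3 F \<in> Rg (n - 1)"
    using F eq unfolding Rg_iff s1_def s2_def s3_def strip_def by metis+
qed

text \<open>The edges of the Cayley graph are sent to the linear forms \<open>a\<close>, \<open>a + w\<close>, \<open>a + \<alpha>\<close>, \<open>a + w + \<alpha> + t\<^sub>1 + t\<^sub>3\<close>,
  \<open>b\<close>, \<open>b + w + t\<^sub>1\<close>, \<open>b + \<beta>\<close> and \<open>b + w + \<beta> + t\<^sub>2\<close>. They are chosen such that the sums of the four edges
  at a vertex are \<open>t\<^sub>1\<close>, \<open>t\<^sub>2\<close>, \<open>t\<^sub>3\<close> and \<open>t\<^sub>1 + t\<^sub>2 + t\<^sub>3\<close>.\<close>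

definition te :: "edge \<Rightarrow> (nat \<Rightarrow> nat \<Rightarrow> nat \<Rightarrow> 's) \<Rightarrow> nat \<Rightarrow> nat \<Rightarrow> nat \<Rightarrow> 's" where
  "te e F = (if e = ((1, 1), False) then t1 F + t3 F else if e = ((0, 1), True) then t1 F
     else if e = ((1, 1), True) then t2 F else 0)"

definition lin :: "edge \<Rightarrow> (nat \<Rightarrow> nat \<Rightarrow> nat \<Rightarrow> 's) \<Rightarrow> nat \<Rightarrow> nat \<Rightarrow> nat \<Rightarrow> 's" where
  "lin e F = (\<lambda>i j k. xs e (F i j k)) + te e F"

text \<open>Every edge has two ends, so the four vertex forms add up to 0 and the last must be the
  sum of the others.\<close>

definition L :: "vertex \<Rightarrow> (nat \<Rightarrow> nat \<Rightarrow> nat \<Rightarrow> 's) \<Rightarrow> nat \<Rightarrow> nat \<Rightarrow> nat \<Rightarrow> 's" where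
  "L r F = (if r = (0, 0) then t1 F else if r = (1, 0) then t2 F else if r = (0, 1) then t3 F
     else t1 F + t2 F + t3 F)"

lemma hom_te: "add_hom (te e)"
  by (rule add_homI) (simp add: te_def t_simps ac_simps)

lemma hom_lin: "add_hom (lin e)"
  by (rule add_homI) (simp add: lin_def add_hom_add[OF hom_te] add_hom_add[OF hom_xs] fun_eq_iff ac_simps)

lemma hom_L: "add_hom (L r)"
  by (rule add_homI) (simp add: L_def t_simps ac_simps)

lemma te_xs: "te e (\<lambda>i j k. xs f (F i j k)) = (\<lambda>i j k. xs f (te e F i j k))"
proof -
  have "t1 (\<lambda>i j k. xs f (F i j k)) = (\<lambda>i j k. xs f (t1 F i j k))"
    "t2 (\<lambda>i j k. xs f (F i j k)) = (\<lambda>i j k. xs f (t2 F i j k))"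
    "t3 (\<lambda>i j k. xs f (F i j k)) = (\<lambda>i j k. xs f (t3 F i j k))"
    by (auto simp: t_defs fun_eq_iff add_hom_0[OF hom_xs] split: nat.splits)
  then show ?thesis by (simp add: te_def add_hom_add[OF hom_xs] add_hom_0[OF hom_xs] fun_eq_iff)
qed

lemma te_commute: "te e (te f F) = te f (te e F)"
  by (simp add: te_def t_simps ac_simps)

lemma lin_commute: "lin e (lin f F) = lin f (lin e F)"
proof -
  have *: "lin e (lin f F) = (\<lambda>i j k. xs e (xs f (F i j k))) + (\<lambda>i j k. xs e (te f F i j k))
      + ((\<lambda>i j k. xs f (te e F i j k)) + te e (te f F))" for e f
    unfolding lin_def add_hom_add[OF hom_te] te_xs by (simp add: fun_eq_iff add_hom_add[OF hom_xs] ac_simps)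
  show ?thesis unfolding *[of e f] *[of f e] by (simp add: xs_commute[of f e] te_commute[of f e] ac_simps)
qed

lemma te_Rg: "F \<in> Rg n \<Longrightarrow> te e F \<in> Rg (n + 1)"
  by (auto simp: te_def intro: t_Rg graded_add[OF graded_Rg] graded_0[OF graded_Rg])

lemma lin_Rg: "F \<in> Rg n \<Longrightarrow> lin e F \<in> Rg (n + 1)"
proof -
  assume F: "F \<in> Rg n"
  have "n + 1 - int i - int j - int k = n - int i - int j - int k + 1" for i j k by auto
  then have "(\<lambda>i j k. xs e (F i j k)) \<in> Rg (n + 1)"
    using F xs_V unfolding Rg_iff by metis
  then show ?thesis unfolding lin_def by (intro graded_add[OF graded_Rg] te_Rg F)
qed

lemma sum_edge: "(\<Sum>e\<in>UNIV. f (e :: edge)) = (\<Sum>r\<in>UNIV. f (r, False) + f (r, True) :: 'v :: comm_monoid_add)"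
proof -
  have "(\<Sum>e\<in>UNIV. f e) = (\<Sum>r\<in>UNIV. \<Sum>d\<in>UNIV. f (r, d))" unfolding sum.cartesian_product by simp
  then show ?thesis by (simp add: UNIV_bool)
qed

lemma sum_lin: "(\<Sum>e\<in>UNIV. if r = src e \<or> r = tgt e then lin e F else 0) = L r F"
proof -
  consider "r = (0, 0)" | "r = (1, 0)" | "r = (0, 1)" | "r = (1, 1)"
    by (cases r; cases "fst r"; cases "snd r") auto
  then show ?thesis
    by cases (simp_all add: sum_edge sum_vertex src_def tgt_def dir_def lin_def xs_def te_def L_def fun_eq_iff zero_prod_def ac_simps)
qed

definition edges :: "edge list" where
  "edges = (SOME es. set es = UNIV \<and> distinct es)"

lemma edges: "set edges = UNIV" "distinct edges"
  using someI_ex[OF finite_distinct_list[OF finite[of "UNIV :: edge set"]]] by (auto simp: edges_def)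

definition one_R :: "nat \<Rightarrow> nat \<Rightarrow> nat \<Rightarrow> 's" where
  "one_R = const_series (const_series (const_series unity))"

text \<open>A monomial in the images of the edges, applied to 1. The order of the edges is arbitrary
  because the operators commute.\<close>

definition lin_prod :: "(edge \<Rightarrow> nat) \<Rightarrow> nat \<Rightarrow> nat \<Rightarrow> nat \<Rightarrow> 's" where
  "lin_prod m = foldr (\<lambda>e. lin e ^^ m e) edges one_R"

lemma lin_power_commute: "lin e ((lin f ^^ k) F) = (lin f ^^ k) (lin e F)"
  by (induction k) (simp_all add: lin_commute[of e f])

lemma lin_prod_drop_edge: assumes "m e > 0" shows "lin_prod m = lin e (lin_prod (drop_edge m e))"
proof -
  have "distinct es \<Longrightarrow> foldr (\<lambda>e. lin e ^^ m e) es F = (if e \<in> set es then lin e else id)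
      (foldr (\<lambda>f. lin f ^^ drop_edge m e f) es F)" for es F
  proof (induction es)
    case (Cons f es)
    show ?case
    proof (cases "f = e")
      case True
      obtain k where "m e = Suc k" using assms gr0_implies_Suc by blast
      then show ?thesis using Cons True by (simp add: drop_edge_def)
    next
      case False
      then show ?thesis using Cons by (simp add: drop_edge_def lin_power_commute)
    qed
  qed simp
  from this[OF edges(2)] show ?thesis by (simp add: lin_prod_def edges(1))
qed

lemma lin_prod_0: "lin_prod (\<lambda>e. 0) = one_R"
proof -
  have "foldr (\<lambda>e. lin e ^^ 0) es F = F" for es F by (induction es) auto
  then show ?thesis by (simp add: lin_prod_def)
qed

lemma one_R_Rg: "one_R \<in> Rg 0"
  unfolding one_R_def Rg_def
  by (intro const_series_series graded_series graded) (simp add: V_0)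

lemma lin_prod_Rg: "lin_prod m \<in> Rg (int (sum m UNIV))"
proof (induction "sum m UNIV" arbitrary: m)
  case 0
  then have "m = (\<lambda>e. 0)" by auto
  then show ?case using one_R_Rg by (simp add: lin_prod_0)
next
  case (Suc n)
  then obtain e where e: "m e > 0" by (metis not_gr_zero sum.neutral nat.distinct(1))
  have "n = sum (drop_edge m e) UNIV" using Suc(2) sum_drop_edge[of m e, OF e] by simp
  from lin_Rg[OF Suc(1)[OF this], of e] show ?case
    unfolding lin_prod_drop_edge[of m e, OF e] Suc(2)[symmetric] \<open>n = _\<close>[symmetric] by (simp add: add.commute)
qed

end

section \<open>The substitution as a bijection in each degree\<close>

context symmetric_algebra
begin

definition raise_edge :: "edge \<Rightarrow> ((edge \<Rightarrow> nat) \<Rightarrow> bit) \<Rightarrow> (edge \<Rightarrow> nat) \<Rightarrow> bit" where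
  "raise_edge e \<phi> = (\<lambda>m. if m e > 0 then \<phi> (drop_edge m e) else 0)"

text \<open>The substitution of the linear forms for the edges, on polynomials given by coefficient
  functions.\<close>

definition Theta :: "nat \<Rightarrow> ((edge \<Rightarrow> nat) \<Rightarrow> bit) \<Rightarrow> nat \<Rightarrow> nat \<Rightarrow> nat \<Rightarrow> 's" where
  "Theta n \<phi> = (\<Sum>m\<in>{m. sum m UNIV = n}. scale (\<phi> m) (lin_prod m))"

definition homogeneous :: "nat \<Rightarrow> ((edge \<Rightarrow> nat) \<Rightarrow> bit) set" where
  "homogeneous n = supported {m. sum m UNIV = n}"

lemma hom_Theta: "add_hom (Theta n)"
  by (rule add_homI) (simp add: Theta_def scale_add_left sum.distrib)

lemma Theta_raise_edge: "Theta (Suc n) (raise_edge e \<phi>) = lin e (Theta n \<phi>)"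
proof -
  have "Theta (Suc n) (raise_edge e \<phi>)
      = (\<Sum>m\<in>{m. sum m UNIV = Suc n \<and> m e > 0}. scale (\<phi> (drop_edge m e)) (lin_prod m))"
    unfolding Theta_def
    by (rule sum.mono_neutral_cong_right) (auto simp: finite_multidegrees raise_edge_def)
  also have "\<dots> = (\<Sum>m\<in>{m. sum m UNIV = n}. scale (\<phi> m) (lin e (lin_prod m)))"
  proof (rule sum.reindex_bij_witness[where i = "\<lambda>m. m(e := Suc (m e))" and j = "\<lambda>m. drop_edge m e"])
    fix m assume m: "m \<in> {m. sum m UNIV = Suc n \<and> m e > 0}"
    then show "(drop_edge m e)(e := Suc (drop_edge m e e)) = m" by (auto simp: drop_edge_def)
    show "drop_edge m e \<in> {m. sum m UNIV = n}" using m sum_drop_edge[of m e] by simp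
    show "scale (\<phi> (drop_edge m e)) (lin e (lin_prod (drop_edge m e))) = scale (\<phi> (drop_edge m e)) (lin_prod m)"
      using m lin_prod_drop_edge[of m e] by simp
  next
    fix m :: "edge \<Rightarrow> nat" assume m: "m \<in> {m. sum m UNIV = n}"
    show eq: "drop_edge (m(e := Suc (m e))) e = m" by (simp add: drop_edge_def)
    show "m(e := Suc (m e)) \<in> {m. sum m UNIV = Suc n \<and> m e > 0}"
      using sum_drop_edge[of "m(e := Suc (m e))" e] m unfolding eq by simp
  qed
  also have "\<dots> = lin e (Theta n \<phi>)"
    unfolding Theta_def add_hom_sum[OF hom_lin] scale_hom[OF hom_lin] ..
  finally show ?thesis .
qed

lemma incident_eq: "incident r \<phi> = (\<Sum>e\<in>UNIV. if r = src e \<or> r = tgt e then raise_edge e \<phi> else 0)"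
  unfolding fun_eq_iff incident_def sum_fun_apply
  by (intro allI sum.cong refl) (auto simp: raise_edge_def)

text \<open>The purpose of the corrections \<open>te\<close>: by \<open>sum_lin\<close>
  multiplication by a vertex form becomes multiplication by \<open>L r\<close>.\<close>

lemma Theta_incident: "Theta (Suc n) (incident r \<phi>) = L r (Theta n \<phi>)"
proof -
  have "Theta (Suc n) (incident r \<phi>)
      = (\<Sum>e\<in>UNIV. if r = src e \<or> r = tgt e then Theta (Suc n) (raise_edge e \<phi>) else 0)"
    unfolding incident_eq add_hom_sum[OF hom_Theta]
    by (rule sum.cong) (auto simp: add_hom_0[OF hom_Theta])
  then show ?thesis by (simp only: Theta_raise_edge sum_lin)
qed

lemma Theta_Rg: "Theta n \<phi> \<in> Rg (int n)"
proof -
  have "(\<Sum>m\<in>A. scale (\<phi> m) (lin_prod m)) \<in> Rg (int n)" if "finite A" "A \<subseteq> {m. sum m UNIV = n}" for A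
    using that
  proof (induction A)
    case empty
    show ?case unfolding sum.empty by (rule graded_0[OF graded_Rg])
  next
    case (insert m A)
    have "scale (\<phi> m) (lin_prod m) \<in> Rg (int n)"
      using lin_prod_Rg[of m] insert(4) graded_0[OF graded_Rg, of "int n"] unfolding scale_def by auto
    moreover have "(\<Sum>m\<in>A. scale (\<phi> m) (lin_prod m)) \<in> Rg (int n)" using insert by simp
    ultimately show ?case unfolding sum.insert[OF insert(1,2)] by (rule graded_add[OF graded_Rg])
  qed
  from this[OF finite_multidegrees] show ?thesis by (simp add: Theta_def)
qed

lemma raise_edge_homogeneous:
  assumes "\<phi> \<in> homogeneous n" shows "raise_edge e \<phi> \<in> homogeneous (Suc n)"
proof -
  have "sum m UNIV = Suc n" if "raise_edge e \<phi> m \<noteq> 0" for m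
  proof -
    have m: "m e > 0" "\<phi> (drop_edge m e) \<noteq> 0" using that by (auto simp: raise_edge_def split: if_splits)
    then have "sum (drop_edge m e) UNIV = n" using assms by (auto simp: homogeneous_def supported_def)
    then show ?thesis using sum_drop_edge[of m e] m(1) by simp
  qed
  then show ?thesis by (auto simp: homogeneous_def supported_def)
qed

definition const_R :: "'s \<Rightarrow> nat \<Rightarrow> nat \<Rightarrow> nat \<Rightarrow> 's" where
  "const_R v = const_series (const_series (const_series v))"

lemma const_R_apply: "const_R v i j k = (if i = 0 \<and> j = 0 \<and> k = 0 then v else 0)"
  by (simp add: const_R_def const_series_def)

text \<open>Division by \<open>t1\<close>, of the remainder by \<open>t2\<close>, and of the next
  remainder by \<open>t3\<close>.\<close>

lemma R_decompose:
  "F = t1 (s1 F) + t2 (s2 (F + t1 (s1 F)))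
     + t3 (s3 (F + t1 (s1 F) + t2 (s2 (F + t1 (s1 F))))) + const_R (F 0 0 0)"
proof (intro ext)
  fix i j k show "F i j k = (t1 (s1 F) + t2 (s2 (F + t1 (s1 F)))
     + t3 (s3 (F + t1 (s1 F) + t2 (s2 (F + t1 (s1 F))))) + const_R (F 0 0 0)) i j k"
    by (cases i; cases j; cases k) (simp_all add: t_defs const_R_apply)
qed

text \<open>Together with \<open>t_lin\<close> this expresses the eight generators of
  \<open>S[t1, t2, t3]\<close> through the images of the eight edges.\<close>

lemma lin_const_R:
  "const_R (ma v) = lin ((0, 0), False) (const_R v)"
  "const_R (mb v) = lin ((0, 0), True) (const_R v)"
  "const_R (mw v) = lin ((0, 0), False) (const_R v) + lin ((1, 0), False) (const_R v)"
  "const_R (mal v) = lin ((0, 0), False) (const_R v) + lin ((0, 1), False) (const_R v)"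
  "const_R (mbe v) = lin ((0, 0), True) (const_R v) + lin ((1, 0), True) (const_R v)"
  by (auto simp: lin_def xs_def te_def const_R_apply fun_eq_iff hom_simps)

lemma t_lin:
  "t1 F = lin ((0, 0), True) F + lin ((0, 1), True) F + lin ((0, 0), False) F + lin ((1, 0), False) F"
  "t2 F = lin ((1, 0), True) F + lin ((1, 1), True) F + lin ((0, 0), False) F + lin ((1, 0), False) F"
  "t3 F = t1 F + lin ((0, 0), False) F + lin ((1, 0), False) F + lin ((0, 1), False) F + lin ((1, 1), False) F"
  by (auto simp: lin_def xs_def te_def fun_eq_iff ac_simps)

lemma Theta_onto: "Theta n ` homogeneous n = Rg (int n)"
proof (induction n)
  case 0
  have "F \<in> Theta 0 ` homogeneous 0" if F: "F \<in> Rg 0" for F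
  proof -
    have "F i j k = (if i = 0 \<and> j = 0 \<and> k = 0 then F 0 0 0 else 0)" for i j k
      using graded_neg[OF graded, of "0 - int i - int j - int k" "F i j k"] F by (auto simp: Rg_iff)
    moreover have "F 0 0 0 = 0 \<or> F 0 0 0 = unity"
      using F V_0 unfolding Rg_iff by (metis diff_zero empty_iff insert_iff of_nat_0)
    moreover have "F = const_R (F 0 0 0)"
      by (intro ext) (simp only: const_R_apply, rule \<open>\<And>i j k. F i j k = _\<close>)
    moreover have "const_R 0 = 0" "const_R unity = one_R"
      by (simp_all add: const_R_def one_R_def const_series_def fun_eq_iff)
    ultimately have "F = scale 0 one_R \<or> F = scale 1 one_R" by (metis scale_simps)
    then obtain c where c: "F = scale c one_R" by blast
    let ?\<phi> = "\<lambda>m. if m = (\<lambda>e. 0) then c else 0"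
    have "{m :: edge \<Rightarrow> nat. sum m UNIV = 0} = {\<lambda>e. 0}" by auto
    then have "F = Theta 0 ?\<phi>" unfolding c by (simp add: Theta_def lin_prod_0)
    moreover have "?\<phi> \<in> homogeneous 0" by (auto simp: homogeneous_def supported_iff)
    ultimately show ?thesis by (rule image_eqI)
  qed
  then show ?case using Theta_Rg[of 0] by auto
next
  case (Suc n)
  let ?I = "Theta (Suc n) ` homogeneous (Suc n)"
  have closed: "F + G \<in> ?I" if "F \<in> ?I" "G \<in> ?I" for F G
    using that add_closed_add[OF add_closed_image[OF add_closed_supported hom_Theta]]
    unfolding homogeneous_def by blast
  have lin: "lin e F \<in> ?I" if "F \<in> Rg (int n)" for e F
  proof -
    obtain \<phi> where "\<phi> \<in> homogeneous n" "F = Theta n \<phi>" using Suc \<open>F \<in> Rg (int n)\<close> by blast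
    then have "lin e F = Theta (Suc n) (raise_edge e \<phi>)" "raise_edge e \<phi> \<in> homogeneous (Suc n)"
      by (simp_all add: Theta_raise_edge raise_edge_homogeneous)
    then show ?thesis by (rule image_eqI)
  qed
  have t: "t1 F \<in> ?I" "t2 F \<in> ?I" "t3 F \<in> ?I" if "F \<in> Rg (int n)" for F
  proof -
    note l = lin[OF that]
    show t1: "t1 F \<in> ?I" unfolding t_lin(1) by (intro closed l)
    show "t2 F \<in> ?I" unfolding t_lin(2) by (intro closed l)
    show "t3 F \<in> ?I" unfolding t_lin(3) by (intro closed l t1)
  qed
  have const: "const_R v \<in> Rg (int n)" if "v \<in> V (int n)" for v
    using that by (auto simp: Rg_iff const_R_apply graded_0[OF graded])
  have "F \<in> ?I" if F: "F \<in> Rg (int (Suc n))" for F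
  proof -
    have s1: "s1 F \<in> Rg (int n)" using s_Rg(1)[OF F] by simp
    have F1: "F + t1 (s1 F) \<in> Rg (int (Suc n))"
      by (rule graded_add[OF graded_Rg F]) (use t_Rg(1)[OF s1] in \<open>simp add: add.commute\<close>)
    have s2: "s2 (F + t1 (s1 F)) \<in> Rg (int n)" using s_Rg(2)[OF F1] by simp
    have F2: "F + t1 (s1 F) + t2 (s2 (F + t1 (s1 F))) \<in> Rg (int (Suc n))"
      by (rule graded_add[OF graded_Rg F1]) (use t_Rg(2)[OF s2] in \<open>simp add: add.commute\<close>)
    have s3: "s3 (F + t1 (s1 F) + t2 (s2 (F + t1 (s1 F)))) \<in> Rg (int n)" using s_Rg(3)[OF F2] by simp
    have "F 0 0 0 \<in> V (int (Suc n))" using F unfolding Rg_iff by (metis diff_zero of_nat_0)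
    then obtain a b c d e where abc: "a \<in> V (int n)" "b \<in> V (int n)" "c \<in> V (int n)" "d \<in> V (int n)" "e \<in> V (int n)"
      "F 0 0 0 = ma a + mb b + mw c + mal d + mbe e"
      using generate[of "int (Suc n)" "F 0 0 0"] by auto
    have "const_R (F 0 0 0) = const_R (ma a) + const_R (mb b) + const_R (mw c) + const_R (mal d) + const_R (mbe e)"
      unfolding abc(6) by (simp add: fun_eq_iff const_R_apply)
    also have "\<dots> \<in> ?I" unfolding lin_const_R by (intro closed lin const abc)
    finally have "const_R (F 0 0 0) \<in> ?I" .
    then show "F \<in> ?I" by (subst R_decompose) (intro closed t s1 s2 s3)
  qed
  then show ?case using Theta_Rg by blast
qed

text \<open>A surjection between finite sets of equal size; both have the exponent
  \<open>(n + 7) choose 7\<close>, since the five generators of \<open>S\<close> and the three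
  \<open>t\<close>'s are as many as the edges.\<close>

lemma inj_Theta: "inj_on (Theta n) (homogeneous n)"
proof (rule eq_card_imp_inj_on)
  show "finite (homogeneous n)" unfolding homogeneous_def by (rule finite_supported[OF finite_multidegrees])
  have "card (homogeneous n) = 2 ^ ((n + 7) choose 7)"
    unfolding homogeneous_def by (simp only: card_supported[OF finite_multidegrees] card_multidegrees)
  then show "card (Theta n ` homogeneous n) = card (homogeneous n)"
    unfolding Theta_onto by (simp only: card_Rg)
qed

section \<open>The Koszul complex in the new coordinates\<close>

definition comp :: "nat \<Rightarrow> (pair \<Rightarrow> bit) \<Rightarrow> vertex set \<Rightarrow> nat \<Rightarrow> nat \<Rightarrow> nat \<Rightarrow> 's" where
  "comp N g B = Theta (N - card B) (\<lambda>m. g (m, B))"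

definition kd :: "(vertex set \<Rightarrow> nat \<Rightarrow> nat \<Rightarrow> nat \<Rightarrow> 's) \<Rightarrow> vertex set \<Rightarrow> nat \<Rightarrow> nat \<Rightarrow> nat \<Rightarrow> 's" where
  "kd F B = (\<Sum>r\<in>- B. L r (F (insert r B)))"

lemma layer_section:
  assumes "g \<in> layer N j" "j \<le> N" shows "(\<lambda>m. g (m, B)) \<in> homogeneous (N - j)"
proof -
  have "sum m UNIV = N - j" if "g (m, B) \<noteq> 0" for m
  proof -
    have "(m, B) \<in> layer_pairs N j" using that assms(1) unfolding layer_def supported_def by blast
    then show ?thesis by (auto simp: layer_pairs_def)
  qed
  then show ?thesis by (auto simp: homogeneous_def supported_def)
qed

lemma layer_empty: "N < j \<Longrightarrow> g \<in> layer N j \<Longrightarrow> g = 0"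
  by (auto simp: layer_def supported_iff layer_pairs_def fun_eq_iff)

lemma comp_0: "comp N 0 B = 0"
proof -
  have "comp N 0 B = Theta (N - card B) 0" by (simp add: comp_def zero_fun_def)
  then show ?thesis by (simp add: add_hom_0[OF hom_Theta])
qed

lemma comp_Rg: assumes "g \<in> layer N j" "card B = j" shows "comp N g B \<in> Rg (int N - int j)"
proof (cases "N < j")
  case True
  then show ?thesis using layer_empty[OF True assms(1)] by (simp add: comp_0 graded_0[OF graded_Rg])
next
  case False
  then show ?thesis using Theta_Rg[of "N - j" "\<lambda>m. g (m, B)"] assms by (simp add: comp_def of_nat_diff)
qed

lemma comp_koszul:
  assumes g: "g \<in> layer N (Suc j)" and B: "card B = j"
  shows "comp N (koszul g) B = kd (comp N g) B"
proof (cases "N < Suc j")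
  case True
  then have "g = 0" using layer_empty g by blast
  then show ?thesis
    by (simp add: comp_0 kd_def add_hom_0[OF hom_koszul] add_hom_0[OF hom_L])
next
  case False
  then have N: "N - j = Suc (N - Suc j)" by simp
  have eq: "(\<lambda>m. koszul g (m, B)) = (\<Sum>r\<in>- B. incident r (\<lambda>m. g (m, insert r B)))"
    by (simp add: koszul_def fun_eq_iff sum_fun_apply)
  have "comp N (koszul g) B = (\<Sum>r\<in>- B. Theta (N - j) (incident r (\<lambda>m. g (m, insert r B))))"
    unfolding comp_def eq B add_hom_sum[OF hom_Theta] ..
  also have "\<dots> = kd (comp N g) B"
    unfolding kd_def N Theta_incident comp_def by (rule sum.cong) (use B in auto)
  finally show ?thesis .
qed

lemma comp_inject:
  assumes g: "g \<in> layer N j" "g' \<in> layer N j" and eq: "\<And>B. card B = j \<Longrightarrow> comp N g B = comp N g' B"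
  shows "g = g'"
proof (cases "N < j")
  case True
  then show ?thesis using layer_empty g by metis
next
  case False
  have "g (m, B) = g' (m, B)" for m B
  proof (cases "card B = j")
    case True
    then have "(\<lambda>m. g (m, B)) = (\<lambda>m. g' (m, B))"
      using inj_onD[OF inj_Theta[of "N - j"], of "\<lambda>m. g (m, B)" "\<lambda>m. g' (m, B)"] eq[OF True]
        layer_section[OF g(1)] layer_section[OF g(2)] False by (simp add: comp_def)
    then show ?thesis by (rule fun_cong)
  next
    case B: False
    then show ?thesis using g by (auto simp: layer_def supported_iff layer_pairs_def)
  qed
  then show ?thesis by (auto simp: fun_eq_iff)
qed

lemma comp_surj:
  assumes F: "\<And>B. card B = j \<Longrightarrow> F B \<in> Rg (int N - int j)"
  shows "\<exists>g\<in>layer N j. \<forall>B. card B = j \<longrightarrow> comp N g B = F B"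
\<comment> \<open>For \<open>N < j\<close> the subtraction \<open>N - j\<close> is truncated, so
  this case is settled separately: the integer degree is negative and everything is 0.\<close>
proof (cases "N < j")
  case True
  then have "F B = 0" if "card B = j" for B using graded_neg[OF graded_Rg _ F[OF that]] by simp
  moreover have "0 \<in> layer N j" by (rule add_closed_0[OF add_closed_layer])
  ultimately show ?thesis using comp_0 by (intro bexI[of _ 0]) auto
next
  case False
  have "\<exists>\<phi>. \<phi> \<in> homogeneous (N - j) \<and> Theta (N - j) \<phi> = F B" if "card B = j" for B
  proof -
    have "F B \<in> Rg (int (N - j))" using F[OF that] False by (simp add: of_nat_diff)
    then have "F B \<in> Theta (N - j) ` homogeneous (N - j)" by (simp only: Theta_onto)
    then obtain \<phi> where "F B = Theta (N - j) \<phi>" "\<phi> \<in> homogeneous (N - j)" by (rule imageE)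
    then show ?thesis by (intro exI[of _ \<phi>] conjI) simp_all
  qed
  then obtain \<Phi> where \<Phi>: "\<And>B. card B = j \<Longrightarrow> \<Phi> B \<in> homogeneous (N - j) \<and> Theta (N - j) (\<Phi> B) = F B"
    by metis
  define g where "g = (\<lambda>(m, B). if card B = j then \<Phi> B m else 0)"
  have "g (m, B) = 0" if "(m, B) \<notin> layer_pairs N j" for m B
  proof (cases "card B = j")
    case True
    then have "sum m UNIV \<noteq> N - j" using that False by (auto simp: layer_pairs_def)
    then show ?thesis using \<Phi>[OF True] True by (simp add: g_def homogeneous_def supported_iff)
  qed (simp add: g_def)
  then have "g \<in> layer N j" by (auto simp: layer_def supported_iff)
  moreover have "comp N g B = F B" if "card B = j" for B
    using \<Phi>[OF that] that by (simp add: comp_def g_def)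
  ultimately show ?thesis by blast
qed

end

subsection \<open>Exactness of the Koszul complex\<close>

lemma UNIV_vertex: "(UNIV :: vertex set) = {(0, 0), (1, 0), (0, 1), (1, 1)}"
proof (intro equalityI subsetI)
  fix r :: vertex show "r \<in> {(0, 0), (1, 0), (0, 1), (1, 1)}" by (cases r; cases "fst r"; cases "snd r") auto
qed simp

lemma sum_Compl_vertex:
  fixes f :: "vertex \<Rightarrow> 'v :: comm_monoid_add"
  shows "(\<Sum>r\<in>- B. f r) = (if (0, 0) \<in> B then 0 else f (0, 0)) + (if (1, 0) \<in> B then 0 else f (1, 0))
    + (if (0, 1) \<in> B then 0 else f (0, 1)) + (if (1, 1) \<in> B then 0 else f (1, 1))"
proof -
  have "(\<Sum>r\<in>- B. f r) = (\<Sum>r\<in>UNIV. if r \<in> B then 0 else f r)"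
    by (rule sum.mono_neutral_cong_left) auto
  then show ?thesis by (simp only: sum_vertex)
qed

lemma vertex_sets:
  fixes B :: "vertex set"
  shows "card B = 0 \<Longrightarrow> B = {}"
    "card B = 1 \<Longrightarrow> B = {(0, 0)} \<or> B = {(1, 0)} \<or> B = {(0, 1)} \<or> B = {(1, 1)}"
    "card B = 2 \<Longrightarrow> B = {(0, 0), (1, 0)} \<or> B = {(0, 0), (0, 1)} \<or> B = {(0, 0), (1, 1)} \<or>
      B = {(1, 0), (0, 1)} \<or> B = {(1, 0), (1, 1)} \<or> B = {(0, 1), (1, 1)}"
    "card B = 3 \<Longrightarrow> B = {(0, 0), (1, 0), (0, 1)} \<or> B = {(0, 0), (1, 0), (1, 1)} \<or>
      B = {(0, 0), (0, 1), (1, 1)} \<or> B = {(1, 0), (0, 1), (1, 1)}"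
    "card B = 4 \<Longrightarrow> B = {(0, 0), (1, 0), (0, 1), (1, 1)}"
proof -
  define S where "S c d e f = (if c then insert (0 :: bit, 0) else id) ((if d then insert (1, 0) else id)
    ((if e then insert (0, 1) else id) ((if f then insert (1, 1 :: bit) else id) {})))" for c d e f
  have S: "S c d e f = {} \<or> S c d e f = {(0, 0)} \<or> S c d e f = {(1, 0)} \<or> S c d e f = {(0, 1)} \<or> S c d e f = {(1, 1)} \<or>
    S c d e f = {(0, 0), (1, 0)} \<or> S c d e f = {(0, 0), (0, 1)} \<or> S c d e f = {(0, 0), (1, 1)} \<or>
      S c d e f = {(1, 0), (0, 1)} \<or> S c d e f = {(1, 0), (1, 1)} \<or> S c d e f = {(0, 1), (1, 1)} \<or>
      S c d e f = {(0, 0), (1, 0), (0, 1)} \<or> S c d e f = {(0, 0), (1, 0), (1, 1)} \<or>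
      S c d e f = {(0, 0), (0, 1), (1, 1)} \<or> S c d e f = {(1, 0), (0, 1), (1, 1)} \<or> S c d e f = {(0, 0), (1, 0), (0, 1), (1, 1)}" for c d e f
    by (cases c; cases d; cases e; cases f) (simp_all add: S_def)
  have "r \<in> B \<longleftrightarrow> r \<in> S ((0, 0) \<in> B) ((1, 0) \<in> B) ((0, 1) \<in> B) ((1, 1) \<in> B)" for r
    using UNIV_I[of r] unfolding UNIV_vertex by (auto simp: S_def)
  then have "B = S ((0, 0) \<in> B) ((1, 0) \<in> B) ((0, 1) \<in> B) ((1, 1) \<in> B)" by blast
  then obtain c d e f where "B = S c d e f" by blast
  then have B: "B = {} \<or> B = {(0, 0)} \<or> B = {(1, 0)} \<or> B = {(0, 1)} \<or> B = {(1, 1)} \<or>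
    B = {(0, 0), (1, 0)} \<or> B = {(0, 0), (0, 1)} \<or> B = {(0, 0), (1, 1)} \<or>
      B = {(1, 0), (0, 1)} \<or> B = {(1, 0), (1, 1)} \<or> B = {(0, 1), (1, 1)} \<or>
      B = {(0, 0), (1, 0), (0, 1)} \<or> B = {(0, 0), (1, 0), (1, 1)} \<or>
      B = {(0, 0), (0, 1), (1, 1)} \<or> B = {(1, 0), (0, 1), (1, 1)} \<or> B = {(0, 0), (1, 0), (0, 1), (1, 1)}"
    using S[of c d e f] by (simp only:)
  show "card B = 0 \<Longrightarrow> B = {}" by simp
  show "card B = 1 \<Longrightarrow> B = {(0, 0)} \<or> B = {(1, 0)} \<or> B = {(0, 1)} \<or> B = {(1, 1)}"
    using B by (elim disjE) simp_all
  show "card B = 2 \<Longrightarrow> B = {(0, 0), (1, 0)} \<or> B = {(0, 0), (0, 1)} \<or> B = {(0, 0), (1, 1)} \<or>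
      B = {(1, 0), (0, 1)} \<or> B = {(1, 0), (1, 1)} \<or> B = {(0, 1), (1, 1)}"
    using B by (elim disjE) simp_all
  show "card B = 3 \<Longrightarrow> B = {(0, 0), (1, 0), (0, 1)} \<or> B = {(0, 0), (1, 0), (1, 1)} \<or>
      B = {(0, 0), (0, 1), (1, 1)} \<or> B = {(1, 0), (0, 1), (1, 1)}"
    using B by (elim disjE) simp_all
  show "card B = 4 \<Longrightarrow> B = {(0, 0), (1, 0), (0, 1), (1, 1)}"
    using B by (elim disjE) simp_all
qed

text \<open>Brings the sets produced by \<open>insert\<close> into the listing order of
  \<open>vertex_sets\<close>, so that \<open>kd\<close> evaluates by simplification.\<close>

lemma vertex_set_order:
  "{(1, 0), (0, 0)} = {(0, 0), (1, 0) :: vertex}"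
  "{(0, 1), (0, 0)} = {(0, 0), (0, 1) :: vertex}"
  "{(1, 1), (0, 0)} = {(0, 0), (1, 1) :: vertex}"
  "{(0, 1), (1, 0)} = {(1, 0), (0, 1) :: vertex}"
  "{(1, 1), (1, 0)} = {(1, 0), (1, 1) :: vertex}"
  "{(1, 1), (0, 1)} = {(0, 1), (1, 1) :: vertex}"
  "{(1, 0), (0, 0), (0, 1)} = {(0, 0), (1, 0), (0, 1) :: vertex}"
  "{(0, 1), (0, 0), (1, 0)} = {(0, 0), (1, 0), (0, 1) :: vertex}"
  "{(1, 1), (0, 0), (1, 0)} = {(0, 0), (1, 0), (1, 1) :: vertex}"
  "{(1, 0), (0, 0), (1, 1)} = {(0, 0), (1, 0), (1, 1) :: vertex}"
  "{(0, 1), (0, 0), (1, 1)} = {(0, 0), (0, 1), (1, 1) :: vertex}"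
  "{(1, 1), (0, 0), (0, 1)} = {(0, 0), (0, 1), (1, 1) :: vertex}"
  "{(0, 1), (1, 0), (1, 1)} = {(1, 0), (0, 1), (1, 1) :: vertex}"
  "{(1, 1), (1, 0), (0, 1)} = {(1, 0), (0, 1), (1, 1) :: vertex}"
  "{(1, 0), (0, 0), (0, 1), (1, 1)} = {(0, 0), (1, 0), (0, 1), (1, 1) :: vertex}"
  "{(0, 1), (0, 0), (1, 0), (1, 1)} = {(0, 0), (1, 0), (0, 1), (1, 1) :: vertex}"
  "{(1, 1), (0, 0), (1, 0), (0, 1)} = {(0, 0), (1, 0), (0, 1), (1, 1) :: vertex}"
  by (simp_all add: insert_commute)

context symmetric_algebra
begin

text \<open>\<open>q'\<close> divides by the variable \<open>q\<close> and commutes with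
  \<open>p\<close>; applied to the relation it solves for \<open>Q\<close>, and cancelling
  \<open>p\<close> then gives \<open>P\<close>.\<close>

lemma regular_pair:
  assumes eq: "p P + q Q = 0" and h: "add_hom p" "add_hom q" "add_hom q'" "add_hom p'"
    and l: "\<And>F. q' (q F) = F" "\<And>F. p' (p F) = F" "\<And>F. q' (p F) = p (q' F)" "\<And>F. q (p F) = p (q F)"
  shows "P = q (q' P) \<and> Q = p (q' P)"
proof -
  have "q' (p P + q Q) = 0" unfolding eq by (rule add_hom_0[OF h(3)])
  then have Q: "Q = p (q' P)" by (simp add: add_hom_add[OF h(3)] l add_eq_0_iff_char_2)
  have "p (P + q (q' P)) = p P + q Q" by (simp add: Q l add_hom_add[OF h(1)])
  then have "p' (p (P + q (q' P))) = p' 0" unfolding eq by simp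
  then have "P + q (q' P) = 0" unfolding l add_hom_0[OF h(4)] .
  then show ?thesis using Q by (simp add: add_eq_0_iff_char_2)
qed

lemma regular_12: "t1 P + t2 Q = 0 \<Longrightarrow> P = t2 (s2 P) \<and> Q = t1 (s2 P)"
  by (rule regular_pair[where p' = s1]) (simp_all add: hom_t s_t t_commute)

lemma regular_23: "t2 P + t3 Q = 0 \<Longrightarrow> P = t3 (s3 P) \<and> Q = t2 (s3 P)"
  by (rule regular_pair[where p' = s2]) (simp_all add: hom_t s_t t_commute)

lemma t_inject: "t1 P = t1 Q \<Longrightarrow> P = Q" "t2 P = t2 Q \<Longrightarrow> P = Q" "t3 P = t3 Q \<Longrightarrow> P = Q"
  by (metis s_t(1)) (metis s_t(2), metis s_t(3))

text \<open>The Koszul relations generate the syzygies of three variables: dividing by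
  \<open>t3\<close> solves for \<open>C\<close>, and subtracting the multiples of \<open>t3\<close>
  leaves a relation of two variables.\<close>

lemma regular_123:
  assumes eq: "t1 A + t2 B + t3 C = 0" and Rg: "A \<in> Rg n" "B \<in> Rg n" "C \<in> Rg n"
  shows "\<exists>u\<in>Rg (n - 1). \<exists>v\<in>Rg (n - 1). \<exists>z\<in>Rg (n - 1).
    A = t2 u + t3 v \<and> B = t1 u + t3 z \<and> C = t1 v + t2 z"
proof -
  have "s3 (t1 A + t2 B + t3 C) = 0" unfolding eq by (rule add_hom_0[OF hom_t(6)])
  then have "t1 (s3 A) + t2 (s3 B) + C = 0" by (simp only: t_simps)
  then have C: "C = t1 (s3 A) + t2 (s3 B)" unfolding add_eq_0_iff_char_2 by (rule sym)
  have "t1 (A + t3 (s3 A)) + t2 (B + t3 (s3 B)) = t1 A + t2 B + t3 C"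
    unfolding C t_simps by (simp add: ac_simps)
  then have AB: "A + t3 (s3 A) = t2 (s2 (A + t3 (s3 A)))" "B + t3 (s3 B) = t1 (s2 (A + t3 (s3 A)))"
    using regular_12[of "A + t3 (s3 A)" "B + t3 (s3 B)"] eq by simp_all
  have mem: "A + t3 (s3 A) \<in> Rg n" "s3 A \<in> Rg (n - 1)" "s3 B \<in> Rg (n - 1)"
    using t_Rg(3)[OF s_Rg(3)[OF Rg(1)]] Rg s_Rg(3) graded_add[OF graded_Rg] by auto
  show ?thesis
  proof (intro bexI conjI)
    show "A = t2 (s2 (A + t3 (s3 A))) + t3 (s3 A)" unfolding AB(1)[symmetric] by (rule add_self_right[symmetric])
    show "B = t1 (s2 (A + t3 (s3 A))) + t3 (s3 B)" unfolding AB(2)[symmetric] by (rule add_self_right[symmetric])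
    show "C = t1 (s3 A) + t2 (s3 B)" by (rule C)
  qed (use mem s_Rg(2)[OF mem(1)] in auto)
qed

lemma kd_eq_0:
  assumes "g \<in> layer N (Suc j)" "koszul g = 0" "card B = j"
  shows "kd (comp N g) B = 0"
  using comp_koszul[OF assms(1,3)] comp_0[of N B] assms(2) by simp

lemmas kd_simps = kd_def sum_Compl_vertex L_def vertex_set_order

text \<open>There is a single component, and multiplication by \<open>t3\<close> is
  injective.\<close>

lemma exact_4: assumes a: "a \<in> layer N 4" "koszul a = 0" shows "a = 0"
proof (rule comp_inject[OF a(1) add_closed_0[OF add_closed_layer]])
  fix B :: "vertex set" assume B: "card B = 4"
  have "kd (comp N a) {(0, 0), (1, 0), (1, 1)} = 0" by (rule kd_eq_0[of _ _ 3]) (use a in simp_all)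
  then have "t3 (comp N a {(0, 0), (1, 0), (0, 1), (1, 1)}) = t3 0"
    by (simp add: kd_simps t_simps)
  then have "comp N a B = 0" using t_inject(3) vertex_sets(5)[OF B] by metis
  then show "comp N a B = comp N 0 B" by (simp only: comp_0)
qed

text \<open>The cycle conditions force the component on each triple to be the form of its missing
  vertex times one common \<kappa>.\<close>

lemma exact_3: assumes b: "b \<in> layer N 3" "koszul b = 0" shows "\<exists>a\<in>layer N 4. b = koszul a"
proof -
  let ?K = "comp N b"
  define \<kappa> where "\<kappa> = s3 (?K {(0, 0), (1, 0), (1, 1)})"
  have "?K {(0, 0), (1, 0), (1, 1)} \<in> Rg (int N - int 3)" by (rule comp_Rg[OF b(1)]) simp
  from s_Rg(3)[OF this] have "\<kappa> \<in> Rg (int N - int 4)" by (simp add: \<kappa>_def)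
  then obtain a where a: "a \<in> layer N 4" "\<And>B. card B = 4 \<Longrightarrow> comp N a B = \<kappa>"
    using comp_surj[of 4 "\<lambda>_. \<kappa>" N] by blast
  have z: "kd ?K B = 0" if "card B = 2" for B by (rule kd_eq_0[of _ _ 2]) (use b that in simp_all)
  have "t2 (?K {(0, 0), (1, 0), (1, 1)}) + t3 (?K {(0, 0), (0, 1), (1, 1)}) = 0"
    using z[of "{(0, 0), (1, 1)}"] by (simp add: kd_simps)
  from regular_23[OF this] have K: "?K {(0, 0), (1, 0), (1, 1)} = t3 \<kappa>" "?K {(0, 0), (0, 1), (1, 1)} = t2 \<kappa>"
    by (simp_all add: \<kappa>_def)
  have "t1 (t3 \<kappa>) + t3 (?K {(1, 0), (0, 1), (1, 1)}) = 0"
    using z[of "{(1, 0), (1, 1)}"] by (simp add: kd_simps K)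
  then have K3: "?K {(1, 0), (0, 1), (1, 1)} = t1 \<kappa>"
    by - (rule t_inject(3), simp add: t_commute add_eq_0_iff_char_2)
  have "t3 (?K {(0, 0), (1, 0), (0, 1)}) + (t1 (t3 \<kappa>) + t2 (t3 \<kappa>) + t3 (t3 \<kappa>)) = 0"
    using z[of "{(0, 0), (1, 0)}"] by (simp add: kd_simps K)
  then have K4: "?K {(0, 0), (1, 0), (0, 1)} = t1 \<kappa> + t2 \<kappa> + t3 \<kappa>"
    by - (rule t_inject(3), simp add: t_simps add_eq_0_iff_char_2)
  have "b = koszul a"
  proof (rule comp_inject[OF b(1) koszul_layer])
    show "a \<in> layer N (Suc 3)" using a(1) by simp
    fix B :: "vertex set" assume B: "card B = 3"
    have "comp N (koszul a) B = kd (comp N a) B" by (rule comp_koszul[OF _ B]) (use a in simp)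
    also have "\<dots> = ?K B" using vertex_sets(4)[OF B]
      by (elim disjE) (simp_all add: kd_simps a(2) K K3 K4)
    finally show "?K B = comp N (koszul a) B" ..
  qed
  then show ?thesis using a(1) by blast
qed

lemma exact_2: assumes c: "c \<in> layer N 2" "koszul c = 0" shows "\<exists>b\<in>layer N 3. c = koszul b"
proof -
  let ?H = "comp N c"
  let ?v1 = "(0, 0)" and ?v2 = "(1, 0)" and ?v3 = "(0, 1)" and ?v4 = "(1, 1)"
  have z: "kd ?H B = 0" if "card B = 1" for B by (rule kd_eq_0[of _ _ 1]) (use c that in \<open>simp_all add: numeral_2_eq_2\<close>)
  have Rg: "?H B \<in> Rg (int N - 2)" if "card B = 2" for B using comp_Rg[OF c(1) that] by simp
  have "t1 (?H {?v1, ?v4}) + t2 (?H {?v2, ?v4}) + t3 (?H {?v3, ?v4}) = 0"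
    using z[of "{?v4}"] by (simp add: kd_simps)
  from regular_123[OF this Rg Rg Rg] obtain u v w
    where uvw: "u \<in> Rg (int N - 2 - 1)" "v \<in> Rg (int N - 2 - 1)" "w \<in> Rg (int N - 2 - 1)"
      and H: "?H {?v1, ?v4} = t2 u + t3 v" "?H {?v2, ?v4} = t1 u + t3 w" "?H {?v3, ?v4} = t1 v + t2 w"
    by auto
  \<comment> \<open>\<open>u\<close>, \<open>v\<close>, \<open>w\<close> will be the components of
    the preimage on the triples containing \<open>(1, 1)\<close>. Subtracting their boundary leaves
    a relation of \<open>t2\<close> and \<open>t3\<close>, whose witness \<kappa> is the component
    on the remaining triple.\<close>
  define \<kappa> where "\<kappa> = s3 (?H {?v1, ?v2} + (t1 u + t2 u + t3 u))"
  have u': "t1 u + t2 u + t3 u \<in> Rg (int N - 2)"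
    using t_Rg[OF uvw(1)] by (intro graded_add[OF graded_Rg]) simp_all
  have "\<kappa> \<in> Rg (int N - 2 - 1)"
    unfolding \<kappa>_def by (intro s_Rg graded_add[OF graded_Rg] Rg u') simp
  have "t2 (?H {?v1, ?v2} + (t1 u + t2 u + t3 u)) + t3 (?H {?v1, ?v3} + (t1 v + t2 v + t3 v)) = 0"
    using z[of "{?v1}"] by (simp add: kd_simps H t_simps ac_simps)
  from regular_23[OF this]
  have e: "?H {?v1, ?v2} + (t1 u + t2 u + t3 u) = t3 \<kappa>" "?H {?v1, ?v3} + (t1 v + t2 v + t3 v) = t2 \<kappa>"
    by (simp_all only: \<kappa>_def)
  have H12: "?H {?v1, ?v2} = t3 \<kappa> + (t1 u + t2 u + t3 u)" "?H {?v1, ?v3} = t2 \<kappa> + (t1 v + t2 v + t3 v)"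
    unfolding e[symmetric] by (simp_all only: add_self_right)
  have "t3 (?H {?v2, ?v3}) = t3 (t1 \<kappa> + (t1 w + t2 w + t3 w))"
    using z[of "{?v2}"] by (simp add: kd_simps H H12 t_simps ac_simps add_eq_0_iff_char_2)
  then have H23: "?H {?v2, ?v3} = t1 \<kappa> + (t1 w + t2 w + t3 w)" by (rule t_inject)
  define F where "F B = (if ?v4 \<notin> B then \<kappa> else if ?v3 \<notin> B then u else if ?v2 \<notin> B then v else w)" for B :: "vertex set"
  have "F B \<in> Rg (int N - int 3)" for B
    using uvw \<open>\<kappa> \<in> _\<close> by (simp add: F_def)
  then obtain b where b: "b \<in> layer N 3" "\<And>B. card B = 3 \<Longrightarrow> comp N b B = F B"
    using comp_surj[of 3 F N] by blast
  have "c = koszul b"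
  proof (rule comp_inject[OF c(1) koszul_layer])
    show "b \<in> layer N (Suc 2)" using b(1) by simp
    fix B :: "vertex set" assume B: "card B = 2"
    have "comp N (koszul b) B = kd (comp N b) B" by (rule comp_koszul[OF _ B]) (use b in simp)
    also have "\<dots> = ?H B" using vertex_sets(3)[OF B]
      by (elim disjE) (simp_all add: kd_simps b(2) F_def H H12 H23)
    finally show "?H B = comp N (koszul b) B" ..
  qed
  then show ?thesis using b(1) by blast
qed

text \<open>The fourth form is eliminated through the linear relation. Families with four equal
  components lie in the kernel; they are the source of the homology in exterior degree 1.\<close>

lemma kd_empty: "kd F {} = t1 (F {(0, 0)} + F {(1, 1)}) + t2 (F {(1, 0)} + F {(1, 1)}) + t3 (F {(0, 1)} + F {(1, 1)})"
  by (simp add: kd_simps sum_vertex t_simps ac_simps)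

lemma cycle_components:
  assumes z: "z \<in> layer N 1" "koszul z = 0"
  shows "\<exists>u\<in>Rg (int N - 2). \<exists>v\<in>Rg (int N - 2). \<exists>w\<in>Rg (int N - 2).
    comp N z {(0, 0)} = comp N z {(1, 1)} + (t2 u + t3 v) \<and>
    comp N z {(1, 0)} = comp N z {(1, 1)} + (t1 u + t3 w) \<and>
    comp N z {(0, 1)} = comp N z {(1, 1)} + (t1 v + t2 w)"
proof -
  let ?G = "comp N z"
  have Rg: "?G {r} \<in> Rg (int N - 1)" for r using comp_Rg[OF z(1), of "{r}"] by simp
  note Rg2 = graded_add[OF graded_Rg Rg Rg]
  have "kd ?G {} = 0" by (rule kd_eq_0[of _ _ 0]) (use z in simp_all)
  from regular_123[OF this[unfolded kd_empty] Rg2 Rg2 Rg2] obtain u v w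
    where uvw: "u \<in> Rg (int N - 1 - 1)" "v \<in> Rg (int N - 1 - 1)" "w \<in> Rg (int N - 1 - 1)"
      and e: "?G {(0, 0)} + ?G {(1, 1)} = t2 u + t3 v" "?G {(1, 0)} + ?G {(1, 1)} = t1 u + t3 w"
        "?G {(0, 1)} + ?G {(1, 1)} = t1 v + t2 w" by blast
  have "?G {(0, 0)} = ?G {(1, 1)} + (t2 u + t3 v)" "?G {(1, 0)} = ?G {(1, 1)} + (t1 u + t3 w)"
    "?G {(0, 1)} = ?G {(1, 1)} + (t1 v + t2 w)"
    unfolding e[symmetric] add.commute[of "?G {(1, 1)}"] by (simp_all only: add_self_right)
  with uvw show ?thesis by (intro bexI[of _ u] bexI[of _ v] bexI[of _ w]) simp_all
qed

text \<open>By \<open>cycle_components\<close> the four components of a cycle agree at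
  \<open>t1 = t2 = t3 = 0\<close>, so the vertex \<open>(1, 1)\<close> stands for any other.\<close>

definition residue_map :: "nat \<Rightarrow> (pair \<Rightarrow> bit) \<Rightarrow> 's" where
  "residue_map n g = comp (Suc n) g {(1, 1)} 0 0 0"

lemma exact_1:
  assumes c: "c \<in> layer (Suc n) 1" "koszul c = 0" "residue_map n c = 0"
  shows "\<exists>b\<in>layer (Suc n) 2. c = koszul b"
proof -
  let ?N = "Suc n"
  let ?G = "comp ?N c"
  let ?v1 = "(0, 0)" and ?v2 = "(1, 0)" and ?v3 = "(0, 1)" and ?v4 = "(1, 1)"
  obtain u v w where uvw: "u \<in> Rg (int ?N - 2)" "v \<in> Rg (int ?N - 2)" "w \<in> Rg (int ?N - 2)"
    and G: "?G {?v1} = ?G {?v4} + (t2 u + t3 v)" "?G {?v2} = ?G {?v4} + (t1 u + t3 w)"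
      "?G {?v3} = ?G {?v4} + (t1 v + t2 w)" using cycle_components[OF c(1,2)] by blast
  define a where "a = s1 (?G {?v4})"
  define b where "b = s2 (?G {?v4} + t1 a)"
  define d where "d = s3 (?G {?v4} + t1 a + t2 b)"
  have "const_R (?G {?v4} 0 0 0) = 0" using c(3) by (simp add: residue_map_def const_R_apply fun_eq_iff)
  then have G4: "?G {?v4} = t1 a + t2 b + t3 d"
    using R_decompose[of "?G {?v4}"] by (simp add: a_def b_def d_def)
  have Rg4: "?G {?v4} \<in> Rg (int ?N - 1)" using comp_Rg[OF c(1), of "{?v4}"] by simp
  have a: "a \<in> Rg (int ?N - 2)" using s_Rg(1)[OF Rg4] by (simp add: a_def)
  have 1: "?G {?v4} + t1 a \<in> Rg (int ?N - 1)" using t_Rg(1)[OF a] Rg4 by (intro graded_add[OF graded_Rg]) simp_all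
  have b: "b \<in> Rg (int ?N - 2)" using s_Rg(2)[OF 1] by (simp add: b_def)
  have 2: "?G {?v4} + t1 a + t2 b \<in> Rg (int ?N - 1)" by (rule graded_add[OF graded_Rg 1]) (use t_Rg(2)[OF b] in simp)
  have d: "d \<in> Rg (int ?N - 2)" using s_Rg(3)[OF 2] by (simp add: d_def)
  \<comment> \<open>On the pairs with \<open>?v4\<close> the quotients \<open>a\<close>,
    \<open>b\<close>, \<open>d\<close> reproduce the component there. On the other pairs the sums of
    quotients compensate for the form \<open>t1 + t2 + t3\<close> of \<open>?v4\<close>, and
    \<open>u\<close>, \<open>v\<close>, \<open>w\<close> account for the differences of
    components.\<close>
  define F where "F B = (if ?v4 \<in> B then (if ?v1 \<in> B then a else if ?v2 \<in> B then b else d)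
    else if ?v3 \<notin> B then a + b + u else if ?v2 \<notin> B then a + d + v else b + d + w)" for B :: "vertex set"
  have "F B \<in> Rg (int ?N - int 2)" for B
    using a b d uvw by (auto simp: F_def intro: graded_add[OF graded_Rg])
  then obtain h where h: "h \<in> layer ?N 2" "\<And>B. card B = 2 \<Longrightarrow> comp ?N h B = F B"
    using comp_surj[of 2 F ?N] by blast
  have "c = koszul h"
  proof (rule comp_inject[OF c(1) koszul_layer])
    show "h \<in> layer ?N (Suc 1)" using h(1) by (simp add: eval_nat_numeral)
    fix B :: "vertex set" assume B: "card B = 1"
    have "comp ?N (koszul h) B = kd (comp ?N h) B"
      by (rule comp_koszul[OF _ B]) (use h in \<open>simp add: eval_nat_numeral\<close>)
    also have "\<dots> = ?G B" using vertex_sets(2)[OF B]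
      by (elim disjE) (simp_all add: kd_simps h(2) F_def G G4 t_simps ac_simps)
    finally show "?G B = comp ?N (koszul h) B" ..
  qed
  then show ?thesis using h(1) by blast
qed

lemma residue_boundary: assumes b: "b \<in> layer (Suc n) 2" shows "residue_map n (koszul b) = 0"
proof -
  have "comp (Suc n) (koszul b) {(1, 1)} = kd (comp (Suc n) b) {(1, 1)}"
    by (rule comp_koszul[of _ _ 1]) (use b in \<open>simp_all add: eval_nat_numeral\<close>)
  moreover have "kd (comp (Suc n) b) {(1, 1)} 0 0 0 = 0" by (simp add: kd_simps t_defs)
  ultimately show ?thesis by (simp only: residue_map_def)
qed

lemma residue_onto: assumes v: "v \<in> V (int n)"
  shows "\<exists>z\<in>layer (Suc n) 1. koszul z = 0 \<and> residue_map n z = v"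
proof -
  have "const_R v \<in> Rg (int (Suc n) - int 1)"
    using v by (auto simp: Rg_iff const_R_apply graded_0[OF graded])
  then obtain z where z: "z \<in> layer (Suc n) 1" "\<And>B. card B = 1 \<Longrightarrow> comp (Suc n) z B = const_R v"
    using comp_surj[of 1 "\<lambda>_. const_R v" "Suc n"] by blast
  have "koszul z = 0"
  proof (rule comp_inject[OF koszul_layer add_closed_0[OF add_closed_layer]])
    show "z \<in> layer (Suc n) (Suc 0)" using z(1) by simp
    fix B :: "vertex set" assume "card B = 0"
    then have B: "B = {}" by simp
    have "comp (Suc n) (koszul z) B = kd (comp (Suc n) z) {}"
      unfolding B by (rule comp_koszul[of _ _ 0]) (use z in simp_all)
    also have "\<dots> = 0" by (simp add: kd_empty z(2) t_simps)
    finally show "comp (Suc n) (koszul z) B = comp (Suc n) 0 B" by (simp only: comp_0)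
  qed
  moreover have "residue_map n z = v" by (simp add: residue_map_def z(2) const_R_apply)
  ultimately show ?thesis using z(1) by blast
qed

lemma lin_000: "lin e F 0 0 0 = xs e (F 0 0 0)"
  by (auto simp: lin_def te_def t_defs)

lemma lin_prod_translate:
  assumes "\<sigma> unity = unity" "\<And>e v. \<sigma> (xs e v) = xs (move q e) (\<sigma> v)"
  shows "lin_prod (\<lambda>e. m (move q e)) 0 0 0 = \<sigma> (lin_prod m 0 0 0)"
proof (induction "sum m UNIV" arbitrary: m)
  case 0
  then have "m = (\<lambda>e. 0)" by auto
  then show ?case by (simp add: lin_prod_0 one_R_def const_series_def assms(1))
next
  case (Suc n)
  then obtain e where e: "m e > 0" by (metis not_gr_zero sum.neutral nat.distinct(1))
  have "n = sum (drop_edge m e) UNIV" using Suc(2) sum_drop_edge[of m e, OF e] by simp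
  note IH = Suc(1)[OF this]
  have eq: "drop_edge (\<lambda>f. m (move q f)) (move q e) = (\<lambda>f. drop_edge m e (move q f))"
  proof
    fix f
    have "move q f = e \<longleftrightarrow> f = move q e" by (metis move_0 move_move add_self)
    then show "drop_edge (\<lambda>f. m (move q f)) (move q e) f = drop_edge m e (move q f)"
      by (auto simp: drop_edge_def)
  qed
  have "lin_prod (\<lambda>f. m (move q f)) 0 0 0 = xs (move q e) (lin_prod (\<lambda>f. drop_edge m e (move q f)) 0 0 0)"
    using lin_prod_drop_edge[of "\<lambda>f. m (move q f)" "move q e"] e by (simp add: eq lin_000)
  also have "\<dots> = \<sigma> (lin_prod m 0 0 0)"
    by (simp only: IH assms(2)[symmetric] lin_prod_drop_edge[of m e, OF e] lin_000)
  finally show ?case .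
qed

lemma Theta_000: "Theta n \<phi> 0 0 0 = (\<Sum>m\<in>{m. sum m UNIV = n}. scale (\<phi> m) (lin_prod m 0 0 0))"
proof -
  have "scale c F 0 0 0 = scale c (F 0 0 0)" for c and F :: "nat \<Rightarrow> nat \<Rightarrow> nat \<Rightarrow> 's"
    by (simp add: scale_def)
  then show ?thesis by (simp only: Theta_def sum_fun_apply)
qed

lemma Theta_translate:
  assumes "add_hom \<sigma>" "\<sigma> unity = unity" "\<And>e v. \<sigma> (xs e v) = xs (move q e) (\<sigma> v)"
  shows "Theta n (\<lambda>m. \<phi> (\<lambda>e. m (move q e))) 0 0 0 = \<sigma> (Theta n \<phi> 0 0 0)"
proof -
  have "Theta n (\<lambda>m. \<phi> (\<lambda>e. m (move q e))) 0 0 0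
      = (\<Sum>m\<in>{m. sum m UNIV = n}. scale (\<phi> m) (lin_prod (\<lambda>e. m (move q e)) 0 0 0))"
    unfolding Theta_000
    by (rule sum.reindex_bij_witness[where i = "\<lambda>m e. m (move q e)" and j = "\<lambda>m e. m (move q e)"])
      (auto simp: sum_move)
  also have "\<dots> = \<sigma> (Theta n \<phi> 0 0 0)"
    unfolding Theta_000 add_hom_sum[OF assms(1)] scale_hom[OF assms(1)]
    by (simp only: lin_prod_translate[of \<sigma> q, OF assms(2,3)])
  finally show ?thesis .
qed

text \<open>The corrections \<open>te\<close> are not equivariant but vanish where
  \<open>t1 = t2 = t3 = 0\<close>, and there translation acts as \<sigma>. The translation also
  moves the vertex \<open>(1, 1)\<close>, but the residue is the same at all vertices.\<close>

lemma residue_shift: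
  assumes z: "z \<in> layer (Suc n) 1" "koszul z = 0"
    and \<sigma>: "add_hom \<sigma>" "\<sigma> unity = unity" "\<And>e v. \<sigma> (xs e v) = xs (move q e) (\<sigma> v)"
  shows "residue_map n (shift q z) = \<sigma> (residue_map n z)"
proof -
  obtain u v w where "comp (Suc n) z {(0, 0)} = comp (Suc n) z {(1, 1)} + (t2 u + t3 v)"
      "comp (Suc n) z {(1, 0)} = comp (Suc n) z {(1, 1)} + (t1 u + t3 w)"
      "comp (Suc n) z {(0, 1)} = comp (Suc n) z {(1, 1)} + (t1 v + t2 w)"
    using cycle_components[OF z] by blast
  then have "comp (Suc n) z {r} 0 0 0 = residue_map n z" for r
    by (cases r; cases "fst r"; cases "snd r") (auto simp: residue_map_def t_defs)
  then have eq: "Theta n (\<lambda>m. z (m, {r})) 0 0 0 = residue_map n z" for r by (simp add: comp_def)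
  have "r + q \<in> {(1, 1)} \<longleftrightarrow> r = (1, 1) + q" for r by (metis add_self_right singleton_iff)
  then have set: "{r. r + q \<in> {(1, 1)}} = {(1, 1) + q}" by blast
  have "residue_map n (shift q z) = Theta n (\<lambda>m. z (\<lambda>e. m (move q e), {(1, 1) + q})) 0 0 0"
    unfolding residue_map_def comp_def shift_def translate_def prod.case set by simp
  also have "\<dots> = \<sigma> (Theta n (\<lambda>m. z (m, {(1, 1) + q})) 0 0 0)"
    by (rule Theta_translate[where \<phi> = "\<lambda>m. z (m, {(1, 1) + q})", OF \<sigma>])
  finally show ?thesis unfolding eq .
qed

lemma hom_residue_map: "add_hom (residue_map n)"
proof (rule add_homI)
  fix g g' :: "pair \<Rightarrow> bit"
  show "residue_map n (g + g') = residue_map n g + residue_map n g'"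
    using add_hom_add[OF hom_Theta, of n "\<lambda>m. g (m, {(1, 1)})" "\<lambda>m. g' (m, {(1, 1)})"]
    by (simp add: residue_map_def comp_def plus_fun_def)
qed

sublocale koszul_homology "\<lambda>n. V (int n)" residue_map ax ay
proof unfold_locales
  fix n
  show "exact_sequence (layer (Suc n) 4) (layer (Suc n) 3) (layer (Suc n) 2)
      {g \<in> layer (Suc n) 1. koszul g = 0} (V (int n)) koszul (residue_map n)"
    unfolding exact_sequence_def
  proof (intro conjI ballI impI equalityI subsetI)
    fix a assume "a \<in> layer (Suc n) 4" "koszul a = 0"
    then show "a = 0" by (rule exact_4)
  next
    fix b assume "b \<in> {b \<in> layer (Suc n) 3. koszul b = 0}"
    then show "b \<in> koszul ` layer (Suc n) 4" using exact_3 by blast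
  next
    fix b assume "b \<in> koszul ` layer (Suc n) 4"
    then show "b \<in> {b \<in> layer (Suc n) 3. koszul b = 0}"
      using koszul_layer[of _ "Suc n" 3] koszul_square by auto
  next
    fix b assume "b \<in> {b \<in> layer (Suc n) 2. koszul b = 0}"
    then show "b \<in> koszul ` layer (Suc n) 3" using exact_2 by blast
  next
    fix b assume "b \<in> koszul ` layer (Suc n) 3"
    then show "b \<in> {b \<in> layer (Suc n) 2. koszul b = 0}"
      using koszul_layer[of _ "Suc n" 2] koszul_square by auto
  next
    fix b assume "b \<in> koszul ` layer (Suc n) 2"
    then show "b \<in> {b \<in> layer (Suc n) 1. koszul b = 0}"
      using koszul_layer[of _ "Suc n" 1] koszul_square by (auto simp: eval_nat_numeral)
  next
    fix z assume "z \<in> {z \<in> {g \<in> layer (Suc n) 1. koszul g = 0}. residue_map n z = 0}"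
    then show "z \<in> koszul ` layer (Suc n) 2" using exact_1 by blast
  next
    fix b assume "b \<in> koszul ` layer (Suc n) 2"
    then show "b \<in> {z \<in> {g \<in> layer (Suc n) 1. koszul g = 0}. residue_map n z = 0}"
      using koszul_layer[of _ "Suc n" 1] koszul_square residue_boundary by (auto simp: eval_nat_numeral)
  next
    fix v assume "v \<in> residue_map n ` {g \<in> layer (Suc n) 1. koszul g = 0}"
    then obtain z where z: "z \<in> layer (Suc n) 1" "v = residue_map n z" by blast
    have "comp (Suc n) z {(1, 1)} \<in> Rg (int n)" using comp_Rg[OF z(1), of "{(1, 1)}"] by simp
    then show "v \<in> V (int n)" unfolding z(2) residue_map_def Rg_iff by (metis diff_zero of_nat_0)
  next
    fix v assume "v \<in> V (int n)"
    then show "v \<in> residue_map n ` {g \<in> layer (Suc n) 1. koszul g = 0}" using residue_onto by blast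
  qed
  show "add_hom (residue_map n)" by (rule hom_residue_map)
  show "residue_map n (shift (1, 0) g) = ax (residue_map n g)" if "g \<in> layer (Suc n) 1" "koszul g = 0" for g
    using residue_shift[OF that hom(6) ax(1) ax_xs] .
  show "residue_map n (shift (0, 1) g) = ay (residue_map n g)" if "g \<in> layer (Suc n) 1" "koszul g = 0" for g
    using residue_shift[OF that hom(7) ay(1) ay_xs] .
qed

end

subsection \<open>Graded polynomials\<close>

instance poly :: (char_2) char_2
  by standard (simp add: poly_eq_iff)

text \<open>Homogeneous polynomials in a variable of degree \<open>d\<close> over graded
  coefficients.\<close>

definition graded_poly :: "int \<Rightarrow> (int \<Rightarrow> 'a :: zero set) \<Rightarrow> int \<Rightarrow> 'a poly set" where
  "graded_poly d H n = {f. \<forall>i. coeff f i \<in> H (n - d * int i)}"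

lemma graded_poly_coeff: "f \<in> graded_poly d H n \<Longrightarrow> coeff f i \<in> H (n - d * int i)"
  by (simp add: graded_poly_def)

lemma pCons_graded_poly: "pCons a f \<in> graded_poly d H n \<longleftrightarrow> a \<in> H n \<and> f \<in> graded_poly d H (n - d)"
proof -
  have eq: "n - d * int (Suc i) = n - d - d * int i" for i by (simp add: algebra_simps)
  have "pCons a f \<in> graded_poly d H n \<longleftrightarrow> a \<in> H n \<and> (\<forall>i. coeff f i \<in> H (n - d * int (Suc i)))"
    unfolding graded_poly_def by (auto simp: coeff_pCons split: nat.split)
  then show ?thesis unfolding eq by (simp add: graded_poly_def)
qed

lemma bij_betw_pCons:
  "bij_betw (\<lambda>(a, f). pCons a f) (H n \<times> graded_poly d H (n - d)) (graded_poly d H n)"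
  unfolding bij_betw_def
proof
  show "inj_on (\<lambda>(a, f). pCons a f) (H n \<times> graded_poly d H (n - d))" by (auto intro: inj_onI)
  show "(\<lambda>(a, f). pCons a f) ` (H n \<times> graded_poly d H (n - d)) = graded_poly d H n"
  proof (intro equalityI subsetI)
    fix f assume "f \<in> graded_poly d H n"
    then show "f \<in> (\<lambda>(a, f). pCons a f) ` (H n \<times> graded_poly d H (n - d))"
      by (cases f) (auto simp: pCons_graded_poly)
  qed (auto simp: pCons_graded_poly)
qed

lemma card_graded_poly: "card (graded_poly d H n) = card (H n) * card (graded_poly d H (n - d))"
  using bij_betw_same_card[OF bij_betw_pCons, of H n d] by (simp add: card_cartesian_product)

lemma graded_poly_neg: "graded H \<Longrightarrow> d > 0 \<Longrightarrow> n < 0 \<Longrightarrow> graded_poly d H n = {0}"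
proof -
  assume H: "graded H" "d > 0" "n < 0"
  have "f = 0" if f: "f \<in> graded_poly d H n" for f
  proof (rule poly_eqI)
    fix i
    have "0 \<le> d * int i" using H(2) by simp
    then have "n - d * int i < 0" using H(3) by linarith
    then show "coeff f i = coeff 0 i" using graded_neg[OF H(1) _ graded_poly_coeff[OF f]] by simp
  qed
  then show ?thesis using graded_0[OF H(1)] by (auto simp: graded_poly_def)
qed

lemma graded_graded_poly:
  assumes H: "graded H" and d: "d > 0" shows "graded (graded_poly d H)"
proof -
  have "finite (graded_poly d H n)" for n
  proof (induction "nat n" arbitrary: n rule: less_induct)
    case less
    show ?case
    proof (cases "n < 0")
      case False
      have "finite (graded_poly d H (n - d))"
      proof (cases "n - d < 0")
        case False
        then show ?thesis using less[of "n - d"] d \<open>\<not> n < 0\<close> by simp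
      qed (simp add: graded_poly_neg[OF H d])
      moreover have "finite (H n)" using H by (simp add: graded_def)
      ultimately show ?thesis using bij_betw_finite[OF bij_betw_pCons, of H n d] by simp
    qed (simp add: graded_poly_neg[OF H d])
  qed
  moreover have "add_closed (graded_poly d H n)" for n
    using H by (auto simp: graded_def add_closed_def graded_poly_def)
  ultimately show ?thesis using graded_poly_neg[OF H d] by (simp add: graded_def)
qed

lemma smult_graded_poly:
  assumes "\<And>m a. a \<in> H m \<Longrightarrow> s * a \<in> H (m + e)" "f \<in> graded_poly d H n"
  shows "Polynomial.smult s f \<in> graded_poly d H (n + e)"
proof -
  have "n + e - d * int i = n - d * int i + e" for i by simp
  then show ?thesis using assms(1)[OF graded_poly_coeff[OF assms(2)]] by (simp only: graded_poly_def mem_Collect_eq coeff_smult) simp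
qed

lemma const_graded_poly: "graded H \<Longrightarrow> a \<in> H n \<Longrightarrow> [:a:] \<in> graded_poly d H n"
  by (simp add: pCons_graded_poly) (simp add: graded_poly_def graded_0)

subsection \<open>The ground ring\<close>

text \<open>From the outermost variable inwards the variables of \<open>ground\<close> are \<open>w\<close>, \<open>\<beta>\<close>, \<open>\<alpha>\<close> of
  degree 1 and the norms of \<open>b\<close> and \<open>a\<close> of degree 4.\<close>

type_synonym norms = "bit poly poly"
type_synonym base = "norms poly poly"
type_synonym ground = "base poly"

definition bits :: "int \<Rightarrow> bit set" where "bits n = (if n = 0 then UNIV else {0})"

definition norms_gr :: "int \<Rightarrow> norms set" where "norms_gr = graded_poly 4 (graded_poly 4 bits)"
definition base_gr :: "int \<Rightarrow> base set" where "base_gr = graded_poly 1 (graded_poly 1 norms_gr)"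
definition ground_gr :: "int \<Rightarrow> ground set" where "ground_gr = graded_poly 1 base_gr"

definition al0 :: base where "al0 = [:[:0, 1:]:]"
definition be0 :: base where "be0 = [:0, 1:]"
definition w :: ground where "w = [:0, 1:]"
definition al :: ground where "al = [:al0:]"
definition be :: ground where "be = [:be0:]"
definition na :: ground where "na = [:[:[:[:[:0, 1:]:]:]:]:]"
definition nb :: ground where "nb = [:[:[:[:0, 1:]:]:]:]"
definition ga :: ground where "ga = w * (w + al)"
definition de :: ground where "de = w * (w + be)"

lemma graded_bits: "graded bits"
  by (auto simp: graded_def bits_def add_closed_def)

lemma graded_norms: "graded norms_gr"
  unfolding norms_gr_def by (intro graded_graded_poly graded_bits) simp_all

lemma graded_base: "graded base_gr"
  unfolding base_gr_def by (intro graded_graded_poly graded_norms) simp_all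

lemma graded_ground: "graded ground_gr"
  unfolding ground_gr_def by (intro graded_graded_poly graded_base) simp

lemma mult_var_graded_poly: "f \<in> graded_poly d H n \<Longrightarrow> graded H \<Longrightarrow> [:0, 1:] * f \<in> graded_poly d H (n + d)"
  for f :: "'a :: {comm_ring_1, char_2} poly"
  by (simp add: pCons_graded_poly graded_0)

lemma mult_const_graded_poly:
  fixes f :: "'a :: {comm_ring_1, char_2} poly"
  assumes "\<And>m a. a \<in> H m \<Longrightarrow> s * a \<in> H (m + e)" "f \<in> graded_poly d H n"
  shows "[:s:] * f \<in> graded_poly d H (n + e)"
  using smult_graded_poly[of H s e f d n, OF assms] by simp

lemma mult_base: "a \<in> base_gr n \<Longrightarrow> al0 * a \<in> base_gr (n + 1)" "a \<in> base_gr n \<Longrightarrow> be0 * a \<in> base_gr (n + 1)"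
proof -
  assume a: "a \<in> base_gr n"
  show "al0 * a \<in> base_gr (n + 1)"
    using a unfolding base_gr_def al0_def
    by (rule mult_const_graded_poly[rotated]) (rule mult_var_graded_poly[OF _ graded_norms])
  show "be0 * a \<in> base_gr (n + 1)"
    using a unfolding base_gr_def be0_def
    by (rule mult_var_graded_poly) (intro graded_graded_poly graded_norms, simp)
qed

lemma mult_ground:
  assumes f: "f \<in> ground_gr n"
  shows "w * f \<in> ground_gr (n + 1)" "al * f \<in> ground_gr (n + 1)" "be * f \<in> ground_gr (n + 1)"
    "na * f \<in> ground_gr (n + 4)" "nb * f \<in> ground_gr (n + 4)"
proof -
  show "w * f \<in> ground_gr (n + 1)"
    using f unfolding ground_gr_def w_def by (rule mult_var_graded_poly) (rule graded_base)
  show "al * f \<in> ground_gr (n + 1)"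
    using f unfolding ground_gr_def al_def by (rule mult_const_graded_poly[rotated]) (rule mult_base(1))
  show "be * f \<in> ground_gr (n + 1)"
    using f unfolding ground_gr_def be_def by (rule mult_const_graded_poly[rotated]) (rule mult_base(2))
  have K: "[:[:0, 1:]:] * k \<in> norms_gr (m + 4)" "[:0, 1:] * k \<in> norms_gr (m + 4)" if "k \<in> norms_gr m" for k m
  proof -
    show "[:[:0, 1:]:] * k \<in> norms_gr (m + 4)"
      using that unfolding norms_gr_def
      by (rule mult_const_graded_poly[rotated]) (rule mult_var_graded_poly[OF _ graded_bits])
    show "[:0, 1:] * k \<in> norms_gr (m + 4)"
      using that unfolding norms_gr_def
      by (rule mult_var_graded_poly) (intro graded_graded_poly graded_bits, simp)
  qed
  show "na * f \<in> ground_gr (n + 4)"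
    using f unfolding ground_gr_def na_def base_gr_def
    by (rule mult_const_graded_poly[rotated]) (rule mult_const_graded_poly, rule mult_const_graded_poly, rule K(1))
  show "nb * f \<in> ground_gr (n + 4)"
    using f unfolding ground_gr_def nb_def base_gr_def
    by (rule mult_const_graded_poly[rotated]) (rule mult_const_graded_poly, rule mult_const_graded_poly, rule K(2))
qed

lemma add_ground: "f \<in> ground_gr n \<Longrightarrow> g \<in> ground_gr n \<Longrightarrow> f + g \<in> ground_gr n"
  by (rule graded_add[OF graded_ground])

lemma mult_ga_de:
  assumes f: "f \<in> ground_gr n"
  shows "ga * f \<in> ground_gr (n + 2)" "de * f \<in> ground_gr (n + 2)"
proof -
  have "w * (w * f) \<in> ground_gr (n + 1 + 1)" "w * (al * f) \<in> ground_gr (n + 1 + 1)" "w * (be * f) \<in> ground_gr (n + 1 + 1)"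
    by (intro mult_ground f)+
  note add_ground[OF this(1,2)] add_ground[OF this(1,3)]
  then show "ga * f \<in> ground_gr (n + 2)" "de * f \<in> ground_gr (n + 2)"
    by (simp_all add: ga_def de_def algebra_simps)
qed

lemma ground_decompose:
  assumes f: "f \<in> ground_gr n" and n: "n > 0"
  shows "\<exists>f1\<in>ground_gr (n - 1). \<exists>f2\<in>ground_gr (n - 1). \<exists>f3\<in>ground_gr (n - 1). \<exists>f4\<in>ground_gr (n - 4). \<exists>f5\<in>ground_gr (n - 4).
    f = w * f1 + al * f2 + be * f3 + na * f4 + nb * f5"
proof -
  obtain b f1 where f1: "f = pCons b f1" by (cases f)
  obtain a b1 where b1: "b = pCons a b1" by (cases b)
  obtain k a1 where a1: "a = pCons k a1" by (cases a)
  obtain l k1 where k1: "k = pCons l k1" by (cases k)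
  obtain c l1 where l1: "l = pCons c l1" by (cases l)
  note gr = graded_graded_poly graded_base graded_norms graded_bits
  have "f1 \<in> graded_poly 1 base_gr (n - 1)" "b \<in> base_gr n"
    using f by (auto simp: f1 ground_gr_def pCons_graded_poly)
  then have "b1 \<in> graded_poly 1 (graded_poly 1 norms_gr) (n - 1)" "a \<in> graded_poly 1 norms_gr n"
    by (auto simp: b1 base_gr_def pCons_graded_poly)
  then have "a1 \<in> graded_poly 1 norms_gr (n - 1)" "k \<in> norms_gr n" by (auto simp: a1 pCons_graded_poly)
  then have "k1 \<in> graded_poly 4 (graded_poly 4 bits) (n - 4)" "l \<in> graded_poly 4 bits n"
    by (auto simp: k1 norms_gr_def pCons_graded_poly)
  then have "l1 \<in> graded_poly 4 bits (n - 4)" "c \<in> bits n" by (auto simp: l1 pCons_graded_poly)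
  then have c: "c = 0" using n by (simp add: bits_def)
  show ?thesis
  proof (intro bexI)
    show "f = w * f1 + al * [:[:a1:]:] + be * [:b1:] + na * [:[:[:[:l1:]:]:]:] + nb * [:[:[:k1:]:]:]"
      by (simp add: f1 b1 a1 k1 l1 c w_def al_def be_def al0_def be0_def na_def nb_def)
    show "f1 \<in> ground_gr (n - 1)" using \<open>f1 \<in> _\<close> by (simp add: ground_gr_def)
    show "[:[:a1:]:] \<in> ground_gr (n - 1)" unfolding ground_gr_def base_gr_def
      by (intro const_graded_poly gr \<open>a1 \<in> _\<close>) simp_all
    show "[:b1:] \<in> ground_gr (n - 1)" unfolding ground_gr_def
      by (intro const_graded_poly gr) (use \<open>b1 \<in> _\<close> in \<open>simp add: base_gr_def\<close>)
    show "[:[:[:[:l1:]:]:]:] \<in> ground_gr (n - 4)" unfolding ground_gr_def base_gr_def norms_gr_def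
      by (intro const_graded_poly gr \<open>l1 \<in> _\<close>) (simp_all add: gr)
    show "[:[:[:k1:]:]:] \<in> ground_gr (n - 4)" unfolding ground_gr_def base_gr_def
      by (intro const_graded_poly gr) (use \<open>k1 \<in> _\<close> in \<open>simp_all add: norms_gr_def\<close>)
  qed
qed

subsection \<open>The symmetric algebra as a free module of rank 16\<close>

text \<open>\<open>quad\<close> has the basis \<open>1, p, q, pq\<close> over \<open>ground\<close>, where \<open>p = a(a + \<alpha>)\<close> and \<open>q = b(b + \<beta>)\<close>
  satisfy \<open>p\<^sup>2 = \<gamma>p + N\<^sub>a\<close> and \<open>q\<^sup>2 = \<delta>q + N\<^sub>b\<close> with \<open>\<gamma> = w(w + \<alpha>)\<close>, \<open>\<delta> = w(w + \<beta>)\<close>; and \<open>sym\<close> has the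
  basis \<open>1, a, b, ab\<close> over \<open>quad\<close>, where \<open>a\<^sup>2 = \<alpha>a + p\<close> and \<open>b\<^sup>2 = \<beta>b + q\<close>.\<close>

type_synonym quad = "ground \<times> ground \<times> ground \<times> ground"
type_synonym sym = "quad \<times> quad \<times> quad \<times> quad"

fun sc :: "ground \<Rightarrow> quad \<Rightarrow> quad" where
  "sc s (g0, g1, g2, g3) = (s * g0, s * g1, s * g2, s * g3)"
text \<open>Multiplication by \<open>p\<close>. The relation makes the free variable
  \<open>na\<close> the product \<open>p (p + \<gamma>)\<close>, which is the product of the four
  translates of \<open>a\<close>.\<close>

fun mp :: "quad \<Rightarrow> quad" where "mp (g0, g1, g2, g3) = (na * g1, g0 + ga * g1, na * g3, g2 + ga * g3)"
fun mq :: "quad \<Rightarrow> quad" where "mq (g0, g1, g2, g3) = (nb * g2, nb * g3, g0 + de * g2, g1 + de * g3)"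
text \<open>The first generator sends \<open>a\<close> to \<open>a + w\<close> and \<open>b\<close>
  to \<open>b + \<beta>\<close>, hence \<open>p\<close> to \<open>p + \<gamma>\<close>, and it fixes
  \<open>q\<close>; \<open>yq\<close> is the mirror image.\<close>

fun xq :: "quad \<Rightarrow> quad" where "xq (g0, g1, g2, g3) = (g0 + ga * g1, g1, g2 + ga * g3, g3)"
fun yq :: "quad \<Rightarrow> quad" where "yq (g0, g1, g2, g3) = (g0 + de * g2, g1 + de * g3, g2, g3)"

fun ssc :: "ground \<Rightarrow> sym \<Rightarrow> sym" where "ssc s (f0, f1, f2, f3) = (sc s f0, sc s f1, sc s f2, sc s f3)"
fun ma :: "sym \<Rightarrow> sym" where "ma (f0, f1, f2, f3) = (mp f1, f0 + sc al f1, mp f3, f2 + sc al f3)"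
fun mb :: "sym \<Rightarrow> sym" where "mb (f0, f1, f2, f3) = (mq f2, mq f3, f0 + sc be f2, f1 + sc be f3)"
fun ax :: "sym \<Rightarrow> sym" where
  "ax (f0, f1, f2, f3) = (xq f0 + sc w (xq f1) + sc be (xq f2) + sc (w * be) (xq f3),
     xq f1 + sc be (xq f3), xq f2 + sc w (xq f3), xq f3)"
fun ay :: "sym \<Rightarrow> sym" where
  "ay (f0, f1, f2, f3) = (yq f0 + sc al (yq f1) + sc w (yq f2) + sc (al * w) (yq f3),
     yq f1 + sc w (yq f3), yq f2 + sc al (yq f3), yq f3)"

definition quad_gr :: "int \<Rightarrow> quad set" where
  "quad_gr n = ground_gr n \<times> ground_gr (n - 2) \<times> ground_gr (n - 2) \<times> ground_gr (n - 4)"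
definition sym_gr :: "int \<Rightarrow> sym set" where
  "sym_gr n = quad_gr n \<times> quad_gr (n - 1) \<times> quad_gr (n - 1) \<times> quad_gr (n - 2)"

lemma quad_add:
  "sc s (g + h) = sc s g + sc s h" "mp (g + h) = mp g + mp h" "mq (g + h) = mq g + mq h"
  "xq (g + h) = xq g + xq h" "yq (g + h) = yq g + yq h"
  by (cases g rule: prod_cases4; cases h rule: prod_cases4; simp add: algebra_simps)+

lemma sc_sc: "sc s (sc t g) = sc (s * t) g"
  by (cases g rule: prod_cases4) (simp add: algebra_simps)

lemma sc_add_left: "sc (s + t) g = sc s g + sc t g"
  by (cases g rule: prod_cases4) (simp add: algebra_simps)

lemma quad_sc: "mp (sc s g) = sc s (mp g)" "mq (sc s g) = sc s (mq g)" "xq (sc s g) = sc s (xq g)" "yq (sc s g) = sc s (yq g)"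
  by (cases g rule: prod_cases4; simp add: algebra_simps)+

lemma quad_mult: "mq (mp g) = mp (mq g)" "xq (mp g) = mp (xq g) + sc ga (xq g)" "xq (mq g) = mq (xq g)"
  "yq (mp g) = mp (yq g)" "yq (mq g) = mq (yq g) + sc de (yq g)"
  by (cases g rule: prod_cases4; simp add: algebra_simps)+

lemmas quad_simps = quad_add quad_sc quad_mult sc_sc sc_add_left

lemma hom_sym: "add_hom (ssc s)" "add_hom ma" "add_hom mb" "add_hom ax" "add_hom ay"
proof -
  have *: "ssc s (f + g) = ssc s f + ssc s g" "ma (f + g) = ma f + ma g" "mb (f + g) = mb f + mb g"
    "ax (f + g) = ax f + ax g" "ay (f + g) = ay f + ay g" for f g
    by (cases f rule: prod_cases4; cases g rule: prod_cases4; simp add: quad_add ac_simps)+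
  show "add_hom (ssc s)" by (rule add_homI) (rule *)
  show "add_hom ma" by (rule add_homI) (rule *)
  show "add_hom mb" by (rule add_homI) (rule *)
  show "add_hom ax" by (rule add_homI) (rule *)
  show "add_hom ay" by (rule add_homI) (rule *)
qed

lemma sym_commute: "mb (ma f) = ma (mb f)" "ssc s (ma f) = ma (ssc s f)" "ssc s (mb f) = mb (ssc s f)"
  "ssc s (ssc t f) = ssc t (ssc s f)"
  by (cases f rule: prod_cases4; simp add: quad_simps ac_simps)+

lemma ax_sym: "ax (ma f) = ma (ax f) + ssc w (ax f)" "ax (mb f) = mb (ax f) + ssc be (ax f)" "ax (ssc s f) = ssc s (ax f)"
  by (cases f rule: prod_cases4; simp add: quad_simps ga_def algebra_simps)+

lemma ay_sym: "ay (ma f) = ma (ay f) + ssc al (ay f)" "ay (mb f) = mb (ay f) + ssc w (ay f)" "ay (ssc s f) = ssc s (ay f)"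
  by (cases f rule: prod_cases4; simp add: quad_simps de_def algebra_simps)+

lemma graded_times:
  assumes "graded A" "graded B" "d \<ge> 0" shows "graded (\<lambda>n. A n \<times> B (n - d))"
  using assms by (auto simp: graded_def add_closed_def zero_prod_def)

lemma graded_quad: "graded quad_gr"
proof -
  have "graded (\<lambda>n. ground_gr n \<times> (\<lambda>n. ground_gr n \<times> (\<lambda>n. ground_gr n \<times> ground_gr (n - 2)) (n - 0)) (n - 2))"
    by (intro graded_times graded_ground) simp_all
  then show ?thesis unfolding quad_gr_def[abs_def] by simp
qed

lemma graded_sym: "graded sym_gr"
proof -
  have "graded (\<lambda>n. quad_gr n \<times> (\<lambda>n. quad_gr n \<times> (\<lambda>n. quad_gr n \<times> quad_gr (n - 1)) (n - 0)) (n - 1))"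
    by (intro graded_times graded_quad) simp_all
  then show ?thesis unfolding sym_gr_def[abs_def] by simp
qed

lemma graded_eqI: "v \<in> H m \<Longrightarrow> m = n \<Longrightarrow> v \<in> H n" for m :: int
  by simp

lemma quad_gr_mult:
  assumes g: "g \<in> quad_gr n"
  shows "mp g \<in> quad_gr (n + 2)" "mq g \<in> quad_gr (n + 2)" "xq g \<in> quad_gr n" "yq g \<in> quad_gr n"
    "sc w g \<in> quad_gr (n + 1)" "sc al g \<in> quad_gr (n + 1)" "sc be g \<in> quad_gr (n + 1)"
proof -
  obtain g0 g1 g2 g3 where eq: "g = (g0, g1, g2, g3)" by (cases g rule: prod_cases4)
  then have m: "g0 \<in> ground_gr n" "g1 \<in> ground_gr (n - 2)" "g2 \<in> ground_gr (n - 2)" "g3 \<in> ground_gr (n - 4)"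
    using g by (auto simp: quad_gr_def)
  note * = m[THEN mult_ground(1)] m[THEN mult_ground(2)] m[THEN mult_ground(3)] m[THEN mult_ground(4)]
    m[THEN mult_ground(5)] m[THEN mult_ga_de(1)] m[THEN mult_ga_de(2)]
  show "mp g \<in> quad_gr (n + 2)" "mq g \<in> quad_gr (n + 2)" "xq g \<in> quad_gr n" "yq g \<in> quad_gr n"
    "sc w g \<in> quad_gr (n + 1)" "sc al g \<in> quad_gr (n + 1)" "sc be g \<in> quad_gr (n + 1)"
    using * m by (auto simp: eq quad_gr_def intro!: add_ground elim!: graded_eqI)
qed

lemma add_quad: "f \<in> quad_gr n \<Longrightarrow> g \<in> quad_gr n \<Longrightarrow> f + g \<in> quad_gr n"
  by (rule graded_add[OF graded_quad])

lemma sym_gr_mult: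
  assumes f: "f \<in> sym_gr n"
  shows "ma f \<in> sym_gr (n + 1)" "mb f \<in> sym_gr (n + 1)" "ssc w f \<in> sym_gr (n + 1)" "ssc al f \<in> sym_gr (n + 1)"
    "ssc be f \<in> sym_gr (n + 1)" "ax f \<in> sym_gr n" "ay f \<in> sym_gr n"
proof -
  obtain f0 f1 f2 f3 where eq: "f = (f0, f1, f2, f3)" by (cases f rule: prod_cases4)
  then have m: "f0 \<in> quad_gr n" "f1 \<in> quad_gr (n - 1)" "f2 \<in> quad_gr (n - 1)" "f3 \<in> quad_gr (n - 2)"
    using f by (auto simp: sym_gr_def)
  note * = m[THEN quad_gr_mult(1)] m[THEN quad_gr_mult(2)] m[THEN quad_gr_mult(5)] m[THEN quad_gr_mult(6)]
    m[THEN quad_gr_mult(7)]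
  show "ma f \<in> sym_gr (n + 1)" "mb f \<in> sym_gr (n + 1)" "ssc w f \<in> sym_gr (n + 1)" "ssc al f \<in> sym_gr (n + 1)"
    "ssc be f \<in> sym_gr (n + 1)"
    using * m by (auto simp: eq sym_gr_def intro!: add_quad elim!: graded_eqI)
  note x = m[THEN quad_gr_mult(3)] and y = m[THEN quad_gr_mult(4)]
  have "sc w (sc be (xq f3)) \<in> quad_gr (n - 2 + 1 + 1)" "sc al (sc w (yq f3)) \<in> quad_gr (n - 2 + 1 + 1)"
    by (intro quad_gr_mult m)+
  then have wb: "sc (w * be) (xq f3) \<in> quad_gr n" "sc (al * w) (yq f3) \<in> quad_gr n" by (simp_all add: sc_sc)
  show "ax f \<in> sym_gr n" "ay f \<in> sym_gr n"
    using x y x[THEN quad_gr_mult(5)] x[THEN quad_gr_mult(6)] x[THEN quad_gr_mult(7)]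
      y[THEN quad_gr_mult(5)] y[THEN quad_gr_mult(6)] y[THEN quad_gr_mult(7)] wb
    by (auto simp: eq sym_gr_def intro!: add_quad elim!: graded_eqI)
qed

definition spanned :: "int \<Rightarrow> sym set" where
  "spanned n = {f. \<exists>a b c d e. a \<in> sym_gr (n - 1) \<and> b \<in> sym_gr (n - 1) \<and> c \<in> sym_gr (n - 1) \<and>
     d \<in> sym_gr (n - 1) \<and> e \<in> sym_gr (n - 1) \<and> f = ma a + mb b + ssc w c + ssc al d + ssc be e}"

lemma zero_ground [simp]: "0 \<in> ground_gr n" and zero_quad [simp]: "0 \<in> quad_gr n" and zero_sym [simp]: "0 \<in> sym_gr n"
  by (rule graded_0[OF graded_ground] graded_0[OF graded_quad] graded_0[OF graded_sym])+

lemma sc_0 [simp]: "sc s 0 = 0" "mp 0 = 0" "mq 0 = 0"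
  by (simp_all add: zero_prod_def)

lemma spanned_add: "f \<in> spanned n \<Longrightarrow> g \<in> spanned n \<Longrightarrow> f + g \<in> spanned n"
proof -
  assume f: "f \<in> spanned n" and g: "g \<in> spanned n"
  from f obtain a b c d e where
    m: "a \<in> sym_gr (n - 1)" "b \<in> sym_gr (n - 1)" "c \<in> sym_gr (n - 1)" "d \<in> sym_gr (n - 1)" "e \<in> sym_gr (n - 1)"
    and f_eq: "f = ma a + mb b + ssc w c + ssc al d + ssc be e"
    unfolding spanned_def mem_Collect_eq by (elim exE conjE)
  from g obtain a' b' c' d' e' where
    m': "a' \<in> sym_gr (n - 1)" "b' \<in> sym_gr (n - 1)" "c' \<in> sym_gr (n - 1)" "d' \<in> sym_gr (n - 1)" "e' \<in> sym_gr (n - 1)"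
    and g_eq: "g = ma a' + mb b' + ssc w c' + ssc al d' + ssc be e'"
    unfolding spanned_def mem_Collect_eq by (elim exE conjE)
  have "f + g = ma (a + a') + mb (b + b') + ssc w (c + c') + ssc al (d + d') + ssc be (e + e')"
    unfolding f_eq g_eq hom_sym[THEN add_hom_add] by (simp only: ac_simps)
  moreover note add = graded_add[OF graded_sym]
  ultimately show ?thesis unfolding spanned_def
    by (intro CollectI exI[of _ "a + a'"] exI[of _ "b + b'"] exI[of _ "c + c'"] exI[of _ "d + d'"] exI[of _ "e + e'"]
        conjI) (simp_all only: add m m')
qed

lemma spanned_mult:
  assumes "f \<in> sym_gr (n - 1)"
  shows "ma f \<in> spanned n" "mb f \<in> spanned n" "ssc w f \<in> spanned n" "ssc al f \<in> spanned n" "ssc be f \<in> spanned n"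
proof -
  have z: "ma 0 = 0" "mb 0 = 0" "ssc s 0 = 0" for s by (rule hom_sym[THEN add_hom_0])+
  show "ma f \<in> spanned n" unfolding spanned_def
    by (rule CollectI, rule exI[of _ f], (rule exI[of _ 0])+) (simp add: assms z)
  show "mb f \<in> spanned n" unfolding spanned_def
    by (rule CollectI, rule exI[of _ 0], rule exI[of _ f], (rule exI[of _ 0])+) (simp add: assms z)
  show "ssc w f \<in> spanned n" unfolding spanned_def
    by (rule CollectI, rule exI[of _ 0], rule exI[of _ 0], rule exI[of _ f], (rule exI[of _ 0])+) (simp add: assms z)
  show "ssc al f \<in> spanned n" unfolding spanned_def
    by (rule CollectI, rule exI[of _ 0], rule exI[of _ 0], rule exI[of _ 0], rule exI[of _ f], rule exI[of _ 0]) (simp add: assms z)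
  show "ssc be f \<in> spanned n" unfolding spanned_def
    by (rule CollectI, rule exI[of _ 0], rule exI[of _ 0], rule exI[of _ 0], rule exI[of _ 0], rule exI[of _ f]) (simp add: assms z)
qed

text \<open>The module structure uses generators of degrees 2 and 4, which have to be recovered from
  degree 1: \<open>p\<close> from \<open>a\<close>, \<open>q\<close> from \<open>b\<close>, and the
  norms from \<open>p\<close> and \<open>q\<close>.\<close>

lemma sym_gr_spanned:
  assumes n: "n > 0" and f: "f \<in> sym_gr n" shows "f \<in> spanned n"
proof -
  have mp: "(mp u, 0, 0, 0) \<in> spanned n" if "u \<in> quad_gr (n - 2)" for u
  proof -
    have "(0, u, 0, 0) \<in> sym_gr (n - 1)" using that by (simp add: sym_gr_def)
    \<comment> \<open>\<open>a (a u) + \<alpha> (a u) = p u\<close>.\<close>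
    from spanned_add[OF spanned_mult(1)[OF this] spanned_mult(4)[OF this]]
    show ?thesis by (rule back_subst[of "\<lambda>f. f \<in> spanned n"]) (simp add: prod_eq_iff)
  qed
  have mq: "(mq u, 0, 0, 0) \<in> spanned n" if "u \<in> quad_gr (n - 2)" for u
  proof -
    have "(0, 0, u, 0) \<in> sym_gr (n - 1)" using that by (simp add: sym_gr_def)
    from spanned_add[OF spanned_mult(2)[OF this] spanned_mult(5)[OF this]]
    show ?thesis by (rule back_subst[of "\<lambda>f. f \<in> spanned n"]) (simp add: prod_eq_iff)
  qed
  have base: "((g, 0, 0, 0), 0, 0, 0) \<in> spanned n" if g: "g \<in> ground_gr n" for g
  proof -
    obtain g1 g2 g3 g4 g5 where m: "g1 \<in> ground_gr (n - 1)" "g2 \<in> ground_gr (n - 1)" "g3 \<in> ground_gr (n - 1)"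
      "g4 \<in> ground_gr (n - 4)" "g5 \<in> ground_gr (n - 4)" and eq: "g = w * g1 + al * g2 + be * g3 + na * g4 + nb * g5"
      using ground_decompose[OF g n] by blast
    have c: "((h, 0, 0, 0), 0, 0, 0) \<in> sym_gr (n - 1)" if "h \<in> ground_gr (n - 1)" for h
      using that by (simp add: sym_gr_def quad_gr_def zero_prod_def)
    have w: "((w * g1, 0, 0, 0), 0, 0, 0) \<in> spanned n" using spanned_mult(3)[OF c[OF m(1)]] by simp
    have al: "((al * g2, 0, 0, 0), 0, 0, 0) \<in> spanned n" using spanned_mult(4)[OF c[OF m(2)]] by simp
    have be: "((be * g3, 0, 0, 0), 0, 0, 0) \<in> spanned n" using spanned_mult(5)[OF c[OF m(3)]] by simp
    have "n - 2 - 2 = n - 4" "n - 4 + 2 = n - 2" by simp_all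
    \<comment> \<open>These are \<open>(p + \<gamma>) g4\<close> and
      \<open>(q + \<delta>) g5\<close>; multiplied by \<open>p\<close> and \<open>q\<close> they
      become \<open>na * g4\<close> and \<open>nb * g5\<close>.\<close>
    then have "(ga * g4, g4, 0, 0) \<in> quad_gr (n - 2)" "(de * g5, 0, g5, 0) \<in> quad_gr (n - 2)"
      using m mult_ga_de[OF m(4)] mult_ga_de[OF m(5)] by (simp_all add: quad_gr_def)
    from mp[OF this(1)] mq[OF this(2)]
    have "((na * g4, 0, 0, 0), 0, 0, 0) \<in> spanned n" "((nb * g5, 0, 0, 0), 0, 0, 0) \<in> spanned n"
      by simp_all
    from spanned_add[OF spanned_add[OF spanned_add[OF spanned_add[OF w al] be] this(1)] this(2)]
    show ?thesis by (simp add: eq)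
  qed
  have quad: "(g, 0, 0, 0) \<in> spanned n" if g: "g \<in> quad_gr n" for g
  proof -
    obtain g0 g1 g2 g3 where eq: "g = (g0, g1, g2, g3)" by (cases g rule: prod_cases4)
    then have m: "g0 \<in> ground_gr n" "g1 \<in> ground_gr (n - 2)" "g2 \<in> ground_gr (n - 2)" "g3 \<in> ground_gr (n - 4)"
      using g by (auto simp: quad_gr_def)
    have "(g1, 0, g3, 0) \<in> quad_gr (n - 2)" "(g2, 0, 0, 0) \<in> quad_gr (n - 2)"
      using m by (simp_all add: quad_gr_def)
    from spanned_add[OF spanned_add[OF base[OF m(1)] mp[OF this(1)]] mq[OF this(2)]]
    show ?thesis by (simp add: eq zero_prod_def)
  qed
  obtain f0 f1 f2 f3 where eq: "f = (f0, f1, f2, f3)" by (cases f rule: prod_cases4)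
  then have m: "f0 \<in> quad_gr n" "f1 \<in> quad_gr (n - 1)" "f2 \<in> quad_gr (n - 1)" "f3 \<in> quad_gr (n - 2)"
    using f by (auto simp: sym_gr_def)
  have "(f1, 0, f3, 0) \<in> sym_gr (n - 1)" "(f2, 0, 0, 0) \<in> sym_gr (n - 1)"
    using m by (simp_all add: sym_gr_def)
  from spanned_add[OF spanned_add[OF quad[OF m(1)] spanned_mult(1)[OF this(1)]] spanned_mult(2)[OF this(2)]]
  show ?thesis by (simp add: eq)
qed

subsection \<open>Hilbert series\<close>

text \<open>The coefficients are the exponents of 2 in the cardinalities. Rational coefficients
  permit subtraction and inversion of series.\<close>

definition hilbert :: "(int \<Rightarrow> 'a set) \<Rightarrow> rat fps \<Rightarrow> bool" where
  "hilbert H F \<longleftrightarrow> (\<forall>n<0. card (H n) = 1) \<and> (\<forall>n. \<exists>e. card (H (int n)) = 2 ^ e \<and> fps_nth F n = of_nat e)"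

lemma hilbertD: "hilbert H F \<Longrightarrow> \<exists>e. card (H (int n)) = 2 ^ e \<and> fps_nth F n = of_nat e"
  unfolding hilbert_def by blast

lemma hilbert_bits: "hilbert bits 1"
  unfolding hilbert_def bits_def by (auto simp: card_UNIV_bit intro: exI[of _ 1] exI[of _ 0])

lemma hilbert_times:
  assumes "hilbert A F" "hilbert B G"
  shows "hilbert (\<lambda>n. A n \<times> B (n - int d)) (F + fps_X ^ d * G)"
  unfolding hilbert_def
proof (intro conjI allI impI)
  fix n :: int assume "n < 0"
  then show "card (A n \<times> B (n - int d)) = 1" using assms by (simp add: hilbert_def card_cartesian_product)
next
  fix n
  obtain e where e: "card (A (int n)) = 2 ^ e" "fps_nth F n = of_nat e" using hilbertD[OF assms(1), of n] by blast
  show "\<exists>e. card (A (int n) \<times> B (int n - int d)) = 2 ^ e \<and> fps_nth (F + fps_X ^ d * G) n = of_nat e"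
  proof (cases "n < d")
    case True
    then have "card (B (int n - int d)) = 1" using assms by (simp add: hilbert_def)
    then show ?thesis using e True by (intro exI[of _ e]) (simp add: card_cartesian_product fps_X_power_mult_nth)
  next
    case False
    then have "int n - int d = int (n - d)" by simp
    moreover obtain k where k: "card (B (int (n - d))) = 2 ^ k" "fps_nth G (n - d) = of_nat k"
      using hilbertD[OF assms(2), of "n - d"] by blast
    ultimately show ?thesis using e False
      by (intro exI[of _ "e + k"]) (simp add: card_cartesian_product fps_X_power_mult_nth power_add)
  qed
qed

lemma hilbert_graded_poly:
  assumes H: "hilbert H F" and gr: "graded H" and d: "d > 0" and G: "G * (1 - fps_X ^ d) = F"
  shows "hilbert (graded_poly (int d) H) G"
  unfolding hilbert_def
proof (intro conjI allI impI)
  fix n :: int assume "n < 0"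
  then show "card (graded_poly (int d) H n) = 1" using graded_poly_neg[OF gr] d by simp
next
  fix n
  show "\<exists>e. card (graded_poly (int d) H (int n)) = 2 ^ e \<and> fps_nth G n = of_nat e"
  proof (induction n rule: less_induct)
    case (less n)
    obtain e where e: "card (H (int n)) = 2 ^ e" "fps_nth F n = of_nat e" using hilbertD[OF H, of n] by blast
    have "fps_nth G n - fps_nth (fps_X ^ d * G) n = of_nat e"
      unfolding e(2)[symmetric] G[symmetric] by (simp add: algebra_simps)
    then have G': "fps_nth G n = of_nat e + (if n < d then 0 else fps_nth G (n - d))"
      by (simp add: fps_X_power_mult_nth split: if_splits)
    show ?case
    proof (cases "n < d")
      case True
      then have "card (graded_poly (int d) H (int n - int d)) = 1" using graded_poly_neg[OF gr] d by simp
      then show ?thesis using card_graded_poly[of "int d" H "int n"] e G' True by auto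
    next
      case False
      then have "int n - int d = int (n - d)" by simp
      moreover obtain k where "card (graded_poly (int d) H (int (n - d))) = 2 ^ k" "fps_nth G (n - d) = of_nat k"
        using less[of "n - d"] d False by auto
      ultimately show ?thesis using card_graded_poly[of "int d" H "int n"] e G' False
        by (intro exI[of _ "e + k"]) (simp add: power_add)
    qed
  qed
qed

text \<open>The series of one polynomial variable of degree \<open>d\<close>.\<close>

definition gp :: "nat \<Rightarrow> rat fps" where "gp d = inverse (1 - fps_X ^ d)"

lemma gp: "d > 0 \<Longrightarrow> gp d * (1 - fps_X ^ d) = 1"
  unfolding gp_def by (rule inverse_mult_eq_1) (simp add: fps_X_power_nth)

lemma gp_1: "gp 1 * (1 - fps_X ^ 1) = 1"
  by (rule gp) simp

lemma hilbert_gp: "hilbert H F \<Longrightarrow> graded H \<Longrightarrow> d > 0 \<Longrightarrow> hilbert (graded_poly (int d) H) (F * gp d)"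
  by (rule hilbert_graded_poly) (simp_all add: mult.assoc gp)

lemma hilbert_norms: "hilbert norms_gr (gp 4 ^ 2)"
  using hilbert_gp[OF hilbert_gp[OF hilbert_bits graded_bits, of 4], of 4] graded_graded_poly[OF graded_bits, of 4]
  by (simp add: norms_gr_def power2_eq_square)

definition ground_series :: "rat fps" where "ground_series = gp 4 ^ 2 * gp 1 ^ 3"

lemma hilbert_ground: "hilbert ground_gr ground_series"
proof -
  have "hilbert (graded_poly 1 norms_gr) (gp 4 ^ 2 * gp 1)"
    using hilbert_gp[OF hilbert_norms graded_norms, of 1] by simp
  then have "hilbert base_gr (gp 4 ^ 2 * gp 1 * gp 1)"
    using hilbert_gp[of "graded_poly 1 norms_gr" _ 1] graded_graded_poly[OF graded_norms, of 1]
    unfolding base_gr_def by simp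
  from hilbert_gp[OF this graded_base, of 1] show ?thesis
    by (simp add: ground_gr_def ground_series_def power3_eq_cube mult.assoc)
qed

lemma hilbert_sym: "hilbert sym_gr (ground_series * (1 + fps_X ^ 2) ^ 2 * (1 + fps_X) ^ 2)"
proof -
  let ?G = ground_series
  have "hilbert (\<lambda>n. ground_gr n \<times> ground_gr (n - int 2)) (?G + fps_X ^ 2 * ?G)"
    by (intro hilbert_times hilbert_ground)
  from hilbert_times[OF hilbert_ground this, of 0]
  have "hilbert (\<lambda>n. ground_gr n \<times> ground_gr n \<times> ground_gr (n - 2)) (?G + (?G + fps_X ^ 2 * ?G))" by simp
  from hilbert_times[OF hilbert_ground this, of 2]
  have Q: "hilbert quad_gr (?G + fps_X ^ 2 * (?G + (?G + fps_X ^ 2 * ?G)))" (is "hilbert _ ?Q")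
    unfolding quad_gr_def[abs_def] by simp
  have "hilbert (\<lambda>n. quad_gr n \<times> quad_gr (n - int 1)) (?Q + fps_X ^ 1 * ?Q)"
    by (intro hilbert_times Q)
  from hilbert_times[OF Q this, of 0]
  have "hilbert (\<lambda>n. quad_gr n \<times> quad_gr n \<times> quad_gr (n - 1)) (?Q + (?Q + fps_X ^ 1 * ?Q))" by simp
  from hilbert_times[OF Q this, of 1]
  have "hilbert sym_gr (?Q + fps_X ^ 1 * (?Q + (?Q + fps_X ^ 1 * ?Q)))"
    unfolding sym_gr_def[abs_def] by simp
  also have "?Q + fps_X ^ 1 * (?Q + (?Q + fps_X ^ 1 * ?Q)) = ?G * (1 + fps_X ^ 2) ^ 2 * (1 + fps_X) ^ 2"
    by (simp add: power2_eq_square algebra_simps)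
  finally show ?thesis .
qed

lemma gp_power:
  assumes k: "k > 0"
  shows "gp k ^ Suc d = Abs_fps (\<lambda>n. if k dvd n then of_nat ((n div k + d) choose d) else 0)"
proof (induction d)
  case 0
  have "Abs_fps (\<lambda>n. if k dvd n then 1 else 0 :: rat) * (1 - fps_X ^ k) = 1"
  proof (rule fps_ext)
    fix n show "fps_nth (Abs_fps (\<lambda>n. if k dvd n then 1 else 0 :: rat) * (1 - fps_X ^ k)) n = fps_nth 1 n"
    proof (cases "n < k")
      case True
      then have "k dvd n \<longleftrightarrow> n = 0" by (auto dest: dvd_imp_le)
      then show ?thesis using True by (auto simp: right_diff_distrib fps_X_power_mult_right_nth)
    next
      case False
      then have "k dvd n - k \<longleftrightarrow> k dvd n" by (auto simp: dvd_minus_self)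
      then show ?thesis using False k by (auto simp: right_diff_distrib fps_X_power_mult_right_nth)
    qed
  qed
  then have "gp k = gp k * (1 - fps_X ^ k) * Abs_fps (\<lambda>n. if k dvd n then 1 else 0)"
    by (simp add: mult.assoc mult.commute[of "1 - _"])
  then show ?case by (simp add: gp[OF k] cong: if_cong)
next
  case (Suc d)
  let ?A = "\<lambda>d. Abs_fps (\<lambda>n. if k dvd n then of_nat ((n div k + d) choose d) else 0) :: rat fps"
  have "?A (Suc d) * (1 - fps_X ^ k) = ?A d"
  proof (rule fps_ext)
    fix n
    show "fps_nth (?A (Suc d) * (1 - fps_X ^ k)) n = fps_nth (?A d) n"
    proof (cases "n < k")
      case True
      then have "k dvd n \<longleftrightarrow> n = 0" by (auto dest: dvd_imp_le)
      then show ?thesis using True by (auto simp: right_diff_distrib fps_X_power_mult_right_nth)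
    next
      case False
      then have "k dvd n - k \<longleftrightarrow> k dvd n" "n div k = Suc ((n - k) div k)"
        using k by (auto simp: dvd_minus_self le_div_geq)
      then show ?thesis using False by (auto simp: right_diff_distrib fps_X_power_mult_right_nth)
    qed
  qed
  then have "gp k * ?A d = gp k * (1 - fps_X ^ k) * ?A (Suc d)"
    by (simp only: mult.assoc mult.commute[of "1 - _"])
  then have "gp k * ?A d = ?A (Suc d)" by (simp only: gp[OF k] mult_1)
  then show ?case unfolding power_Suc[of _ "Suc d"] Suc .
qed

lemma gp_1_power: "gp 1 ^ Suc d = Abs_fps (\<lambda>n. of_nat ((n + d) choose d))"
  using gp_power[of 1 d] by simp

lemma gp_4: "gp 4 * (1 + fps_X) * (1 + fps_X ^ 2) = gp 1"
proof -
  have "gp 1 = gp 1 * (gp 4 * (1 - fps_X ^ 4))" by (simp add: gp)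
  also have "(1 - fps_X ^ 4 :: rat fps) = (1 - fps_X ^ 1) * ((1 + fps_X) * (1 + fps_X ^ 2))"
    by (simp add: algebra_simps eval_nat_numeral)
  also have "gp 1 * (gp 4 * ((1 - fps_X ^ 1) * ((1 + fps_X) * (1 + fps_X ^ 2))))
      = gp 1 * (1 - fps_X ^ 1) * (gp 4 * (1 + fps_X) * (1 + fps_X ^ 2))" by (simp only: ac_simps)
  finally show ?thesis by (simp only: gp_1 mult_1)
qed

text \<open>The sixteen basis degrees turn each factor for a norm of degree 4 into the factor for a
  variable of degree 1, so the series is that of five such variables.\<close>

lemma card_sym: "card (sym_gr (int n)) = 2 ^ ((n + 4) choose 4)"
proof -
  have "ground_series * (1 + fps_X ^ 2) ^ 2 * (1 + fps_X) ^ 2 = gp 1 ^ 3 * (gp 4 * (1 + fps_X) * (1 + fps_X ^ 2)) ^ 2"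
    unfolding ground_series_def power_mult_distrib by (simp only: ac_simps)
  also have "\<dots> = gp 1 ^ Suc 4" unfolding gp_4 by (simp only: power_add[symmetric]) simp
  finally have "hilbert sym_gr (gp 1 ^ Suc 4)" using hilbert_sym by simp
  from hilbertD[OF this, of n] show ?thesis unfolding gp_1_power by auto
qed

definition sym_one :: sym where "sym_one = ((1, 0, 0, 0), 0, 0, 0)"

lemma one_ground: "1 \<in> ground_gr 0"
proof -
  have "(1 :: bit) \<in> bits 0" by (simp add: bits_def)
  then have "[:[:[:[:[:1:]:]:]:]:] \<in> ground_gr 0"
    unfolding ground_gr_def base_gr_def norms_gr_def
    by (intro const_graded_poly graded_graded_poly graded_bits) simp_all
  then show ?thesis by (simp add: one_pCons)
qed

interpretation sym: symmetric_algebra sym_gr sym_one ma mb "ssc w" "ssc al" "ssc be" ax ay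
proof unfold_locales
  show "graded sym_gr" by (rule graded_sym)
  have "sym_one \<in> sym_gr 0" using one_ground by (simp add: sym_one_def sym_gr_def quad_gr_def zero_prod_def)
  then have "{0, sym_one} \<subseteq> sym_gr 0" by simp
  moreover have "finite (sym_gr 0)" using graded_sym by (simp add: graded_def)
  moreover have "(0 :: sym) \<noteq> sym_one" by (simp add: sym_one_def zero_prod_def)
  then have "card {0, sym_one} = 2" by simp
  then have "card (sym_gr 0) \<le> card {0, sym_one}" using card_sym[of 0] by simp
  ultimately show "sym_gr 0 = {0, sym_one}" using card_seteq by blast
  show "card (sym_gr (int k)) = 2 ^ ((k + 4) choose 4)" for k by (rule card_sym)
  show "\<exists>a b c d e. a \<in> sym_gr (n - 1) \<and> b \<in> sym_gr (n - 1) \<and> c \<in> sym_gr (n - 1) \<and>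
      d \<in> sym_gr (n - 1) \<and> e \<in> sym_gr (n - 1) \<and> v = ma a + mb b + ssc w c + ssc al d + ssc be e"
    if "0 < n" "v \<in> sym_gr n" for n v
    using sym_gr_spanned[OF that] unfolding spanned_def by blast
  show "ax sym_one = sym_one" "ay sym_one = sym_one" by (simp_all add: sym_one_def zero_prod_def)
qed (fact hom_sym sym_gr_mult sym_commute ax_sym ay_sym)+

subsection \<open>Invariants of the symmetric algebra\<close>

lemma ground_nonzero: "w \<noteq> 0" "al \<noteq> 0" "be \<noteq> 0" "w + al \<noteq> 0" "w + be \<noteq> 0" "al0 \<noteq> 0" "be0 \<noteq> 0" "al0 + be0 \<noteq> 0"
  by (simp_all add: w_def al_def be_def al0_def be0_def)

lemma ga_de_nonzero: "ga \<noteq> 0" "de \<noteq> 0"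
  by (simp_all add: ga_def de_def ground_nonzero)

lemma poly_eval: "poly w z = z" "poly al z = al0" "poly be z = be0"
  by (simp_all add: w_def al_def be_def)

lemma root_factor:
  "poly f 0 = 0 \<Longrightarrow> \<exists>g. f = w * g" "poly f al0 = 0 \<Longrightarrow> \<exists>g. f = (w + al) * g" "poly f be0 = 0 \<Longrightarrow> \<exists>g. f = (w + be) * g"
proof -
  have "w = [:- 0, 1:]" "w + al = [:- al0, 1:]" "w + be = [:- be0, 1:]" by (simp_all add: w_def al_def be_def)
  then show "poly f 0 = 0 \<Longrightarrow> \<exists>g. f = w * g" "poly f al0 = 0 \<Longrightarrow> \<exists>g. f = (w + al) * g"
    "poly f be0 = 0 \<Longrightarrow> \<exists>g. f = (w + be) * g"
    by (simp_all only: poly_eq_0_iff_dvd dvd_def)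
qed

text \<open>\<open>e\<close>, \<open>h1\<close>, \<open>h2\<close>, \<open>c\<close> are the
  coefficients of \<open>1\<close>, \<open>a\<close>, \<open>b\<close>, \<open>ab\<close>;
  \<open>p\<close>, \<open>q\<close>, \<open>r\<close> with index \<open>i\<close> are those of
  \<open>p\<close>, \<open>q\<close>, \<open>pq\<close> in the block \<open>i\<close>. Nonvanishing
  of \<gamma> and \<delta> first removes five unknowns, and the rest is comparison of
  coefficients.\<close>

lemma fixed_iff:
  "ax ((e, p0, q0, r0), (h1, p1, q1, r1), (h2, p2, q2, r2), (c, p3, q3, r3))
      = ((e, p0, q0, r0), (h1, p1, q1, r1), (h2, p2, q2, r2), (c, p3, q3, r3)) \<and>
   ay ((e, p0, q0, r0), (h1, p1, q1, r1), (h2, p2, q2, r2), (c, p3, q3, r3))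
      = ((e, p0, q0, r0), (h1, p1, q1, r1), (h2, p2, q2, r2), (c, p3, q3, r3)) \<longleftrightarrow>
   p3 = 0 \<and> q3 = 0 \<and> r3 = 0 \<and> r1 = 0 \<and> r2 = 0 \<and>
   ga * p1 = be * c \<and> de * q1 = w * c \<and> ga * p2 = w * c \<and> de * q2 = al * c \<and>
   w * p1 = be * p2 \<and> al * q1 = w * q2 \<and> ga * r0 = w * q1 + be * q2 \<and> de * r0 = al * p1 + w * p2 \<and>
   ga * p0 = w * h1 + be * h2 + w * be * c \<and> de * q0 = al * h1 + w * h2 + al * w * c" (is "?L \<longleftrightarrow> ?R")
proof
  assume L: ?L
  then have z: "p3 = 0" "q3 = 0" "r3 = 0" by (auto simp: ga_de_nonzero)
  then have z': "r1 = 0" "r2 = 0" using L by (auto simp: ga_de_nonzero)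
  have 1: "ga * p1 = be * c" "de * q1 = w * c" "ga * p2 = w * c" "de * q2 = al * c"
    using L by (auto simp: z z' add.assoc add_eq_0_iff_char_2)
  have 2: "w * p1 = be * p2" "al * q1 = w * q2" "ga * r0 = w * q1 + be * q2" "de * r0 = al * p1 + w * p2"
    using L by (auto simp: z z' add.assoc add_eq_0_iff_char_2)
  have "ga * p0 + (w * h1 + w * (ga * p1) + (be * h2 + be * (ga * p2)) + w * be * c) = 0"
    using L by (simp add: z z' add.assoc distrib_left)
  then have 3: "ga * p0 = w * h1 + be * h2 + w * be * c"
    unfolding 1 add_eq_0_iff_char_2 by (simp add: ac_simps)
  have "de * q0 + (al * h1 + al * (de * q1) + (w * h2 + w * (de * q2)) + al * w * c) = 0"
    using L by (simp add: z z' add.assoc distrib_left)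
  then have 4: "de * q0 = al * h1 + w * h2 + al * w * c"
    unfolding 1 add_eq_0_iff_char_2 by (simp add: ac_simps)
  show ?R using z z' 1 2 3 4 by simp
next
  assume R: ?R
  then have z: "p3 = 0" "q3 = 0" "r3 = 0" "r1 = 0" "r2 = 0" by auto
  have 1: "ga * p1 = be * c" "de * q1 = w * c" "ga * p2 = w * c" "de * q2 = al * c"
    "w * p1 = be * p2" "al * q1 = w * q2" "ga * r0 = w * q1 + be * q2" "de * r0 = al * p1 + w * p2"
    "ga * p0 = w * h1 + be * h2 + w * be * c" "de * q0 = al * h1 + w * h2 + al * w * c" using R by auto
  show ?L unfolding z ax.simps ay.simps xq.simps yq.simps sc.simps distrib_left 1 by (simp add: ac_simps)
qed

section \<open>Solving the invariance equations\<close>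

definition inv_gr :: "int \<Rightarrow> sym set" where
  "inv_gr n = {f \<in> sym_gr n. ax f = f \<and> ay f = f}"

text \<open>The pairs for which \<open>w * k1\<close> and \<open>w * k2\<close> occur as
  coefficients of \<open>a\<close> and \<open>b\<close> in an invariant.\<close>

definition syz :: "int \<Rightarrow> (ground \<times> ground) set" where
  "syz n = {(k1, k2). k1 \<in> ground_gr n \<and> k2 \<in> ground_gr n \<and> (\<exists>m. al * k1 + be * k2 = (w + al) * (w + be) * m)}"

definition components :: "sym \<Rightarrow> ground \<times> ground \<times> ground \<times> ground" where
  "components = (\<lambda>((e, p0, q0, r0), (h1, p1, q1, r1), (h2, p2, q2, r2), (c, p3, q3, r3)). (e, c, h1, h2))"

lemma reflect_w: "w * f \<in> ground_gr (n + 1) \<Longrightarrow> f \<in> ground_gr n"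
  by (simp add: w_def ground_gr_def pCons_graded_poly)

lemma coeff_linear: "coeff ((w + [:s:]) * f) (Suc i) = coeff f i + s * coeff f (Suc i)"
  by (simp add: w_def algebra_simps)

text \<open>Division by a monic linear polynomial in \<open>w\<close> preserves homogeneity, since
  the coefficients of the quotient are recovered from the top downwards.\<close>

lemma reflect_linear:
  assumes s: "\<And>m a. a \<in> base_gr m \<Longrightarrow> s * a \<in> base_gr (m + 1)" and f: "(w + [:s:]) * f \<in> ground_gr (n + 1)"
  shows "f \<in> ground_gr n"
proof -
  have "coeff f (degree f + 1 - k) \<in> base_gr (n - int (degree f + 1 - k))" for k
  proof (induction k)
    case 0
    have "coeff f (degree f + 1) = 0" by (simp add: coeff_eq_0)
    then show ?case by (simp add: graded_0[OF graded_base])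
  next
    case (Suc k)
    show ?case
    proof (cases "k \<le> degree f")
      case True
      define i where "i = degree f - k"
      have i: "degree f + 1 - Suc k = i" "degree f + 1 - k = Suc i" using True by (simp_all add: i_def)
      have "s * coeff f (Suc i) \<in> base_gr (n - int i)" using s[OF Suc[unfolded i]] by (simp add: algebra_simps)
      moreover have "coeff ((w + [:s:]) * f) (Suc i) \<in> base_gr (n - int i)"
        using graded_poly_coeff[of _ 1 base_gr "n + 1" "Suc i"] f by (simp add: ground_gr_def)
      ultimately have "coeff ((w + [:s:]) * f) (Suc i) + s * coeff f (Suc i) \<in> base_gr (n - int i)"
        by (intro graded_add[OF graded_base])
      then show ?thesis unfolding coeff_linear i by (simp add: add.assoc)
    next
      case False
      then have "degree f + 1 - Suc k = degree f + 1 - k" by simp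
      then show ?thesis using Suc by simp
    qed
  qed
  note * = this
  have "coeff f i \<in> base_gr (n - int i)" for i
  proof (cases "i \<le> degree f")
    case True
    then show ?thesis using *[of "degree f + 1 - i"] by simp
  next
    case False
    then show ?thesis by (simp add: coeff_eq_0 graded_0[OF graded_base])
  qed
  then show ?thesis by (simp add: ground_gr_def graded_poly_def)
qed

lemma reflect_wal: "(w + al) * f \<in> ground_gr (n + 1) \<Longrightarrow> f \<in> ground_gr n"
  and reflect_wbe: "(w + be) * f \<in> ground_gr (n + 1) \<Longrightarrow> f \<in> ground_gr n"
  unfolding al_def be_def by (rule reflect_linear[OF mult_base(1)] reflect_linear[OF mult_base(2)]; simp)+

lemma mult_linear: "f \<in> ground_gr n \<Longrightarrow> (w + al) * f \<in> ground_gr (n + 1)" "f \<in> ground_gr n \<Longrightarrow> (w + be) * f \<in> ground_gr (n + 1)"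
  by (simp_all add: distrib_right add_ground mult_ground)

text \<open>All other coefficients are fixed by equations with left factor \<gamma> or \<delta>,
  which cancel in an integral domain.\<close>

lemma components_inject:
  assumes f: "ax f = f" "ay f = f" and g: "ax g = g" "ay g = g" and eq: "components f = components g"
  shows "f = g"
proof -
  obtain f0 f1 f2 f3 g0 g1 g2 g3 where fg: "f = (f0, f1, f2, f3)" "g = (g0, g1, g2, g3)"
    by (cases f rule: prod_cases4; cases g rule: prod_cases4) auto
  obtain e p0 q0 r0 where 0: "f0 = (e, p0, q0, r0)" by (cases f0 rule: prod_cases4)
  obtain h1 p1 q1 r1 where 1: "f1 = (h1, p1, q1, r1)" by (cases f1 rule: prod_cases4)
  obtain h2 p2 q2 r2 where 2: "f2 = (h2, p2, q2, r2)" by (cases f2 rule: prod_cases4)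
  obtain c p3 q3 r3 where 3: "f3 = (c, p3, q3, r3)" by (cases f3 rule: prod_cases4)
  obtain p0' q0' r0' where u0: "g0 = (e, p0', q0', r0')" using eq unfolding fg 0 1 2 3
    by (cases g0 rule: prod_cases4; cases g1 rule: prod_cases4; cases g2 rule: prod_cases4; cases g3 rule: prod_cases4)
      (auto simp: components_def)
  obtain p1' q1' r1' where u1: "g1 = (h1, p1', q1', r1')" using eq unfolding fg 0 1 2 3
    by (cases g0 rule: prod_cases4; cases g1 rule: prod_cases4; cases g2 rule: prod_cases4; cases g3 rule: prod_cases4)
      (auto simp: components_def)
  obtain p2' q2' r2' where u2: "g2 = (h2, p2', q2', r2')" using eq unfolding fg 0 1 2 3
    by (cases g0 rule: prod_cases4; cases g1 rule: prod_cases4; cases g2 rule: prod_cases4; cases g3 rule: prod_cases4)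
      (auto simp: components_def)
  obtain p3' q3' r3' where u3: "g3 = (c, p3', q3', r3')" using eq unfolding fg 0 1 2 3
    by (cases g0 rule: prod_cases4; cases g1 rule: prod_cases4; cases g2 rule: prod_cases4; cases g3 rule: prod_cases4)
      (auto simp: components_def)
  have F: "p3 = 0" "q3 = 0" "r3 = 0" "r1 = 0" "r2 = 0" "ga * p1 = be * c" "de * q1 = w * c" "ga * p2 = w * c"
    "de * q2 = al * c" "ga * r0 = w * q1 + be * q2" "ga * p0 = w * h1 + be * h2 + w * be * c"
    "de * q0 = al * h1 + w * h2 + al * w * c"
    using f fixed_iff[of e p0 q0 r0 h1 p1 q1 r1 h2 p2 q2 r2 c p3 q3 r3] unfolding fg 0 1 2 3 by blast+
  have G: "p3' = 0" "q3' = 0" "r3' = 0" "r1' = 0" "r2' = 0" "ga * p1' = be * c" "de * q1' = w * c" "ga * p2' = w * c"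
    "de * q2' = al * c" "ga * r0' = w * q1' + be * q2'" "ga * p0' = w * h1 + be * h2 + w * be * c"
    "de * q0' = al * h1 + w * h2 + al * w * c"
    using g fixed_iff[of e p0' q0' r0' h1 p1' q1' r1' h2 p2' q2' r2' c p3' q3' r3'] unfolding fg u0 u1 u2 u3 by blast+
  have ga: "x = y" if "ga * x = ga * y" for x y using that ga_de_nonzero by simp
  have de: "x = y" if "de * x = de * y" for x y using that ga_de_nonzero by simp
  have "p1 = p1'" "p2 = p2'" "p0 = p0'" by (rule ga, simp only: F G)+
  moreover have q: "q1 = q1'" "q2 = q2'" "q0 = q0'" by (rule de, simp only: F G)+
  moreover have "r0 = r0'" by (rule ga) (simp only: F G q)
  ultimately show ?thesis by (simp add: fg 0 1 2 3 u0 u1 u2 u3 F(1-5) G(1-5))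
qed

text \<open>The factors split off one at a time: substituting 0 or \<alpha> for \<open>w\<close> in
  an equation shows that a quotient vanishes there, since \<open>al0\<close>, \<open>be0\<close> and
  \<open>al0 + be0\<close> are nonzero.\<close>

lemma dvd_components:
  assumes eq: "ga * p1 = be * c" "de * q1 = w * c" "ga * p2 = w * c" "de * q2 = al * c"
    "ga * r0 = w * q1 + be * q2"
  shows "\<exists>g. c = w * w * (w + al) * (w + be) * g"
proof -
  have c1: "(w + al) * p2 = c" and c2: "(w + be) * q1 = c"
    using eq(2,3) ground_nonzero(1) by (simp_all add: ga_def de_def mult.assoc)
  \<comment> \<open>Substituting \<alpha> for \<open>w\<close> kills the left side in characteristic
    two.\<close>
  have "poly ((w + al) * p2) al0 = poly ((w + be) * q1) al0" by (simp only: c1 c2)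
  then have "(al0 + be0) * poly q1 al0 = 0" by (simp add: poly_eval)
  then obtain s where s: "q1 = (w + al) * s" using root_factor(2)[of q1] ground_nonzero(8) by auto
  have c: "c = (w + al) * ((w + be) * s)" unfolding c2[symmetric] s by (simp only: ac_simps)
  have "(w + al) * (w * p1) = (w + al) * (be * ((w + be) * s))"
    using eq(1) unfolding c ga_def by (simp only: ac_simps)
  then have p1: "w * p1 = be * ((w + be) * s)" using ground_nonzero(4) by simp
  have "poly (w * p1) 0 = poly (be * ((w + be) * s)) 0" by (simp only: p1)
  then have "be0 * (be0 * poly s 0) = 0" by (simp add: poly_eval)
  then obtain t where t: "s = w * t" using root_factor(1)[of s] ground_nonzero(7) by auto
  have "(w + be) * (w * q2) = (w + be) * (w * (al * ((w + al) * t)))"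
    using eq(4) unfolding c t de_def by (simp only: ac_simps)
  then have q2: "q2 = al * ((w + al) * t)" using ground_nonzero(1,5) by simp
  have "(w + al) * (w * r0) = (w + al) * ((w * w + al * be) * t)"
    using eq(5) unfolding s t q2 ga_def by (simp add: algebra_simps)
  then have r0: "w * r0 = (w * w + al * be) * t" using ground_nonzero(4) by simp
  have "poly (w * r0) 0 = poly ((w * w + al * be) * t) 0" by (simp only: r0)
  then have "al0 * be0 * poly t 0 = 0" by (simp add: poly_eval)
  then obtain g where g: "t = w * g" using root_factor(1)[of t] ground_nonzero(6,7) by auto
  show ?thesis unfolding c t g by (intro exI[of _ g]) (simp only: ac_simps)
qed

text \<open>Substituting 0 for \<open>w\<close> gives the factors \<open>w\<close>; after cancelling
  them, \<alpha> and \<beta> give the two linear factors, as the known divisibility of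
  \<open>c\<close> removes it from the equations.\<close>

lemma dvd_syzygy:
  assumes p0: "ga * p0 = w * h1 + be * h2 + w * be * c" and q0: "de * q0 = al * h1 + w * h2 + al * w * c"
    and c: "c = w * w * (w + al) * (w + be) * g"
  shows "\<exists>k1 k2 m. h1 = w * k1 \<and> h2 = w * k2 \<and> al * k1 + be * k2 = (w + al) * (w + be) * m"
proof -
  have "poly (ga * p0) 0 = poly (w * h1 + be * h2 + w * be * c) 0" "poly (de * q0) 0 = poly (al * h1 + w * h2 + al * w * c) 0"
    by (simp_all only: p0 q0)
  then have "be0 * poly h2 0 = 0" "al0 * poly h1 0 = 0" by (simp_all add: poly_eval ga_def de_def)
  then obtain k1 k2 where k: "h1 = w * k1" "h2 = w * k2"
    using root_factor(1)[of h1] root_factor(1)[of h2] ground_nonzero(6,7) by auto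
  have "w * ((w + al) * p0) = w * (w * k1 + be * k2 + be * c)" "w * ((w + be) * q0) = w * (al * k1 + w * k2 + al * c)"
    using p0 q0 by (simp_all add: k ga_def de_def algebra_simps)
  then have e: "(w + al) * p0 = w * k1 + be * k2 + be * c" "(w + be) * q0 = al * k1 + w * k2 + al * c"
    using ground_nonzero(1) by simp_all
  have "poly ((w + al) * p0) al0 = poly (w * k1 + be * k2 + be * c) al0" "poly ((w + be) * q0) be0 = poly (al * k1 + w * k2 + al * c) be0"
    by (simp_all only: e)
  then have z: "al0 * poly k1 al0 + be0 * poly k2 al0 = 0" "al0 * poly k1 be0 + be0 * poly k2 be0 = 0"
    by (simp_all add: poly_eval c)
  then obtain m1 where m1: "al * k1 + be * k2 = (w + al) * m1"
    using root_factor(2)[of "al * k1 + be * k2"] by (auto simp: poly_eval)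
  have "poly ((w + al) * m1) be0 = 0" unfolding m1[symmetric] using z by (simp add: poly_eval)
  then have "(al0 + be0) * poly m1 be0 = 0" by (simp add: poly_eval add.commute)
  then obtain m where "m1 = (w + be) * m" using root_factor(3)[of m1] ground_nonzero(8) by auto
  then have "al * k1 + be * k2 = (w + al) * (w + be) * m" using m1 by (simp only: mult.assoc)
  then show ?thesis using k by blast
qed

definition norm_multiples :: "int \<Rightarrow> ground set" where
  "norm_multiples n = (\<lambda>g. w * w * (w + al) * (w + be) * g) ` ground_gr (n - 4)"

text \<open>Invariants are parametrised by an arbitrary \<open>e\<close>, an arbitrary cofactor
  \<open>g\<close> of \<open>c\<close>, and a pair in \<open>syz\<close>.\<close>

lemma components_image:
  "components ` inv_gr n = {(e, c, h1, h2). e \<in> ground_gr n \<and> c \<in> norm_multiples (n - 2) \<and>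
     (\<exists>k1 k2. (k1, k2) \<in> syz (n - 2) \<and> h1 = w * k1 \<and> h2 = w * k2)}" (is "_ = ?P")
proof (intro equalityI subsetI)
  fix x assume "x \<in> components ` inv_gr n"
  then obtain f where f: "f \<in> sym_gr n" "ax f = f" "ay f = f" and x: "x = components f" by (auto simp: inv_gr_def)
  obtain f0 f1 f2 f3 where fs: "f = (f0, f1, f2, f3)" by (cases f rule: prod_cases4)
  obtain e p0 q0 r0 where 0: "f0 = (e, p0, q0, r0)" by (cases f0 rule: prod_cases4)
  obtain h1 p1 q1 r1 where 1: "f1 = (h1, p1, q1, r1)" by (cases f1 rule: prod_cases4)
  obtain h2 p2 q2 r2 where 2: "f2 = (h2, p2, q2, r2)" by (cases f2 rule: prod_cases4)
  obtain c p3 q3 r3 where 3: "f3 = (c, p3, q3, r3)" by (cases f3 rule: prod_cases4)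
  have F: "ga * p1 = be * c" "de * q1 = w * c" "ga * p2 = w * c"
    "de * q2 = al * c" "ga * r0 = w * q1 + be * q2" "ga * p0 = w * h1 + be * h2 + w * be * c"
    "de * q0 = al * h1 + w * h2 + al * w * c"
    using f(2,3) fixed_iff[of e p0 q0 r0 h1 p1 q1 r1 h2 p2 q2 r2 c p3 q3 r3] unfolding fs 0 1 2 3 by blast+
  have gr: "e \<in> ground_gr n" "h1 \<in> ground_gr (n - 1)" "h2 \<in> ground_gr (n - 1)" "c \<in> ground_gr (n - 2)"
    using f(1) by (auto simp: fs 0 1 2 3 sym_gr_def quad_gr_def)
  obtain g where g: "c = w * w * (w + al) * (w + be) * g" using dvd_components[OF F(1-5)] by blast
  then have "c = w * (w * ((w + al) * ((w + be) * g)))" by (simp only: mult.assoc)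
  then have "g \<in> ground_gr (n - 6)"
    using gr(4) by - (rule reflect_wbe, rule reflect_wal, rule reflect_w, rule reflect_w, simp)
  then have c: "c \<in> norm_multiples (n - 2)" unfolding norm_multiples_def g by (intro image_eqI[OF refl]) simp
  obtain k1 k2 m where k: "h1 = w * k1" "h2 = w * k2" "al * k1 + be * k2 = (w + al) * (w + be) * m"
    using dvd_syzygy[OF F(6,7) g] by blast
  have "k1 \<in> ground_gr (n - 2)" "k2 \<in> ground_gr (n - 2)"
    using gr(2,3) reflect_w[of k1 "n - 2"] reflect_w[of k2 "n - 2"] by (simp_all add: k)
  then have "(k1, k2) \<in> syz (n - 2)" using k(3) unfolding syz_def by blast
  then show "x \<in> ?P" using gr(1) c k(1,2) by (auto simp: x fs 0 1 2 3 components_def)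
next
  fix x assume "x \<in> ?P"
  then obtain e c h1 h2 k1 k2 where x: "x = (e, c, h1, h2)" and e: "e \<in> ground_gr n" and c: "c \<in> norm_multiples (n - 2)"
    and k: "(k1, k2) \<in> syz (n - 2)" and h: "h1 = w * k1" "h2 = w * k2" by blast
  obtain g where g: "g \<in> ground_gr (n - 6)" "c = w * w * (w + al) * (w + be) * g" using c by (auto simp: norm_multiples_def)
  obtain m where km: "k1 \<in> ground_gr (n - 2)" "k2 \<in> ground_gr (n - 2)" and m: "al * k1 + be * k2 = (w + al) * (w + be) * m"
    using k by (auto simp: syz_def)
  have "al * k1 + be * k2 \<in> ground_gr (n - 1)" using mult_ground(2)[OF km(1)] mult_ground(3)[OF km(2)] by (simp add: add_ground)
  then have m_gr: "m \<in> ground_gr (n - 3)"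
    unfolding m mult.assoc by - (rule reflect_wbe, rule reflect_wal, simp)
  \<comment> \<open>The equations solved for the other coefficients. For example
    \<open>(w + \<alpha>) p0 = w k1 + \<beta> k2 + \<beta> c\<close>; replacing
    \<open>\<beta> k2\<close> by \<open>\<alpha> k1 + (w + \<alpha>) (w + \<beta>) m\<close> makes
    the right side divisible.\<close>
  define f :: sym where "f = ((e, k1 + (w + be) * m + be * (w * (w * ((w + be) * g))), k2 + (w + al) * m + al * (w * (w * ((w + al) * g))),
      w * (w * g) + al * (be * g)), (h1, be * (w * ((w + be) * g)), w * (w * ((w + al) * g)), 0),
      (h2, w * (w * ((w + be) * g)), al * (w * ((w + al) * g)), 0), (c, 0, 0, 0) :: quad)"
  have a: "al * k1 = (w + al) * (w + be) * m + be * k2" using m by (metis add_self_right)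
  have "f \<in> sym_gr n"
  proof -
    have s: "h \<in> ground_gr j \<Longrightarrow> w * h \<in> ground_gr (j + 1)" "h \<in> ground_gr j \<Longrightarrow> al * h \<in> ground_gr (j + 1)"
      "h \<in> ground_gr j \<Longrightarrow> be * h \<in> ground_gr (j + 1)" "h \<in> ground_gr j \<Longrightarrow> (w + al) * h \<in> ground_gr (j + 1)"
      "h \<in> ground_gr j \<Longrightarrow> (w + be) * h \<in> ground_gr (j + 1)" for h j
      by (intro mult_ground mult_linear; assumption)+
    note g1 = g(1)[THEN s(5)] g(1)[THEN s(4)]
    note g2 = g1(1)[THEN s(1)] g1(2)[THEN s(1)]
    note g3 = g2(1)[THEN s(1)] g2(2)[THEN s(1)]
    note g4 = g3(1)[THEN s(3)] g3(2)[THEN s(2)] g2(1)[THEN s(3)] g2(2)[THEN s(2)] g(1)[THEN s(1), THEN s(1)]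
      g(1)[THEN s(3), THEN s(2)] m_gr[THEN s(5)] m_gr[THEN s(4)] km[THEN s(1)]
    have "w * (w * ((w + al) * ((w + be) * g))) \<in> ground_gr (n - 6 + 1 + 1 + 1 + 1)" by (intro s g)
    then have c: "c \<in> ground_gr (n - 2)" by (simp add: g(2) mult.assoc)
    show ?thesis using e km c g3 g4
      by (auto simp: f_def sym_gr_def quad_gr_def h intro!: add_ground elim!: graded_eqI)
  qed
  moreover have "ax f = f \<and> ay f = f"
    unfolding f_def fixed_iff g(2) h ga_def de_def
  proof (intro conjI)
    show "w * (w + al) * (k1 + (w + be) * m + be * (w * (w * ((w + be) * g)))) =
      w * (w * k1) + be * (w * k2) + w * be * (w * w * (w + al) * (w + be) * g)"
    proof -
      have "w * (w + al) * (k1 + (w + be) * m + be * (w * (w * ((w + be) * g)))) = w * (w * k1 + al * k1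
          + (w + al) * (w + be) * m) + w * be * (w * w * (w + al) * (w + be) * g)" by (simp only: algebra_simps)
      then show ?thesis unfolding a by (simp add: algebra_simps)
    qed
    show "w * (w + be) * (k2 + (w + al) * m + al * (w * (w * ((w + al) * g)))) =
      al * (w * k1) + w * (w * k2) + al * w * (w * w * (w + al) * (w + be) * g)"
    proof -
      have "al * (w * k1) + w * (w * k2) = w * (al * k1 + w * k2)" by (simp only: algebra_simps)
      then show ?thesis unfolding a by (simp add: algebra_simps)
    qed
  qed (simp_all add: algebra_simps)
  ultimately show "x \<in> components ` inv_gr n"
    by (intro image_eqI[of _ _ f]) (auto simp: inv_gr_def f_def components_def x)
qed

section \<open>The ideal generated by \<alpha> and \<beta>, and its linear syzygies\<close>

definition residue :: "base \<Rightarrow> norms" where "residue x = coeff (coeff x 0) 0"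

definition reduction :: "ground \<Rightarrow> norms poly" where "reduction f = map_poly residue f"

text \<open>The kernel of setting \<alpha> and \<beta> to 0. As a kernel it can be counted, and
  \<open>ideal_decompose\<close> identifies it with the ideal.\<close>

definition ideal_gr :: "int \<Rightarrow> ground set" where
  "ideal_gr n = {f \<in> ground_gr n. reduction f = 0}"

lemma residue_simps [simp]: "residue 0 = 0" "residue (x + y) = residue x + residue y"
  "residue (al0 * x) = 0" "residue (be0 * x) = 0"
  by (simp_all add: residue_def al0_def be0_def)

lemma coeff_reduction [simp]: "coeff (reduction f) i = residue (coeff f i)"
  by (simp add: reduction_def coeff_map_poly)

lemma hom_reduction: "add_hom reduction"
  by (rule add_homI) (simp add: poly_eq_iff)

lemma residue_gr: "x \<in> base_gr n \<Longrightarrow> residue x \<in> norms_gr n"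
  using graded_poly_coeff[of x 1 "graded_poly 1 norms_gr" n 0] graded_poly_coeff[of "coeff x 0" 1 norms_gr n 0]
  by (simp add: base_gr_def residue_def)

lemma reduction_image: "reduction ` ground_gr n = graded_poly 1 norms_gr n"
proof (intro equalityI subsetI)
  fix f assume "f \<in> reduction ` ground_gr n"
  then show "f \<in> graded_poly 1 norms_gr n" by (auto simp: graded_poly_def ground_gr_def residue_gr)
next
  fix f assume f: "f \<in> graded_poly 1 norms_gr n"
  have "map_poly (\<lambda>k. [:[:k:]:]) f \<in> ground_gr n"
  proof -
    have "[:[:coeff f i:]:] \<in> base_gr (n - 1 * int i)" for i
      unfolding base_gr_def
      by (intro const_graded_poly graded_graded_poly graded_norms graded_poly_coeff[OF f]) simp
    then show ?thesis unfolding ground_gr_def graded_poly_def[of 1 base_gr] by (simp add: coeff_map_poly)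
  qed
  moreover have "reduction (map_poly (\<lambda>k. [:[:k:]:]) f) = f"
    by (simp add: poly_eq_iff coeff_map_poly residue_def)
  ultimately show "f \<in> reduction ` ground_gr n" by (metis image_eqI)
qed

lemma add_closed_ground: "add_closed (ground_gr n)" and finite_ground: "finite (ground_gr n)"
  using graded_ground by (auto simp: graded_def)

lemma card_ground_ideal: "card (ground_gr n) = card (graded_poly 1 norms_gr n) * card (ideal_gr n)"
  using card_eq_image_kernel[OF finite_ground add_closed_ground hom_reduction, of n]
  by (simp add: reduction_image ideal_gr_def)

lemma poly_shift_pCons: "pCons (coeff x 0) (poly_shift 1 x) = x"
  by (rule poly_eqI) (simp add: coeff_pCons coeff_poly_shift split: nat.split)

lemma poly_shift_1: "poly_shift (Suc 0) (pCons a f) = f"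
  by (rule poly_eqI) (simp add: coeff_poly_shift)

lemma poly_shift_gr: "x \<in> graded_poly 1 H n \<Longrightarrow> poly_shift 1 x \<in> graded_poly 1 H (n - 1)"
  using pCons_graded_poly[of "coeff x 0" "poly_shift 1 x" 1 H n] unfolding poly_shift_pCons by blast

lemma map_poly_gr:
  assumes f: "f \<in> ground_gr n" and h: "h 0 = 0" "\<And>x m. x \<in> base_gr m \<Longrightarrow> h x \<in> base_gr (m - 1)"
  shows "map_poly h f \<in> ground_gr (n - 1)"
proof -
  have "n - 1 - 1 * int i = n - 1 * int i - 1" for i by simp
  then have "h (coeff f i) \<in> base_gr (n - 1 - 1 * int i)" for i
    using h(2)[OF graded_poly_coeff[OF f[unfolded ground_gr_def]]] by (simp only:)
  then show ?thesis unfolding ground_gr_def graded_poly_def[of 1 base_gr] by (simp add: coeff_map_poly h(1))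
qed

lemma reflect_be: assumes "be * f \<in> ground_gr (n + 1)" shows "f \<in> ground_gr n"
proof -
  have "coeff f i \<in> base_gr (n - 1 * int i)" for i
  proof -
    have "pCons 0 (coeff f i) \<in> base_gr (n + 1 - 1 * int i)"
      using graded_poly_coeff[of "be * f" 1 base_gr "n + 1" i] assms by (simp add: ground_gr_def be_def be0_def)
    then show ?thesis by (simp add: base_gr_def pCons_graded_poly algebra_simps)
  qed
  then show ?thesis by (simp add: ground_gr_def graded_poly_def)
qed

text \<open>Coefficientwise in \<open>w\<close>: the part involving \<beta> is divided by \<beta>,
  and the remaining part, whose constant term is the residue 0, by \<alpha>.\<close>

lemma ideal_decompose:
  assumes f: "f \<in> ideal_gr n"
  shows "\<exists>e1\<in>ground_gr (n - 1). \<exists>e2\<in>ground_gr (n - 1). f = al * e1 + be * e2"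
proof (intro bexI)
  let ?h1 = "\<lambda>x. [:poly_shift 1 (coeff x 0):]" and ?h2 = "poly_shift 1"
  have gr: "f \<in> ground_gr n" using f by (simp add: ideal_gr_def)
  have h0: "?h1 (0 :: base) = 0" "?h2 (0 :: base) = 0" by (simp_all add: poly_eq_iff coeff_poly_shift)
  show "f = al * map_poly ?h1 f + be * map_poly ?h2 f"
  proof (rule poly_eqI)
    fix i
    obtain y c where "coeff f i = pCons y c" by (cases "coeff f i")
    moreover obtain a b where "y = pCons a b" by (cases y)
    ultimately have x: "coeff f i = pCons (pCons a b) c" by simp
    have "residue (coeff f i) = 0" using f by (simp add: ideal_gr_def poly_eq_iff)
    then have "a = 0" by (simp add: x residue_def)
    then have "coeff f i = al0 * ?h1 (coeff f i) + be0 * ?h2 (coeff f i)"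
      by (simp add: x poly_shift_1 al0_def be0_def)
    then show "coeff f i = coeff (al * map_poly ?h1 f + be * map_poly ?h2 f) i"
      by (simp add: al_def be_def coeff_map_poly h0)
  qed
  show "map_poly ?h1 f \<in> ground_gr (n - 1)"
  proof (rule map_poly_gr[where h = ?h1, OF gr h0(1)])
    fix x :: base and m assume "x \<in> base_gr m"
    then have "coeff x 0 \<in> graded_poly 1 norms_gr m" using graded_poly_coeff[of x 1 _ m 0] by (simp add: base_gr_def)
    from poly_shift_gr[OF this] show "?h1 x \<in> base_gr (m - 1)"
      unfolding base_gr_def by (intro const_graded_poly graded_graded_poly graded_norms) simp_all
  qed
  show "map_poly ?h2 f \<in> ground_gr (n - 1)"
    by (rule map_poly_gr[where h = ?h2, OF gr h0(2)]) (unfold base_gr_def, rule poly_shift_gr)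
qed

text \<open>The terms free of \<beta> in \<open>al * k1\<close> must vanish, so \<beta> divides
  \<open>k1\<close>; the other factor follows by cancellation.\<close>

lemma linear_syzygy:
  assumes eq: "al * k1 = be * k2" shows "\<exists>h. k1 = be * h \<and> k2 = al * h"
proof -
  have h0: "poly_shift 1 (0 :: base) = 0" by (simp add: poly_eq_iff coeff_poly_shift)
  have "coeff k1 i = be0 * poly_shift 1 (coeff k1 i)" for i
  proof -
    have "al0 * coeff k1 i = be0 * coeff k2 i"
      using arg_cong[OF eq, of "\<lambda>f. coeff f i"] by (simp add: al_def be_def)
    then have "coeff (al0 * coeff k1 i) 0 = coeff (be0 * coeff k2 i) 0" by (rule arg_cong)
    then have "[:0, 1:] * coeff (coeff k1 i) 0 = 0" by (simp add: al0_def be0_def)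
    then have "coeff (coeff k1 i) 0 = 0" by simp
    then show ?thesis using poly_shift_pCons[of "coeff k1 i"] by (simp add: be0_def)
  qed
  then have k1: "k1 = be * map_poly (poly_shift 1) k1"
    by (intro poly_eqI) (simp add: be_def coeff_map_poly h0)
  then have "be * k2 = be * (al * map_poly (poly_shift 1) k1)" using eq by (metis mult.left_commute)
  then have "k2 = al * map_poly (poly_shift 1) k1" using ground_nonzero(3) by simp
  with k1 show ?thesis by blast
qed

text \<open>The map \<open>\<alpha> k1 + \<beta> k2\<close> has a copy of the ground ring as kernel.
  Modulo \<alpha> and \<beta> the product \<open>(w + \<alpha>) (w + \<beta>)\<close> is the square
  of \<open>w\<close>, so its multiple by \<open>m\<close> is a value exactly when \<open>m\<close>
  lies in the ideal.\<close>

lemma card_syz: "card (syz (n + 1)) = card (ground_gr n) * card (ideal_gr n)"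
proof -
  let ?D = "ground_gr (n + 1) \<times> ground_gr (n + 1)" and ?\<mu> = "\<lambda>(k1, k2). al * k1 + be * k2"
  let ?A = "(\<lambda>m. (w + al) * ((w + be) * m)) ` ideal_gr n"
  have hom: "add_hom ?\<mu>" by (rule add_homI) (auto simp: algebra_simps)
  have fin: "finite ?D" using finite_ground by simp
  have closed: "add_closed ?D" using add_closed_ground[of "n + 1"] by (auto simp: add_closed_def zero_prod_def)
  have sub: "?A \<subseteq> ?\<mu> ` ?D"
  proof
    fix x assume "x \<in> ?A"
    then obtain m where m: "m \<in> ideal_gr n" "x = (w + al) * ((w + be) * m)" by blast
    obtain e1 e2 where e: "e1 \<in> ground_gr (n - 1)" "e2 \<in> ground_gr (n - 1)" "m = al * e1 + be * e2"
      using ideal_decompose[OF m(1)] by blast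
    have "(w + al) * ((w + be) * e1) \<in> ground_gr (n - 1 + 1 + 1)" "(w + al) * ((w + be) * e2) \<in> ground_gr (n - 1 + 1 + 1)"
      by (intro mult_linear e)+
    then have "((w + al) * ((w + be) * e1), (w + al) * ((w + be) * e2)) \<in> ?D" by simp
    moreover have "x = ?\<mu> ((w + al) * ((w + be) * e1), (w + al) * ((w + be) * e2))"
      unfolding m(2) e(3) prod.case by (simp only: algebra_simps)
    ultimately show "x \<in> ?\<mu> ` ?D" by (rule image_eqI[rotated])
  qed
  have "{d \<in> ?D. ?\<mu> d \<in> ?A} = syz (n + 1)"
  proof (intro equalityI subsetI)
    fix d assume "d \<in> {d \<in> ?D. ?\<mu> d \<in> ?A}"
    then show "d \<in> syz (n + 1)" by (auto simp: syz_def mult.assoc)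
  next
    fix d assume "d \<in> syz (n + 1)"
    then obtain k1 k2 m where d: "d = (k1, k2)" and k: "k1 \<in> ground_gr (n + 1)" "k2 \<in> ground_gr (n + 1)"
      and m: "al * k1 + be * k2 = (w + al) * ((w + be) * m)" by (auto simp: syz_def mult.assoc)
    have "al * k1 + be * k2 \<in> ground_gr (n + 1 + 1)" by (intro add_ground mult_ground k)
    then have gr: "m \<in> ground_gr n" unfolding m by - (rule reflect_wbe, rule reflect_wal)
    have "residue (coeff m i) = 0" for i
    proof -
      \<comment> \<open>Two powers of \<open>w\<close> higher, the coefficient of the product is
        that of \<open>m\<close> up to multiples of \<alpha> and \<beta>.\<close>
      have "coeff (al * k1 + be * k2) (Suc (Suc i)) = coeff m i + be0 * coeff m (Suc i)
          + al0 * (coeff m (Suc i) + be0 * coeff m (Suc (Suc i)))"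
        unfolding m by (simp only: al_def be_def coeff_linear)
      moreover have "coeff (al * k1 + be * k2) (Suc (Suc i)) = al0 * coeff k1 (Suc (Suc i)) + be0 * coeff k2 (Suc (Suc i))"
        by (simp add: al_def be_def)
      ultimately have "residue (al0 * coeff k1 (Suc (Suc i)) + be0 * coeff k2 (Suc (Suc i)))
          = residue (coeff m i + be0 * coeff m (Suc i) + al0 * (coeff m (Suc i) + be0 * coeff m (Suc (Suc i))))" by simp
      then show ?thesis by (simp only: residue_simps add_0_right)
    qed
    then have "m \<in> ideal_gr n" using gr by (simp add: ideal_gr_def poly_eq_iff)
    then show "d \<in> {d \<in> ?D. ?\<mu> d \<in> ?A}" using k m by (auto simp: d)
  qed
  moreover have "card ?A = card (ideal_gr n)"
    by (rule card_image) (auto intro!: inj_onI simp: ground_nonzero)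
  moreover have "{d \<in> ?D. ?\<mu> d = 0} = (\<lambda>h. (be * h, al * h)) ` ground_gr n"
  proof (intro equalityI subsetI)
    fix d assume "d \<in> {d \<in> ?D. ?\<mu> d = 0}"
    then obtain k1 k2 where d: "d = (k1, k2)" "k1 \<in> ground_gr (n + 1)" "al * k1 = be * k2"
      by (auto simp: add_eq_0_iff_char_2)
    then obtain h where h: "k1 = be * h" "k2 = al * h" using linear_syzygy by blast
    then have "h \<in> ground_gr n" using d(2) reflect_be by blast
    then show "d \<in> (\<lambda>h. (be * h, al * h)) ` ground_gr n"
      unfolding d(1) h by (rule image_eqI[OF refl])
  qed (auto intro: mult_ground simp: mult.left_commute)
  moreover have "card ((\<lambda>h. (be * h, al * h)) ` ground_gr n) = card (ground_gr n)"
    by (rule card_image) (auto intro!: inj_onI simp: ground_nonzero)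
  ultimately show ?thesis using card_fibres[OF fin closed hom sub] by (simp add: mult.commute)
qed

text \<open>Shifts: 6 is the degree 2 of \<open>ab\<close> plus the degree 4 of the forced factor of
  \<open>c\<close>; 3 is the degree of \<open>a\<close> or \<open>b\<close>, plus 1 for the factor
  \<open>w\<close> and 1 from \<open>card_syz\<close>.\<close>

lemma card_inv_gr:
  "card (inv_gr n) = card (ground_gr n) * card (ground_gr (n - 6)) * (card (ground_gr (n - 3)) * card (ideal_gr (n - 3)))"
proof -
  have "inj_on components (inv_gr n)"
  proof (rule inj_onI)
    fix f g assume "f \<in> inv_gr n" "g \<in> inv_gr n" "components f = components g"
    then show "f = g" unfolding inv_gr_def mem_Collect_eq by (elim conjE) (rule components_inject; assumption)
  qed
  then have "card (inv_gr n) = card (components ` inv_gr n)" by (rule card_image[symmetric])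
  also have "components ` inv_gr n = (\<lambda>(e, c, k1, k2). (e, c, w * k1, w * k2)) `
      (ground_gr n \<times> norm_multiples (n - 2) \<times> syz (n - 2))"
    unfolding components_image by force
  also have "card \<dots> = card (ground_gr n \<times> norm_multiples (n - 2) \<times> syz (n - 2))"
    by (rule card_image) (auto intro!: inj_onI simp: ground_nonzero)
  finally have "card (inv_gr n) = card (ground_gr n) * (card (norm_multiples (n - 2)) * card (syz (n - 2)))"
    by (simp add: card_cartesian_product)
  moreover have "card (norm_multiples (n - 2)) = card (ground_gr (n - 6))"
  proof -
    have "n - 2 - 4 = n - 6" by simp
    moreover have "inj_on (\<lambda>g. w * w * (w + al) * (w + be) * g) (ground_gr (n - 6))"
      by (auto intro!: inj_onI simp: ground_nonzero)
    ultimately show ?thesis unfolding norm_multiples_def by (simp only: card_image)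
  qed
  moreover have "card (syz (n - 2)) = card (ground_gr (n - 3)) * card (ideal_gr (n - 3))"
    using card_syz[of "n - 3"] by simp
  ultimately show ?thesis by simp
qed

lemma graded_ideal: "graded ideal_gr"
  unfolding graded_def
proof (intro conjI allI impI)
  fix n
  show "add_closed (ideal_gr n)" unfolding ideal_gr_def by (rule add_closed_kernel[OF add_closed_ground hom_reduction])
  show "finite (ideal_gr n)" using finite_ground by (simp add: ideal_gr_def)
next
  fix n :: int assume "n < 0"
  then have "ground_gr n = {0}" using graded_ground by (simp add: graded_def)
  then show "ideal_gr n = {0}" using add_hom_0[OF hom_reduction] by (auto simp: ideal_gr_def)
qed

lemma hilbert_ideal: "hilbert ideal_gr (ground_series - gp 4 ^ 2 * gp 1)"
  unfolding hilbert_def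
proof (intro conjI allI impI)
  fix n :: int assume "n < 0"
  then have "ideal_gr n = {0}" using graded_ideal by (simp add: graded_def)
  then show "card (ideal_gr n) = 1" by simp
next
  fix n
  have "hilbert (graded_poly 1 norms_gr) (gp 4 ^ 2 * gp 1)"
    using hilbert_gp[OF hilbert_norms graded_norms, of 1] by simp
  from hilbertD[OF this, of n] obtain b
    where b: "card (graded_poly 1 norms_gr (int n)) = 2 ^ b" "fps_nth (gp 4 ^ 2 * gp 1) n = of_nat b" by blast
  from hilbertD[OF hilbert_ground, of n] obtain a
    where a: "card (ground_gr (int n)) = 2 ^ a" "fps_nth ground_series n = of_nat a" by blast
  have eq: "2 ^ a = 2 ^ b * card (ideal_gr (int n))" using card_ground_ideal[of "int n"] a b by simp
  then have "card (ideal_gr (int n)) > 0" by (intro Nat.gr0I) simp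
  then have "(2 :: nat) ^ b \<le> 2 ^ a" unfolding eq by simp
  then have le: "b \<le> a" by simp
  then have "(2 :: nat) ^ a = 2 ^ b * 2 ^ (a - b)" by (simp add: power_add[symmetric])
  then have "card (ideal_gr (int n)) = 2 ^ (a - b)" using eq by simp
  then show "\<exists>e. card (ideal_gr (int n)) = 2 ^ e \<and> fps_nth (ground_series - gp 4 ^ 2 * gp 1) n = of_nat e"
    using a b le by (intro exI[of _ "a - b"]) (simp add: of_nat_diff)
qed

section \<open>The Hilbert series of the invariants\<close>

definition inv_series :: "rat fps" where
  "inv_series = (1 + 2 * fps_X ^ 3 + fps_X ^ 6) * ground_series - fps_X ^ 3 * (gp 4 ^ 2 * gp 1)"

lemma hilbert_inv: "\<exists>e. card (inv_gr (int n)) = 2 ^ e \<and> fps_nth inv_series n = of_nat e"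
proof -
  have "hilbert (\<lambda>n. ground_gr n \<times> ideal_gr (n - int 0)) (ground_series + fps_X ^ 0 * (ground_series - gp 4 ^ 2 * gp 1))"
    by (intro hilbert_times hilbert_ground hilbert_ideal)
  then have 1: "hilbert (\<lambda>n. ground_gr n \<times> ideal_gr n) (2 * ground_series - gp 4 ^ 2 * gp 1)" by simp
  have "hilbert (\<lambda>n. ground_gr n \<times> ground_gr (n - int 6)) (ground_series + fps_X ^ 6 * ground_series)"
    by (intro hilbert_times hilbert_ground)
  from hilbertD[OF hilbert_times[OF this 1, of 3], of n]
  obtain e where e: "card ((ground_gr (int n) \<times> ground_gr (int n - int 6)) \<times> (ground_gr (int n - int 3) \<times> ideal_gr (int n - int 3))) = 2 ^ e"
    "fps_nth (ground_series + fps_X ^ 6 * ground_series + fps_X ^ 3 * (2 * ground_series - gp 4 ^ 2 * gp 1)) n = of_nat e"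
    by blast
  have "inv_series = ground_series + fps_X ^ 6 * ground_series + fps_X ^ 3 * (2 * ground_series - gp 4 ^ 2 * gp 1)"
    by (simp add: inv_series_def algebra_simps)
  with e(2) have "fps_nth inv_series n = of_nat e" by (simp only:)
  moreover have "card (inv_gr (int n)) = 2 ^ e"
    using e(1) card_inv_gr[of "int n"] by (simp add: card_cartesian_product)
  ultimately show ?thesis by blast
qed

lemma gp_2: "gp 4 * (1 + fps_X ^ 2) = gp 2"
proof -
  have "gp 2 = gp 2 * (gp 4 * (1 - fps_X ^ 4))" by (simp add: gp)
  also have "(1 - fps_X ^ 4 :: rat fps) = (1 - fps_X ^ 2) * (1 + fps_X ^ 2)"
    by (simp add: algebra_simps eval_nat_numeral)
  also have "gp 2 * (gp 4 * ((1 - fps_X ^ 2) * (1 + fps_X ^ 2))) = gp 2 * (1 - fps_X ^ 2) * (gp 4 * (1 + fps_X ^ 2))"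
    by (simp only: ac_simps)
  finally show ?thesis by (simp add: gp)
qed

text \<open>The identity \<open>inv_series_eq\<close> with its denominators cleared.\<close>

lemma inv_series_polynomial:
  fixes x :: "'a :: comm_ring_1"
  shows "4 * ((1 + x ^ 3) ^ 2 - x ^ 3 * (1 - x) ^ 2)
    = ((1 + x) * (1 + x ^ 2)) ^ 2 + 3 * ((1 + x ^ 2) * (1 - x)) ^ 2 + 4 * x * (1 - x) ^ 3"
  by (simp add: algebra_simps eval_nat_numeral)

text \<open>A partial fraction form whose last term lives in degrees congruent to 1 modulo 4. In
  even degrees, the ones needed, only the first two terms count.\<close>

lemma inv_series_eq: "4 * inv_series = gp 1 ^ 5 + 3 * (1 + fps_X) * gp 2 ^ 3 + 4 * fps_X * gp 4 ^ 2"
proof -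
  let ?X = "fps_X :: rat fps"
  have h: "gp 1 * (1 - ?X) = 1" using gp_1 by simp
  have h1: "gp 1 = gp 1 ^ 3 * (1 - ?X) ^ 2" and h3: "gp 1 ^ 3 * (1 - ?X) ^ 3 = 1"
  proof -
    have "gp 1 ^ 3 * (1 - ?X) ^ 2 = gp 1 * (gp 1 * (1 - ?X)) ^ 2"
      by (simp only: power_mult_distrib power3_eq_cube power2_eq_square ac_simps)
    then show "gp 1 = gp 1 ^ 3 * (1 - ?X) ^ 2" by (simp only: h power_one mult_1_right)
    show "gp 1 ^ 3 * (1 - ?X) ^ 3 = 1" by (simp only: power_mult_distrib[symmetric] h power_one)
  qed
  have sq: "1 + 2 * ?X ^ 3 + ?X ^ 6 = (1 + ?X ^ 3) ^ 2" by (simp add: power2_eq_square algebra_simps eval_nat_numeral)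
  have "4 * inv_series = 4 * ((1 + ?X ^ 3) ^ 2 * (gp 4 ^ 2 * gp 1 ^ 3) - ?X ^ 3 * (gp 4 ^ 2 * gp 1))"
    unfolding inv_series_def ground_series_def sq ..
  also have "\<dots> = 4 * ((1 + ?X ^ 3) ^ 2 * (gp 4 ^ 2 * gp 1 ^ 3) - ?X ^ 3 * (gp 4 ^ 2 * (gp 1 ^ 3 * (1 - ?X) ^ 2)))"
    using h1 by simp
  also have "\<dots> = gp 4 ^ 2 * gp 1 ^ 3 * (4 * ((1 + ?X ^ 3) ^ 2 - ?X ^ 3 * (1 - ?X) ^ 2))"
    by (simp only: right_diff_distrib ac_simps)
  also have "\<dots> = gp 1 ^ 3 * (gp 4 * (1 + ?X) * (1 + ?X ^ 2)) ^ 2 + 3 * (gp 4 * (1 + ?X ^ 2)) ^ 2 * (gp 1 ^ 3 * (1 - ?X) ^ 2)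
      + 4 * ?X * gp 4 ^ 2 * (gp 1 ^ 3 * (1 - ?X) ^ 3)"
  proof -
    have "g ^ 2 * h ^ 3 * ((a * b) ^ 2 + 3 * (b * c) ^ 2 + 4 * x * c ^ 3)
        = h ^ 3 * (g * a * b) ^ 2 + 3 * (g * b) ^ 2 * (h ^ 3 * c ^ 2) + 4 * x * g ^ 2 * (h ^ 3 * c ^ 3)"
      for g h a b c x :: "rat fps" by (simp only: distrib_left power_mult_distrib ac_simps)
    then show ?thesis unfolding inv_series_polynomial .
  qed
  also have "\<dots> = gp 1 ^ 3 * gp 1 ^ 2 + 3 * gp 2 ^ 2 * gp 1 + 4 * ?X * gp 4 ^ 2"
    unfolding gp_4 gp_2 h3 h1[symmetric] by simp
  finally have *: "4 * inv_series = gp 1 ^ 3 * gp 1 ^ 2 + 3 * gp 2 ^ 2 * gp 1 + 4 * ?X * gp 4 ^ 2" .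
  have "gp 1 = (1 + ?X) * gp 2" unfolding gp_4[symmetric] gp_2[symmetric] by (simp only: ac_simps)
  then have "3 * gp 2 ^ 2 * gp 1 = 3 * gp 2 ^ 2 * ((1 + ?X) * gp 2)" by (rule arg_cong)
  also have "\<dots> = 3 * (1 + ?X) * gp 2 ^ 3" by (simp only: power3_eq_cube power2_eq_square ac_simps)
  finally show ?thesis unfolding * by (simp add: power_add[symmetric])
qed

lemma nth_one_plus_X_gp: "fps_nth ((1 + fps_X) * gp 2 ^ 3) n = of_nat ((n div 2 + 2) choose 2)"
proof -
  have "gp 2 ^ 3 = Abs_fps (\<lambda>n. if 2 dvd n then of_nat ((n div 2 + 2) choose 2) else 0)"
    using gp_power[of 2 2] by simp
  then show ?thesis by (cases n) (auto simp: distrib_right)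
qed

lemma nth_X_gp: "even n \<Longrightarrow> fps_nth (fps_X * gp 4 ^ 2) n = 0"
proof -
  assume n: "even n"
  have "gp 4 ^ Suc 1 = Abs_fps (\<lambda>n. if 4 dvd n then of_nat ((n div 4 + 1) choose 1) else 0)"
    by (rule gp_power) simp
  then have "gp 4 ^ 2 = Abs_fps (\<lambda>n. if 4 dvd n then of_nat ((n div 4 + 1) choose 1) else 0)"
    unfolding Suc_1 .
  moreover have "\<not> 4 dvd n - 1" if "n \<noteq> 0" using n that by presburger
  ultimately show ?thesis by simp
qed

lemma card_inv_S:
  assumes n: "even n"
  shows "\<exists>e. card (sym.inv_S n) = 2 ^ e \<and> 4 * e = ((n + 4) choose 4) + 3 * ((n div 2 + 2) choose 2)"
proof -
  obtain e where e: "card (inv_gr (int n)) = 2 ^ e" "fps_nth inv_series n = of_nat e"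
    using hilbert_inv by blast
  have c: "fps_nth (numeral j * F) n = numeral j * fps_nth F n" for j and F :: "rat fps"
    by (simp add: numeral_fps_const)
  have "fps_nth (4 * inv_series) n = fps_nth (gp 1 ^ Suc 4 + 3 * ((1 + fps_X) * gp 2 ^ 3) + 4 * (fps_X * gp 4 ^ 2)) n"
    unfolding inv_series_eq mult.assoc by simp
  then have "4 * rat_of_nat e = of_nat ((n + 4) choose 4) + 3 * of_nat ((n div 2 + 2) choose 2)"
    unfolding c fps_add_nth nth_one_plus_X_gp nth_X_gp[OF n] e(2) gp_1_power by simp
  then have "rat_of_nat (4 * e) = rat_of_nat (((n + 4) choose 4) + 3 * ((n div 2 + 2) choose 2))" by simp
  then have "4 * e = ((n + 4) choose 4) + 3 * ((n div 2 + 2) choose 2)" unfolding of_nat_eq_iff .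
  moreover have "sym.inv_S n = inv_gr (int n)" by (simp add: sym.inv_S_def inv_gr_def)
  ultimately show ?thesis using e(1) by auto
qed

lemma card_layer_pairs: "card (layer_pairs N j) = (if j \<le> N then (4 choose j) * ((N - j + 7) choose 7) else 0)"
proof (cases "j \<le> N")
  case True
  have "card (UNIV :: vertex set) = 4" by (simp add: UNIV_vertex)
  then have B: "card {B :: vertex set. card B = j} = 4 choose j" using n_subsets[of "UNIV :: vertex set" j] by simp
  have "layer_pairs N j = {m. sum m UNIV = N - j} \<times> {B. card B = j}"
    using True by (auto simp: layer_pairs_def)
  then show ?thesis using True by (simp add: card_cartesian_product B card_multidegrees)
next
  case False
  then have "layer_pairs N j = {}" by (auto simp: layer_pairs_def)
  then show ?thesis using False by simp
qed

text \<open>With \<open>card_inv_layer\<close> this shows that the number of basis pairs in a layer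
  of odd degree is a multiple of 4.\<close>

lemma four_dvd_exponent: fixes x :: nat assumes "x ^ 4 = 2 ^ c" shows "4 dvd c"
proof -
  have "x dvd 2 ^ c" unfolding assms[symmetric] by simp
  then obtain k where "x = 2 ^ k" using divides_primepow_nat[of 2 x c] by auto
  then have "(2 :: nat) ^ (k * 4) = 2 ^ c" using assms by (simp add: power_mult)
  then have "k * 4 = c" by simp
  then show ?thesis by (metis dvd_triv_right)
qed

text \<open>The alternating sum over the exterior generators multiplies the series of eight
  variables by the fourth power of \<open>1 - X\<close>, which leaves the series of four
  variables.\<close>

lemma euler_characteristic:
  assumes k: "\<And>j. j \<le> 4 \<Longrightarrow> card (layer_pairs N j) = 4 * k j"
  shows "4 * (k 0 + k 2 + k 4) = 4 * (k 1 + k 3) + ((N + 3) choose 3)"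
proof -
  let ?G = "gp 1 ^ Suc 7"
  have nth: "fps_nth (fps_X ^ j * ?G) N = (if j \<le> N then of_nat ((N - j + 7) choose 7) else 0)" for j
    unfolding gp_1_power by (auto simp: fps_X_power_mult_nth)
  have kj: "4 * rat_of_nat (k j) = of_nat (4 choose j) * fps_nth (fps_X ^ j * ?G) N" if "j \<le> 4" for j
  proof -
    have "rat_of_nat (4 * k j) = rat_of_nat (card (layer_pairs N j))" using k[OF that] by simp
    then show ?thesis unfolding card_layer_pairs nth by simp
  qed
  have "gp 1 ^ Suc 3 = gp 1 ^ Suc 3 * (gp 1 * (1 - fps_X ^ 1)) ^ 4" by (simp only: gp_1 power_one mult_1_right)
  also have "\<dots> = ?G * (1 - fps_X) ^ 4" by (simp add: power_mult_distrib power_add[symmetric] flip: mult.assoc)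
  also have "\<dots> = fps_X ^ 0 * ?G + 6 * (fps_X ^ 2 * ?G) + fps_X ^ 4 * ?G - 4 * (fps_X ^ 1 * ?G) - 4 * (fps_X ^ 3 * ?G)"
  proof -
    have "g * (1 - x) ^ 4 = x ^ 0 * g + 6 * (x ^ 2 * g) + x ^ 4 * g - 4 * (x ^ 1 * g) - 4 * (x ^ 3 * g)"
      for g x :: "rat fps" by (simp add: algebra_simps eval_nat_numeral)
    then show ?thesis .
  qed
  finally have eq: "fps_nth (gp 1 ^ Suc 3) N = fps_nth (fps_X ^ 0 * ?G + 6 * (fps_X ^ 2 * ?G) + fps_X ^ 4 * ?G
      - 4 * (fps_X ^ 1 * ?G) - 4 * (fps_X ^ 3 * ?G)) N" by (rule arg_cong)
  have c: "fps_nth (numeral j * F) N = numeral j * fps_nth F N" for j and F :: "rat fps"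
    by (simp add: numeral_fps_const)
  have b: "4 choose 2 = (6 :: nat)" "4 choose 3 = (4 :: nat)" "4 choose 0 = (1 :: nat)" "4 choose 1 = (4 :: nat)" "4 choose 4 = (1 :: nat)"
    by (simp_all add: eval_nat_numeral)
  have "rat_of_nat ((N + 3) choose 3) = 4 * of_nat (k 0) + 4 * of_nat (k 2) + 4 * of_nat (k 4) - 4 * of_nat (k 1) - 4 * of_nat (k 3)"
    using eq unfolding fps_sub_nth fps_add_nth c kj[of 0, simplified b] kj[of 1, simplified b]
    by (simp add: kj b gp_1_power[of 3, simplified])
  then have "rat_of_nat (4 * (k 0 + k 2 + k 4)) = rat_of_nat (4 * (k 1 + k 3) + ((N + 3) choose 3))" by simp
  then show ?thesis unfolding of_nat_eq_iff .
qed

text \<open>Degree 0 is outside the staircase comparison; there the coboundary is 0 because the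
  coefficients are trivial.\<close>

lemma cohomology_dim_0: "cohomology_dim TYPE(bit) (V_group 2) 0 = 1"
proof -
  let ?G = "V_group 2"
  have G: "Group.group ?G" by (rule group_V_group)
  obtain h where "h \<in> iso (V_group 2) magnus" using V_group_iso by blast
  then have "bij_betw h (carrier ?G) (carrier magnus)" by (auto simp: iso_def)
  moreover have "finite (carrier magnus)" by simp
  ultimately have fin: "finite (carrier ?G)" using bij_betw_finite by blast
  have t0: "tuples ?G 0 = {[]}" by (auto simp: tuples_def)
  have car: "carrier (cochains ?G 0 :: (bit, _) module) = {[]} \<rightarrow>\<^sub>E UNIV" by (simp add: cochains_sel[OF G] t0)
  have cob: "coboundary ?G 0 f = \<zero>\<^bsub>cochains ?G (Suc 0)\<^esub>" for f :: "_ \<Rightarrow> bit"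
  proof -
    have "f (tl gs) + - f (butlast gs) = 0" if "gs \<in> tuples ?G (Suc 0)" for gs
      using that by (cases gs) (auto simp: tuples_def)
    then show ?thesis by (auto simp: coboundary_def cochains_sel[OF G] fun_eq_iff restrict_def)
  qed
  have cocycles: "cocycles ?G 0 = ({[]} \<rightarrow>\<^sub>E (UNIV :: bit set))"
    unfolding cocycles_def car using cob by simp
  have sub: "coboundaries ?G 0 \<subseteq> (cocycles ?G 0 :: (_ \<Rightarrow> bit) set)"
    unfolding cocycles by (simp add: cochains_sel[OF G] t0)
  have "card (cocycles ?G 0 :: (_ \<Rightarrow> bit) set) = 2 ^ 1 * card (coboundaries ?G 0 :: (_ \<Rightarrow> bit) set)"
    unfolding cocycles by (simp add: card_PiE card_UNIV_bit)
  then show ?thesis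
    by (intro cohomology_dim_eq fin submodule_cocycles[OF G] submodule_coboundaries[OF G] sub)
qed

text \<open>One formula for both parities: in odd degree the invariants of degree
  \<open>n - 1\<close> and the Euler characteristic are joined by Pascal's rule, while
  \<open>n div 2\<close> does not change.\<close>

lemma cohomology_dim_formula:
  "4 * cohomology_dim TYPE(bit) (V_group 2) n = ((n + 4) choose 4) + 3 * ((n div 2 + 2) choose 2)"
proof (cases n)
  case 0
  have "((0 + 4) choose 4) + 3 * ((0 div 2 + 2) choose 2) = (4 :: nat)" by (simp add: eval_nat_numeral)
  then show ?thesis unfolding 0 cohomology_dim_0 by simp
next
  case (Suc n')
  show ?thesis
  proof (cases "even n")
    case True
    obtain e where e: "card (sym.inv_S n) = 2 ^ e" "4 * e = ((n + 4) choose 4) + 3 * ((n div 2 + 2) choose 2)"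
      using card_inv_S[OF True] by blast
    then show ?thesis using sym.cohomology_dim_even[of n' e] True Suc by simp
  next
    case False
    then have n': "even n'" using Suc by simp
    obtain s where s: "card (sym.inv_S n') = 2 ^ s" "4 * s = ((n' + 4) choose 4) + 3 * ((n' div 2 + 2) choose 2)"
      using card_inv_S[OF n'] by blast
    have "\<exists>k. card (layer_pairs n j) = 4 * k" for j
      using four_dvd_exponent[OF card_inv_layer[OF False]] by (auto simp: dvd_def)
    then obtain k where k: "\<And>j. card (layer_pairs n j) = 4 * k j" by metis
    have \<chi>: "4 * (k 0 + k 2 + k 4) = 4 * (k 1 + k 3) + ((n + 3) choose 3)"
      using euler_characteristic[of n k] k by simp
    define d where "d = s + (k 0 + k 2 + k 4) - (k 1 + k 3)"
    have d: "s + k 0 + k 2 + k 4 = d + k 1 + k 3" using \<chi> by (simp add: d_def)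
    have dim: "cohomology_dim TYPE(bit) (V_group 2) (Suc n') = d"
      by (rule sym.cohomology_dim_odd[OF n' s(1) _ d]) (use k Suc in simp)
    have "4 * d = 4 * s + ((n + 3) choose 3)" using d \<chi> by simp
    also have "\<dots> = ((n + 4) choose 4) + 3 * ((n' div 2 + 2) choose 2)"
      unfolding s(2) using Suc by (simp add: eval_nat_numeral)
    finally show ?thesis using dim Suc n' by simp
  qed
qed

theorem proposition6p4:
  shows "poincare_series TYPE(bit) (V_group 2)
           = (1 - fps_X + fps_X ^ 2) / ((1 - fps_X) ^ 3 * (1 - fps_X ^ 2) ^ 2)
         \<and> map (cohomology_dim TYPE(bit) (V_group 2)) [0..<11]
           = [1, 2, 6, 11, 22, 36, 60, 90, 135, 190, 266]"
proof
  let ?P = "poincare_series TYPE(bit) (V_group 2)" and ?X = "fps_X :: rat fps"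
  \<comment> \<open>The factor 4 keeps the closed formula free of division; multiplication by
    \<open>D\<close> then leaves a polynomial identity.\<close>
  have "4 * ?P = gp 1 ^ 5 + 3 * ((1 + ?X) * gp 2 ^ 3)"
  proof (rule fps_ext)
    fix n
    have c: "fps_nth (numeral j * F) n = numeral j * fps_nth F n" for j and F :: "rat fps"
      by (simp add: numeral_fps_const)
    have "fps_nth (4 * ?P) n = rat_of_nat (4 * cohomology_dim TYPE(bit) (V_group 2) n)"
      unfolding c poincare_series_def by simp
    also have "\<dots> = fps_nth (gp 1 ^ Suc 4 + 3 * ((1 + ?X) * gp 2 ^ 3)) n"
      unfolding cohomology_dim_formula fps_add_nth c nth_one_plus_X_gp gp_1_power by simp
    finally show "fps_nth (4 * ?P) n = fps_nth (gp 1 ^ 5 + 3 * ((1 + ?X) * gp 2 ^ 3)) n" by simp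
  qed
  define D where "D = (1 - ?X) ^ 3 * (1 - ?X ^ 2) ^ 2"
  have h: "gp 1 * (1 - ?X) = 1" using gp_1 by simp
  have g: "gp 2 * ((1 - ?X) * (1 + ?X)) = 1"
    using gp[of 2] by (simp add: power2_eq_square algebra_simps)
  have D: "D = (1 - ?X) ^ 3 * ((1 - ?X) * (1 + ?X)) ^ 2" by (simp add: D_def power2_eq_square algebra_simps)
  have "D \<noteq> 0" using h g unfolding D by auto
  have "4 * (?P * D) = (gp 1 ^ 5 + 3 * ((1 + ?X) * gp 2 ^ 3)) * D"
    using \<open>4 * ?P = _\<close> by (simp only: mult.assoc[symmetric])
  also have "\<dots> = (gp 1 * (1 - ?X)) ^ 5 * (1 + ?X) ^ 2 + 3 * ((gp 2 * ((1 - ?X) * (1 + ?X))) ^ 3 * (1 - ?X) ^ 2)"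
  proof -
    have "(h ^ 5 + 3 * (a * g ^ 3)) * (c ^ 3 * (c * a) ^ 2) = (h * c) ^ 5 * a ^ 2 + 3 * ((g * (c * a)) ^ 3 * c ^ 2)"
      for h g a c :: "rat fps" by (simp add: power_mult_distrib eval_nat_numeral algebra_simps)
    then show ?thesis unfolding D .
  qed
  also have "\<dots> = 4 * (1 - ?X + ?X ^ 2)" unfolding h g by (simp add: power2_eq_square algebra_simps)
  finally have "?P * D = 1 - ?X + ?X ^ 2" by (metis mult_left_cancel zero_neq_numeral)
  then show "?P = (1 - ?X + ?X ^ 2) / ((1 - ?X) ^ 3 * (1 - ?X ^ 2) ^ 2)"
    unfolding D_def[symmetric] using \<open>D \<noteq> 0\<close> by (metis nonzero_mult_div_cancel_right)
  have dim: "cohomology_dim TYPE(bit) (V_group 2) = (\<lambda>n. (((n + 4) choose 4) + 3 * ((n div 2 + 2) choose 2)) div 4)"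
    unfolding cohomology_dim_formula[symmetric] by simp
  show "map (cohomology_dim TYPE(bit) (V_group 2)) [0..<11]
           = [1, 2, 6, 11, 22, 36, 60, 90, 135, 190, 266]"
    unfolding dim by (simp add: upt_rec choose_reduce_nat binomial_eq_0)
qed

end
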